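(* Let $k$ be a field of characteristic zero, $S=k[x_1,x_2,x_3,x_4]$, and let $f,g$ be a homogeneous $S$-regular sequence of quadrics (forms of degree 2) such that $R=S/(f,g)$ is normal. Let $\Omega_{R/k}$ denote the module of Kähler differentials of $R$ over $k$, and let $\mathcal A$ be the kernel of the natural epimorphism from the symmetric algebra $\mathcal S(\Omega_{R/k})$ onto the Rees algebra $\mathcal R(\Omega_{R/k})$. Then $\mathcal A$ is generated as follows (generation of $\mathcal A_i$ is as a $T$-module, $T=k[y_1,\ldots,y_4]$). (i) $\mathcal A_2$ is minimally generated by one equation of bidegree $(2,2)$. (ii) $\mathcal A_1$ is minimally generated by four equations of bidegree $(1,4)$. (iii) $\mathcal A_0$ is minimally generated by one equation of bidegree $(0,n)$, for some positive integer $n$.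
   Context: Rees algebra: for an $R$-module $E$ with a rank, $\mathcal R(E)=\mathcal S(E)/\tau_R(\mathcal S(E))$, where $\tau_R(\mathcal S(E))$ is the $R$-torsion submodule of the symmetric algebra; thus $\mathcal A=\tau_R(\mathcal S(\Omega_{R/k}))$. Bigrading: let $T=k[y_1,\ldots,y_4]$ and $B=S\otimes_kT$ with $\operatorname{bideg}x_i=(1,0)$, $\operatorname{bideg}y_i=(0,1)$. Let $\Theta$ be the $4\times2$ matrix with columns $(\partial f/\partial x_i)_{i=1}^4$ and $(\partial g/\partial x_i)_{i=1}^4$, and $[\ell_1\ \ell_2]=[y_1\ y_2\ y_3\ y_4]\cdot\Theta$. Then $\mathcal S(\Omega_{R/k})\cong B/(\ell_1,\ell_2,f,g)$ (with $y_i$ corresponding to $dx_i$) is bigraded and $\mathcal A$ is a bihomogeneous ideal of it. For a bigraded $B$-module $M$, $M_i=\bigoplus_jM_{(i,j)}$, a graded $T$-module. *)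

theory Defs
  imports
    "HOL-Algebra.Algebra"
    "HOL-Algebra.Algebraic_Closure_Type"
    "HOL-Library.Poly_Mapping"
    "HOL-Library.Numeral_Type"
begin

section \<open>Commutative rings\<close>

definition regular_sequence :: "('a, 'm) ring_scheme \<Rightarrow> 'a list \<Rightarrow> bool" where
  "regular_sequence R xs \<longleftrightarrow>
     set xs \<subseteq> carrier R \<and>
     (\<forall>i<length xs. \<forall>a\<in>carrier R.
        xs ! i \<otimes>\<^bsub>R\<^esub> a \<in> genideal R (set (take i xs)) \<longrightarrow> a \<in> genideal R (set (take i xs))) \<and>
     genideal R (set xs) \<noteq> carrier R"

definition nonzerodivisors :: "('a, 'm) ring_scheme \<Rightarrow> 'a set" where
  "nonzerodivisors R =
     {b \<in> carrier R. \<forall>a\<in>carrier R. b \<otimes>\<^bsub>R\<^esub> a = \<zero>\<^bsub>R\<^esub> \<longrightarrow> a = \<zero>\<^bsub>R\<^esub>}"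

text \<open>
  A normal ring is a reduced ring that is integrally closed in its total ring of fractions (for
  Noetherian rings this means that all localizations at primes are integrally closed domains).
  An element of the total ring of fractions is a fraction \<open>a / b\<close> with \<open>b\<close> a nonzerodivisor.
  Multiplied by \<open>b\<^sup>n\<close>, a monic equation of degree \<open>n\<close> for \<open>a / b\<close> is an equation in the ring
  itself, and \<open>a / b\<close> lies in the ring iff \<open>b\<close> divides \<open>a\<close>.
\<close>

definition normal_ring :: "('a, 'm) ring_scheme \<Rightarrow> bool" where
  "normal_ring R \<longleftrightarrow>
     cring R \<and>
     (\<forall>a\<in>carrier R. \<forall>n::nat. a [^]\<^bsub>R\<^esub> n = \<zero>\<^bsub>R\<^esub> \<longrightarrow> a = \<zero>\<^bsub>R\<^esub>) \<and>
     (\<forall>a\<in>carrier R. \<forall>b\<in>nonzerodivisors R.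
        (\<exists>n>0. \<exists>c\<in>{..<n} \<rightarrow> carrier R.
           a [^]\<^bsub>R\<^esub> (n::nat) \<oplus>\<^bsub>R\<^esub>
             (\<Oplus>\<^bsub>R\<^esub>i\<in>{..<n}. c i \<otimes>\<^bsub>R\<^esub> (a [^]\<^bsub>R\<^esub> i \<otimes>\<^bsub>R\<^esub> b [^]\<^bsub>R\<^esub> (n - i))) = \<zero>\<^bsub>R\<^esub>) \<longrightarrow>
        (\<exists>r\<in>carrier R. a = b \<otimes>\<^bsub>R\<^esub> r))"


section \<open>Modules\<close>

text \<open>The fields \<open>mult\<close> and \<open>one\<close> of the record \<^type>\<open>module\<close> play no role for a module.\<close>

definition submodule_gen :: "('a, 'm) ring_scheme \<Rightarrow> ('a, 'b, 'n) module_scheme \<Rightarrow> 'b set \<Rightarrow> 'b set"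
  where "submodule_gen R M G = \<Inter>{N. submodule N R M \<and> G \<subseteq> N}"

definition minimally_generates ::
  "('a, 'm) ring_scheme \<Rightarrow> ('a, 'b, 'n) module_scheme \<Rightarrow> 'b set \<Rightarrow> 'b set \<Rightarrow> bool" where
  "minimally_generates R M G N \<longleftrightarrow>
     submodule_gen R M G = N \<and> (\<forall>H. H \<subset> G \<longrightarrow> submodule_gen R M H \<noteq> N)"

definition quotient_module ::
  "('a, 'm) ring_scheme \<Rightarrow> ('a, 'b, 'n) module_scheme \<Rightarrow> 'b set \<Rightarrow> ('a, 'b set) module" where
  "quotient_module R M N =
     \<lparr>carrier = a_rcosets\<^bsub>M\<^esub> N, monoid.mult = undefined, one = undefined,
      ring.zero = N, add = set_add M,
      module.smult = (\<lambda>r C. \<Union>c\<in>C. N +>\<^bsub>M\<^esub> (r \<odot>\<^bsub>M\<^esub> c))\<rparr>"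

definition free_module :: "('a, 'm) ring_scheme \<Rightarrow> 'x set \<Rightarrow> ('a, 'x \<Rightarrow> 'a) module" where
  "free_module R V =
     \<lparr>carrier = {v. (\<forall>x. v x \<in> carrier R) \<and> (\<forall>x. x \<notin> V \<longrightarrow> v x = \<zero>\<^bsub>R\<^esub>) \<and>
                    finite {x. v x \<noteq> \<zero>\<^bsub>R\<^esub>}},
      monoid.mult = undefined, one = undefined,
      ring.zero = (\<lambda>x. \<zero>\<^bsub>R\<^esub>), add = (\<lambda>v w x. v x \<oplus>\<^bsub>R\<^esub> w x),
      module.smult = (\<lambda>r v x. r \<otimes>\<^bsub>R\<^esub> v x)\<rparr>"

definition free_basis :: "('a, 'm) ring_scheme \<Rightarrow> 'x \<Rightarrow> 'x \<Rightarrow> 'a" where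
  "free_basis R x = (\<lambda>y. if y = x then \<one>\<^bsub>R\<^esub> else \<zero>\<^bsub>R\<^esub>)"


section \<open>Kaehler differentials\<close>

text \<open>
  \<open>\<Omega>\<close> of \<open>R\<close> over a subring \<open>K\<close>: the free \<open>R\<close>-module on symbols \<open>d a\<close>, \<open>a \<in> R\<close>, modulo
  additivity, the Leibniz rule, and \<open>d c = 0\<close> for \<open>c \<in> K\<close>.
\<close>

definition kaehler_relations :: "('a, 'm) ring_scheme \<Rightarrow> 'a set \<Rightarrow> ('a \<Rightarrow> 'a) set" where
  "kaehler_relations R K =
     (let F = free_module R (carrier R); e = free_basis R in
        {e (a \<oplus>\<^bsub>R\<^esub> b) \<ominus>\<^bsub>F\<^esub> (e a \<oplus>\<^bsub>F\<^esub> e b) | a b. a \<in> carrier R \<and> b \<in> carrier R} \<union>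
        {e (a \<otimes>\<^bsub>R\<^esub> b) \<ominus>\<^bsub>F\<^esub> (a \<odot>\<^bsub>F\<^esub> e b \<oplus>\<^bsub>F\<^esub> b \<odot>\<^bsub>F\<^esub> e a) | a b. a \<in> carrier R \<and> b \<in> carrier R} \<union>
        e ` K)"

definition kaehler_submodule :: "('a, 'm) ring_scheme \<Rightarrow> 'a set \<Rightarrow> ('a \<Rightarrow> 'a) set" where
  "kaehler_submodule R K =
     submodule_gen R (free_module R (carrier R)) (kaehler_relations R K)"

definition kaehler_differentials ::
  "('a, 'm) ring_scheme \<Rightarrow> 'a set \<Rightarrow> ('a, ('a \<Rightarrow> 'a) set) module" where
  "kaehler_differentials R K =
     quotient_module R (free_module R (carrier R)) (kaehler_submodule R K)"

definition kaehler_d :: "('a, 'm) ring_scheme \<Rightarrow> 'a set \<Rightarrow> 'a \<Rightarrow> ('a \<Rightarrow> 'a) set" where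
  "kaehler_d R K a = kaehler_submodule R K +>\<^bsub>free_module R (carrier R)\<^esub> free_basis R a"


section \<open>Symmetric algebra and Rees algebra\<close>

text \<open>
  Polynomials over \<open>R\<close> in a set \<open>V\<close> of indeterminates, on the carrier provided by
  \<^theory>\<open>HOL-Algebra.Indexed_Polynomials\<close>: monomials are multisets of indeterminates.
\<close>

definition poly_ring_over :: "('a, 'm) ring_scheme \<Rightarrow> 'x set \<Rightarrow> ('x multiset \<Rightarrow> 'a) ring" where
  "poly_ring_over R V =
     \<lparr>carrier = ring.indexed_pset R V (carrier R),
      monoid.mult = (\<lambda>P Q m. \<Oplus>\<^bsub>R\<^esub>u\<in>{u. u \<subseteq># m}. P u \<otimes>\<^bsub>R\<^esub> Q (m - u)),
      one = ring.indexed_const R \<one>\<^bsub>R\<^esub>,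
      ring.zero = ring.indexed_const R \<zero>\<^bsub>R\<^esub>,
      add = ring.indexed_padd R\<rparr>"

text \<open>
  The symmetric algebra of \<open>M\<close>: the polynomial ring over \<open>R\<close> with one indeterminate for each
  element of \<open>M\<close>, modulo the relations making \<open>M \<rightarrow> Sym M\<close> an \<open>R\<close>-linear map.
\<close>

definition sym_ideal :: "('a, 'm) ring_scheme \<Rightarrow> ('a, 'b, 'n) module_scheme \<Rightarrow> ('b multiset \<Rightarrow> 'a) set"
  where
  "sym_ideal R M =
     (let P = poly_ring_over R (carrier M); var = ring.indexed_var R; const = ring.indexed_const R in
        genideal P
          ({var (u \<oplus>\<^bsub>M\<^esub> v) \<ominus>\<^bsub>P\<^esub> (var u \<oplus>\<^bsub>P\<^esub> var v) | u v. u \<in> carrier M \<and> v \<in> carrier M} \<union>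
           {var (r \<odot>\<^bsub>M\<^esub> u) \<ominus>\<^bsub>P\<^esub> (const r \<otimes>\<^bsub>P\<^esub> var u) | r u. r \<in> carrier R \<and> u \<in> carrier M}))"

definition sym_algebra ::
  "('a, 'm) ring_scheme \<Rightarrow> ('a, 'b, 'n) module_scheme \<Rightarrow> ('b multiset \<Rightarrow> 'a) set ring" where
  "sym_algebra R M = poly_ring_over R (carrier M) Quot sym_ideal R M"

definition sym_const ::
  "('a, 'm) ring_scheme \<Rightarrow> ('a, 'b, 'n) module_scheme \<Rightarrow> 'a \<Rightarrow> ('b multiset \<Rightarrow> 'a) set" where
  "sym_const R M r =
     sym_ideal R M +>\<^bsub>poly_ring_over R (carrier M)\<^esub> ring.indexed_const R r"

definition sym_incl ::
  "('a, 'm) ring_scheme \<Rightarrow> ('a, 'b, 'n) module_scheme \<Rightarrow> 'b \<Rightarrow> ('b multiset \<Rightarrow> 'a) set" where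
  "sym_incl R M u =
     sym_ideal R M +>\<^bsub>poly_ring_over R (carrier M)\<^esub> ring.indexed_var R u"

definition sym_torsion ::
  "('a, 'm) ring_scheme \<Rightarrow> ('a, 'b, 'n) module_scheme \<Rightarrow> ('b multiset \<Rightarrow> 'a) set set" where
  "sym_torsion R M =
     {s \<in> carrier (sym_algebra R M).
        \<exists>r\<in>nonzerodivisors R. sym_const R M r \<otimes>\<^bsub>sym_algebra R M\<^esub> s = \<zero>\<^bsub>sym_algebra R M\<^esub>}"

definition rees_algebra ::
  "('a, 'm) ring_scheme \<Rightarrow> ('a, 'b, 'n) module_scheme \<Rightarrow> ('b multiset \<Rightarrow> 'a) set set ring" where
  "rees_algebra R M = sym_algebra R M Quot sym_torsion R M"

definition rees_kernel ::
  "('a, 'm) ring_scheme \<Rightarrow> ('a, 'b, 'n) module_scheme \<Rightarrow> ('b multiset \<Rightarrow> 'a) set set" where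
  "rees_kernel R M =
     a_kernel (sym_algebra R M) (rees_algebra R M)
       (\<lambda>s. sym_torsion R M +>\<^bsub>sym_algebra R M\<^esub> s)"


section \<open>Polynomial rings over a field\<close>

type_synonym ('i, 'k) mpoly = "('i \<Rightarrow>\<^sub>0 nat) \<Rightarrow>\<^sub>0 'k"

text \<open>\<open>S = k[x\<^sub>1,\<dots>,x\<^sub>4]\<close> and \<open>T = k[y\<^sub>1,\<dots>,y\<^sub>4]\<close>; the four indices are the elements of the type \<open>4\<close>.\<close>

type_synonym 'k poly4 = "(4, 'k) mpoly"

text \<open>\<open>B = S \<otimes>\<^sub>k T\<close>: \<open>Inl i\<close> is the index of \<open>x\<^sub>i\<close> and \<open>Inr i\<close> that of \<open>y\<^sub>i\<close>.\<close>

type_synonym 'k poly44 = "(4 + 4, 'k) mpoly"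

definition mpoly_const :: "'k \<Rightarrow> ('i, 'k::zero) mpoly" where
  "mpoly_const c = Poly_Mapping.single 0 c"

definition mpoly_var :: "'i \<Rightarrow> ('i, 'k::zero_neq_one) mpoly" where
  "mpoly_var i = Poly_Mapping.single (Poly_Mapping.single i 1) 1"

definition homogeneous :: "nat \<Rightarrow> ('i::finite, 'k::zero) mpoly \<Rightarrow> bool" where
  "homogeneous d p \<longleftrightarrow>
     (\<forall>m\<in>Poly_Mapping.keys p. (\<Sum>i\<in>UNIV. Poly_Mapping.lookup m i) = d)"

definition bihomogeneous :: "nat \<Rightarrow> nat \<Rightarrow> 'k::zero poly44 \<Rightarrow> bool" where
  "bihomogeneous i j b \<longleftrightarrow>
     (\<forall>m\<in>Poly_Mapping.keys b.
        (\<Sum>a\<in>UNIV. Poly_Mapping.lookup m (Inl a)) = i \<and>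
        (\<Sum>a\<in>UNIV. Poly_Mapping.lookup m (Inr a)) = j)"

text \<open>Evaluation in \<open>A\<close>: scalars are mapped by \<open>h\<close> and the indeterminates by \<open>v\<close>.\<close>

definition mpoly_eval ::
  "('a, 'm) ring_scheme \<Rightarrow> ('k::zero \<Rightarrow> 'a) \<Rightarrow> ('i::finite \<Rightarrow> 'a) \<Rightarrow> ('i, 'k) mpoly \<Rightarrow> 'a" where
  "mpoly_eval A h v p =
     (\<Oplus>\<^bsub>A\<^esub>m\<in>Poly_Mapping.keys p.
        h (Poly_Mapping.lookup p m) \<otimes>\<^bsub>A\<^esub>
        (\<Otimes>\<^bsub>A\<^esub>i\<in>UNIV. v i [^]\<^bsub>A\<^esub> Poly_Mapping.lookup m i))"


section \<open>The ring \<open>R = S/(f,g)\<close>, its differentials, and the bigrading\<close>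

abbreviation poly4_ring :: "'k::field poly4 ring" where
  "poly4_ring \<equiv> ring_of_type_algebra"

definition fg_class :: "'k::field poly4 \<Rightarrow> 'k poly4 \<Rightarrow> 'k poly4 \<Rightarrow> 'k poly4 set" where
  "fg_class f g p = genideal poly4_ring {f, g} +>\<^bsub>poly4_ring\<^esub> p"

definition fg_ring :: "'k::field poly4 \<Rightarrow> 'k poly4 \<Rightarrow> 'k poly4 set ring" where
  "fg_ring f g = poly4_ring Quot genideal poly4_ring {f, g}"

definition fg_scalars :: "'k::field poly4 \<Rightarrow> 'k poly4 \<Rightarrow> 'k poly4 set set" where
  "fg_scalars f g = range (\<lambda>c. fg_class f g (mpoly_const c))"

type_synonym 'k omega_elem = "('k poly4 set \<Rightarrow> 'k poly4 set) set"

type_synonym 'k sym_elem = "('k omega_elem multiset \<Rightarrow> 'k poly4 set) set"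

definition Omega :: "'k::field poly4 \<Rightarrow> 'k poly4 \<Rightarrow> ('k poly4 set, 'k omega_elem) module" where
  "Omega f g = kaehler_differentials (fg_ring f g) (fg_scalars f g)"

definition SymOmega :: "'k::field poly4 \<Rightarrow> 'k poly4 \<Rightarrow> 'k sym_elem ring" where
  "SymOmega f g = sym_algebra (fg_ring f g) (Omega f g)"

definition calA :: "'k::field poly4 \<Rightarrow> 'k poly4 \<Rightarrow> 'k sym_elem set" where
  "calA f g = rees_kernel (fg_ring f g) (Omega f g)"

definition sym_scalar :: "'k::field poly4 \<Rightarrow> 'k poly4 \<Rightarrow> 'k \<Rightarrow> 'k sym_elem" where
  "sym_scalar f g c = sym_const (fg_ring f g) (Omega f g) (fg_class f g (mpoly_const c))"

definition sym_x :: "'k::field poly4 \<Rightarrow> 'k poly4 \<Rightarrow> 4 \<Rightarrow> 'k sym_elem" where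
  "sym_x f g i = sym_const (fg_ring f g) (Omega f g) (fg_class f g (mpoly_var i))"

definition sym_dx :: "'k::field poly4 \<Rightarrow> 'k poly4 \<Rightarrow> 4 \<Rightarrow> 'k sym_elem" where
  "sym_dx f g i =
     sym_incl (fg_ring f g) (Omega f g)
       (kaehler_d (fg_ring f g) (fg_scalars f g) (fg_class f g (mpoly_var i)))"

text \<open>
  The bigrading of \<open>Sym \<Omega>\<close> is that of \<open>B/(\<ell>\<^sub>1,\<ell>\<^sub>2,f,g)\<close>, transported along the isomorphism induced by
  the \<open>k\<close>-algebra map \<open>B \<rightarrow> Sym \<Omega>\<close>, \<open>x\<^sub>i \<mapsto> x\<^sub>i\<close>, \<open>y\<^sub>i \<mapsto> dx\<^sub>i\<close>. Hence its \<open>(i,j)\<close>-component is the image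
  of the bihomogeneous polynomials of bidegree \<open>(i,j)\<close> under that map.
\<close>

definition B_to_Sym :: "'k::field poly4 \<Rightarrow> 'k poly4 \<Rightarrow> 'k poly44 \<Rightarrow> 'k sym_elem" where
  "B_to_Sym f g =
     mpoly_eval (SymOmega f g) (sym_scalar f g) (case_sum (sym_x f g) (sym_dx f g))"

definition SymOmega_bideg :: "'k::field poly4 \<Rightarrow> 'k poly4 \<Rightarrow> nat \<Rightarrow> nat \<Rightarrow> 'k sym_elem set" where
  "SymOmega_bideg f g i j = B_to_Sym f g ` {b. bihomogeneous i j b}"

definition calA_bideg :: "'k::field poly4 \<Rightarrow> 'k poly4 \<Rightarrow> nat \<Rightarrow> nat \<Rightarrow> 'k sym_elem set" where
  "calA_bideg f g i j = calA f g \<inter> SymOmega_bideg f g i j"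

definition calA_row :: "'k::field poly4 \<Rightarrow> 'k poly4 \<Rightarrow> nat \<Rightarrow> 'k sym_elem set" where
  "calA_row f g i =
     {\<Oplus>\<^bsub>SymOmega f g\<^esub>j\<in>{..n}. a j | a n. \<forall>j::nat. a j \<in> calA_bideg f g i j}"

text \<open>\<open>Sym \<Omega>\<close> as a module over \<open>T\<close>, where \<open>y\<^sub>i\<close> acts as multiplication by \<open>dx\<^sub>i\<close>.\<close>

definition SymOmega_T :: "'k::field poly4 \<Rightarrow> 'k poly4 \<Rightarrow> ('k poly4, 'k sym_elem) module" where
  "SymOmega_T f g =
     \<lparr>carrier = carrier (SymOmega f g), monoid.mult = monoid.mult (SymOmega f g),
      one = monoid.one (SymOmega f g),
      ring.zero = ring.zero (SymOmega f g), add = ring.add (SymOmega f g),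
      module.smult = (\<lambda>t s. mpoly_eval (SymOmega f g) (sym_scalar f g) (sym_dx f g) t
                       \<otimes>\<^bsub>SymOmega f g\<^esub> s)\<rparr>"

definition T_minimally_generates ::
  "'k::field poly4 \<Rightarrow> 'k poly4 \<Rightarrow> 'k sym_elem set \<Rightarrow> 'k sym_elem set \<Rightarrow> bool" where
  "T_minimally_generates f g G N \<longleftrightarrow> minimally_generates poly4_ring (SymOmega_T f g) G N"

end

theory Submission
 imports Defs "HOL-Analysis.Determinants"
begin

text \<open>Normality of R makes the curve f = g = 0 in projective 3-space smooth, and for a pencil
  of quadrics this means four distinct singular members. Over an algebraic closure the pencil is
  therefore simultaneously diagonal, f = sum p_i x_i^2 and g = sum q_i x_i^2 with all minors d_ij =
  p_i q_j - p_j q_i nonzero (\<open>diagonalization\<close>). The argument is elementary: every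
  degeneration of the pencil has a normal form in which an explicit fraction is integral over R but
  not in R, or a nilpotent or an extra syzygy appears (\<open>not_nrm_rank2\<close> to
  \<open>not_nrm_cubic\<close>). This is done over k itself, where a double root of det (A + tC) is
  either rational or one of two conjugates (\<open>Pd_simple_roots\<close>).

  For the diagonal pencil the symmetric algebra is B/I with I = (FF, GG, L1, L2). Where x_i x_j is
  invertible, two of the y-variables can be solved for, so R-torsion is the same as being killed by
  powers of the x_i (\<open>torsion_X\<close>, \<open>torsion_iff\<close>). Modulo (FF, GG) both L1,
  L2 and x_1, x_2 are regular sequences. Koszul relations then match elements killed by x_1, x_2
  modulo I with elements of B/(FF, GG, x_1, x_2) = T[x_3, x_4]/(x_3^2, x_4^2) killed by the L's,
  that is with T-multiples of x_3 x_4. So the former are a free T-module on one element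
  \<open>Del\<close> of bidegree (2,2) (\<open>socle\<close>, \<open>Del_free\<close>).

  The other degrees follow by multiplying with the x_j. In x-degree at least 3 there is no torsion,
  and in x-degree 2 it is T times \<open>Del\<close>. In x-degree 1, x_j b = v_j Del where v is a
  syzygy of the 2 by 4 matrix with columns (p_m y_m, q_m y_m). These syzygies are generated by the
  four rows of a skew matrix of quadrics, which gives four generators of bidegree (1,4)
  (\<open>syzygy_span\<close>, \<open>row1\<close>). In x-degree 0, the matrix psi in x_i x_j b =
  psi_ij Del is proportional to a symmetric matrix of sextics with no common factor, which gives one
  generator of bidegree (0,8) (\<open>WW_proportional\<close>, \<open>row0\<close>); geometrically
  it is the equation of the tangent developable of the elliptic quartic.

  Generators return to the original coordinates and to k by linear algebra
  (\<open>good_linB\<close>, \<open>good_descent\<close>). The formally constructed symmetric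
  algebra is identified with B modulo the ideal of f, g and their differentials
  (\<open>pres_B\<close>, \<open>beta_eq_0\<close>). Minimality follows because all generators of a
  row have one bidegree and are linearly independent over k (\<open>row_generated\<close>).\<close>

abbreviation (input) "pml \<equiv> Poly_Mapping.lookup"
abbreviation (input) "pmk \<equiv> Poly_Mapping.keys"
abbreviation (input) "pms \<equiv> Poly_Mapping.single"
abbreviation (input) "pco \<equiv> Polynomial.coeff"
abbreviation (input) "pdeg \<equiv> Polynomial.degree"
abbreviation (input) "mc \<equiv> mpoly_const"
abbreviation (input) "mpv \<equiv> mpoly_var"

section \<open>Homomorphisms of type-class rings and evaluation of polynomials\<close>

section \<open>Ring homomorphisms and evaluation\<close>

text \<open>A predicate on functions, so that evaluations, projections, gradings and coordinate
  changes can be composed freely and compared on generators.\<close>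

definition rhom :: "('a::comm_ring_1 \<Rightarrow> 'b::comm_ring_1) \<Rightarrow> bool" where
 "rhom h \<longleftrightarrow> h 1 = 1 \<and> (\<forall>a b. h (a + b) = h a + h b) \<and> (\<forall>a b. h (a * b) = h a * h b)"

lemma rhomI: "h 1 = 1 ==> (\<And>a b. h (a + b) = h a + h b) ==> (\<And>a b. h (a * b) = h a * h b) ==> rhom h"
 by (simp add: rhom_def)

lemma rhom_1: "rhom h ==> h 1 = 1"
 and rhom_add: "rhom h ==> h (a + b) = h a + h b"
 and rhom_mult: "rhom h ==> h (a * b) = h a * h b"
 by (simp_all add: rhom_def)

lemma rhom_0: assumes "rhom h" shows "h 0 = 0"
 using rhom_add[OF assms, of 0 0] by simp

lemma rhom_minus: assumes "rhom h" shows "h (- a) = - h a"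
 using rhom_add[OF assms, of a "-a"] rhom_0[OF assms] by (simp add: eq_neg_iff_add_eq_0 add.commute)

lemma rhom_diff: "rhom h ==> h (a - b) = h a - h b"
 using rhom_add[of h a "-b"] rhom_minus[of h b] by simp

lemma rhom_power: "rhom h ==> h (a ^ n) = h a ^ n"
 by (induction n) (simp_all add: rhom_1 rhom_mult)

lemma rhom_sum: "rhom h ==> h (sum f A) = (\<Sum>a\<in>A. h (f a))"
 by (induction A rule: infinite_finite_induct) (simp_all add: rhom_0 rhom_add)

lemma rhom_prod: "rhom h ==> h (prod f A) = (\<Prod>a\<in>A. h (f a))"
 by (induction A rule: infinite_finite_induct) (simp_all add: rhom_1 rhom_mult)

lemma rhom_of_nat: "rhom h ==> h (of_nat n) = of_nat n"
 by (induction n) (simp_all add: rhom_0 rhom_add rhom_1)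

lemma rhom_numeral: "rhom h ==> h (numeral n) = numeral n"
 using rhom_of_nat[of h "numeral n"] by simp

lemmas rhom_simps = rhom_0 rhom_1 rhom_add rhom_mult rhom_minus rhom_diff rhom_power rhom_sum
 rhom_prod rhom_numeral

lemma rhom_comp: "rhom h ==> rhom g ==> rhom (\<lambda>x. g (h x))"
 by (simp add: rhom_def)

lemma rhom_id: "rhom (\<lambda>x. x)"
 by (simp add: rhom_def)

lemma rhom_poly_const: "rhom (\<lambda>c. [:c:])"
 by (simp add: rhom_def one_pCons)

lemma rhom_poly_eval: "rhom (\<lambda>p. poly p x)"
 by (simp add: rhom_def)

text \<open>Monomials are mapped by an arbitrary multiplicative \<mu>. One construction thereby
  serves polynomials in finitely many variables (\<open>ev\<close>), gradings (\<open>gpoly\<close>)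
  and polynomials whose monomials are multisets (\<open>Psi\<close>).\<close>

definition evm :: "('a::comm_ring_1 \<Rightarrow> 'r::comm_ring_1) \<Rightarrow> ('m::comm_monoid_add \<Rightarrow> 'r) \<Rightarrow> ('m \<Rightarrow>\<^sub>0 'a) \<Rightarrow> 'r"
 where "evm h \<mu> p = (\<Sum>m\<in>pmk p. h (pml p m) * \<mu> m)"

lemma evm_superset:
 assumes "rhom h" "finite A" "pmk p \<subseteq> A"
 shows "evm h \<mu> p = (\<Sum>m\<in>A. h (pml p m) * \<mu> m)"
 unfolding evm_def by (rule sum.mono_neutral_left) (use assms in \<open>auto simp: in_keys_iff rhom_0\<close>)

lemma evm_0: "evm h \<mu> 0 = 0"
 by (simp add: evm_def)

lemma evm_add: assumes "rhom h" shows "evm h \<mu> (p + q) = evm h \<mu> p + evm h \<mu> q"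
proof -
 let ?A = "pmk p \<union> pmk q"
 have "evm h \<mu> (p + q) = (\<Sum>m\<in>?A. h (pml (p + q) m) * \<mu> m)"
  by (rule evm_superset[OF assms]) (use Poly_Mapping.keys_add[of p q] in auto)
 also have "\<dots> = (\<Sum>m\<in>?A. h (pml p m) * \<mu> m) + (\<Sum>m\<in>?A. h (pml q m) * \<mu> m)"
  by (simp add: lookup_add rhom_add[OF assms] distrib_right sum.distrib)
 also have "\<dots> = evm h \<mu> p + evm h \<mu> q"
  using evm_superset[OF assms, of ?A p \<mu>] evm_superset[OF assms, of ?A q \<mu>] by simp
 finally show ?thesis .
qed

lemma evm_sum: "rhom h ==> evm h \<mu> (sum f A) = (\<Sum>a\<in>A. evm h \<mu> (f a))"
 by (induction A rule: infinite_finite_induct) (simp_all add: evm_0 evm_add)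

lemma evm_single: assumes "rhom h" shows "evm h \<mu> (pms m c) = h c * \<mu> m"
 by (cases "c = 0") (simp_all add: evm_def rhom_0[OF assms])

lemma poly_mapping_eq_sum: "(\<Sum>a\<in>pmk p. pms a (pml p a)) = p"
proof (rule poly_mapping_eqI)
 fix k
 show "pml (\<Sum>a\<in>pmk p. pms a (pml p a)) k =
   pml p k"
  by (auto simp: lookup_sum lookup_single when_def in_keys_iff)
qed

lemma rhom_evm:
 assumes h: "rhom h" and m0: "\<mu> 0 = 1" and ma: "\<And>a b. \<mu> (a + b) = \<mu> a * \<mu> b"
 shows "rhom (evm h \<mu>)"
proof (rule rhomI)
 have "evm h \<mu> 1 = evm h \<mu> (pms 0 1)" by simp
 then show "evm h \<mu> 1 = 1" using evm_single[OF h, of \<mu> 0 1] by (simp add: rhom_1[OF h] m0)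
 show "evm h \<mu> (p + q) = evm h \<mu> p + evm h \<mu> q" for p q by (rule evm_add[OF h])
 show "evm h \<mu> (p * q) = evm h \<mu> p * evm h \<mu> q" for p q
 proof -
  have "p * q = (\<Sum>a\<in>pmk p. pms a (pml p a)) *
    (\<Sum>b\<in>pmk q. pms b (pml q b))"
   by (simp add: poly_mapping_eq_sum)
  also have "\<dots> = (\<Sum>a\<in>pmk p. \<Sum>b\<in>pmk q.
    pms (a + b) (pml p a * pml q b))"
   by (simp add: sum_product mult_single)
  finally have e: "p * q = \<dots>" .
  show ?thesis
   unfolding e by (simp add: evm_sum[OF h] evm_single[OF h] rhom_mult[OF h] ma)
    (simp add: evm_def sum_product algebra_simps)
 qed
qed

definition ev :: "('a::comm_ring_1 \<Rightarrow> 'r::comm_ring_1) \<Rightarrow> ('i::finite \<Rightarrow> 'r) \<Rightarrow> ('i, 'a) mpoly \<Rightarrow> 'r"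
 where "ev h v = evm h (\<lambda>m. \<Prod>i\<in>UNIV. v i ^ pml m i)"

lemma rhom_ev: "rhom h ==> rhom (ev h v)"
 unfolding ev_def by (rule rhom_evm) (simp_all add: lookup_add power_add prod.distrib)

lemma ev_const: assumes "rhom h" shows "ev h v (mc c) = h c"
 using assms by (simp add: ev_def mpoly_const_def evm_single)

lemma ev_var: assumes "rhom h" shows "ev h v (mpv i) = v i"
proof -
 have "(\<Prod>j\<in>UNIV. v j ^ pml (pms i (1::nat)) j) = (\<Prod>j\<in>UNIV. if j = i then v i else 1)"
  by (rule prod.cong) (auto simp: lookup_single when_def)
 then show ?thesis
  using assms by (simp add: ev_def mpoly_var_def evm_single rhom_1)
qed

lemma mpoly_const_0 [simp]: "mc 0 = 0"
 and mpoly_const_1 [simp]: "mc (1::'a::comm_ring_1) = 1"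
 and mpoly_const_add: "mc (a + b) = mc a + mc (b::'a)"
 and mpoly_const_mult: "mc (a * b) = mc a * mc (b::'a)"
 by (simp_all add: mpoly_const_def single_add mult_single)

lemma rhom_const: "rhom (mc :: 'a::comm_ring_1 \<Rightarrow> ('i, 'a) mpoly)"
 by (rule rhomI) (simp_all add: mpoly_const_add mpoly_const_mult)

lemma mpoly_var_power: "mpv i ^ n = pms (pms i n) (1::'a::comm_ring_1)"
proof (induction n)
 case (Suc n)
 have "mpv i ^ Suc n = mpv i * mpv i ^ n" by simp
 also have "\<dots> = pms (pms i (Suc n)) (1::'a)"
  unfolding Suc by (simp add: mpoly_var_def mult_single single_add[symmetric])
 finally show ?case .
qed simp

lemma single_prod: "finite A ==> (\<Prod>i\<in>A. pms (m i) (1::'a::comm_ring_1)) = pms (\<Sum>i\<in>A. m i) 1"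
 for m :: "'b \<Rightarrow> ('i \<Rightarrow>\<^sub>0 nat)"
 by (induction A rule: finite_induct) (simp_all add: mult_single)

lemma single_eq_prod:
 fixes m :: "'i::finite \<Rightarrow>\<^sub>0 nat"
 shows "pms m (c::'a::comm_ring_1) =
  mc c * (\<Prod>i\<in>UNIV. mpv i ^ pml m i)"
proof -
 have "(\<Sum>i\<in>UNIV. pms i (pml m i)) = m"
  by (rule poly_mapping_eqI) (simp add: lookup_sum lookup_single when_def)
 then show ?thesis
  by (simp add: mpoly_var_power single_prod mpoly_const_def mult_single)
qed

text \<open>Every polynomial is a sum of products of constants and variables. Almost all later
  identities between composed maps are reduced to generators by this lemma.\<close>

lemma mpoly_hom_unique:
 fixes \<phi> \<psi> :: "('i::finite, 'a::comm_ring_1) mpoly \<Rightarrow> 'r::comm_ring_1"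
 assumes \<phi>: "rhom \<phi>" and \<psi>: "rhom \<psi>" and c: "\<And>c. \<phi> (mc c) = \<psi> (mc c)"
  and v: "\<And>i. \<phi> (mpv i) = \<psi> (mpv i)"
 shows "\<phi> p = \<psi> p"
proof -
 have "\<phi> (\<Sum>a\<in>pmk p. pms a (pml p a)) =
   \<psi> (\<Sum>a\<in>pmk p. pms a (pml p a))"
  unfolding single_eq_prod by (simp add: rhom_simps[OF \<phi>] rhom_simps[OF \<psi>] c v)
 then show ?thesis by (simp add: poly_mapping_eq_sum)
qed

lemma mpoly_induct [case_names const var add mult]:
 fixes p :: "('i::finite, 'a::comm_ring_1) mpoly"
 assumes c: "\<And>c. P (mc c)" and v: "\<And>i. P (mpv i)"
  and a: "\<And>p q. P p ==> P q ==> P (p + q)" and m: "\<And>p q. P p ==> P q ==> P (p * q)"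
 shows "P p"
proof -
 have P0: "P 0" and P1: "P 1" using c[of 0] c[of 1] by simp_all
 have pw: "P (x ^ n)" if "P x" for x n
  using that by (induction n) (auto simp: P1 m)
 have pr: "P (\<Prod>i\<in>A. mpv i ^ e i)" if "finite A" for A and e :: "'i \<Rightarrow> nat"
  using that by (induction A rule: finite_induct) (auto simp: P1 intro!: m pw v)
 have "P (pms a x)" for a x
  unfolding single_eq_prod by (intro m c pr) simp
 note this [intro]
 have "P (\<Sum>a\<in>A. pms a (pml p a))" if "finite A" for A
  using that
  by (induction A rule: finite_induct) (auto simp: P0 intro!: a)
 then have "P (\<Sum>a\<in>pmk p. pms a (pml p a))" by simp
 then show ?thesis by (simp add: poly_mapping_eq_sum)
qed

section \<open>Expansion in one variable\<close>

section \<open>Coefficients with respect to one variable\<close>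

text \<open>The coefficients stay in the full polynomial ring (they are merely free of z), so degree
  arguments for univariate polynomials apply without changing the ring. \<open>zfree\<close>
  expresses that z does not occur.\<close>

definition zpoly :: "'i::finite \<Rightarrow> ('i, 'a::comm_ring_1) mpoly \<Rightarrow> ('i, 'a) mpoly poly" where
 "zpoly z = ev (\<lambda>c. [:mc c:]) (\<lambda>i. if i = z then [:0, 1:] else [:mpv i:])"

abbreviation cf :: "'i::finite \<Rightarrow> nat \<Rightarrow> ('i, 'a::comm_ring_1) mpoly \<Rightarrow> ('i, 'a) mpoly" where
 "cf z n p \<equiv> pco (zpoly z p) n"

definition zfree :: "'i::finite \<Rightarrow> ('i, 'a::comm_ring_1) mpoly \<Rightarrow> bool" where
 "zfree z p \<longleftrightarrow> zpoly z p = [:p:]"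

lemma rhom_zconst: "rhom (\<lambda>c. [:mc c:])"
 using rhom_comp[OF rhom_const rhom_poly_const] .

lemma rhom_zpoly: "rhom (zpoly z)"
 unfolding zpoly_def by (rule rhom_ev[OF rhom_zconst])

lemma zpoly_const: "zpoly z (mc c) = [:mc c:]"
 and zpoly_var: "zpoly z (mpv i) = (if i = z then [:0, 1:] else [:mpv i:])"
 unfolding zpoly_def by (simp_all add: ev_const[OF rhom_zconst] ev_var[OF rhom_zconst])

lemmas zpoly_simps = zpoly_const zpoly_var rhom_0[OF rhom_zpoly] rhom_1[OF rhom_zpoly]
 rhom_add[OF rhom_zpoly] rhom_mult[OF rhom_zpoly] rhom_minus[OF rhom_zpoly]
 rhom_diff[OF rhom_zpoly] rhom_power[OF rhom_zpoly] rhom_sum[OF rhom_zpoly]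
 rhom_prod[OF rhom_zpoly] rhom_numeral[OF rhom_zpoly]

lemma poly_zpoly: "poly (zpoly z p) (mpv z) = p"
 by (rule mpoly_hom_unique[OF rhom_comp[OF rhom_zpoly rhom_poly_eval] rhom_id])
  (simp_all add: zpoly_simps)

lemma zfree_const [simp]: "zfree z (mc c)"
 and zfree_var [simp]: "zfree z (mpv i) \<longleftrightarrow> i \<noteq> z"
 and zfree_0 [simp]: "zfree z 0"
 and zfree_1 [simp]: "zfree z 1"
 and zfree_add [simp]: "zfree z p ==> zfree z q ==> zfree z (p + q)"
 and zfree_diff [simp]: "zfree z p ==> zfree z q ==> zfree z (p - q)"
 and zfree_minus [simp]: "zfree z p ==> zfree z (- p)"
 and zfree_mult [simp]: "zfree z p ==> zfree z q ==> zfree z (p * q)"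
 by (auto simp: zfree_def zpoly_simps one_pCons)

lemma zfree_power [simp]: "zfree z p ==> zfree z (p ^ n)"
 by (induction n) simp_all

lemma zfree_numeral [simp]: "zfree z (numeral n)"
 by (simp add: zfree_def zpoly_simps numeral_poly)

lemma zfree_sum [simp]: "(\<And>a. a \<in> A ==> zfree z (f a)) ==> zfree z (sum f A)"
 by (induction A rule: infinite_finite_induct) simp_all

lemma zfree_cf [simp]: "zfree z (cf z n p)"
proof (induction p arbitrary: n rule: mpoly_induct)
 case (const c)
 then show ?case by (cases n) (simp_all add: zpoly_simps)
next
 case (var i)
 then show ?case by (cases n; cases "n - 1") (auto simp: zpoly_simps coeff_pCons split: nat.splits)
next
 case (mult p q)
 then show ?case by (simp add: zpoly_simps coeff_mult)
qed (simp add: zpoly_simps)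

lemma zfree_zpoly: "zfree z p ==> zpoly z p = [:p:]"
 by (simp add: zfree_def)

lemma cf_mult_zfree: "zfree z c ==> cf z n (c * p) = c * cf z n p"
 by (simp add: zpoly_simps zfree_zpoly)

lemma mpoly_split_var: "\<exists>q. p = cf z 0 p + mpv z * q"
 using poly_zpoly[of z p] by (cases "zpoly z p") (metis coeff_pCons_0 poly_pCons)

lemma mpoly_split_var2: "\<exists>q. p = cf z 0 p + mpv z * cf z 1 p + (mpv z)\<^sup>2 * q"
proof -
 obtain a b r where e: "zpoly z p = pCons a (pCons b r)" by (metis pCons_cases)
 have "p = a + mpv z * (b + mpv z * poly r (mpv z))"
  using poly_zpoly[of z p] by (simp add: e)
 moreover have "cf z 0 p = a" "cf z 1 p = b" by (simp_all add: e)
 ultimately have "p = cf z 0 p + mpv z * cf z 1 p + (mpv z)\<^sup>2 * poly r (mpv z)"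
  by (simp only: power2_eq_square distrib_left mult.assoc add.assoc)
 then show ?thesis ..
qed

section \<open>Ideals, regular elements and elimination\<close>

section \<open>Ideals and nonzerodivisors\<close>

abbreviation idl :: "'a::comm_ring_1 set \<Rightarrow> 'a set" where "idl \<equiv> Modules.module.span (*)"

lemma module_mult: "Modules.module ((*) :: 'a::comm_ring_1 \<Rightarrow> 'a \<Rightarrow> 'a)"
 by unfold_locales (simp_all add: algebra_simps)

lemmas ispan_base = Modules.module.span_base[OF module_mult]
lemmas ispan_zero = Modules.module.span_zero[OF module_mult]
lemmas ispan_add = Modules.module.span_add[OF module_mult]
lemmas ispan_scale = Modules.module.span_scale[OF module_mult]
lemmas ispan_neg = Modules.module.span_neg[OF module_mult]
lemmas ispan_diff = Modules.module.span_diff[OF module_mult]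
lemmas ispan_sum = Modules.module.span_sum[OF module_mult]
lemmas ispan_insert = Modules.module.span_insert[OF module_mult]
lemmas ispan_empty = Modules.module.span_empty[OF module_mult]
lemmas ispan_minimal = Modules.module.span_minimal[OF module_mult]
lemmas idl_subspace = Modules.module.subspace_span[OF module_mult]
lemmas ispan_induct_alt [consumes 1, case_names base step] = Modules.module.span_induct_alt[OF module_mult]

lemma idl_mult_right: "a \<in> idl G ==> a * c \<in> idl G" for c :: "'a::comm_ring_1"
 using ispan_scale[of a G c] by (simp add: mult.commute)

lemma idl_insert: "x \<in> idl (insert a G) \<longleftrightarrow> (\<exists>k. x - k * a \<in> idl G)" for x :: "'a::comm_ring_1"
 by (simp add: ispan_insert)

lemma idl_mono: "G \<subseteq> idl H ==> idl G \<subseteq> idl H" for G :: "'a::comm_ring_1 set"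
 by (simp add: ispan_minimal idl_subspace)

lemma idl_eqI: "G \<subseteq> idl H ==> H \<subseteq> idl G ==> idl G = idl H" for G :: "'a::comm_ring_1 set"
 using idl_mono[of G H] idl_mono[of H G] by blast

lemma idl_image:
 assumes "rhom \<phi>" "\<And>g. g \<in> G ==> \<phi> g \<in> idl H" "b \<in> idl G"
 shows "\<phi> b \<in> idl H"
 using assms(3)
 by (induction rule: ispan_induct_alt)
  (simp_all add: rhom_simps[OF assms(1)] ispan_zero ispan_add ispan_scale assms(2))

lemma idl_cong_mult: "a - b \<in> idl G ==> c - d \<in> idl G ==> a * c - b * d \<in> idl G"
 for a :: "'a::comm_ring_1"
proof -
 assume "a - b \<in> idl G" "c - d \<in> idl G"
 then have "c * (a - b) + b * (c - d) \<in> idl G" by (intro ispan_add ispan_scale)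
 then show ?thesis by (simp add: algebra_simps)
qed

definition nzd :: "'a::comm_ring_1 \<Rightarrow> 'a set \<Rightarrow> bool" where
 "nzd c J \<longleftrightarrow> (\<forall>b. c * b \<in> J \<longrightarrow> b \<in> J)"

lemma nzdD: "nzd c J ==> c * b \<in> J ==> b \<in> J"
 by (simp add: nzd_def)

lemma nzd_unit: "c * c' = 1 ==> nzd c (idl G)" for c :: "'a::comm_ring_1"
 unfolding nzd_def by (metis ispan_scale mult.assoc mult.commute mult_1)

lemma nzd_const: "c \<noteq> 0 ==> nzd (mc c) (idl G)" for c :: "'a::field"
 by (rule nzd_unit[of _ "mc (inverse c)"]) (simp add: mpoly_const_mult[symmetric])

lemma nzd_mult: "nzd a J ==> nzd b J ==> nzd (a * b) J"
 unfolding nzd_def by (metis mult.assoc)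

lemma nzd_1: "nzd 1 J"
 by (simp add: nzd_def)

lemma nzd_power: "nzd a J ==> nzd (a ^ n) J"
 by (induction n) (simp_all add: nzd_1 nzd_mult)

lemma nzd_left: "nzd (a * b) (idl G) ==> nzd b (idl G)" for a :: "'a::comm_ring_1"
 unfolding nzd_def by (metis ispan_scale mult.assoc mult.left_commute)

lemma nzd_cong:
 fixes a :: "'a::comm_ring_1"
 assumes "a - b \<in> idl G" "nzd a (idl G)" shows "nzd b (idl G)"
 unfolding nzd_def
proof (intro allI impI)
 fix x assume "b * x \<in> idl G"
 then have "b * x + (a - b) * x \<in> idl G" by (rule ispan_add) (rule idl_mult_right[OF assms(1)])
 then have "a * x \<in> idl G" by (simp add: algebra_simps)
 then show "x \<in> idl G" using assms(2) unfolding nzd_def by blast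
qed

text \<open>Exchange in regular sequences: a u = v b makes v a multiple w a modulo G because b is
  regular modulo a, and cancelling a leaves u = w b.\<close>

lemma nzd_exchange:
 fixes a :: "'a::comm_ring_1"
 assumes a: "nzd a (idl G)" and ba: "nzd b (idl (insert a G))" and b: "nzd b (idl G)"
 shows "nzd a (idl (insert b G))"
 unfolding nzd_def
proof (intro allI impI)
 fix u assume "a * u \<in> idl (insert b G)"
 then obtain v where v: "a * u - v * b \<in> idl G" by (auto simp: idl_insert)
 have "b * v \<in> idl (insert a G)"
  unfolding idl_insert by (rule exI[of _ u]) (use ispan_neg[OF v] in \<open>simp add: algebra_simps\<close>)
 then have "v \<in> idl (insert a G)" using ba by (simp add: nzd_def)
 then obtain w where w: "v - w * a \<in> idl G" by (auto simp: idl_insert)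
 have "(a * u - v * b) + b * (v - w * a) \<in> idl G" by (intro ispan_add ispan_scale v w)
 moreover have "(a * u - v * b) + b * (v - w * a) = a * (u - b * w)" by (simp add: algebra_simps)
 ultimately have "a * (u - b * w) \<in> idl G" by simp
 then have "u - w * b \<in> idl G" using a by (auto simp: nzd_def mult.commute)
 then show "u \<in> idl (insert b G)" by (auto simp: idl_insert)
qed

lemma cf_idl:
 assumes "\<And>g. g \<in> G ==> zfree z g" "b \<in> idl G" shows "cf z n b \<in> idl G"
 using assms(2)
 by (induction rule: ispan_induct_alt)
  (simp_all add: zpoly_simps zfree_zpoly assms(1) ispan_zero ispan_add ispan_scale
   ispan_base idl_mult_right)

text \<open>If some coefficient of B lay outside the ideal, take the last such index N: modulo the
  ideal, coefficient m + N of P * B is the leading coefficient of P times coefficient N of B, which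
  regularity forbids. Only coefficients of P * B from m upwards are constrained, as elimination
  requires.\<close>

lemma poly_lead_coeffs_in_idl:
 assumes P: "\<And>n. n > m ==> pco P n = 0" and c: "nzd (pco P m) (idl G)"
  and PB: "\<And>n. n \<ge> m ==> pco (P * B) n \<in> idl G"
 shows "pco B n \<in> idl G"
proof (rule ccontr)
 assume n: "pco B n \<notin> idl G"
 define N where "N = Max {k. pco B k \<notin> idl G}"
 have sub: "{k. pco B k \<notin> idl G} \<subseteq> {..Polynomial.degree B}"
  using ispan_zero[of G] coeff_eq_0[of B] by (metis (mono_tags) atMost_iff mem_Collect_eq not_le subsetI)
 then have fin: "finite {k. pco B k \<notin> idl G}" by (rule finite_subset) simp
 have N: "pco B N \<notin> idl G"
  using Max_in[OF fin] n unfolding N_def by auto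
 have gt: "pco B k \<in> idl G" if "k > N" for k
  using Max_ge[OF fin, of k] that unfolding N_def by auto
 have "pco (P * B) (m + N) = (\<Sum>i\<le>m + N. pco P i * pco B (m + N - i))"
  by (simp add: coeff_mult)
 also have "\<dots> = pco P m * pco B N +
   (\<Sum>i\<in>{..m + N} - {m}. pco P i * pco B (m + N - i))"
  by (subst sum.remove[of _ m]) auto
 finally have e: "pco (P * B) (m + N) = \<dots>" .
 have "(\<Sum>i\<in>{..m + N} - {m}. pco P i * pco B (m + N - i)) \<in> idl G"
 proof (rule ispan_sum)
  fix i assume "i \<in> {..m + N} - {m}"
  then consider "i < m" | "i > m" by fastforce
  then show "pco P i * pco B (m + N - i) \<in> idl G"
   by cases (auto simp: P ispan_zero intro!: ispan_scale gt)
 qed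
 then have "pco P m * pco B N \<in> idl G"
  using ispan_diff[OF PB[of "m + N"]] unfolding e by fastforce
 then show False using c N by (auto simp: nzd_def)
qed

lemma nzd_lead:
 assumes G: "\<And>g. g \<in> G ==> zfree z g" and d: "\<And>n. n > m ==> cf z n p = 0"
  and c: "nzd (cf z m p) (idl G)"
 shows "nzd p (idl G)"
 unfolding nzd_def
proof (intro allI impI)
 fix b assume b: "p * b \<in> idl G"
 have "cf z n b \<in> idl G" for n
 proof (rule poly_lead_coeffs_in_idl[OF d c])
  show "pco (zpoly z p * zpoly z b) k \<in> idl G" for k
   using cf_idl[OF G b, of k] by (simp add: rhom_mult[OF rhom_zpoly])
 qed
 then have "poly (zpoly z b) (mpv z) \<in> idl G"
  unfolding poly_altdef by (intro ispan_sum idl_mult_right)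
 then show "b \<in> idl G" by (simp add: poly_zpoly)
qed

text \<open>The coefficients of positive degree in z force the whole cofactor of p into the ideal,
  so a linear equation with regular leading coefficient imposes nothing on z-free elements.\<close>

lemma idl_elim:
 assumes G: "\<And>g. g \<in> G ==> zfree z g" and d: "\<And>n. n > 1 ==> cf z n p = 0"
  and c: "nzd (cf z 1 p) (idl G)" and x: "zfree z x" "x \<in> idl (insert p G)"
 shows "x \<in> idl G"
proof -
 obtain k where k: "x - k * p \<in> idl G" using x(2) by (auto simp: idl_insert)
 have "pco (zpoly z p * zpoly z k) n \<in> idl G" if "n \<ge> 1" for n
 proof -
  have "cf z n (x - k * p) \<in> idl G" by (rule cf_idl[OF G k])
  then show ?thesis using that ispan_neg[of "cf z n (x - k * p)" G]
   by (simp add: zpoly_simps zfree_zpoly[OF x(1)] coeff_pCons mult.commute split: nat.splits)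
 qed
 then have "cf z n k \<in> idl G" for n
  by (rule poly_lead_coeffs_in_idl[where m = 1 and P = "zpoly z p", rotated 2]) (use c in \<open>simp_all add: d\<close>)
 then have "poly (zpoly z k) (mpv z) \<in> idl G"
  unfolding poly_altdef by (intro ispan_sum idl_mult_right)
 then have "k * p \<in> idl G" by (simp add: poly_zpoly idl_mult_right)
 then show ?thesis using ispan_add[OF k, of "k * p"] by simp
qed

lemma nzd_var: "(\<And>g. g \<in> G ==> zfree z g) ==> nzd (mpv z) (idl G)"
 by (rule nzd_lead[where m = 1]) (auto simp: zpoly_simps coeff_pCons nzd_1 split: nat.splits)

section \<open>Gradings and homogeneous components\<close>

section \<open>Gradings\<close>

definition graded :: "('m::comm_monoid_add \<Rightarrow> nat) \<Rightarrow> bool" where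
 "graded \<delta> \<longleftrightarrow> \<delta> 0 = 0 \<and> (\<forall>a b. \<delta> (a + b) = \<delta> a + \<delta> b)"

definition hdeg :: "('m \<Rightarrow> nat) \<Rightarrow> nat \<Rightarrow> ('m \<Rightarrow>\<^sub>0 'a::zero) \<Rightarrow> bool" where
 "hdeg \<delta> n p \<longleftrightarrow> (\<forall>m\<in>pmk p. \<delta> m = n)"

text \<open>Records the degree as the exponent of an auxiliary variable: homogeneous components
  become coefficients (\<open>hcomp\<close>) and homogeneity becomes being a single monomial
  (\<open>hdeg_iff_gpoly\<close>).\<close>

definition gpoly :: "('m::comm_monoid_add \<Rightarrow> nat) \<Rightarrow> ('m \<Rightarrow>\<^sub>0 'a::comm_ring_1) \<Rightarrow> ('m \<Rightarrow>\<^sub>0 'a) poly" where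
 "gpoly \<delta> = evm (\<lambda>c. [:pms 0 c:]) (\<lambda>m. Polynomial.monom (pms m 1) (\<delta> m))"

abbreviation hcomp :: "('m::comm_monoid_add \<Rightarrow> nat) \<Rightarrow> nat \<Rightarrow> ('m \<Rightarrow>\<^sub>0 'a::comm_ring_1) \<Rightarrow> ('m \<Rightarrow>\<^sub>0 'a)" where
 "hcomp \<delta> n p \<equiv> pco (gpoly \<delta> p) n"

lemma rhom_single0: "rhom (\<lambda>c. pms (0::'m::comm_monoid_add) (c::'a::comm_ring_1))"
 by (rule rhomI) (simp_all add: single_add mult_single)

lemma rhom_gpoly: "graded \<delta> ==> rhom (gpoly \<delta>)"
 unfolding gpoly_def
 by (rule rhom_evm[OF rhom_comp[OF rhom_single0 rhom_poly_const]])
  (simp_all add: graded_def mult_monom mult_single monom_0 one_pCons)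

lemma gpoly_single: "gpoly \<delta> (pms m c) = Polynomial.monom (pms m c) (\<delta> m)"
 unfolding gpoly_def evm_single[OF rhom_comp[OF rhom_single0 rhom_poly_const]]
 by (simp add: smult_monom mult_single)

lemma gpoly_sum_keys: "gpoly \<delta> p = (\<Sum>m\<in>pmk p.
  Polynomial.monom (pms m (pml p m)) (\<delta> m))"
 unfolding gpoly_def evm_def by (simp add: smult_monom mult_single)

lemma hdeg_gpoly: "hdeg \<delta> n p ==> gpoly \<delta> p = Polynomial.monom p n"
proof -
 assume "hdeg \<delta> n p"
 then have "gpoly \<delta> p = (\<Sum>m\<in>pmk p.
   Polynomial.monom (pms m (pml p m)) n)"
  unfolding gpoly_sum_keys by (intro sum.cong) (auto simp: hdeg_def)
 also have "\<dots> = Polynomial.monom (\<Sum>m\<in>pmk p. pms m (pml p m)) n"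
  by (rule poly_eqI) (simp add: coeff_sum)
 finally show ?thesis by (simp add: poly_mapping_eq_sum)
qed

lemma lookup_hcomp: "pml (hcomp \<delta> n p) m = (if \<delta> m = n then pml p m else 0)"
proof -
 have "hcomp \<delta> n p = (\<Sum>a\<in>pmk p. if \<delta> a = n then pms a (pml p a) else 0)"
  by (simp add: gpoly_sum_keys coeff_sum)
 then have "pml (hcomp \<delta> n p) m = (\<Sum>a\<in>pmk p. if a = m then (if \<delta> m = n then pml p m else 0) else 0)"
  unfolding \<open>hcomp \<delta> n p = _\<close> lookup_sum by (intro sum.cong) (auto simp: lookup_single when_def)
 then show ?thesis by (auto simp: in_keys_iff)
qed

lemma hdeg_iff_gpoly: "hdeg \<delta> n p \<longleftrightarrow> gpoly \<delta> p = Polynomial.monom p n"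
proof
 assume e: "gpoly \<delta> p = Polynomial.monom p n"
 show "hdeg \<delta> n p"
  unfolding hdeg_def
 proof
  fix m assume m: "m \<in> pmk p"
  have "pml p m = (if \<delta> m = n then pml p m else 0)"
   using lookup_hcomp[of \<delta> p n m] by (simp add: e)
  then show "\<delta> m = n" using m by (auto simp: in_keys_iff split: if_splits)
 qed
qed (rule hdeg_gpoly)

lemma hdeg_hcomp: "hdeg \<delta> n (hcomp \<delta> n p)"
 by (auto simp: hdeg_def in_keys_iff lookup_hcomp split: if_splits)

lemma hdeg_keep: "hdeg \<epsilon> k p ==> hdeg \<epsilon> k (hcomp \<delta> n p)"
 by (auto simp: hdeg_def in_keys_iff lookup_hcomp split: if_splits)

lemma sum_hcomp: "(\<Sum>n\<le>pdeg (gpoly \<delta> p). hcomp \<delta> n p) = p"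
proof (rule poly_mapping_eqI)
 fix m
 have "\<delta> m \<le> pdeg (gpoly \<delta> p)" if "pml p m \<noteq> 0"
 proof (rule le_degree)
  have "pml (hcomp \<delta> (\<delta> m) p) m \<noteq> 0" using that by (simp add: lookup_hcomp)
  then show "hcomp \<delta> (\<delta> m) p \<noteq> 0" by (metis lookup_zero)
 qed
 then show "pml (\<Sum>n\<le>pdeg (gpoly \<delta> p). hcomp \<delta> n p) m = pml p m"
  by (auto simp: lookup_sum lookup_hcomp)
qed

lemma hdeg_0 [simp]: "hdeg \<delta> n 0"
 by (simp add: hdeg_def)

lemma hdeg_add: "hdeg \<delta> n p ==> hdeg \<delta> n q ==> hdeg \<delta> n (p + q)"
 unfolding hdeg_def using Poly_Mapping.keys_add[of p q] by blast

lemma hdeg_minus: "hdeg \<delta> n p ==> hdeg \<delta> n (- p)"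
 by (simp add: hdeg_def)

lemma hdeg_diff: "hdeg \<delta> n p ==> hdeg \<delta> n q ==> hdeg \<delta> n (p - q)" for p :: "_ \<Rightarrow>\<^sub>0 'a::comm_ring_1"
 using hdeg_add[of \<delta> n p "- q"] by (simp add: hdeg_minus)

lemma hdeg_mult: "graded \<delta> ==> hdeg \<delta> n p ==> hdeg \<delta> k q ==> hdeg \<delta> (n + k) (p * q)"
 for p :: "_ \<Rightarrow>\<^sub>0 'a::comm_ring_1"
 by (simp add: hdeg_iff_gpoly rhom_mult[OF rhom_gpoly] mult_monom)

lemma hdeg_sum: "(\<And>a. a \<in> A ==> hdeg \<delta> n (f a)) ==> hdeg \<delta> n (sum f A)"
 by (induction A rule: infinite_finite_induct) (simp_all add: hdeg_add)

lemma hdeg_power: "graded \<delta> ==> hdeg \<delta> n p ==> hdeg \<delta> (k * n) (p ^ k)"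
 for p :: "_ \<Rightarrow>\<^sub>0 'a::comm_ring_1"
proof (induction k)
 case 0
 then show ?case by (simp add: hdeg_iff_gpoly rhom_1[OF rhom_gpoly] monom_0 one_pCons)
next
 case (Suc k)
 then show ?case using hdeg_mult[of \<delta> n p "k * n" "p ^ k"] by simp
qed

lemma hcomp_mult: "graded \<delta> ==> hdeg \<delta> d h ==> hcomp \<delta> n (h * p) = (if d \<le> n then h * hcomp \<delta> (n - d) p else 0)"
 by (simp add: rhom_mult[OF rhom_gpoly] hdeg_gpoly coeff_monom_mult)

lemma hcomp_hom: "hdeg \<delta> d h ==> hcomp \<delta> n h = (if d = n then h else 0)"
 by (simp add: hdeg_gpoly)

lemma hcomp_add: "graded \<delta> ==> hcomp \<delta> n (p + q) = hcomp \<delta> n p + hcomp \<delta> n q"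
 and hcomp_diff: "graded \<delta> ==> hcomp \<delta> n (p - q) = hcomp \<delta> n p - hcomp \<delta> n q"
 and hcomp_sum: "graded \<delta> ==> hcomp \<delta> n (sum f A) = (\<Sum>a\<in>A. hcomp \<delta> n (f a))"
 by (simp_all add: rhom_simps[OF rhom_gpoly] coeff_sum)

lemma hcomp_idl:
 assumes \<delta>: "graded \<delta>" and G: "\<And>g. g \<in> G ==> \<exists>d. hdeg \<delta> d g" and "b \<in> idl G"
 shows "hcomp \<delta> n b \<in> idl G"
 using assms(3)
proof (induction rule: ispan_induct_alt)
 case base
 then show ?case by (simp add: rhom_0[OF rhom_gpoly[OF \<delta>]] ispan_zero)
next
 case (step c x y)
 obtain d where "hdeg \<delta> d x" using G step by blast
 then have "hcomp \<delta> n (x * c) \<in> idl G"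
  using hcomp_mult[OF \<delta>, of d x c n] step by (auto simp: ispan_zero ispan_base idl_mult_right)
 then show ?case using step by (simp add: hcomp_add[OF \<delta>] ispan_add mult.commute)
qed

lemma zpoly_monic:
 assumes "zfree z c" "zfree z r" "m > 0"
 shows "cf z n (c * mpv z ^ m + r) = (if n = m then c else if n = 0 then r else 0)"
proof -
 have "[:0, 1:] ^ m = Polynomial.monom (1 :: ('a, 'b) mpoly) m" for m
  by (induction m) (simp_all add: monom_0 one_pCons monom_Suc)
 then show ?thesis
  using assms by (simp add: zpoly_simps zfree_zpoly coeff_pCons split: nat.splits)
qed

lemma nzd_monic:
 assumes G: "\<And>g. g \<in> G ==> zfree z g" and c: "zfree z c" "nzd c (idl G)" and r: "zfree z r" and m: "m > 0"
 shows "nzd (c * mpv z ^ m + r) (idl G)"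
 by (rule nzd_lead[OF G, where m = m]) (simp_all add: zpoly_monic c r m)

lemma idl_elim_linear:
 assumes G: "\<And>g. g \<in> G ==> zfree z g" and c: "zfree z c" "nzd c (idl G)" and r: "zfree z r"
  and x: "zfree z x" "x \<in> idl (insert (c * mpv z + r) G)"
 shows "x \<in> idl G"
 by (rule idl_elim[OF G, where p = "c * mpv z + r"])
  (use zpoly_monic[OF c(1) r, of 1] in \<open>simp_all add: c x\<close>)

section \<open>Syzygies over T attached to the diagonal pencil\<close>

section \<open>Syzygies of the diagonal pencil\<close>

lemma rhom_cf0: "rhom (cf z 0)"
 by (rule rhomI) (simp_all add: zpoly_simps coeff_mult_0)

lemma cf0_const [simp]: "cf z 0 (mc c) = mc c"
 and cf0_var: "cf z 0 (mpv i) = (if i = z then 0 else mpv i)"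
 and cf0_idem [simp]: "cf z 0 (cf z 0 h) = cf z 0 h"
 using zfree_cf[where z = z and n = 0 and p = h] by (simp_all add: zpoly_simps zfree_zpoly)

lemmas cf0_simps = rhom_simps[OF rhom_cf0] cf0_var

lemma cf0_eq_0: "cf z 0 h = 0 ==> \<exists>h'. h = mpv z * h'"
 using mpoly_split_var[of h z] by auto

lemma mpoly_var_neq_0 [simp]: "mpv i \<noteq> (0 :: ('i, 'a::zero_neq_one) mpoly)"
 unfolding mpoly_var_def by (metis lookup_single_eq lookup_zero zero_neq_one)

lemma mpoly_const_eq_0 [simp]: "mc c = 0 \<longleftrightarrow> c = 0"
 unfolding mpoly_const_def by (metis lookup_single_eq lookup_zero single_zero)

lemma mpoly_const_dvd: "c \<noteq> 0 ==> \<exists>t. h = mc c * t" for c :: "'a::field"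
 by (rule exI[of _ "mc (inverse c) * h"]) (simp add: mult.assoc[symmetric] mpoly_const_mult[symmetric])

text \<open>The pencil spanned by sum p_i x_i^2 and sum q_i x_i^2; \<open>nondeg\<close> says that
  the four points (p_i : q_i) of the projective line are distinct, that is, that the four singular
  members are.\<close>

locale diag =
 fixes p q :: "4 \<Rightarrow> 'a::field_char_0"
 assumes nondeg: "i \<noteq> j ==> p i * q j - p j * q i \<noteq> 0"
begin

definition d :: "4 \<Rightarrow> 4 \<Rightarrow> 'a" where "d i j = p i * q j - p j * q i"

lemma d_same [simp]: "d i i = 0" by (simp add: d_def)
lemma d_nz [simp]: "d i j = 0 \<longleftrightarrow> i = j" using nondeg[of i j] by (auto simp: d_def)
lemma d_swap: "d i j = - d j i" by (simp add: d_def)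

text \<open>The Buchsbaum-Rim relations of the 2 by 4 matrix with columns (p_m y_m, q_m y_m): up to
  sign, entry i j is the 2 by 2 minor on the two complementary columns.\<close>

definition PP :: "4 \<Rightarrow> 4 \<Rightarrow> 'a poly4" where
 "PP i j = (let y = mpv; D = (\<lambda>i j. mc (d i j)) in
  if i = 1 then (if j = 2 then D 3 4 * y 3 * y 4 else if j = 3 then - D 2 4 * y 2 * y 4
   else if j = 4 then D 2 3 * y 2 * y 3 else 0)
  else if i = 2 then (if j = 1 then - D 3 4 * y 3 * y 4 else if j = 3 then D 1 4 * y 1 * y 4
   else if j = 4 then - D 1 3 * y 1 * y 3 else 0)
  else if i = 3 then (if j = 1 then D 2 4 * y 2 * y 4 else if j = 2 then - D 1 4 * y 1 * y 4
   else if j = 4 then D 1 2 * y 1 * y 2 else 0)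
  else (if j = 1 then - D 2 3 * y 2 * y 3 else if j = 2 then D 1 3 * y 1 * y 3
   else if j = 3 then - D 1 2 * y 1 * y 2 else 0))"

text \<open>The table of coefficients in x_i x_j rho = WW j i Del (\<open>X_X_rho\<close>), where
  \<open>rho\<close> generates the torsion in x-degree 0.\<close>

definition WW :: "4 \<Rightarrow> 4 \<Rightarrow> 'a poly4" where
 "WW i j = (\<Sum>k\<in>UNIV. \<Sum>l\<in>UNIV. mc (d k l) * PP i k * PP k l * PP l j)"

lemma PP_syz: "(\<Sum>m\<in>UNIV. mc (d l m) * PP i m * mpv m) = 0"
proof -
 have "i = 1 \<or> i = 2 \<or> i = 3 \<or> i = 4" "l = 1 \<or> l = 2 \<or> l = 3 \<or> l = 4"
  using exhaust_4 by blast+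
 then show ?thesis
  by (elim disjE) (simp_all add: sum_4 PP_def d_def rhom_simps[OF rhom_const] algebra_simps)
qed

lemma PP_skew: "PP i j = - PP j i"
 using exhaust_4[of i] exhaust_4[of j] by (elim disjE) (simp_all add: PP_def)

text \<open>After exchanging the summation indices, \<open>d\<close> and the three factors
  \<open>PP\<close> each change sign; the four signs cancel.\<close>

lemma WW_sym: "WW i j = WW j i"
proof -
 have "WW i j = (\<Sum>l\<in>UNIV. \<Sum>k\<in>UNIV. mc (d k l) * PP i k * PP k l * PP l j)"
  unfolding WW_def by (rule sum.swap)
 also have "\<dots> = WW j i"
  unfolding WW_def
 proof (intro sum.cong refl)
  fix l k :: 4
  show "mc (d k l) * PP i k * PP k l * PP l j = mc (d l k) * PP j l * PP l k * PP k i"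
   unfolding PP_skew[of i k] PP_skew[of k l] PP_skew[of l j] d_swap[of k l]
   by (simp add: rhom_minus[OF rhom_const])
 qed
 finally show ?thesis .
qed

lemma WW_syz: "(\<Sum>m\<in>UNIV. mc (d l m) * WW i m * mpv m) = 0"
proof -
 have "(\<Sum>m\<in>UNIV. mc (d l m) * WW i m * mpv m) =
   (\<Sum>m\<in>UNIV. \<Sum>k\<in>UNIV. \<Sum>n\<in>UNIV. mc (d k n) * PP i k * PP k n *
    (mc (d l m) * PP n m * mpv m))"
  unfolding WW_def by (simp add: sum_distrib_left sum_distrib_right mult_ac)
 also have "\<dots> = (\<Sum>k\<in>UNIV. \<Sum>n\<in>UNIV. \<Sum>m\<in>UNIV. mc (d k n) * PP i k * PP k n *
    (mc (d l m) * PP n m * mpv m))"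
  by (subst sum.swap) (intro sum.cong refl sum.swap)
 also have "\<dots> = 0"
  by (simp add: sum_distrib_left[symmetric] PP_syz)
 finally show ?thesis .
qed

text \<open>The syzygy is reduced modulo y_1, where it is a multiple of the first row of
  \<open>PP\<close>. The remainder is divisible by y_1, and dividing leaves an ordinary relation
  between y_2, y_3, y_4, which yields the other three rows.\<close>

lemma syzygy_span:
 fixes v :: "4 \<Rightarrow> 'a poly4"
 assumes v: "\<And>l. (\<Sum>m\<in>UNIV. mc (d l m) * v m * mpv m) = 0"
 shows "\<exists>t. \<forall>j. v j = (\<Sum>l\<in>UNIV. t l * PP l j)"
proof -
 define y where "y = (mpv :: 4 \<Rightarrow> 'a poly4)"
 define D where "D = (\<lambda>i j. mc (d i j) :: 'a poly4)"
 have Dn: "D i j \<noteq> 0" if "i \<noteq> j" for i j using that by (simp add: D_def)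
 have yn: "y i \<noteq> 0" for i by (simp add: y_def)
 have cy: "cf z 0 (y i) = (if i = z then 0 else y i)" and cD: "cf z 0 (D i j) = D i j" for z i j
  by (simp_all add: y_def D_def cf0_var)
 have dv: "\<exists>h'. h = y z * h'" if "cf z 0 h = 0" for z h
  using cf0_eq_0[OF that] by (simp add: y_def)
 have Dv: "\<exists>t. h = D i j * t" if "i \<noteq> j" for h i j
  using mpoly_const_dvd[of "d i j" h] that by (simp add: D_def)
 have Dsw: "D i j = - D j i" for i j
  unfolding D_def d_swap[of i j] by (simp add: rhom_minus[OF rhom_const])
 have D0: "D i i = 0" for i by (simp add: D_def)
 have E: "D l 1 * v 1 * y 1 + D l 2 * v 2 * y 2 + D l 3 * v 3 * y 3 + D l 4 * v 4 * y 4 = 0" for l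
  using v[of l] by (simp add: sum_4 D_def y_def)
 \<comment> \<open>At y_1 = 0 the equations for l = 3 and l = 4 determine the last three entries up
   to one factor t1, the multiple of the first row of \<open>PP\<close>.\<close>
 have E0: "D l 2 * cf 1 0 (v 2) * y 2 + D l 3 * cf 1 0 (v 3) * y 3 + D l 4 * cf 1 0 (v 4) * y 4 = 0" for l
  using arg_cong[OF E[of l], of "cf 1 0"] by (simp only: cf0_simps cy cD) simp
 define v2 v3 v4 where "v2 = cf 1 0 (v 2)" and "v3 = cf 1 0 (v 3)" and "v4 = cf 1 0 (v 4)"
 have e4: "D 4 2 * v2 * y 2 + D 4 3 * v3 * y 3 = 0" and e3: "D 3 2 * v2 * y 2 + D 3 4 * v4 * y 4 = 0"
  using E0[of 4] E0[of 3] by (simp_all add: v2_def v3_def v4_def D0)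
 have "D 4 2 * cf 3 0 v2 * y 2 = 0"
  using arg_cong[OF e4, of "cf 3 0"] by (simp only: cf0_simps cy cD) simp
 then obtain w where w: "v2 = y 3 * w" using dv[of 3 v2] Dn[of 4 2] yn by auto
 have "D 3 2 * (y 3 * cf 4 0 w) * y 2 = 0"
  using arg_cong[OF e3, of "cf 4 0"] unfolding w by (simp only: cf0_simps cy cD) simp
 then obtain h where "w = y 4 * h" using dv[of 4 w] Dn[of 3 2] yn by auto
 then obtain t1 where t1: "v2 = D 3 4 * y 3 * y 4 * t1" using w Dv[of 3 4 h] by (auto simp: mult_ac)
 have "D 3 4 * y 3 * (v3 + D 2 4 * y 2 * y 4 * t1) = 0"
 proof -
  have "D 3 4 * y 3 * (v3 + D 2 4 * y 2 * y 4 * t1) = - (D 4 2 * v2 * y 2 + D 4 3 * v3 * y 3)"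
   unfolding t1 Dsw[of 4 2] Dsw[of 4 3] by (simp add: algebra_simps)
  then show ?thesis using e4 by simp
 qed
 then have t13: "v3 = - D 2 4 * y 2 * y 4 * t1"
  using Dn[of 3 4] yn by (simp add: eq_neg_iff_add_eq_0)
 have "D 3 4 * y 4 * (v4 - D 2 3 * y 2 * y 3 * t1) = 0"
 proof -
  have "D 3 4 * y 4 * (v4 - D 2 3 * y 2 * y 3 * t1) = D 3 2 * v2 * y 2 + D 3 4 * v4 * y 4"
   unfolding t1 Dsw[of 3 2] by (simp add: algebra_simps)
  then show ?thesis using e3 by simp
 qed
 then have t14: "v4 = D 2 3 * y 2 * y 3 * t1"
  using Dn[of 3 4] yn by simp
 have idem: "cf 1 0 v2 = v2" "cf 1 0 v3 = v3" "cf 1 0 v4 = v4"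
  by (simp_all add: v2_def v3_def v4_def)
 have "cf 1 0 (v 2 - v2) = 0" "cf 1 0 (v 3 - v3) = 0" "cf 1 0 (v 4 - v4) = 0"
  unfolding rhom_diff[OF rhom_cf0] idem by (simp_all add: v2_def v3_def v4_def)
 then obtain u2 u3 u4 where u: "v 2 = v2 + y 1 * u2" "v 3 = v3 + y 1 * u3" "v 4 = v4 + y 1 * u4"
  using dv by (metis diff_eq_eq add.commute)
 define w2 w3 w4 where "w2 = D 1 2 * u2" and "w3 = D 1 3 * u3" and "w4 = D 1 4 * u4"
 \<comment> \<open>The Pluecker relation, which makes the contribution of t1 drop out of the
   equation for l = 1.\<close>
 have pl: "D 1 2 * D 3 4 - D 1 3 * D 2 4 + D 1 4 * D 2 3 = 0"
  by (simp add: D_def mpoly_const_mult[symmetric] rhom_diff[OF rhom_const, symmetric] mpoly_const_add[symmetric])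
   (simp add: d_def algebra_simps)
 have "y 1 * (w2 * y 2 + w3 * y 3 + w4 * y 4) = 0"
 proof -
  have "y 1 * (w2 * y 2 + w3 * y 3 + w4 * y 4) = (D 1 1 * v 1 * y 1 + D 1 2 * v 2 * y 2 + D 1 3 * v 3 * y 3 + D 1 4 * v 4 * y 4)
    - (D 1 2 * D 3 4 - D 1 3 * D 2 4 + D 1 4 * D 2 3) * (y 2 * y 3 * y 4 * t1)"
   unfolding u t1 t13 t14 w2_def w3_def w4_def D0 by (simp add: algebra_simps)
  then show ?thesis unfolding E pl by simp
 qed
 then have k: "w2 * y 2 + w3 * y 3 + w4 * y 4 = 0" using yn by simp
 \<comment> \<open>The relation \<open>k\<close> between y_2, y_3, y_4 is solved by Koszul
   relations; c, e and e' are their cofactors.\<close>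
 have k2: "cf 2 0 w3 * y 3 + cf 2 0 w4 * y 4 = 0"
  using arg_cong[OF k, of "cf 2 0"] by (simp only: cf0_simps cy cD) simp
 have "cf 4 0 (cf 2 0 w3) * y 3 = 0"
  using arg_cong[OF k2, of "cf 4 0"] by (simp only: cf0_simps cy cD) simp
 then obtain c where c: "cf 2 0 w3 = y 4 * c" using dv[of 4 "cf 2 0 w3"] yn by auto
 have "y 4 * (cf 2 0 w4 + y 3 * c) = 0" using k2 unfolding c by (simp add: algebra_simps)
 then have c4: "cf 2 0 w4 = - (y 3 * c)" using yn by (simp add: eq_neg_iff_add_eq_0)
 have c3': "cf 2 0 (y 4 * c) = y 4 * c" using cf0_idem[of 2 w3] unfolding c .
 have c4': "cf 2 0 (y 3 * c) = y 3 * c"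
  using cf0_idem[of 2 w4] unfolding c4 rhom_minus[OF rhom_cf0] by simp
 have "cf 2 0 (w3 - y 4 * c) = 0" "cf 2 0 (w4 + y 3 * c) = 0"
  unfolding rhom_diff[OF rhom_cf0] rhom_add[OF rhom_cf0] c3' c4' c c4 by simp_all
 then obtain e e' where e: "w3 = y 4 * c + y 2 * e" "w4 = - (y 3 * c) + y 2 * e'"
  using dv[of 2 "w3 - y 4 * c"] dv[of 2 "w4 + y 3 * c"] by (auto simp: algebra_simps add_eq_0_iff)
 have "y 2 * (w2 + y 3 * e + y 4 * e') = 0" using k unfolding e by (simp add: algebra_simps)
 then have "w2 + y 3 * e + y 4 * e' = 0" using yn by (simp only: mult_eq_0_iff) simp
 then have "w2 + (y 3 * e + y 4 * e') = 0" by (simp only: add.assoc)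
 then have "w2 = - (y 3 * e + y 4 * e')" by (simp only: eq_neg_iff_add_eq_0)
 then have e2: "w2 = - (y 3 * e) - y 4 * e'" by simp
 \<comment> \<open>Nonzero constants are units, so the cofactors can be rescaled to become the
   coefficients t2, t3, t4 of the last three rows of \<open>PP\<close>.\<close>
 have DDv: "\<exists>t. g = D i j * D k l * t" if "i \<noteq> j" "k \<noteq> l" for g i j k l
  using Dv[OF that(1), of g] Dv[OF that(2)] by (metis mult.assoc)
 obtain t2 where t2: "c = D 1 3 * D 1 4 * t2" using DDv[of 1 3 1 4 c] by auto
 obtain t3 where t3: "e' = D 1 2 * D 1 4 * t3" using DDv[of 1 2 1 4 e'] by auto
 obtain t4 where t4: "- e = D 1 2 * D 1 3 * t4" using DDv[of 1 2 1 3 "- e"] by auto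
 then have t4': "e = - (D 1 2 * D 1 3 * t4)" by (metis minus_minus)
 have "D 1 3 * u3 = D 1 3 * (D 1 4 * y 4 * t2 - D 1 2 * y 2 * t4)"
  using e(1) unfolding w3_def t2 t4' by (simp add: algebra_simps)
 then have u3: "u3 = D 1 4 * y 4 * t2 - D 1 2 * y 2 * t4" using Dn[of 1 3] by simp
 have "D 1 4 * u4 = D 1 4 * (D 1 2 * y 2 * t3 - D 1 3 * y 3 * t2)"
  using e(2) unfolding w4_def t2 t3 by (simp add: algebra_simps)
 then have u4: "u4 = D 1 2 * y 2 * t3 - D 1 3 * y 3 * t2" using Dn[of 1 4] by simp
 have "D 1 2 * u2 = D 1 2 * (D 1 3 * y 3 * t4 - D 1 4 * y 4 * t3)"
  using e2 unfolding w2_def t3 t4' by (simp add: algebra_simps)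
 then have u2: "u2 = D 1 3 * y 3 * t4 - D 1 4 * y 4 * t3" using Dn[of 1 2] by simp
 have V2: "v 2 = D 3 4 * y 3 * y 4 * t1 + y 1 * (D 1 3 * y 3 * t4 - D 1 4 * y 4 * t3)"
  and V3: "v 3 = - D 2 4 * y 2 * y 4 * t1 + y 1 * (D 1 4 * y 4 * t2 - D 1 2 * y 2 * t4)"
  and V4: "v 4 = D 2 3 * y 2 * y 3 * t1 + y 1 * (D 1 2 * y 2 * t3 - D 1 3 * y 3 * t2)"
  unfolding u t1 t13 t14 u2 u3 u4 by (rule refl)+
 \<comment> \<open>The first entry has played no part so far, since the equation for l = 1 does not
   contain it; the equation for l = 2 now determines it.\<close>
 have "D 1 2 * y 1 * (v 1 - (- D 3 4 * y 3 * y 4 * t2 + D 2 4 * y 2 * y 4 * t3 - D 2 3 * y 2 * y 3 * t4)) =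
   - (D 2 1 * v 1 * y 1 + D 2 2 * v 2 * y 2 + D 2 3 * v 3 * y 3 + D 2 4 * v 4 * y 4) -
   (D 1 2 * D 3 4 - D 1 3 * D 2 4 + D 1 4 * D 2 3) * (- (y 1 * y 3 * y 4 * t2))"
  unfolding V2 V3 V4 Dsw[of 2 1] D0 by (simp add: algebra_simps)
 then have V1: "v 1 = - D 3 4 * y 3 * y 4 * t2 + D 2 4 * y 2 * y 4 * t3 - D 2 3 * y 2 * y 3 * t4"
  unfolding E[of 2] pl using Dn[of 1 2] yn by simp
 define t where "t l = (if l = 1 then t1 else if l = 2 then t2 else if l = 3 then t3 else t4)" for l :: 4
 have T: "t 1 = t1" "t 2 = t2" "t 3 = t3" "t 4 = t4" by (simp_all add: t_def)
 have P: "PP 1 1 = 0" "PP 2 2 = 0" "PP 3 3 = 0" "PP 4 4 = 0"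
  "PP 1 2 = D 3 4 * y 3 * y 4" "PP 1 3 = - D 2 4 * y 2 * y 4" "PP 1 4 = D 2 3 * y 2 * y 3"
  "PP 2 1 = - D 3 4 * y 3 * y 4" "PP 2 3 = D 1 4 * y 1 * y 4" "PP 2 4 = - D 1 3 * y 1 * y 3"
  "PP 3 1 = D 2 4 * y 2 * y 4" "PP 3 2 = - D 1 4 * y 1 * y 4" "PP 3 4 = D 1 2 * y 1 * y 2"
  "PP 4 1 = - D 2 3 * y 2 * y 3" "PP 4 2 = D 1 3 * y 1 * y 3" "PP 4 3 = - D 1 2 * y 1 * y 2"
  by (simp_all add: PP_def D_def y_def)
 have "v j = (\<Sum>l\<in>UNIV. t l * PP l j)" for j
  using exhaust_4[of j]
  by (elim disjE; hypsubst; simp only: sum_4 T P V1 V2 V3 V4; simp add: algebra_simps)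
 then show ?thesis by blast
qed

text \<open>The entries of \<open>WW\<close> have no common factor, so an r that divides all b * WW
  i j divides b. Entries 1 1 and 2 2 leave only a monomial in the y_i as a possible obstruction;
  entries 1 2 and 3 4 rule out each variable.\<close>

lemma WW_proportional:
 fixes \<psi> :: "4 \<Rightarrow> 4 \<Rightarrow> 'a poly4"
 assumes r: "r \<noteq> 0" and \<psi>: "\<And>i j. r * \<psi> i j = b * WW i j"
 shows "\<exists>e. b = e * r"
proof -
 define y where "y = (mpv :: 4 \<Rightarrow> 'a poly4)"
 define D where "D = (\<lambda>i j. mc (d i j) :: 'a poly4)"
 have Dn: "D i j \<noteq> 0" if "i \<noteq> j" for i j using that by (simp add: D_def)
 have yn: "y i \<noteq> 0" for i by (simp add: y_def)
 have cy: "cf z 0 (y i) = (if i = z then 0 else y i)" and cD: "cf z 0 (D i j) = D i j" for z i j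
  by (simp_all add: y_def D_def cf0_var)
 have Dsw: "D i j = - D j i" for i j
  unfolding D_def d_swap[of i j] by (simp add: rhom_minus[OF rhom_const])
 have D0: "D i i = 0" for i by (simp add: D_def)
 have P: "PP 1 1 = 0" "PP 2 2 = 0" "PP 3 3 = 0" "PP 4 4 = 0"
  "PP 1 2 = D 3 4 * y 3 * y 4" "PP 1 3 = - D 2 4 * y 2 * y 4" "PP 1 4 = D 2 3 * y 2 * y 3"
  "PP 2 1 = - D 3 4 * y 3 * y 4" "PP 2 3 = D 1 4 * y 1 * y 4" "PP 2 4 = - D 1 3 * y 1 * y 3"
  "PP 3 1 = D 2 4 * y 2 * y 4" "PP 3 2 = - D 1 4 * y 1 * y 4" "PP 3 4 = D 1 2 * y 1 * y 2"
  "PP 4 1 = - D 2 3 * y 2 * y 3" "PP 4 2 = D 1 3 * y 1 * y 3" "PP 4 3 = - D 1 2 * y 1 * y 2"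
  by (simp_all add: PP_def D_def y_def)
 define E1 where "E1 = D 1 2 * y 2 ^ 2 + D 1 3 * y 3 ^ 2 + D 1 4 * y 4 ^ 2"
 define E2 where "E2 = D 1 2 * y 1 ^ 2 + (- (D 2 3 * y 3 ^ 2) - D 2 4 * y 4 ^ 2)"
 define Y where "Y = y 1 * y 2 * y 3 * y 4"
 define c1 where "c1 = 2 * D 2 3 * D 2 4 * D 3 4"
 define c2 where "c2 = 2 * D 1 3 * D 1 4 * D 3 4"
 define E12 where "E12 = D 3 4 * (D 1 2 * D 3 4 ^ 2 * y 3 ^ 2 * y 4 ^ 2 - D 2 3 * D 1 4 ^ 2 * y 1 ^ 2 * y 4 ^ 2
  - D 2 4 * D 1 3 ^ 2 * y 1 ^ 2 * y 3 ^ 2 + D 1 3 * D 2 4 ^ 2 * y 2 ^ 2 * y 4 ^ 2 + D 1 4 * D 2 3 ^ 2 * y 2 ^ 2 * y 3 ^ 2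
  - D 1 2 * (D 1 3 * D 2 4 + D 1 4 * D 2 3) * y 1 ^ 2 * y 2 ^ 2)"
 define E34 where "E34 = D 1 2 * (D 3 4 * D 1 2 ^ 2 * y 1 ^ 2 * y 2 ^ 2 + D 1 4 * D 2 3 ^ 2 * y 2 ^ 2 * y 3 ^ 2
  + D 2 4 * D 1 3 ^ 2 * y 1 ^ 2 * y 3 ^ 2 - D 1 3 * D 2 4 ^ 2 * y 2 ^ 2 * y 4 ^ 2 - D 2 3 * D 1 4 ^ 2 * y 1 ^ 2 * y 4 ^ 2
  - D 3 4 * (D 1 3 * D 2 4 + D 1 4 * D 2 3) * y 3 ^ 2 * y 4 ^ 2)"
 have two: "(2 :: 'a poly4) \<noteq> 0"
  using mpoly_const_eq_0[of "2 :: 'a"] rhom_numeral[OF rhom_const] by (metis zero_neq_numeral)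
 have W11: "WW 1 1 = Y * (c1 * E1)"
  unfolding WW_def D_def[symmetric, THEN fun_cong, THEN fun_cong] sum_4 P Y_def c1_def E1_def
   Dsw[of 2 1] Dsw[of 3 1] Dsw[of 4 1] Dsw[of 3 2] Dsw[of 4 2] Dsw[of 4 3] D0
  by (simp add: algebra_simps power2_eq_square)
 have W22: "WW 2 2 = Y * (c2 * E2)"
  unfolding WW_def D_def[symmetric, THEN fun_cong, THEN fun_cong] sum_4 P Y_def c2_def E2_def
   Dsw[of 2 1] Dsw[of 3 1] Dsw[of 4 1] Dsw[of 3 2] Dsw[of 4 2] Dsw[of 4 3] D0
  by (simp add: algebra_simps power2_eq_square)
 have W12: "WW 1 2 = y 3 * y 4 * E12"
  unfolding WW_def D_def[symmetric, THEN fun_cong, THEN fun_cong] sum_4 P E12_def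
   Dsw[of 2 1] Dsw[of 3 1] Dsw[of 4 1] Dsw[of 3 2] Dsw[of 4 2] Dsw[of 4 3] D0
  by (simp add: algebra_simps power2_eq_square)
 have W34: "WW 3 4 = y 1 * y 2 * E34"
  unfolding WW_def D_def[symmetric, THEN fun_cong, THEN fun_cong] sum_4 P E34_def
   Dsw[of 2 1] Dsw[of 3 1] Dsw[of 4 1] Dsw[of 3 2] Dsw[of 4 2] Dsw[of 4 3] D0
  by (simp add: algebra_simps power2_eq_square)
 have zf: "zfree z (y i) \<longleftrightarrow> i \<noteq> z" "zfree z (D i j)" for z i j
  by (simp_all add: y_def D_def)
 have "r * Y * (E2 * (c2 * \<psi> 1 1)) = r * Y * (\<psi> 2 2 * c1 * E1)"
  using \<psi>[of 1 1] \<psi>[of 2 2] unfolding W11 W22 by (metis (no_types, lifting) mult.assoc mult.commute mult.left_commute)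
 then have e: "E2 * (c2 * \<psi> 1 1) = \<psi> 2 2 * c1 * E1" using r yn by (simp add: Y_def)
 \<comment> \<open>In y_1, \<open>E2\<close> is monic up to a unit, and \<open>E1\<close> is free of
   y_1.\<close>
 have "nzd E2 (idl {E1})"
  unfolding E2_def y_def[THEN fun_cong, of 1]
 proof (rule nzd_monic)
  show "nzd (D 1 2) (idl {E1})" using nzd_const[of "d 1 2"] by (simp add: D_def)
 qed (auto simp: E1_def zf)
 then have "c2 * \<psi> 1 1 \<in> idl {E1}"
  by (rule nzdD) (simp add: e ispan_base ispan_scale)
 then obtain k where k: "c2 * \<psi> 1 1 = k * E1"
  by (auto simp: idl_insert ispan_empty)
 have "cf 4 0 (cf 3 0 E1) = D 1 2 * y 2 ^ 2"
  unfolding E1_def by (simp add: cf0_simps cy cD)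
 then have E1n: "E1 \<noteq> 0" using Dn[of 1 2] yn by (auto simp: rhom_0[OF rhom_cf0])
 have "E1 * (r * k) = E1 * (c1 * c2 * b * Y)"
  using k \<psi>[of 1 1] unfolding W11 by (metis (no_types, lifting) mult.assoc mult.commute mult.left_commute)
 then have rk: "r * k = c1 * c2 * b * Y" using E1n by simp
 have kW: "c1 * c2 * Y * \<psi> i j = k * WW i j" for i j
 proof -
  have "r * (c1 * c2 * Y * \<psi> i j) = r * (k * WW i j)"
   using rk \<psi>[of i j] by (metis (no_types, lifting) mult.assoc mult.commute mult.left_commute)
  then show ?thesis using r by simp
 qed
 have "y 3 * y 4 * (c1 * c2 * y 1 * y 2 * \<psi> 1 2) = y 3 * y 4 * (k * E12)"
  using kW[of 1 2] unfolding W12 Y_def by (simp add: mult_ac)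
 then have k12: "c1 * c2 * y 1 * y 2 * \<psi> 1 2 = k * E12" using yn by simp
 have "y 1 * y 2 * (c1 * c2 * y 3 * y 4 * \<psi> 3 4) = y 1 * y 2 * (k * E34)"
  using kW[of 3 4] unfolding W34 Y_def by (simp add: mult_ac)
 then have k34: "c1 * c2 * y 3 * y 4 * \<psi> 3 4 = k * E34" using yn by simp
 have "cf 1 0 (cf 2 0 E12) = D 3 4 * (D 1 2 * D 3 4 ^ 2 * y 3 ^ 2 * y 4 ^ 2)"
  "cf 2 0 (cf 1 0 E12) = D 3 4 * (D 1 2 * D 3 4 ^ 2 * y 3 ^ 2 * y 4 ^ 2)"
  unfolding E12_def by (simp_all add: cf0_simps cy cD rhom_numeral[OF rhom_cf0])
 then have n12: "cf 2 0 E12 \<noteq> 0" "cf 1 0 E12 \<noteq> 0"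
  using Dn[of 1 2] Dn[of 3 4] yn by (auto simp: rhom_0[OF rhom_cf0])
 have "cf 3 0 (cf 4 0 E34) = D 1 2 * (D 3 4 * D 1 2 ^ 2 * y 1 ^ 2 * y 2 ^ 2)"
  "cf 4 0 (cf 3 0 E34) = D 1 2 * (D 3 4 * D 1 2 ^ 2 * y 1 ^ 2 * y 2 ^ 2)"
  unfolding E34_def by (simp_all add: cf0_simps cy cD rhom_numeral[OF rhom_cf0])
 then have n34: "cf 4 0 E34 \<noteq> 0" "cf 3 0 E34 \<noteq> 0"
  using Dn[of 1 2] Dn[of 3 4] yn by (auto simp: rhom_0[OF rhom_cf0])
 have dv: "\<exists>h'. h = y z * h'" if "cf z 0 h = 0" for z h
  using cf0_eq_0[OF that] by (simp add: y_def)
 \<comment> \<open>Setting y_1 or y_2 to zero kills the left side of \<open>k12\<close> but not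
   \<open>E12\<close>, and likewise y_3 or y_4 with \<open>k34\<close> and \<open>E34\<close>. Hence
   all four variables divide k, one after another.\<close>
 have "cf 1 0 k * cf 1 0 E12 = 0"
  unfolding rhom_mult[OF rhom_cf0, symmetric] k12[symmetric] by (simp add: cf0_simps cy)
 then obtain k1 where k1: "k = y 1 * k1" using dv n12 by auto
 have "cf 2 0 (y 1 * k1 * E12) = 0"
  unfolding k1[symmetric] k12[symmetric] by (simp add: cf0_simps cy)
 then obtain k2 where k2: "k1 = y 2 * k2" using dv[of 2 k1] n12 yn by (auto simp: cf0_simps cy)
 have "cf 3 0 (y 1 * (y 2 * k2) * E34) = 0"
  unfolding k2[symmetric] k1[symmetric] k34[symmetric] by (simp add: cf0_simps cy)
 then obtain k3 where k3: "k2 = y 3 * k3" using dv[of 3 k2] n34 yn by (auto simp: cf0_simps cy)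
 have "cf 4 0 (y 1 * (y 2 * (y 3 * k3)) * E34) = 0"
  unfolding k3[symmetric] k2[symmetric] k1[symmetric] k34[symmetric] by (simp add: cf0_simps cy)
 then obtain k4 where k4: "k3 = y 4 * k4" using dv[of 4 k3] n34 yn by (auto simp: cf0_simps cy)
 have "Y * (r * k4) = Y * (c1 * c2 * b)"
  using rk unfolding k1 k2 k3 k4 Y_def by (simp add: mult_ac)
 then have b: "c1 * c2 * b = r * k4" using yn by (simp add: Y_def)
 define \<kappa> where "\<kappa> = (2 * d 2 3 * d 2 4 * d 3 4) * (2 * d 1 3 * d 1 4 * d 3 4)"
 have K: "c1 * c2 = mc \<kappa>"
  by (simp add: \<kappa>_def c1_def c2_def D_def rhom_mult[OF rhom_const] rhom_numeral[OF rhom_const])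
 have kn: "\<kappa> \<noteq> 0" by (simp add: \<kappa>_def)
 have "b = mc (inverse \<kappa>) * (mc \<kappa> * b)"
  using kn by (simp add: mult.assoc[symmetric] mpoly_const_mult[symmetric])
 also have "\<dots> = (mc (inverse \<kappa>) * k4) * r"
  using b K by (simp add: mult_ac)
 finally show ?thesis by blast
qed

text \<open>Diagonal entry m is, up to sign and a common factor, the quadric sum_n d m n y_n^2 times
  the product of the minors avoiding m. These products are Vandermonde cofactors, so their
  alternating sums against p^2, p q and q^2 vanish, which is the content of
  \<open>pp\<close>.\<close>

lemma WW_trace: "(\<Sum>m\<in>UNIV. mc (d l m) * WW m m) = 0"
proof -
 define y where "y = (mpv :: 4 \<Rightarrow> 'a poly4)"
 define P where "P = (\<lambda>i. mc (p i) :: 'a poly4)"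
 define Q where "Q = (\<lambda>i. mc (q i) :: 'a poly4)"
 define D where "D = (\<lambda>i j. P i * Q j - P j * Q i)"
 have Dd: "mc (d i j) = D i j" for i j
  by (simp add: D_def P_def Q_def d_def rhom_simps[OF rhom_const])
 have Dsw: "D i j = - D j i" for i j by (simp add: D_def)
 have D0: "D i i = 0" for i by (simp add: D_def)
 have PP: "PP 1 1 = 0" "PP 2 2 = 0" "PP 3 3 = 0" "PP 4 4 = 0"
  "PP 1 2 = D 3 4 * y 3 * y 4" "PP 1 3 = - D 2 4 * y 2 * y 4" "PP 1 4 = D 2 3 * y 2 * y 3"
  "PP 2 1 = - D 3 4 * y 3 * y 4" "PP 2 3 = D 1 4 * y 1 * y 4" "PP 2 4 = - D 1 3 * y 1 * y 3"
  "PP 3 1 = D 2 4 * y 2 * y 4" "PP 3 2 = - D 1 4 * y 1 * y 4" "PP 3 4 = D 1 2 * y 1 * y 2"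
  "PP 4 1 = - D 2 3 * y 2 * y 3" "PP 4 2 = D 1 3 * y 1 * y 3" "PP 4 3 = - D 1 2 * y 1 * y 2"
  by (simp_all add: PP_def Dd y_def)
 note W = WW_def Dd sum_4 PP Dsw[of 2 1] Dsw[of 3 1] Dsw[of 4 1] Dsw[of 3 2] Dsw[of 4 2] Dsw[of 4 3] D0
 define V1 V2 V3 V4 where "V1 = D 2 3 * D 2 4 * D 3 4" and "V2 = D 1 3 * D 1 4 * D 3 4"
  and "V3 = D 1 2 * D 1 4 * D 2 4" and "V4 = D 1 2 * D 1 3 * D 2 3"
 define Y where "Y = y 1 * y 2 * y 3 * y 4"
 have W1: "WW 1 1 = 2 * Y * V1 * (\<Sum>m\<in>UNIV. D 1 m * y m ^ 2)"
  unfolding W Y_def V1_def by (simp add: algebra_simps power2_eq_square)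
 have W2: "WW 2 2 = - 2 * Y * V2 * (\<Sum>m\<in>UNIV. D 2 m * y m ^ 2)"
  unfolding W Y_def V2_def by (simp add: algebra_simps power2_eq_square)
 have W3: "WW 3 3 = 2 * Y * V3 * (\<Sum>m\<in>UNIV. D 3 m * y m ^ 2)"
  unfolding W Y_def V3_def by (simp add: algebra_simps power2_eq_square)
 have W4: "WW 4 4 = - 2 * Y * V4 * (\<Sum>m\<in>UNIV. D 4 m * y m ^ 2)"
  unfolding W Y_def V4_def by (simp add: algebra_simps power2_eq_square)
 have V: "D l 1 * V1 * D 1 m - D l 2 * V2 * D 2 m + D l 3 * V3 * D 3 m - D l 4 * V4 * D 4 m = 0" for m
 proof -
  have pp: "P 1 * P 1 * V1 - P 2 * P 2 * V2 + P 3 * P 3 * V3 - P 4 * P 4 * V4 = 0"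
   "P 1 * Q 1 * V1 - P 2 * Q 2 * V2 + P 3 * Q 3 * V3 - P 4 * Q 4 * V4 = 0"
   "Q 1 * Q 1 * V1 - Q 2 * Q 2 * V2 + Q 3 * Q 3 * V3 - Q 4 * Q 4 * V4 = 0"
   by (simp_all add: V1_def V2_def V3_def V4_def D_def algebra_simps)
  have "D l 1 * V1 * D 1 m - D l 2 * V2 * D 2 m + D l 3 * V3 * D 3 m - D l 4 * V4 * D 4 m =
   P l * Q m * (P 1 * Q 1 * V1 - P 2 * Q 2 * V2 + P 3 * Q 3 * V3 - P 4 * Q 4 * V4)
   - P l * P m * (Q 1 * Q 1 * V1 - Q 2 * Q 2 * V2 + Q 3 * Q 3 * V3 - Q 4 * Q 4 * V4)
   - Q l * Q m * (P 1 * P 1 * V1 - P 2 * P 2 * V2 + P 3 * P 3 * V3 - P 4 * P 4 * V4)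
   + Q l * P m * (P 1 * Q 1 * V1 - P 2 * Q 2 * V2 + P 3 * Q 3 * V3 - P 4 * Q 4 * V4)"
   unfolding D_def by (simp add: algebra_simps)
  then show ?thesis unfolding pp by simp
 qed
 have "(\<Sum>m\<in>UNIV. mc (d l m) * WW m m) = 2 * Y * (\<Sum>m\<in>UNIV. y m ^ 2 *
   (D l 1 * V1 * D 1 m - D l 2 * V2 * D 2 m + D l 3 * V3 * D 3 m - D l 4 * V4 * D 4 m))"
  unfolding Dd sum_4[of "\<lambda>m. D l m * WW m m"] W1 W2 W3 W4
  unfolding sum_4 by (simp add: algebra_simps)
 then show ?thesis unfolding V by simp
qed

end

section \<open>Index bookkeeping, changes of generators, and radicals of annihilators\<close>

section \<open>The symmetric algebra of a diagonal pencil\<close>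

lemma sum_distinct4:
 assumes "distinct [i, j, k, l :: 4]" shows "sum f UNIV = f i + f j + f k + f l"
proof -
 have "card {i, j, k, l} = card (UNIV :: 4 set)" using assms by simp
 then have U: "UNIV = {i, j, k, l}" by (metis card_subset_eq finite subset_UNIV)
 show ?thesis unfolding U using assms by (simp add: add.assoc)
qed

lemma ex_distinct4: "i \<noteq> j ==> \<exists>k l. distinct [i, j, k, l :: 4]"
proof -
 assume ij: "i \<noteq> j"
 have "card (UNIV - {i, j}) = 2" using ij by (simp add: card_Diff_subset)
 then obtain k l where "UNIV - {i, j} = {k, l}" "k \<noteq> l" by (auto simp: card_2_iff)
 then have "k \<notin> {i, j}" "l \<notin> {i, j}" by blast+
 then show ?thesis using ij \<open>k \<noteq> l\<close> by (intro exI[of _ k] exI[of _ l]) auto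
qed

lemma idl_pencil:
 fixes a b :: "('i, 'a::field) mpoly"
 assumes "s * v - t * u \<noteq> 0"
 shows "idl (insert (mc s * a + mc t * b) (insert (mc u * a + mc v * b) G)) =
  idl (insert a (insert b G))"
proof (rule idl_eqI)
 let ?A = "mc s * a + mc t * b" and ?B = "mc u * a + mc v * b"
 have "?A \<in> idl (insert a (insert b G))" "?B \<in> idl (insert a (insert b G))"
  by (intro ispan_add ispan_scale ispan_base; simp)+
 then show "insert ?A (insert ?B G) \<subseteq> idl (insert a (insert b G))"
  by (auto intro: ispan_base)
 define r where "r = inverse (s * v - t * u)"
 have r: "mc r * mc (s * v - t * u) = (1 :: ('i, 'a) mpoly)"
  using assms by (simp add: r_def mpoly_const_mult[symmetric])
 have "a = mc r * mc (s * v - t * u) * a" unfolding r by simp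
 also have "\<dots> = mc (r * v) * ?A + mc (- (r * t)) * ?B"
  by (simp add: rhom_simps[OF rhom_const] algebra_simps)
 finally have a: "a = \<dots>" .
 have "b = mc r * mc (s * v - t * u) * b" unfolding r by simp
 also have "\<dots> = mc (- (r * u)) * ?A + mc (r * s) * ?B"
  by (simp add: rhom_simps[OF rhom_const] algebra_simps)
 finally have b: "b = \<dots>" .
 let ?I = "idl (insert ?A (insert ?B G))"
 have "mc (r * v) * ?A + mc (- (r * t)) * ?B \<in> ?I"
  "mc (- (r * u)) * ?A + mc (r * s) * ?B \<in> ?I"
  by (intro ispan_add ispan_scale ispan_base; simp)+
 then have "a \<in> ?I" "b \<in> ?I" using a b by simp_all
 then show "insert a (insert b G) \<subseteq> ?I" by (auto intro: ispan_base)
qed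

lemma idl_insert_cong: "idl A = idl B ==> idl (insert a A) = idl (insert a B)"
 for a :: "'a::comm_ring_1"
 by (auto simp: idl_insert)

text \<open>Every term of the binomial expansion of exponent N + M contains u^N or v^M.\<close>

lemma rad_add:
 fixes u :: "'a::comm_ring_1"
 assumes "u ^ N * b \<in> idl G" "v ^ M * b \<in> idl G"
 shows "(u + v) ^ (N + M) * b \<in> idl G"
proof -
 have "(of_nat (N + M choose k) * u ^ k * v ^ (N + M - k)) * b \<in> idl G" for k
 proof (cases "k \<ge> N")
  case True
  then have "u ^ k = u ^ (k - N) * u ^ N" by (metis le_add_diff_inverse2 power_add)
  then have "(of_nat (N + M choose k) * u ^ k * v ^ (N + M - k)) * b =
   (of_nat (N + M choose k) * u ^ (k - N) * v ^ (N + M - k)) * (u ^ N * b)" by (simp add: mult_ac)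
  then show ?thesis using ispan_scale[OF assms(1)] by simp
 next
  case False
  then have "v ^ (N + M - k) = v ^ (N - k) * v ^ M"
   by (simp add: power_add[symmetric])
  then have "(of_nat (N + M choose k) * u ^ k * v ^ (N + M - k)) * b =
   (of_nat (N + M choose k) * u ^ k * v ^ (N - k)) * (v ^ M * b)" by (simp add: mult_ac)
  then show ?thesis using ispan_scale[OF assms(2)] by simp
 qed
 then show ?thesis
  unfolding binomial_ring sum_distrib_right by (intro ispan_sum)
qed

lemma rad_mult: "u ^ N * b \<in> idl G ==> (c * u) ^ N * b \<in> idl G" for u :: "'a::comm_ring_1"
 using ispan_scale[of "u ^ N * b" G "c ^ N"] by (simp add: power_mult_distrib mult_ac)

text \<open>The radical of the annihilator of b modulo the ideal generated by G.\<close>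

definition rad :: "'a::comm_ring_1 set \<Rightarrow> 'a \<Rightarrow> 'a set" where
 "rad G b = {u. \<exists>N. u ^ N * b \<in> idl G}"

lemma rad_closed:
 shows "u \<in> rad G b ==> v \<in> rad G b ==> u + v \<in> rad G b"
  and "u \<in> rad G b ==> c * u \<in> rad G b"
  and "u \<in> rad G b ==> u * c \<in> rad G b"
  and "u ^ Suc n \<in> rad G b ==> u \<in> rad G b"
  and "u \<in> idl G ==> u \<in> rad G b"
  and "0 \<in> rad G b"
proof -
 show "u \<in> rad G b ==> v \<in> rad G b ==> u + v \<in> rad G b" by (auto simp: rad_def intro: rad_add)
 show m: "u \<in> rad G b ==> c * u \<in> rad G b" for u c by (auto simp: rad_def intro: rad_mult)
 show "u \<in> rad G b ==> u * c \<in> rad G b" using m[of u c] by (simp add: mult.commute)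
 show "u ^ Suc n \<in> rad G b ==> u \<in> rad G b"
  unfolding rad_def by (auto simp del: power_Suc simp: power_mult[symmetric])
 show i: "u \<in> rad G b" if "u \<in> idl G" for u
 proof -
  have "u ^ 1 * b \<in> idl G" using idl_mult_right[OF that] by simp
  then show ?thesis unfolding rad_def by blast
 qed
 show "0 \<in> rad G b" by (rule i) (rule ispan_zero)
qed

lemma rad_sum: "(\<And>a. a \<in> A ==> f a \<in> rad G b) ==> sum f A \<in> rad G b"
 by (induction A rule: infinite_finite_induct) (auto intro: rad_closed(1,6))

section \<open>The bigraded ring B and its subring T\<close>

abbreviation vx :: "4 \<Rightarrow> 'a::comm_ring_1 poly44" where "vx i \<equiv> mpv (Inl i)"
abbreviation vy :: "4 \<Rightarrow> 'a::comm_ring_1 poly44" where "vy i \<equiv> mpv (Inr i)"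

definition emT :: "'a::comm_ring_1 poly4 \<Rightarrow> 'a poly44" where "emT = ev mc (\<lambda>i. vy i)"
definition prT :: "'a::comm_ring_1 poly44 \<Rightarrow> 'a poly4" where
 "prT = ev mc (case_sum (\<lambda>_. 0) mpv)"

lemma rhom_emT: "rhom emT" unfolding emT_def by (rule rhom_ev[OF rhom_const])
lemma rhom_prT: "rhom prT" unfolding prT_def by (rule rhom_ev[OF rhom_const])
lemma emT_const [simp]: "emT (mc c) = mc c"
 and emT_var [simp]: "emT (mpv i) = vy i"
 unfolding emT_def by (simp_all add: ev_const[OF rhom_const] ev_var[OF rhom_const])
lemma prT_const [simp]: "prT (mc c) = mc c"
 and prT_var [simp]: "prT (vx i) = 0" "prT (vy i) = mpv i"
 unfolding prT_def by (simp_all add: ev_const[OF rhom_const] ev_var[OF rhom_const])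
lemma prT_emT [simp]: "prT (emT t) = t"
 by (rule mpoly_hom_unique[OF rhom_comp[OF rhom_emT rhom_prT] rhom_id]) simp_all

definition dx :: "(4 + 4 \<Rightarrow>\<^sub>0 nat) \<Rightarrow> nat" where "dx m = (\<Sum>a\<in>UNIV. pml m (Inl a))"
definition dy :: "(4 + 4 \<Rightarrow>\<^sub>0 nat) \<Rightarrow> nat" where "dy m = (\<Sum>a\<in>UNIV. pml m (Inr a))"

lemma graded_dx: "graded dx" and graded_dy: "graded dy"
 by (simp_all add: graded_def dx_def dy_def lookup_add sum.distrib)

lemma hdeg_single: "\<delta> m = n ==> hdeg \<delta> n (pms m c)"
 by (simp add: hdeg_def)

lemma hom_dx [simp]: "hdeg dx 1 (vx i)" "hdeg dx 0 (vy i)" "hdeg dx 0 (mc c)"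
 and hom_dy [simp]: "hdeg dy 0 (vx i)" "hdeg dy 1 (vy i)" "hdeg dy 0 (mc c)"
 by (auto simp: mpoly_var_def mpoly_const_def dx_def dy_def lookup_single when_def intro!: hdeg_single)

lemma hom_dx_emT [simp]: "hdeg dx 0 (emT t)"
proof (induction t rule: mpoly_induct)
 case (add p q)
 then show ?case by (simp add: rhom_add[OF rhom_emT] hdeg_add)
next
 case (mult p q)
 then show ?case using hdeg_mult[OF graded_dx, of 0 "emT p" 0 "emT q"] by (simp add: rhom_mult[OF rhom_emT])
qed simp_all

lemma emT_prT: "hdeg dx 0 b ==> emT (prT b) = b" for b :: "'a::comm_ring_1 poly44"
proof -
 assume b: "hdeg dx 0 b"
 have s: "emT (prT (pms m c)) = pms m c" if "dx m = 0" for m and c :: 'a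
 proof -
  have z: "pml m (Inl a) = 0" for a using that by (simp add: dx_def)
  have U: "(UNIV :: (4 + 4) set) = Inl ` UNIV \<union> Inr ` UNIV" by (simp add: UNIV_sum)
  have "(\<Prod>i\<in>UNIV. mpv i ^ pml m i) =
    (\<Prod>i\<in>Inl ` UNIV. (mpv i :: 'a poly44) ^ pml m i) * (\<Prod>i\<in>Inr ` UNIV. mpv i ^ pml m i)"
   unfolding U by (rule prod.union_disjoint) auto
  also have "\<dots> = (\<Prod>i\<in>UNIV. vy i ^ pml m (Inr i))"
   by (simp add: prod.reindex z)
  finally show ?thesis
   unfolding single_eq_prod[of m c] by (simp add: rhom_simps[OF rhom_prT] rhom_simps[OF rhom_emT])
 qed
 have "emT (prT (\<Sum>a\<in>pmk b. pms a (pml b a))) =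
   (\<Sum>a\<in>pmk b. pms a (pml b a))"
  unfolding rhom_sum[OF rhom_prT] rhom_sum[OF rhom_emT]
  by (rule sum.cong) (use b s in \<open>auto simp: hdeg_def\<close>)
 then show ?thesis by (simp add: poly_mapping_eq_sum)
qed

lemma zfree_emT [simp]: "zfree (Inl i) (emT t)"
 by (induction t rule: mpoly_induct) (simp_all add: rhom_simps[OF rhom_emT])

section \<open>Regularity of the defining equations of the diagonal pencil, and its torsion\<close>

context diag
begin

definition FF :: "'a poly44" where "FF = (\<Sum>i\<in>UNIV. mc (p i) * vx i ^ 2)"
definition GG :: "'a poly44" where "GG = (\<Sum>i\<in>UNIV. mc (q i) * vx i ^ 2)"
definition L1 :: "'a poly44" where "L1 = (\<Sum>i\<in>UNIV. mc (p i) * vx i * vy i)"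
definition L2 :: "'a poly44" where "L2 = (\<Sum>i\<in>UNIV. mc (q i) * vx i * vy i)"
text \<open>\<open>Gf l\<close> and \<open>Lf l\<close> are the members of the pencils (FF, GG) and
  (L1, L2) in which the l-th variables cancel, since d l l = 0. Any two of them generate the same
  ideal as the whole pencil, so one may choose which variables to eliminate.\<close>

definition Gf :: "4 \<Rightarrow> 'a poly44" where "Gf l = (\<Sum>m\<in>UNIV. mc (d l m) * vx m ^ 2)"
definition Lf :: "4 \<Rightarrow> 'a poly44" where "Lf l = (\<Sum>m\<in>UNIV. mc (d l m) * vx m * vy m)"
abbreviation J :: "'a poly44 set" where "J \<equiv> {FF, GG}"
abbreviation II :: "'a poly44 set" where "II \<equiv> {FF, GG, L1, L2}"

lemma Gf_eq: "Gf l = mc (- q l) * FF + mc (p l) * GG"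
 by (simp add: Gf_def FF_def GG_def d_def sum_distrib_left sum.distrib[symmetric] rhom_simps[OF rhom_const] algebra_simps)

lemma Lf_eq: "Lf l = mc (- q l) * L1 + mc (p l) * L2"
 by (simp add: Lf_def L1_def L2_def d_def sum_distrib_left sum.distrib[symmetric] rhom_simps[OF rhom_const] algebra_simps)

lemma idl_Gf: "k \<noteq> l ==> idl (insert (Gf k) (insert (Gf l) G)) = idl (insert FF (insert GG G))"
 unfolding Gf_eq by (rule idl_pencil) (use nondeg[of l k] in \<open>simp add: algebra_simps\<close>)

lemma idl_Lf: "k \<noteq> l ==> idl (insert (Lf k) (insert (Lf l) G)) = idl (insert L1 (insert L2 G))"
 unfolding Lf_eq by (rule idl_pencil) (use nondeg[of l k] in \<open>simp add: algebra_simps\<close>)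

lemma II_eq: "k \<noteq> l ==> idl {Lf k, Lf l, FF, GG} = idl II"
 using idl_Lf[of k l J] by (simp add: insert_commute)

lemma Gf_in_J: "Gf l \<in> idl (insert FF (insert GG G))"
 unfolding Gf_eq by (intro ispan_add ispan_scale ispan_base) simp_all

lemma Lf_in_II: "Lf l \<in> idl II"
 unfolding Lf_eq by (intro ispan_add ispan_scale ispan_base) simp_all

lemma idl_J_II: "b \<in> idl J ==> b \<in> idl II"
 using idl_mono[of J II] by (auto intro: ispan_base)

lemma zfree_Gf [simp]: "zfree (Inl l) (Gf l)" "zfree (Inr z) (Gf l)"
 and zfree_FG [simp]: "zfree (Inr z) FF" "zfree (Inr z) GG"
 and zfree_Lf [simp]: "zfree (Inr l) (Lf l)"
proof -
 have "zfree (Inl l) (mc (d l m) * vx m ^ 2 :: 'a poly44)" for m by (cases "m = l") simp_all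
 then show "zfree (Inl l) (Gf l)" unfolding Gf_def by (rule zfree_sum)
 have "zfree (Inr l) (mc (d l m) * vx m * vy m :: 'a poly44)" for m by (cases "m = l") simp_all
 then show "zfree (Inr l) (Lf l)" unfolding Lf_def by (rule zfree_sum)
qed (simp_all add: Gf_def FF_def GG_def)

lemma Gf_split: "Gf l = mc (d l k) * vx k ^ 2 + (\<Sum>m\<in>UNIV - {k}. mc (d l m) * vx m ^ 2)"
 unfolding Gf_def by (rule sum.remove) simp_all

lemma Lf_split: "Lf l = mc (d l k) * vx k * vy k + (\<Sum>m\<in>UNIV - {k}. mc (d l m) * vx m * vy m)"
 unfolding Lf_def by (rule sum.remove) simp_all

lemma zfree_rest [simp]:
 "zfree (Inl k) (\<Sum>m\<in>UNIV - {k}. mc (d l m) * vx m ^ 2 :: 'a poly44)"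
 "zfree (Inr k) (\<Sum>m\<in>UNIV - {k}. mc (d l m) * vx m * vy m :: 'a poly44)"
 by (rule zfree_sum; simp)+

lemma nzd_Gf:
 assumes "k \<noteq> l" "\<And>g. g \<in> G ==> zfree (Inl k) g" shows "nzd (Gf l) (idl G)"
 unfolding Gf_split[of l k]
 by (rule nzd_monic) (use assms in \<open>auto intro: nzd_const\<close>)

text \<open>\<open>Gf l\<close> is monic in x_k and \<open>Gf k\<close> in x_l, up to units, so both
  are regular modulo things free of these variables; two exchanges bring a to the end of the
  sequence.\<close>

lemma nzd_mod_FG:
 assumes kl: "k \<noteq> l" and a: "zfree (Inl k) a" "zfree (Inl l) a"
  and G: "\<And>g. g \<in> G ==> zfree (Inl k) g" "\<And>g. g \<in> G ==> zfree (Inl l) g" and n: "nzd a (idl G)"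
 shows "nzd a (idl (insert FF (insert GG G)))"
proof -
 have 1: "nzd a (idl (insert (Gf l) G))"
  by (rule nzd_exchange[OF n]; rule nzd_Gf[OF kl]) (use a G in auto)
 have 2: "nzd a (idl (insert (Gf k) (insert (Gf l) G)))"
  by (rule nzd_exchange[OF 1]; rule nzd_Gf[OF kl[symmetric]]) (use a G in auto)
 then show ?thesis using idl_Gf[OF kl] by simp
qed

lemma nzd_X: "nzd (vx i) (idl J)"
proof -
 obtain j :: 4 where "i \<noteq> j" using exhaust_4[of i] by (metis one_neq_zero numeral_neq_zero zero_neq_one)
 then obtain k l where "distinct [i, j, k, l]" using ex_distinct4 by blast
 then show ?thesis
  by (intro nzd_mod_FG[of k l]) (auto intro: nzd_var)
qed

lemma nzd_X_X: "i \<noteq> j ==> nzd (vx j) (idl {FF, GG, vx i})"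
proof -
 assume ij: "i \<noteq> j"
 obtain k l where "distinct [i, j, k, l]" using ex_distinct4[OF ij] by blast
 then show ?thesis by (intro nzd_mod_FG[of k l]) (auto intro: nzd_var)
qed

lemma nzd_Lf_aux:
 assumes "i \<noteq> j" "\<And>g. g \<in> G ==> zfree (Inr j) g" "nzd (vx j) (idl G)"
 shows "nzd (Lf i) (idl G)"
proof -
 have "nzd (mc (d i j) * vx j * vy j ^ 1 + (\<Sum>m\<in>UNIV - {j}. mc (d i m) * vx m * vy m)) (idl G)"
  by (rule nzd_monic) (use assms in \<open>auto intro!: nzd_mult nzd_const\<close>)
 then show ?thesis unfolding Lf_split[of i j] by simp
qed

lemma nzd_Lf: "i \<noteq> j ==> nzd (Lf i) (idl J)"
 by (rule nzd_Lf_aux[of i j]) (auto intro: nzd_X)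

lemma nzd_X_Lf: "i \<noteq> j ==> nzd (vx i) (idl (insert (Lf i) J))"
proof (rule nzd_exchange[OF nzd_X])
 assume ij: "i \<noteq> j"
 show "nzd (Lf i) (idl J)" by (rule nzd_Lf[OF ij])
 show "nzd (Lf i) (idl (insert (vx i) J))"
  by (rule nzd_Lf_aux[OF ij]) (use nzd_X_X[OF ij] in \<open>auto simp: insert_commute\<close>)
qed

text \<open>In the variable y_i the leading coefficient of \<open>Lf j\<close> is a unit times x_i,
  regular by \<open>nzd_X_Lf\<close>. So FF, GG, \<open>Lf i\<close>, \<open>Lf j\<close> are each
  regular modulo the preceding ones.\<close>

lemma nzd_Lf_Lf: "i \<noteq> j ==> nzd (Lf j) (idl (insert (Lf i) J))"
 by (rule nzd_Lf_aux[of j i]) (auto intro: nzd_X_Lf)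

text \<open>\<open>Lf j\<close> contains x_i y_i and no y_j, and \<open>Lf i\<close> contains x_j
  y_j and no y_i. After inverting x_i x_j they therefore solve for y_i and y_j.\<close>

lemma pseudo_division:
 assumes ij: "i \<noteq> j"
 shows "\<exists>N b'. zfree (Inr i) b' \<and> zfree (Inr j) b' \<and> (vx i * vx j) ^ N * b - b' \<in> idl II"
proof -
 have yvar: "\<exists>N b'. zfree (Inr i) b' \<and> zfree (Inr j) b' \<and> (vx i * vx j) ^ N * vy i - b' \<in> idl II"
  if "i \<noteq> j" for i j
 proof -
  define r where "r = (\<Sum>m\<in>UNIV - {i}. mc (d j m) * vx m * vy m :: 'a poly44)"
  have "zfree (Inr j) (mc (d j m) * vx m * vy m :: 'a poly44)" for m by (cases "m = j") simp_all
  then have rz: "zfree (Inr i) r" "zfree (Inr j) r" unfolding r_def by (auto intro: zfree_sum simp del: zfree_mult)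
  let ?c = "mc (inverse (d j i)) :: 'a poly44"
  have c1: "?c * mc (d j i) = 1" using that by (simp add: mpoly_const_mult[symmetric])
  have "?c * vx j * Lf j = (?c * mc (d j i)) * (vx i * vx j * vy i) + ?c * vx j * r"
   unfolding Lf_split[of j i] r_def[symmetric] by (simp add: algebra_simps)
  then have "(vx i * vx j) ^ 1 * vy i - (- (?c * vx j * r)) = ?c * vx j * Lf j" unfolding c1 by simp
  then show ?thesis using rz ispan_scale[OF Lf_in_II] by (intro exI[of _ 1] exI[of _ "- (?c * vx j * r)"]) auto
 qed
 show ?thesis
 proof (induction b rule: mpoly_induct)
  case (const c)
  then show ?case by (intro exI[of _ 0] exI[of _ "mc c"]) (simp add: ispan_zero)
 next
  case (var z)
  show ?case
  proof (cases "z = Inr i \<or> z = Inr j")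
   case True
   then show ?thesis
   proof
    assume "z = Inr i"
    then show ?thesis using yvar[OF ij] by simp
   next
    assume "z = Inr j"
    then show ?thesis
     using yvar[OF ij[symmetric]] unfolding mult.commute[of "vx j" "vx i"] by simp metis
   qed
  next
   case False
   then show ?thesis by (intro exI[of _ 0] exI[of _ "mpv z"]) (auto simp: ispan_zero)
  qed
 next
  case (add f g)
  then obtain N f' M g' where *: "zfree (Inr i) f'" "zfree (Inr j) f'" "(vx i * vx j) ^ N * f - f' \<in> idl II"
   "zfree (Inr i) g'" "zfree (Inr j) g'" "(vx i * vx j) ^ M * g - g' \<in> idl II" by blast
  have "(vx i * vx j) ^ M * ((vx i * vx j) ^ N * f - f') + (vx i * vx j) ^ N * ((vx i * vx j) ^ M * g - g') \<in> idl II"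
   by (intro ispan_add ispan_scale *)
  then have "(vx i * vx j) ^ (N + M) * (f + g) - ((vx i * vx j) ^ M * f' + (vx i * vx j) ^ N * g') \<in> idl II"
   by (simp add: power_add algebra_simps)
  then show ?case using * ij
   by (intro exI[of _ "N + M"] exI[of _ "(vx i * vx j) ^ M * f' + (vx i * vx j) ^ N * g'"]) auto
 next
  case (mult f g)
  then obtain N f' M g' where *: "zfree (Inr i) f'" "zfree (Inr j) f'" "(vx i * vx j) ^ N * f - f' \<in> idl II"
   "zfree (Inr i) g'" "zfree (Inr j) g'" "(vx i * vx j) ^ M * g - g' \<in> idl II" by blast
  have "((vx i * vx j) ^ N * f) * ((vx i * vx j) ^ M * g) - f' * g' \<in> idl II"
   by (rule idl_cong_mult) (use * in auto)
  then have "(vx i * vx j) ^ (N + M) * (f * g) - f' * g' \<in> idl II"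
   by (simp add: power_add mult_ac)
  then show ?case using * by (intro exI[of _ "N + M"] exI[of _ "f' * g'"]) auto
 qed
qed

text \<open>After pseudo-division b is represented by b' free of y_i and y_j. The relations
  \<open>Lf j\<close> and \<open>Lf i\<close> can then be eliminated from r b', leaving r b' in (FF,
  GG), and r is regular there.\<close>

lemma torsion_XX:
 assumes ij: "i \<noteq> j" and r: "\<And>z. zfree (Inr z) r" and n: "nzd r (idl J)" and b: "r * b \<in> idl II"
 shows "vx i * vx j \<in> rad II b"
proof -
 obtain N b' where b': "zfree (Inr i) b'" "zfree (Inr j) b'" "(vx i * vx j) ^ N * b - b' \<in> idl II"
  using pseudo_division[OF ij] by blast
 have "(vx i * vx j) ^ N * (r * b) - r * ((vx i * vx j) ^ N * b - b') \<in> idl II"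
  by (intro ispan_diff ispan_scale b b')
 then have "r * b' \<in> idl II" by (simp add: algebra_simps)
 then have 1: "r * b' \<in> idl {Lf j, Lf i, FF, GG}" using II_eq[of j i] ij by simp
 have "r * b' \<in> idl {Lf i, FF, GG}"
 proof (rule idl_elim_linear[where z = "Inr i"])
  show "r * b' \<in> idl (insert (mc (d j i) * vx i * vy i + (\<Sum>m\<in>UNIV - {i}. mc (d j m) * vx m * vy m)) {Lf i, FF, GG})"
   using 1 by (simp only: Lf_split[of j i, symmetric])
  show "nzd (mc (d j i) * vx i) (idl {Lf i, FF, GG})"
   using nzd_X_Lf[OF ij] ij by (intro nzd_mult nzd_const) simp_all
 qed (use b' r in auto)
 have 2: "r * b' \<in> idl (insert (Lf i) J)" by fact
 have "r * b' \<in> idl J"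
 proof (rule idl_elim_linear[where z = "Inr j"])
  show "r * b' \<in> idl (insert (mc (d i j) * vx j * vy j + (\<Sum>m\<in>UNIV - {j}. mc (d i m) * vx m * vy m)) J)"
   using 2 by (simp only: Lf_split[of i j, symmetric])
  show "nzd (mc (d i j) * vx j) (idl J)"
   using nzd_X ij by (intro nzd_mult nzd_const) simp_all
 qed (use b' r in auto)
 then have "b' \<in> idl II" using n idl_J_II by (auto simp: nzd_def)
 then have "(vx i * vx j) ^ N * b \<in> idl II" using ispan_add[OF b'(3)] by fastforce
 then show ?thesis by (auto simp: rad_def)
qed

text \<open>Modulo \<open>Gf j\<close>, x_i^2 is a combination of the other squares, so x_i^3 is a
  combination of multiples of the products x_i x_m, which lie in the radical by
  \<open>torsion_XX\<close>.\<close>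

lemma torsion_X:
 assumes r: "\<And>z. zfree (Inr z) r" and n: "nzd r (idl J)" and b: "r * b \<in> idl II"
 shows "vx i \<in> rad II b"
proof -
 obtain j :: 4 where ij: "i \<noteq> j" using exhaust_4[of i] by (metis one_neq_zero numeral_neq_zero zero_neq_one)
 let ?c = "mc (inverse (d j i)) :: 'a poly44"
 have c1: "?c * mc (d j i) = 1" using ij by (simp add: mpoly_const_mult[symmetric])
 have "vx i ^ Suc 2 = (?c * mc (d j i)) * vx i * vx i ^ 2" unfolding c1 by (simp add: power3_eq_cube power2_eq_square mult_ac)
 also have "\<dots> = (?c * vx i) * Gf j + (\<Sum>m\<in>UNIV - {i}. - (?c * mc (d j m) * vx m * (vx i * vx m)))"
  unfolding Gf_split[of j i] by (simp add: sum_negf sum_distrib_left power2_eq_square algebra_simps)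
 also have "\<dots> \<in> rad II b"
 proof (rule rad_closed(1))
  show "?c * vx i * Gf j \<in> rad II b" by (intro rad_closed(2) rad_closed(5) idl_J_II Gf_in_J)
  show "(\<Sum>m\<in>UNIV - {i}. - (?c * mc (d j m) * vx m * (vx i * vx m))) \<in> rad II b"
  proof (rule rad_sum)
   fix m assume m: "m \<in> UNIV - {i}"
   have "vx i * vx m \<in> rad II b" using torsion_XX[OF _ r n b] m by auto
   then have "(- (?c * mc (d j m) * vx m)) * (vx i * vx m) \<in> rad II b" by (rule rad_closed(2))
   then show "- (?c * mc (d j m) * vx m * (vx i * vx m)) \<in> rad II b" by simp
  qed
 qed
 finally show ?thesis by (rule rad_closed(4))
qed

end

section \<open>Linear forms modulo the quadrics, and the quotient by two variables\<close>

context diag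
begin

lemma nzd_binary_form:
 fixes n :: "nat \<Rightarrow> 'a"
 assumes r: "r \<le> N" "n r \<noteq> 0"
 shows "nzd (\<Sum>k\<le>N. mc (n k) * vx 2 ^ (N - k) * vx 1 ^ k) (idl {})"
proof -
 let ?h = "\<Sum>k\<le>N. mc (n k) * vx 2 ^ (N - k) * vx 1 ^ k :: 'a poly44"
 have x: "[:0, 1:] ^ m = Polynomial.monom (1 :: 'a poly44) m" for m
  by (induction m) (simp_all add: monom_0 one_pCons monom_Suc)
 have z2: "zpoly (Inl 1) (vx 2 ^ k) = [:vx 2 ^ k :: 'a poly44:]" for k
  by (rule zfree_zpoly) simp
 have "zpoly (Inl 1) ?h = (\<Sum>k\<le>N. Polynomial.monom (mc (n k) * vx 2 ^ (N - k)) k)"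
  unfolding rhom_sum[OF rhom_zpoly] rhom_mult[OF rhom_zpoly] z2
  by (simp add: rhom_power[OF rhom_zpoly] zpoly_const zpoly_var x smult_monom mult.commute)
 then have cf: "cf (Inl 1) k ?h = (if k \<le> N then mc (n k) * vx 2 ^ (N - k) else 0)" for k
  by (simp add: coeff_sum)
 define m where "m = Max {k. k \<le> N \<and> n k \<noteq> 0}"
 have fin: "finite {k. k \<le> N \<and> n k \<noteq> 0}" by simp
 have "m \<in> {k. k \<le> N \<and> n k \<noteq> 0}" unfolding m_def by (rule Max_in[OF fin]) (use r in auto)
 moreover have "n k = 0" if "k \<le> N" "k > m" for k
  using Max_ge[OF fin, of k] that unfolding m_def[symmetric] by fastforce
 ultimately have m: "m \<le> N" "n m \<noteq> 0" "\<And>k. k \<le> N ==> k > m ==> n k = 0" by auto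
 show ?thesis
 proof (rule nzd_lead[where z = "Inl 1" and m = m])
  show "cf (Inl 1) k ?h = 0" if "k > m" for k using m that unfolding cf by auto
  show "nzd (cf (Inl 1) m ?h) (idl {})"
   unfolding cf using m by (auto intro!: nzd_mult nzd_const nzd_power nzd_var)
 qed simp
qed

text \<open>Modulo (FF, GG), x_3^2 and x_4^2 are forms in x_1^2 and x_2^2. Multiplying the linear
  form by its conjugates under sign changes of x_3 and x_4 thus gives a binary quartic h in x_1,
  x_2. A nonzero h is regular, hence so is its factor.\<close>

lemma nzd_linear_form:
 assumes c: "c k0 \<noteq> 0"
 shows "nzd (\<Sum>m\<in>UNIV. mc (c m) * vx m) (idl J)"
proof -
 \<comment> \<open>Coefficients of the substitutions x_3^2 = al x_1^2 + be x_2^2 and x_4^2 = ga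
   x_1^2 + de x_2^2 modulo (FF, GG).\<close>
 define al where "al = - d 4 1 / d 4 3"
 define be where "be = - d 4 2 / d 4 3"
 define ga where "ga = - d 3 1 / d 3 4"
 define de where "de = - d 3 2 / d 3 4"
 have det: "al * de - be * ga \<noteq> 0"
 proof -
  have "al * de - be * ga = (d 4 1 * d 3 2 - d 4 2 * d 3 1) / (d 4 3 * d 3 4)"
   by (simp add: al_def be_def ga_def de_def diff_divide_distrib)
  also have "d 4 1 * d 3 2 - d 4 2 * d 3 1 = d 1 2 * d 4 3"
   by (simp add: d_def algebra_simps)
  finally show ?thesis by simp
 qed
 have nz: "al \<noteq> 0" "be \<noteq> 0" "ga \<noteq> 0" "de \<noteq> 0" by (simp_all add: al_def be_def ga_def de_def)
 define ka where "ka = (c 3)\<^sup>2 * (c 4)\<^sup>2"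
 define a where "a = (c 1)\<^sup>2 - (c 3)\<^sup>2 * al - (c 4)\<^sup>2 * ga"
 define b where "b = 2 * c 1 * c 2"
 define e where "e = (c 2)\<^sup>2 - (c 3)\<^sup>2 * be - (c 4)\<^sup>2 * de"
 \<comment> \<open>n k is the coefficient of x_1^k x_2^(4-k) in the norm h.\<close>
 define n where "n k = (if k = 4 then a\<^sup>2 - 4 * ka * al * ga else if k = 3 then 2 * a * b
  else if k = 2 then b\<^sup>2 + 2 * a * e - 4 * ka * (al * de + be * ga)
  else if k = 1 then 2 * b * e else e\<^sup>2 - 4 * ka * be * de)" for k :: nat
 have "\<exists>k\<le>4. n k \<noteq> 0"
 proof (rule ccontr)
  assume "\<not> ?thesis"
  then have n0: "n 0 = 0" "n 1 = 0" "n 2 = 0" "n 3 = 0" "n 4 = 0" by auto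
  have n4: "a\<^sup>2 = 4 * ka * al * ga" and n3: "a * b = 0" and n1: "b * e = 0"
   and n2: "b\<^sup>2 + 2 * a * e = 4 * ka * (al * de + be * ga)" and n0: "e\<^sup>2 = 4 * ka * be * de"
   using n0 by (simp_all add: n_def)
  have ka0: "ka = 0"
  proof (cases "b = 0")
   case False
   then show ?thesis using n3 n4 nz by simp
  next
   case True
   have t: "4 * ka * (al * de + be * ga) = 2 * a * e" using n2 True by simp
   \<comment> \<open>Eliminating a and e leaves 16 ka^2 (al de - be ga)^2 = 0, and the determinant
     is nonzero.\<close>
   have "(4 * ka * (al * de + be * ga))\<^sup>2 = 4 * a\<^sup>2 * e\<^sup>2"
    unfolding t by (simp add: power_mult_distrib)
   also have "\<dots> = 4 * (4 * ka * al * ga) * (4 * ka * be * de)" by (simp only: n4 n0)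
   finally have "(4 * ka * (al * de + be * ga))\<^sup>2 = 4 * (4 * ka * al * ga) * (4 * ka * be * de)" .
   then have "16 * ka\<^sup>2 * (al * de - be * ga)\<^sup>2 = 0"
    by (simp add: power2_eq_square algebra_simps)
   then show ?thesis using det by simp
  qed
  then have ae: "a = 0" "e = 0" using n4 n0 by simp_all
  then have b0: "c 1 = 0 \<or> c 2 = 0" using n2 ka0 by (simp add: b_def)
  have c34: "c 3 = 0 \<or> c 4 = 0" using ka0 by (simp add: ka_def)
  have A: "(c 1)\<^sup>2 = (c 3)\<^sup>2 * al + (c 4)\<^sup>2 * ga" "(c 2)\<^sup>2 = (c 3)\<^sup>2 * be + (c 4)\<^sup>2 * de"
   using ae by (simp_all only: a_def e_def diff_diff_eq right_minus_eq)
  have "c 3 = 0" "c 4 = 0" using b0 c34 A nz by (auto simp: power2_eq_square)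
  then have "c k = 0" for k using A exhaust_4[of k] by auto
  then show False using c by simp
 qed
 then obtain r where r: "r \<le> 4" "n r \<noteq> 0" by blast
 let ?K = "mc :: 'a \<Rightarrow> 'a poly44"
 define h where "h = (\<Sum>k\<le>4. ?K (n k) * vx 2 ^ (4 - k) * vx 1 ^ k)"
 have "nzd h (idl (insert FF (insert GG {})))"
  by (rule nzd_mod_FG[of 3 4]) (use nzd_binary_form[of r 4 n] r in \<open>auto simp: h_def intro!: zfree_sum\<close>)
 then have hn: "nzd h (idl J)" .
 define A where "A = ?K (c 1) * vx 1 + ?K (c 2) * vx 2"
 define B where "B = ?K (c 3) * vx 3"
 define C where "C = ?K (c 4) * vx 4"
 define U where "U = ?K al * vx 1 ^ 2 + ?K be * vx 2 ^ 2"
 define V where "V = ?K ga * vx 1 ^ 2 + ?K de * vx 2 ^ 2"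
 have U: "vx 3 ^ 2 - U \<in> idl J"
 proof -
  have "?K (inverse (d 4 3)) * Gf 4 \<in> idl J" by (intro ispan_scale Gf_in_J)
  also have "?K (inverse (d 4 3)) * Gf 4 = (?K (inverse (d 4 3)) * ?K (d 4 3)) * vx 3 ^ 2 - U"
   unfolding Gf_def sum_4 U_def al_def be_def
   by (simp add: algebra_simps divide_inverse rhom_minus[OF rhom_const] mpoly_const_mult)
  also have "?K (inverse (d 4 3)) * ?K (d 4 3) = 1" by (simp add: mpoly_const_mult[symmetric])
  finally show ?thesis by simp
 qed
 have V: "vx 4 ^ 2 - V \<in> idl J"
 proof -
  have "?K (inverse (d 3 4)) * Gf 3 \<in> idl J" by (intro ispan_scale Gf_in_J)
  also have "?K (inverse (d 3 4)) * Gf 3 = (?K (inverse (d 3 4)) * ?K (d 3 4)) * vx 4 ^ 2 - V"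
   unfolding Gf_def sum_4 V_def ga_def de_def
   by (simp add: algebra_simps divide_inverse rhom_minus[OF rhom_const] mpoly_const_mult)
  also have "?K (inverse (d 3 4)) * ?K (d 3 4) = 1" by (simp add: mpoly_const_mult[symmetric])
  finally show ?thesis by simp
 qed
 let ?U = "?K ((c 3)\<^sup>2) * U" and ?V = "?K ((c 4)\<^sup>2) * V"
 have "B\<^sup>2 - ?U = ?K ((c 3)\<^sup>2) * (vx 3 ^ 2 - U)" "C\<^sup>2 - ?V = ?K ((c 4)\<^sup>2) * (vx 4 ^ 2 - V)"
  by (simp_all add: B_def C_def power_mult_distrib rhom_power[OF rhom_const] algebra_simps)
 then have BU: "B\<^sup>2 - ?U \<in> idl J" and CV: "C\<^sup>2 - ?V \<in> idl J"
  using ispan_scale[OF U] ispan_scale[OF V] by metis+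
 have h_eq: "h = (A\<^sup>2 - ?U - ?V)\<^sup>2 - 4 * ?U * ?V"
  unfolding h_def n_def a_def b_def e_def ka_def A_def U_def V_def
  by (simp add: numeral_eq_Suc atMost_Suc rhom_simps[OF rhom_const] power2_eq_square algebra_simps)
 \<comment> \<open>The product of the four conjugates, with B^2 and C^2 replaced modulo (FF,
   GG).\<close>
 have "(A + B + C) * ((A + B - C) * (A - B + C) * (A - B - C)) - h =
  (A\<^sup>2 - B\<^sup>2 - C\<^sup>2 + (A\<^sup>2 - ?U - ?V)) * (- (B\<^sup>2 - ?U) - (C\<^sup>2 - ?V)) - 4 * ((B\<^sup>2 - ?U) * C\<^sup>2 + ?U * (C\<^sup>2 - ?V))"
  unfolding h_eq by (simp add: power2_eq_square algebra_simps)
 also have "\<dots> \<in> idl J"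
  by (intro ispan_diff ispan_scale ispan_add ispan_neg idl_mult_right BU CV)
 finally have "h - (A + B + C) * ((A + B - C) * (A - B + C) * (A - B - C)) \<in> idl J"
  using ispan_neg by fastforce
 from nzd_cong[OF this hn] have "nzd (A + B + C) (idl J)"
  using nzd_left by (metis mult.commute)
 then show ?thesis unfolding sum_4 A_def B_def C_def .
qed

text \<open>A sum over the three ways of splitting the four indices into pairs, weighted by the
  terms of the Pluecker relation. It is the element that corresponds to x_3 x_4 in the Koszul
  comparison (\<open>Del_koszul\<close>).\<close>

definition Del :: "'a poly44" where
 "Del = mc (d 1 2 * d 3 4) * (vx 1 * vx 2 * vy 3 * vy 4 + vx 3 * vx 4 * vy 1 * vy 2)
  - mc (d 1 3 * d 2 4) * (vx 1 * vx 3 * vy 2 * vy 4 + vx 2 * vx 4 * vy 1 * vy 3)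
  + mc (d 1 4 * d 2 3) * (vx 1 * vx 4 * vy 2 * vy 3 + vx 2 * vx 3 * vy 1 * vy 4)"

abbreviation M3 :: "'a poly44 set" where "M3 \<equiv> {vx 1, vx 2, vx 3 ^ 2, vx 4 ^ 2}"

text \<open>Modulo x_1 and x_2, \<open>Gf 4\<close> and \<open>Gf 3\<close> reduce to unit multiples
  of x_3^2 and x_4^2.\<close>

lemma idl_M3: "idl (insert (vx 1) (insert (vx 2) J)) = idl M3"
proof (rule idl_eqI)
 have sq: "vx i ^ 2 \<in> idl M3" for i
 proof -
  have "vx 1 * vx 1 \<in> idl M3" "vx 2 * vx 2 \<in> idl M3" "vx 3 ^ 2 \<in> idl M3" "vx 4 ^ 2 \<in> idl M3"
   by (auto intro: ispan_base ispan_scale)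
  then show ?thesis using exhaust_4[of i] by (auto simp: power2_eq_square)
 qed
 have "FF \<in> idl M3" "GG \<in> idl M3"
  unfolding FF_def GG_def by (intro ispan_sum ispan_scale sq)+
 then show "insert (vx 1) (insert (vx 2) J) \<subseteq> idl M3" by (auto intro: ispan_base)
 let ?H = "idl (insert (vx 1) (insert (vx 2) J))"
 let ?K = "mc :: 'a \<Rightarrow> 'a poly44"
 have G: "Gf l \<in> ?H" for l
  using Gf_in_J[of l "{vx 1, vx 2}"] by (simp add: insert_commute)
 have x: "vx 1 \<in> ?H" "vx 2 \<in> ?H" by (auto intro: ispan_base)
 have "?K (inverse (d 4 3)) * Gf 4 = (?K (inverse (d 4 3)) * ?K (d 4 3)) * vx 3 ^ 2
   + ?K (inverse (d 4 3) * d 4 1) * vx 1 * vx 1 + ?K (inverse (d 4 3) * d 4 2) * vx 2 * vx 2"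
  unfolding Gf_def sum_4 by (simp add: algebra_simps power2_eq_square mpoly_const_mult)
 also have "?K (inverse (d 4 3)) * ?K (d 4 3) = 1" by (simp add: mpoly_const_mult[symmetric])
 finally have "vx 3 ^ 2 = ?K (inverse (d 4 3)) * Gf 4 - ?K (inverse (d 4 3) * d 4 1) * vx 1 * vx 1
   - ?K (inverse (d 4 3) * d 4 2) * vx 2 * vx 2" by simp
 then have 3: "vx 3 ^ 2 \<in> ?H"
  by (simp only:) (intro ispan_diff ispan_scale G x)
 have "?K (inverse (d 3 4)) * Gf 3 = (?K (inverse (d 3 4)) * ?K (d 3 4)) * vx 4 ^ 2
   + ?K (inverse (d 3 4) * d 3 1) * vx 1 * vx 1 + ?K (inverse (d 3 4) * d 3 2) * vx 2 * vx 2"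
  unfolding Gf_def sum_4 by (simp add: algebra_simps power2_eq_square mpoly_const_mult)
 also have "?K (inverse (d 3 4)) * ?K (d 3 4) = 1" by (simp add: mpoly_const_mult[symmetric])
 finally have "vx 4 ^ 2 = ?K (inverse (d 3 4)) * Gf 3 - ?K (inverse (d 3 4) * d 3 1) * vx 1 * vx 1
   - ?K (inverse (d 3 4) * d 3 2) * vx 2 * vx 2" by simp
 then have 4: "vx 4 ^ 2 \<in> ?H"
  by (simp only:) (intro ispan_diff ispan_scale G x)
 show "M3 \<subseteq> ?H" using x 3 4 by auto
qed

text \<open>The quotient of B by \<open>M3\<close> is free over T on 1, x_3, x_4, x_3 x_4: this is
  the spanning half, \<open>M3_zero\<close> the independence.\<close>

lemma M3_normal_form:
 "\<exists>a b c e. u - (emT a + emT b * vx 3 + emT c * vx 4 + emT e * (vx 3 * vx 4)) \<in> idl M3"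
proof (induction u rule: mpoly_induct)
 case (const k)
 show ?case by (intro exI[of _ "mc k"] exI[of _ 0]) (simp add: rhom_0[OF rhom_emT] ispan_zero)
next
 case (var z)
 show ?case
 proof (cases z)
  case (Inr j)
  then show ?thesis by (intro exI[of _ "mpv j"] exI[of _ 0]) (simp add: rhom_0[OF rhom_emT] ispan_zero)
 next
  case (Inl i)
  consider "i = 1 \<or> i = 2" | "i = 3" | "i = 4" using exhaust_4 by blast
  then show ?thesis
  proof cases
   case 1
   then have "vx i \<in> idl M3" by (auto intro: ispan_base)
   then show ?thesis using Inl by (intro exI[of _ 0]) (simp add: rhom_0[OF rhom_emT])
  next
   case 2
   show ?thesis unfolding Inl 2
    by (rule exI[of _ 0], rule exI[of _ 1], rule exI[of _ 0], rule exI[of _ 0]) (simp add: rhom_0[OF rhom_emT] rhom_1[OF rhom_emT] ispan_zero)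
  next
   case 3
   show ?thesis unfolding Inl 3
    by (rule exI[of _ 0], rule exI[of _ 0], rule exI[of _ 1], rule exI[of _ 0]) (simp add: rhom_0[OF rhom_emT] rhom_1[OF rhom_emT] ispan_zero)
  qed
 qed
next
 case (add f g)
 then obtain a b c e a' b' c' e' where
  "f - (emT a + emT b * vx 3 + emT c * vx 4 + emT e * (vx 3 * vx 4)) \<in> idl M3"
  "g - (emT a' + emT b' * vx 3 + emT c' * vx 4 + emT e' * (vx 3 * vx 4)) \<in> idl M3" by blast
 from ispan_add[OF this]
 have "f + g - (emT (a + a') + emT (b + b') * vx 3 + emT (c + c') * vx 4 + emT (e + e') * (vx 3 * vx 4)) \<in> idl M3"
  by (simp add: rhom_add[OF rhom_emT] algebra_simps)
 then show ?case by blast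
next
 case (mult f g)
 then obtain a b c e a' b' c' e' where *:
  "f - (emT a + emT b * vx 3 + emT c * vx 4 + emT e * (vx 3 * vx 4)) \<in> idl M3"
  "g - (emT a' + emT b' * vx 3 + emT c' * vx 4 + emT e' * (vx 3 * vx 4)) \<in> idl M3" by blast
 have x: "vx 3 ^ 2 \<in> idl M3" "vx 4 ^ 2 \<in> idl M3" by (auto intro: ispan_base)
 let ?a = "a * a'" and ?b = "a * b' + b * a'" and ?c = "a * c' + c * a'" and ?e = "a * e' + e * a' + b * c' + c * b'"
 have "(f * g - (emT a + emT b * vx 3 + emT c * vx 4 + emT e * (vx 3 * vx 4)) *
   (emT a' + emT b' * vx 3 + emT c' * vx 4 + emT e' * (vx 3 * vx 4)))
  + ((emT b * emT b' + (emT b * emT e' + emT e * emT b') * vx 4 + emT e * emT e' * vx 4 ^ 2) * vx 3 ^ 2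
   + (emT c * emT c' + (emT c * emT e' + emT e * emT c') * vx 3) * vx 4 ^ 2) \<in> idl M3"
  by (intro ispan_add idl_cong_mult[OF *] ispan_scale x)
 also have "(f * g - (emT a + emT b * vx 3 + emT c * vx 4 + emT e * (vx 3 * vx 4)) *
   (emT a' + emT b' * vx 3 + emT c' * vx 4 + emT e' * (vx 3 * vx 4)))
  + ((emT b * emT b' + (emT b * emT e' + emT e * emT b') * vx 4 + emT e * emT e' * vx 4 ^ 2) * vx 3 ^ 2
   + (emT c * emT c' + (emT c * emT e' + emT e * emT c') * vx 3) * vx 4 ^ 2)
  = f * g - (emT ?a + emT ?b * vx 3 + emT ?c * vx 4 + emT ?e * (vx 3 * vx 4))"
  by (simp add: rhom_add[OF rhom_emT] rhom_mult[OF rhom_emT] power2_eq_square algebra_simps)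
 finally show ?case by blast
qed

text \<open>Kills x_1 and x_2 and turns x_3 into the outer and x_4 into the inner polynomial
  variable over T; on the ideal of \<open>M3\<close>, coefficients of degree at most one in each
  variable vanish.\<close>

definition Th :: "'a poly44 \<Rightarrow> 'a poly4 poly poly" where
 "Th = ev (\<lambda>c. [:[:mc c:]:]) (case_sum (\<lambda>i. if i = 3 then [:0, 1:] else if i = 4 then [:[:0, 1:]:] else 0)
  (\<lambda>j. [:[:mpv j:]:]))"

lemma rhom_Th: "rhom Th"
 unfolding Th_def by (rule rhom_ev[OF rhom_comp[OF rhom_zconst rhom_poly_const]])

lemma Th_simps: "Th (mc c) = [:[:mc c:]:]" "Th (vy j) = [:[:mpv j:]:]"
 "Th (vx i) = (if i = 3 then [:0, 1:] else if i = 4 then [:[:0, 1:]:] else 0)"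
 unfolding Th_def ev_const[OF rhom_comp[OF rhom_zconst rhom_poly_const]]
  ev_var[OF rhom_comp[OF rhom_zconst rhom_poly_const]] by simp_all

lemma Th_emT: "Th (emT t) = [:[:t:]:]"
 by (rule mpoly_hom_unique[OF rhom_comp[OF rhom_emT rhom_Th] rhom_comp[OF rhom_poly_const rhom_poly_const]])
  (simp_all add: Th_simps)

lemma M3_zero:
 assumes "emT a + emT b * vx 3 + emT c * vx 4 + emT e * (vx 3 * vx 4) \<in> idl M3"
 shows "a = 0" "b = 0" "c = 0" "e = 0"
proof -
 have z: "pco (pco (Th u) i) j = 0" if "u \<in> idl M3" "i \<le> 1" "j \<le> 1" for u i j
  using that(1)
 proof (induction rule: ispan_induct_alt)
  case base
  then show ?case by (simp add: rhom_0[OF rhom_Th])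
 next
  case (step k x y)
  have "pco (pco (Th k * Th x) i) j = 0"
  proof -
   consider "x = vx 1 \<or> x = vx 2" | "x = vx 3 ^ 2" | "x = vx 4 ^ 2" using step by blast
   then show ?thesis
   proof cases
    case 1
    then show ?thesis by (auto simp: Th_simps)
   next
    case 2
    then have "Th x = Polynomial.monom 1 2"
     by (simp only: rhom_power[OF rhom_Th] Th_simps) (simp add: power2_eq_square monom_altdef)
    then show ?thesis using that by (simp add: mult.commute[of "Th k"] coeff_monom_mult)
   next
    case 3
    then have "Th x = [:Polynomial.monom 1 2:]"
     by (simp only: rhom_power[OF rhom_Th] Th_simps) (simp add: power2_eq_square monom_altdef)
    then show ?thesis using that by (simp add: mult.commute[of "Th k"] coeff_monom_mult)
   qed
  qed
  then show ?case using step by (simp add: rhom_add[OF rhom_Th] rhom_mult[OF rhom_Th])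
 qed
 have T: "Th (emT a + emT b * vx 3 + emT c * vx 4 + emT e * (vx 3 * vx 4)) = [:[:a, c:], [:b, e:]:]"
  by (simp add: rhom_add[OF rhom_Th] rhom_mult[OF rhom_Th] Th_emT Th_simps)
 show "a = 0" "b = 0" "c = 0" "e = 0"
  using z[OF assms, of 0 0] z[OF assms, of 1 0] z[OF assms, of 0 1] z[OF assms, of 1 1]
  unfolding T by simp_all
qed

end

section \<open>The shape of the answer: power torsion and generators of a row\<close>

definition tors :: "'a::comm_ring_1 poly44 set \<Rightarrow> 'a poly44 \<Rightarrow> bool" where
 "tors I b \<longleftrightarrow> (\<forall>i. \<exists>N. vx i ^ N * b \<in> I)"

text \<open>Minimality is encoded as linear independence over the field modulo I. All generators
  have the same bidegree (i, j), so in a relation expressing one by the others the part of y-degree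
  j has constant coefficients.\<close>

definition row_gens :: "'a::comm_ring_1 poly44 set \<Rightarrow> nat \<Rightarrow> nat \<Rightarrow> ('n::finite \<Rightarrow> 'a poly44) \<Rightarrow> bool" where
 "row_gens I i j a \<longleftrightarrow>
  (\<forall>l. hdeg dx i (a l) \<and> hdeg dy j (a l) \<and> tors I (a l)) \<and>
  (\<forall>b. tors I b \<longrightarrow> hdeg dx i b \<longrightarrow> (\<exists>t. b - (\<Sum>l\<in>UNIV. emT (t l) * a l) \<in> I)) \<and>
  (\<forall>c. (\<Sum>l\<in>UNIV. mc (c l) * a l) \<in> I \<longrightarrow> (\<forall>l. c l = 0))"

definition good :: "'a::comm_ring_1 poly44 set \<Rightarrow> bool" where
 "good I \<longleftrightarrow> (\<forall>b n. tors I b \<longrightarrow> hdeg dx n b \<longrightarrow> n \<ge> 3 \<longrightarrow> b \<in> I) \<and>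
  (\<exists>a :: unit \<Rightarrow> 'a poly44. row_gens I 2 2 a) \<and>
  (\<exists>a :: 4 \<Rightarrow> 'a poly44. row_gens I 1 4 a) \<and>
  (\<exists>a :: unit \<Rightarrow> 'a poly44. row_gens I 0 8 a)"

definition dt :: "('i::finite \<Rightarrow>\<^sub>0 nat) \<Rightarrow> nat" where "dt m = (\<Sum>i\<in>UNIV. pml m i)"

lemma graded_dt: "graded dt"
 by (simp add: graded_def dt_def lookup_add sum.distrib)

lemma hom_dt [simp]: "hdeg dt 1 (mpv i)" "hdeg dt 0 (mc c)"
 by (auto simp: mpoly_var_def mpoly_const_def dt_def lookup_single when_def intro!: hdeg_single)

lemma hdeg_prod_power:
 fixes v :: "'b \<Rightarrow> ('i \<Rightarrow>\<^sub>0 nat) \<Rightarrow>\<^sub>0 'a::comm_ring_1"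
 assumes \<delta>: "graded \<delta>" and h: "\<And>i. i \<in> A ==> hdeg \<delta> w (v i)" and "finite A"
 shows "hdeg \<delta> (w * (\<Sum>i\<in>A. e i)) (\<Prod>i\<in>A. v i ^ e i)"
 using assms(3) h
proof (induction A rule: finite_induct)
 case empty
 then show ?case using hdeg_power[OF \<delta>, of 0 0 0] by simp
next
 case (insert i A)
 have "hdeg \<delta> (e i * w + w * (\<Sum>i\<in>A. e i)) (v i ^ e i * (\<Prod>i\<in>A. v i ^ e i))"
  by (rule hdeg_mult[OF \<delta>]) (use insert hdeg_power[OF \<delta>] in auto)
 then show ?case using insert by (simp add: algebra_simps)
qed

lemma hom_dy_emT: "hdeg dt k t ==> hdeg dy k (emT t)"
proof -
 assume t: "hdeg dt k t"
 have "hdeg dy k (emT (pms m (pml t m)))" if "m \<in> pmk t" for m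
 proof -
  have "hdeg dy (0 + 1 * (\<Sum>i\<in>UNIV. pml m i))
    (mc (pml t m) * (\<Prod>i\<in>UNIV. vy i ^ pml m i))"
   by (intro hdeg_mult graded_dy hdeg_prod_power hom_dy finite)
  then show ?thesis using t that
   unfolding single_eq_prod by (simp add: rhom_simps[OF rhom_emT] hdeg_def dt_def)
 qed
 then have "hdeg dy k (emT (\<Sum>m\<in>pmk t. pms m (pml t m)))"
  unfolding rhom_sum[OF rhom_emT] by (rule hdeg_sum)
 then show ?thesis by (simp add: poly_mapping_eq_sum)
qed

section \<open>The elements killed by two variables, by Koszul relations\<close>

context diag
begin

abbreviation KD :: "4 \<Rightarrow> 4 \<Rightarrow> 'a poly44" where "KD i j \<equiv> mc (d i j)"

lemma KD_eq: "mc (d i j) = mc (p i) * mc (q j) - mc (p j) * mc (q i)"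
 by (simp add: d_def rhom_simps[OF rhom_const])

lemma KD_swap: "KD i j = - KD j i"
 unfolding d_swap[of i j] by (simp add: rhom_minus[OF rhom_const])

text \<open>\<open>mm\<close> and \<open>rr\<close> are polarisations of \<open>Del\<close>: the
  first replaces one factor x_i of each product x_i x_j by v i, the second replaces the whole
  product by W i j.\<close>

definition mm :: "(4 \<Rightarrow> 'a poly44) \<Rightarrow> 'a poly44" where
 "mm v = KD 1 2 * KD 3 4 * (vy 3 * vy 4 * (vx 1 * v 2 + vx 2 * v 1) + vy 1 * vy 2 * (vx 3 * v 4 + vx 4 * v 3))
  - KD 1 3 * KD 2 4 * (vy 2 * vy 4 * (vx 1 * v 3 + vx 3 * v 1) + vy 1 * vy 3 * (vx 2 * v 4 + vx 4 * v 2))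
  + KD 1 4 * KD 2 3 * (vy 2 * vy 3 * (vx 1 * v 4 + vx 4 * v 1) + vy 1 * vy 4 * (vx 2 * v 3 + vx 3 * v 2))"

definition rr :: "(4 \<Rightarrow> 4 \<Rightarrow> 'a poly44) \<Rightarrow> 'a poly44" where
 "rr W = KD 1 2 * KD 3 4 * (vy 3 * vy 4 * W 1 2 + vy 1 * vy 2 * W 3 4)
  - KD 1 3 * KD 2 4 * (vy 2 * vy 4 * W 1 3 + vy 1 * vy 3 * W 2 4)
  + KD 1 4 * KD 2 3 * (vy 2 * vy 3 * W 1 4 + vy 1 * vy 4 * W 2 3)"

lemma Del_eq: "Del = KD 1 2 * KD 3 4 * (vx 1 * vx 2 * vy 3 * vy 4 + vx 3 * vx 4 * vy 1 * vy 2)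
  - KD 1 3 * KD 2 4 * (vx 1 * vx 3 * vy 2 * vy 4 + vx 2 * vx 4 * vy 1 * vy 3)
  + KD 1 4 * KD 2 3 * (vx 1 * vx 4 * vy 2 * vy 3 + vx 2 * vx 3 * vy 1 * vy 4)"
 unfolding Del_def mpoly_const_mult ..

definition R :: "(4 \<Rightarrow> 'a poly44) \<Rightarrow> 4 \<Rightarrow> 'a poly44" where "R v l = (\<Sum>m\<in>UNIV. KD l m * v m * vy m)"

lemma Gf_II: "Gf l \<in> idl II"
 by (rule idl_J_II[OF Gf_in_J])

text \<open>For a syzygy v, \<open>mm v\<close> behaves like a common quotient of the v_j Del by
  x_j. The difference is an explicit combination of \<open>Gf\<close>, \<open>Lf\<close> and the
  residuals \<open>R v l\<close> of the syzygy equations, which vanish.\<close>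

lemma X_mm:
 assumes v: "\<And>l. R v l = 0"
 shows "vx j * mm v - v j * Del \<in> idl II"
proof -
 note Del_def = Del_eq
 have i1: "vx 1 * mm v - v 1 * Del = 0 + (- (v 2 * KD 3 4 * vy 3 * vy 4) * Gf 2 - vy 2 * KD 3 4 * (vx 3 * v 4 + vx 4 * v 3) * Lf 2 + vy 2 * KD 3 4 * vx 3 * vx 4 * R v 2)
   - (- (v 3 * KD 2 4 * vy 2 * vy 4) * Gf 3 - vy 3 * KD 2 4 * (vx 2 * v 4 + vx 4 * v 2) * Lf 3 + vy 3 * KD 2 4 * vx 2 * vx 4 * R v 3)
   + (- (v 4 * KD 2 3 * vy 2 * vy 3) * Gf 4 - vy 4 * KD 2 3 * (vx 2 * v 3 + vx 3 * v 2) * Lf 4 + vy 4 * KD 2 3 * vx 2 * vx 3 * R v 4)"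
  unfolding mm_def Del_def Gf_def Lf_def R_def sum_4 KD_eq d_same by (simp add: algebra_simps power2_eq_square)
 have i2: "vx 2 * mm v - v 2 * Del = 0 - (- (v 1 * KD 3 4 * vy 3 * vy 4) * Gf 1 - vy 1 * KD 3 4 * (vx 3 * v 4 + vx 4 * v 3) * Lf 1 + vy 1 * KD 3 4 * vx 3 * vx 4 * R v 1)
   + (- (v 3 * KD 1 4 * vy 1 * vy 4) * Gf 3 - vy 3 * KD 1 4 * (vx 1 * v 4 + vx 4 * v 1) * Lf 3 + vy 3 * KD 1 4 * vx 1 * vx 4 * R v 3)
   - (- (v 4 * KD 1 3 * vy 1 * vy 3) * Gf 4 - vy 4 * KD 1 3 * (vx 1 * v 3 + vx 3 * v 1) * Lf 4 + vy 4 * KD 1 3 * vx 1 * vx 3 * R v 4)"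
  unfolding mm_def Del_def Gf_def Lf_def R_def sum_4 KD_eq d_same by (simp add: algebra_simps power2_eq_square)
 have i3: "vx 3 * mm v - v 3 * Del = 0 + (- (v 1 * KD 2 4 * vy 2 * vy 4) * Gf 1 - vy 1 * KD 2 4 * (vx 2 * v 4 + vx 4 * v 2) * Lf 1 + vy 1 * KD 2 4 * vx 2 * vx 4 * R v 1)
   - (- (v 2 * KD 1 4 * vy 1 * vy 4) * Gf 2 - vy 2 * KD 1 4 * (vx 1 * v 4 + vx 4 * v 1) * Lf 2 + vy 2 * KD 1 4 * vx 1 * vx 4 * R v 2)
   + (- (v 4 * KD 1 2 * vy 1 * vy 2) * Gf 4 - vy 4 * KD 1 2 * (vx 1 * v 2 + vx 2 * v 1) * Lf 4 + vy 4 * KD 1 2 * vx 1 * vx 2 * R v 4)"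
  unfolding mm_def Del_def Gf_def Lf_def R_def sum_4 KD_eq d_same by (simp add: algebra_simps power2_eq_square)
 have i4: "vx 4 * mm v - v 4 * Del = 0 - (- (v 1 * KD 2 3 * vy 2 * vy 3) * Gf 1 - vy 1 * KD 2 3 * (vx 2 * v 3 + vx 3 * v 2) * Lf 1 + vy 1 * KD 2 3 * vx 2 * vx 3 * R v 1)
   + (- (v 2 * KD 1 3 * vy 1 * vy 3) * Gf 2 - vy 2 * KD 1 3 * (vx 1 * v 3 + vx 3 * v 1) * Lf 2 + vy 2 * KD 1 3 * vx 1 * vx 3 * R v 2)
   - (- (v 3 * KD 1 2 * vy 1 * vy 2) * Gf 3 - vy 3 * KD 1 2 * (vx 1 * v 2 + vx 2 * v 1) * Lf 3 + vy 3 * KD 1 2 * vx 1 * vx 2 * R v 3)"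
  unfolding mm_def Del_def Gf_def Lf_def R_def sum_4 KD_eq d_same by (simp add: algebra_simps power2_eq_square)

 have "vx 1 * mm v - v 1 * Del \<in> idl II" "vx 2 * mm v - v 2 * Del \<in> idl II"
  "vx 3 * mm v - v 3 * Del \<in> idl II" "vx 4 * mm v - v 4 * Del \<in> idl II"
  unfolding i1 i2 i3 i4 v mult_zero_right
  by (intro ispan_add ispan_diff ispan_scale ispan_zero Gf_II Lf_in_II)+
 then show ?thesis using exhaust_4[of j] by auto
qed

text \<open>The same principle one degree lower. The squares W m m do not occur in
  \<open>rr\<close>, so besides the syzygies of the rows the weighted traces must vanish.\<close>

lemma X_rr:
 assumes S: "W 2 1 = W 1 2" "W 3 1 = W 1 3" "W 4 1 = W 1 4" "W 3 2 = W 2 3" "W 4 2 = W 2 4" "W 4 3 = W 3 4"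
  and v: "\<And>i l. R (W i) l = 0" and tr: "\<And>l. (\<Sum>m\<in>UNIV. KD l m * W m m) = 0"
 shows "vx j * rr W - mm (W j) \<in> idl II"
proof -
 define Tr where "Tr l = (\<Sum>m\<in>UNIV. KD l m * W m m)" for l
 have T0: "Tr l = 0" for l unfolding Tr_def by (rule tr)
 have i1: "vx 1 * rr W - mm (W 1) = 0 + (vx 2 * KD 3 4 * vy 3 * vy 4 * Tr 2 - vy 2 * KD 3 4 * W 3 4 * Lf 2 + vy 2 * KD 3 4 * (vx 3 * R (W 4) 2 + vx 4 * R (W 3) 2))
   - (vx 3 * KD 2 4 * vy 2 * vy 4 * Tr 3 - vy 3 * KD 2 4 * W 2 4 * Lf 3 + vy 3 * KD 2 4 * (vx 2 * R (W 4) 3 + vx 4 * R (W 2) 3))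
   + (vx 4 * KD 2 3 * vy 2 * vy 3 * Tr 4 - vy 4 * KD 2 3 * W 2 3 * Lf 4 + vy 4 * KD 2 3 * (vx 2 * R (W 3) 4 + vx 3 * R (W 2) 4))"
  unfolding mm_def rr_def Lf_def R_def Tr_def sum_4 KD_eq S by (simp add: algebra_simps power2_eq_square)
 have i2: "vx 2 * rr W - mm (W 2) = 0 - (vx 1 * KD 3 4 * vy 3 * vy 4 * Tr 1 - vy 1 * KD 3 4 * W 3 4 * Lf 1 + vy 1 * KD 3 4 * (vx 3 * R (W 4) 1 + vx 4 * R (W 3) 1))
   + (vx 3 * KD 1 4 * vy 1 * vy 4 * Tr 3 - vy 3 * KD 1 4 * W 1 4 * Lf 3 + vy 3 * KD 1 4 * (vx 1 * R (W 4) 3 + vx 4 * R (W 1) 3))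
   - (vx 4 * KD 1 3 * vy 1 * vy 3 * Tr 4 - vy 4 * KD 1 3 * W 1 3 * Lf 4 + vy 4 * KD 1 3 * (vx 1 * R (W 3) 4 + vx 3 * R (W 1) 4))"
  unfolding mm_def rr_def Lf_def R_def Tr_def sum_4 KD_eq S by (simp add: algebra_simps power2_eq_square)
 have i3: "vx 3 * rr W - mm (W 3) = 0 + (vx 1 * KD 2 4 * vy 2 * vy 4 * Tr 1 - vy 1 * KD 2 4 * W 2 4 * Lf 1 + vy 1 * KD 2 4 * (vx 2 * R (W 4) 1 + vx 4 * R (W 2) 1))
   - (vx 2 * KD 1 4 * vy 1 * vy 4 * Tr 2 - vy 2 * KD 1 4 * W 1 4 * Lf 2 + vy 2 * KD 1 4 * (vx 1 * R (W 4) 2 + vx 4 * R (W 1) 2))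
   + (vx 4 * KD 1 2 * vy 1 * vy 2 * Tr 4 - vy 4 * KD 1 2 * W 1 2 * Lf 4 + vy 4 * KD 1 2 * (vx 1 * R (W 2) 4 + vx 2 * R (W 1) 4))"
  unfolding mm_def rr_def Lf_def R_def Tr_def sum_4 KD_eq S by (simp add: algebra_simps power2_eq_square)
 have i4: "vx 4 * rr W - mm (W 4) = 0 - (vx 1 * KD 2 3 * vy 2 * vy 3 * Tr 1 - vy 1 * KD 2 3 * W 2 3 * Lf 1 + vy 1 * KD 2 3 * (vx 2 * R (W 3) 1 + vx 3 * R (W 2) 1))
   + (vx 2 * KD 1 3 * vy 1 * vy 3 * Tr 2 - vy 2 * KD 1 3 * W 1 3 * Lf 2 + vy 2 * KD 1 3 * (vx 1 * R (W 3) 2 + vx 3 * R (W 1) 2))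
   - (vx 3 * KD 1 2 * vy 1 * vy 2 * Tr 3 - vy 3 * KD 1 2 * W 1 2 * Lf 3 + vy 3 * KD 1 2 * (vx 1 * R (W 2) 3 + vx 2 * R (W 1) 3))"
  unfolding mm_def rr_def Lf_def R_def Tr_def sum_4 KD_eq S by (simp add: algebra_simps power2_eq_square)

 have "vx 1 * rr W - mm (W 1) \<in> idl II" "vx 2 * rr W - mm (W 2) \<in> idl II"
  "vx 3 * rr W - mm (W 3) \<in> idl II" "vx 4 * rr W - mm (W 4) \<in> idl II"
  unfolding i1 i2 i3 i4 v T0 mult_zero_right
  by (intro ispan_add ispan_diff ispan_scale ispan_zero Lf_in_II)+
 then show ?thesis using exhaust_4[of j] by auto
qed

text \<open>\<open>A1\<close>, \<open>A2\<close> and \<open>C1\<close>, \<open>C2\<close> are the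
  cofactors of \<open>Lf 1\<close>, \<open>Lf 2\<close> in x_1 Del and x_2 Del, up to the constant
  \<open>KD 1 2\<close> and modulo (FF, GG).\<close>

definition A1 :: "'a poly44" where "A1 = KD 2 3 * KD 2 4 * vx 2 * (vx 3 * vy 4 - vx 4 * vy 3)"
definition A2 :: "'a poly44" where
 "A2 = - (KD 1 2 * KD 3 4 * vy 2 * vx 3 * vx 4 - KD 1 3 * KD 2 4 * vy 3 * vx 2 * vx 4 + KD 1 4 * KD 2 3 * vy 4 * vx 2 * vx 3)"
definition C1 :: "'a poly44" where
 "C1 = KD 1 2 * KD 3 4 * vy 1 * vx 3 * vx 4 + KD 2 3 * KD 1 4 * vy 3 * vx 1 * vx 4 - KD 2 4 * KD 1 3 * vy 4 * vx 1 * vx 3"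
definition C2 :: "'a poly44" where "C2 = KD 1 3 * KD 1 4 * vx 1 * (vx 3 * vy 4 - vx 4 * vy 3)"

text \<open>The last two parts compare the two ways of writing x_1 x_2 Del: they differ by the
  Koszul relation of \<open>Lf 1\<close>, \<open>Lf 2\<close> with cofactor \<open>KD 3 4\<close>
  x_3 x_4. This is the invariant that identifies \<open>Del\<close>.\<close>

lemma Del_koszul:
 "KD 1 2 * vx 1 * Del - (A1 * Lf 1 + A2 * Lf 2) \<in> idl J"
 "KD 1 2 * vx 2 * Del - (C1 * Lf 1 + C2 * Lf 2) \<in> idl J"
 "vx 2 * A1 - vx 1 * C1 - KD 3 4 * vx 3 * vx 4 * Lf 2 \<in> idl J"
 "vx 2 * A2 - vx 1 * C2 + KD 3 4 * vx 3 * vx 4 * Lf 1 \<in> idl J"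
proof -
 define B C where "B = KD 1 3 * KD 2 4" and "C = KD 1 4 * KD 2 3"
 have pl: "KD 1 2 * KD 3 4 = B - C" unfolding B_def C_def KD_eq by (simp add: algebra_simps)
 have D0: "KD l l = 0" for l by simp
 note sw = KD_swap[of 2 1] KD_swap[of 3 1] KD_swap[of 4 1] KD_swap[of 3 2] KD_swap[of 4 2] KD_swap[of 4 3] D0
 have g3: "KD 1 2 * Gf 3 = (B - C) * vx 4 ^ 2 - KD 1 2 * KD 1 3 * vx 1 ^ 2 - KD 1 2 * KD 2 3 * vx 2 ^ 2"
  unfolding pl[symmetric] Gf_def sum_4 sw by (simp add: algebra_simps)
 have g4: "KD 1 2 * Gf 4 = - (B - C) * vx 3 ^ 2 - KD 1 2 * KD 1 4 * vx 1 ^ 2 - KD 1 2 * KD 2 4 * vx 2 ^ 2"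
  unfolding pl[symmetric] Gf_def sum_4 sw by (simp add: algebra_simps)
 have 1: "KD 1 2 * vx 1 * Del - (A1 * Lf 1 + A2 * Lf 2) =
  - ((KD 1 2 * KD 3 4) * vx 2 * vy 3 * vy 4) * Gf 2 + (vx 3 * KD 2 4 * vy 2 * vy 4) * (KD 1 2 * Gf 3)
  - (vx 4 * KD 2 3 * vy 2 * vy 3) * (KD 1 2 * Gf 4)"
  unfolding Del_eq A1_def A2_def unfolding g3 g4 pl
  unfolding Gf_def Lf_def sum_4 sw B_def C_def by (simp add: algebra_simps power2_eq_square)
 have 2: "KD 1 2 * vx 2 * Del - (C1 * Lf 1 + C2 * Lf 2) =
  ((KD 1 2 * KD 3 4) * vx 1 * vy 3 * vy 4) * Gf 1 - (vx 3 * KD 1 4 * vy 1 * vy 4) * (KD 1 2 * Gf 3)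
  + (vx 4 * KD 1 3 * vy 1 * vy 3) * (KD 1 2 * Gf 4)"
  unfolding Del_eq C1_def C2_def unfolding g3 g4 pl
  unfolding Gf_def Lf_def sum_4 sw B_def C_def by (simp add: algebra_simps power2_eq_square)
 have 3: "vx 2 * A1 - vx 1 * C1 - KD 3 4 * vx 3 * vx 4 * Lf 2 =
  KD 2 3 * vx 4 * vy 3 * Gf 4 - KD 2 4 * vx 3 * vy 4 * Gf 3"
  unfolding A1_def C1_def Gf_def Lf_def sum_4 KD_eq by (simp add: algebra_simps power2_eq_square)
 have 4: "vx 2 * A2 - vx 1 * C2 + KD 3 4 * vx 3 * vx 4 * Lf 1 =
  - (KD 1 3 * vx 4 * vy 3) * Gf 4 + KD 1 4 * vx 3 * vy 4 * Gf 3"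
  unfolding A2_def C2_def Gf_def Lf_def sum_4 KD_eq by (simp add: algebra_simps power2_eq_square)
 show "KD 1 2 * vx 1 * Del - (A1 * Lf 1 + A2 * Lf 2) \<in> idl J"
  "KD 1 2 * vx 2 * Del - (C1 * Lf 1 + C2 * Lf 2) \<in> idl J"
  "vx 2 * A1 - vx 1 * C1 - KD 3 4 * vx 3 * vx 4 * Lf 2 \<in> idl J"
  "vx 2 * A2 - vx 1 * C2 + KD 3 4 * vx 3 * vx 4 * Lf 1 \<in> idl J"
  unfolding 1 2 3 4 by (intro ispan_add ispan_diff ispan_scale Gf_in_J)+
qed

text \<open>Injectivity of the comparison. If the cofactor u lies in (x_1, x_2, FF, GG), then a1 and
  a2 can be changed by a Koszul relation until both are divisible by x_1, and x_1 cancels.\<close>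

lemma koszul_zero:
 assumes b: "vx 1 * b - (a1 * Lf 1 + a2 * Lf 2) \<in> idl J"
  and u: "vx 2 * a1 - vx 1 * c1 - u * Lf 2 \<in> idl J" "vx 2 * a2 - vx 1 * c2 + u * Lf 1 \<in> idl J"
  and u0: "u \<in> idl (insert (vx 1) (insert (vx 2) J))"
 shows "b \<in> idl II"
proof -
 have n: "nzd (vx 2) (idl (insert (vx 1) J))"
  using nzd_X_X[of 1 2] by (simp add: insert_commute)
 obtain u1 u2 where U: "u - u1 * vx 1 - u2 * vx 2 \<in> idl J" using u0 by (auto simp: idl_insert)
 have "(vx 2 * a1 - vx 1 * c1 - u * Lf 2) + Lf 2 * (u - u1 * vx 1 - u2 * vx 2) \<in> idl J"
  by (intro ispan_add ispan_scale u U)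
 then have "vx 2 * (a1 - u2 * Lf 2) - (c1 + u1 * Lf 2) * vx 1 \<in> idl J" by (simp add: algebra_simps)
 then have "vx 2 * (a1 - u2 * Lf 2) \<in> idl (insert (vx 1) J)" unfolding idl_insert[of _ "vx 1"] by blast
 then obtain w where w: "a1 - u2 * Lf 2 - w * vx 1 \<in> idl J" using nzdD[OF n] idl_insert[of _ "vx 1"] by blast
 have "(vx 2 * a2 - vx 1 * c2 + u * Lf 1) - Lf 1 * (u - u1 * vx 1 - u2 * vx 2) \<in> idl J"
  by (intro ispan_diff ispan_scale u U)
 then have "vx 2 * (a2 + u2 * Lf 1) - (c2 - u1 * Lf 1) * vx 1 \<in> idl J" by (simp add: algebra_simps)
 then have "vx 2 * (a2 + u2 * Lf 1) \<in> idl (insert (vx 1) J)" unfolding idl_insert[of _ "vx 1"] by blast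
 then obtain w' where w': "a2 + u2 * Lf 1 - w' * vx 1 \<in> idl J" using nzdD[OF n] idl_insert[of _ "vx 1"] by blast
 have "(vx 1 * b - (a1 * Lf 1 + a2 * Lf 2)) + Lf 1 * (a1 - u2 * Lf 2 - w * vx 1) + Lf 2 * (a2 + u2 * Lf 1 - w' * vx 1) \<in> idl J"
  by (intro ispan_add ispan_scale b w w')
 then have "vx 1 * (b - (w * Lf 1 + w' * Lf 2)) \<in> idl J" by (simp add: algebra_simps)
 then have "b - (w * Lf 1 + w' * Lf 2) \<in> idl II" using nzdD[OF nzd_X] idl_J_II by blast
 moreover have "w * Lf 1 + w' * Lf 2 \<in> idl II" by (intro ispan_add ispan_scale Lf_in_II)
 ultimately show ?thesis using ispan_add by fastforce
qed

lemma nzd_L: "nzd (Lf 1) (idl J)" "nzd (Lf 2) (idl J)" "nzd (Lf 2) (idl (insert (Lf 1) J))"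
 using nzd_Lf[of 1 2] nzd_Lf[of 2 1] nzd_Lf_Lf[of 1 2] by simp_all

text \<open>Since \<open>Lf 1\<close>, \<open>Lf 2\<close> is regular modulo (FF, GG), only Koszul
  relations occur.\<close>

lemma koszul_syz:
 assumes "e * Lf 1 + e' * Lf 2 \<in> idl J"
 shows "\<exists>u. e - u * Lf 2 \<in> idl J \<and> e' + u * Lf 1 \<in> idl J"
proof -
 have "Lf 2 * e' - (- e) * Lf 1 \<in> idl J" using assms by (simp add: algebra_simps)
 then have "Lf 2 * e' \<in> idl (insert (Lf 1) J)" unfolding idl_insert[of _ "Lf 1"] by blast
 then obtain k where k: "e' - k * Lf 1 \<in> idl J" using nzdD[OF nzd_L(3)] idl_insert[of _ "Lf 1"] by blast
 have "(e * Lf 1 + e' * Lf 2) - Lf 2 * (e' - k * Lf 1) \<in> idl J"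
  by (intro ispan_diff ispan_scale assms k)
 then have "Lf 1 * (e - (- k) * Lf 2) \<in> idl J" by (simp add: algebra_simps)
 then have "e - (- k) * Lf 2 \<in> idl J" by (rule nzdD[OF nzd_L(1)])
 then show ?thesis using k by (intro exI[of _ "- k"]) simp
qed

lemma II_repr: "b \<in> idl II ==> \<exists>a1 a2. b - (a1 * Lf 1 + a2 * Lf 2) \<in> idl J"
proof -
 assume "b \<in> idl II"
 then have "b \<in> idl (insert (Lf 1) (insert (Lf 2) J))" using II_eq[of 1 2] by simp
 then obtain a1 a2 where "b - a1 * Lf 1 - a2 * Lf 2 \<in> idl J"
  unfolding idl_insert[of _ "Lf 1"] idl_insert[of _ "Lf 2"] by blast
 then show ?thesis by (intro exI[of _ a1] exI[of _ a2]) (simp add: algebra_simps)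
qed

text \<open>The cofactor u of b is killed by \<open>Lf 1\<close> and \<open>Lf 2\<close> in the free
  T-module B/(x_1, x_2, FF, GG), hence is a T-multiple of x_3 x_4. Subtracting the corresponding
  multiple of \<open>Del\<close> brings u to zero, and \<open>koszul_zero\<close> applies.\<close>

lemma socle:
 assumes "vx 1 * b \<in> idl II" "vx 2 * b \<in> idl II"
 shows "\<exists>t. b - emT t * Del \<in> idl II"
proof -
 obtain a1 a2 where a: "vx 1 * b - (a1 * Lf 1 + a2 * Lf 2) \<in> idl J" using II_repr[OF assms(1)] by blast
 obtain c1 c2 where c: "vx 2 * b - (c1 * Lf 1 + c2 * Lf 2) \<in> idl J" using II_repr[OF assms(2)] by blast
 \<comment> \<open>Two expressions of x_1 x_2 b in terms of \<open>Lf 1\<close>,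
   \<open>Lf 2\<close>; they differ by a Koszul relation, whose cofactor is u.\<close>
 have "vx 1 * (vx 2 * b - (c1 * Lf 1 + c2 * Lf 2)) - vx 2 * (vx 1 * b - (a1 * Lf 1 + a2 * Lf 2)) \<in> idl J"
  by (intro ispan_diff ispan_scale a c)
 then have "(vx 2 * a1 - vx 1 * c1) * Lf 1 + (vx 2 * a2 - vx 1 * c2) * Lf 2 \<in> idl J" by (simp add: algebra_simps)
 then obtain u where u: "vx 2 * a1 - vx 1 * c1 - u * Lf 2 \<in> idl J" "vx 2 * a2 - vx 1 * c2 + u * Lf 1 \<in> idl J"
  using koszul_syz by blast
 let ?H = "idl (insert (vx 1) (insert (vx 2) J))"
 have JH: "g \<in> ?H" if "g \<in> idl J" for g using that idl_mono[of J "insert (vx 1) (insert (vx 2) J)"] by (auto intro: ispan_base)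
 have xH: "vx 1 \<in> ?H" "vx 2 \<in> ?H" by (auto intro: ispan_base)
 have x34: "vx 3 * vx 3 \<in> ?H" "vx 4 * vx 4 \<in> ?H"
  unfolding idl_M3 by (auto intro: ispan_base simp: power2_eq_square[symmetric])
 have "a1 * vx 2 - c1 * vx 1 - (vx 2 * a1 - vx 1 * c1 - u * Lf 2) \<in> ?H"
  "(vx 2 * a2 - vx 1 * c2 + u * Lf 1) - a2 * vx 2 + c2 * vx 1 \<in> ?H"
  by (intro ispan_add ispan_diff ispan_scale xH JH u)+
 then have uL: "u * Lf 2 \<in> ?H" "u * Lf 1 \<in> ?H" by (simp_all add: algebra_simps)
 obtain s3 s4 s5 s6 where s: "u - (emT s3 + emT s4 * vx 3 + emT s5 * vx 4 + emT s6 * (vx 3 * vx 4)) \<in> idl M3"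
  using M3_normal_form by blast
 define n where "n = emT s3 + emT s4 * vx 3 + emT s5 * vx 4 + emT s6 * (vx 3 * vx 4)"
 have s': "u - n \<in> ?H" using s unfolding idl_M3 n_def .
 have nL: "n * Lf l \<in> ?H" if "u * Lf l \<in> ?H" for l
  using ispan_diff[OF that idl_mult_right[OF s', of "Lf l"]] by (simp add: algebra_simps)
 \<comment> \<open>The product of the normal form of u with \<open>Lf l\<close> is zero in the
   quotient; its coefficients at x_3 and x_3 x_4 are read off.\<close>
 have step: "s3 = 0 \<and> s4 * mc (d l 4) * mpv 4 + s5 * mc (d l 3) * mpv 3 = 0"
  if l: "u * Lf l \<in> ?H" "l = 1 \<or> l = 2" for l
 proof -
  have e: "n * Lf l = emT 0 + emT (s3 * mc (d l 3) * mpv 3) * vx 3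
    + emT (s3 * mc (d l 4) * mpv 4) * vx 4
    + emT (s4 * mc (d l 4) * mpv 4 + s5 * mc (d l 3) * mpv 3) * (vx 3 * vx 4)
    + (n * KD l 1 * vy 1 * vx 1 + n * KD l 2 * vy 2 * vx 2
     + (emT s4 + emT s6 * vx 4) * KD l 3 * vy 3 * (vx 3 * vx 3)
     + (emT s5 + emT s6 * vx 3) * KD l 4 * vy 4 * (vx 4 * vx 4))"
   unfolding Lf_def sum_4 n_def by (simp add: rhom_simps[OF rhom_emT] algebra_simps)
  have "n * KD l 1 * vy 1 * vx 1 + n * KD l 2 * vy 2 * vx 2
     + (emT s4 + emT s6 * vx 4) * KD l 3 * vy 3 * (vx 3 * vx 3)
     + (emT s5 + emT s6 * vx 3) * KD l 4 * vy 4 * (vx 4 * vx 4) \<in> ?H"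
   by (intro ispan_add ispan_scale xH x34)
  from ispan_diff[OF nL[OF l(1)] this]
  have "emT 0 + emT (s3 * mc (d l 3) * mpv 3) * vx 3
    + emT (s3 * mc (d l 4) * mpv 4) * vx 4
    + emT (s4 * mc (d l 4) * mpv 4 + s5 * mc (d l 3) * mpv 3) * (vx 3 * vx 4) \<in> idl M3"
   unfolding e idl_M3 by simp
  from M3_zero(2,4)[OF this] show ?thesis using l(2) by auto
 qed
 have s30: "s3 = 0" and r1: "s4 * mc (d 1 4) * mpv 4 + s5 * mc (d 1 3) * mpv 3 = 0"
  and r2: "s4 * mc (d 2 4) * mpv 4 + s5 * mc (d 2 3) * mpv 3 = 0"
  using step[OF uL(2)] step[OF uL(1)] by auto
 let ?k = "\<lambda>i j. mc (d i j) :: 'a poly4"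
 \<comment> \<open>The determinant of the two linear equations \<open>r1\<close>, \<open>r2\<close>
   for s4 and s5, nonzero by the Pluecker relation.\<close>
 have dd: "d 1 4 * d 2 3 - d 1 3 * d 2 4 = - (d 1 2 * d 3 4)" by (simp add: d_def algebra_simps)
 have "mc (d 1 4 * d 2 3 - d 1 3 * d 2 4) * (s4 * mpv 4) =
  ?k 2 3 * (s4 * ?k 1 4 * mpv 4 + s5 * ?k 1 3 * mpv 3) - ?k 1 3 * (s4 * ?k 2 4 * mpv 4 + s5 * ?k 2 3 * mpv 3)"
  by (simp add: rhom_simps[OF rhom_const] algebra_simps)
 then have s40: "s4 = 0" unfolding r1 r2 dd by simp
 have s50: "s5 = 0" using r1 s40 by simp
 have us: "u - emT s6 * (vx 3 * vx 4) \<in> ?H"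
  using s' unfolding n_def s30 s40 s50 by (simp add: rhom_0[OF rhom_emT])
 \<comment> \<open>The scale that makes s \<open>KD 3 4\<close> x_3 x_4, the cofactor of s
   \<open>KD 1 2\<close> Del, agree with u.\<close>
 define s where "s = mc (inverse (d 3 4)) * emT s6"
 have sK: "s * KD 3 4 = emT s6"
  by (simp add: s_def mult.assoc mult.left_commute mpoly_const_mult[symmetric] mult.commute[of "emT s6"])
   (simp add: mult.assoc[symmetric] mpoly_const_mult[symmetric])
 have "b - s * KD 1 2 * Del \<in> idl II"
 proof (rule koszul_zero[where ?a1.0 = "a1 - s * A1" and ?a2.0 = "a2 - s * A2" and ?c1.0 = "c1 - s * C1" and ?c2.0 = "c2 - s * C2"
   and u = "u - s * (KD 3 4 * vx 3 * vx 4)"])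
  have "(vx 1 * b - (a1 * Lf 1 + a2 * Lf 2)) - s * (KD 1 2 * vx 1 * Del - (A1 * Lf 1 + A2 * Lf 2)) \<in> idl J"
   by (intro ispan_diff ispan_scale a Del_koszul)
  then show "vx 1 * (b - s * KD 1 2 * Del) - ((a1 - s * A1) * Lf 1 + (a2 - s * A2) * Lf 2) \<in> idl J"
   by (simp add: algebra_simps)
  have "(vx 2 * a1 - vx 1 * c1 - u * Lf 2) - s * (vx 2 * A1 - vx 1 * C1 - KD 3 4 * vx 3 * vx 4 * Lf 2) \<in> idl J"
   by (intro ispan_diff ispan_scale u Del_koszul)
  then show "vx 2 * (a1 - s * A1) - vx 1 * (c1 - s * C1) - (u - s * (KD 3 4 * vx 3 * vx 4)) * Lf 2 \<in> idl J"
   by (simp add: algebra_simps)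
  have "(vx 2 * a2 - vx 1 * c2 + u * Lf 1) - s * (vx 2 * A2 - vx 1 * C2 + KD 3 4 * vx 3 * vx 4 * Lf 1) \<in> idl J"
   by (intro ispan_diff ispan_scale u Del_koszul)
  then show "vx 2 * (a2 - s * A2) - vx 1 * (c2 - s * C2) + (u - s * (KD 3 4 * vx 3 * vx 4)) * Lf 1 \<in> idl J"
   by (simp add: algebra_simps)
  have "s * (KD 3 4 * vx 3 * vx 4) = emT s6 * (vx 3 * vx 4)" unfolding sK[symmetric] by (simp add: mult.assoc)
  then show "u - s * (KD 3 4 * vx 3 * vx 4) \<in> ?H" using us by simp
 qed
 moreover have "s * KD 1 2 = emT (mc (inverse (d 3 4)) * s6 * mc (d 1 2))"
  by (simp add: s_def rhom_mult[OF rhom_emT])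
 ultimately show ?thesis by metis
qed

text \<open>The comparison run backwards: if t Del lies in the ideal, its cofactor t d_34 x_3 x_4
  lies in (x_1, x_2, FF, GG), which forces t = 0 by \<open>M3_zero\<close>.\<close>

lemma Del_free:
 assumes t: "emT t * Del \<in> idl II" shows "t = 0"
proof -
 let ?s = "emT t"
 have "KD 1 2 * (?s * Del) \<in> idl II" by (rule ispan_scale[OF t])
 then obtain a a' where a: "KD 1 2 * (?s * Del) - (a * Lf 1 + a' * Lf 2) \<in> idl J" using II_repr by blast
 have "vx 1 * (KD 1 2 * (?s * Del) - (a * Lf 1 + a' * Lf 2)) - ?s * (KD 1 2 * vx 1 * Del - (A1 * Lf 1 + A2 * Lf 2)) \<in> idl J"
  by (intro ispan_diff ispan_scale a Del_koszul)
 then have "(?s * A1 - vx 1 * a) * Lf 1 + (?s * A2 - vx 1 * a') * Lf 2 \<in> idl J" by (simp add: algebra_simps)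
 then obtain k where k: "?s * A1 - vx 1 * a - k * Lf 2 \<in> idl J" using koszul_syz by blast
 have "vx 2 * (KD 1 2 * (?s * Del) - (a * Lf 1 + a' * Lf 2)) - ?s * (KD 1 2 * vx 2 * Del - (C1 * Lf 1 + C2 * Lf 2)) \<in> idl J"
  by (intro ispan_diff ispan_scale a Del_koszul)
 then have "(?s * C1 - vx 2 * a) * Lf 1 + (?s * C2 - vx 2 * a') * Lf 2 \<in> idl J" by (simp add: algebra_simps)
 then obtain k' where k': "?s * C1 - vx 2 * a - k' * Lf 2 \<in> idl J" using koszul_syz by blast
 have "vx 2 * (?s * A1 - vx 1 * a - k * Lf 2) - vx 1 * (?s * C1 - vx 2 * a - k' * Lf 2)
   - ?s * (vx 2 * A1 - vx 1 * C1 - KD 3 4 * vx 3 * vx 4 * Lf 2) \<in> idl J"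
  by (intro ispan_diff ispan_scale k k' Del_koszul)
 then have "Lf 2 * (?s * (KD 3 4 * vx 3 * vx 4) - k * vx 2 + k' * vx 1) \<in> idl J" by (simp add: algebra_simps)
 then have "?s * (KD 3 4 * vx 3 * vx 4) - k * vx 2 + k' * vx 1 \<in> idl J" by (rule nzdD[OF nzd_L(2)])
 then have "?s * (KD 3 4 * vx 3 * vx 4) - k * vx 2 - (- k') * vx 1 \<in> idl J" by simp
 then have "?s * (KD 3 4 * vx 3 * vx 4) \<in> idl (insert (vx 2) (insert (vx 1) J))"
  unfolding idl_insert[of _ "vx 1"] idl_insert[of _ "vx 2"] by blast
 then have "emT 0 + emT 0 * vx 3 + emT 0 * vx 4 + emT (t * mc (d 3 4)) * (vx 3 * vx 4) \<in> idl M3"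
  unfolding insert_commute[of "vx 2" "vx 1"] idl_M3 by (simp add: rhom_0[OF rhom_emT] rhom_mult[OF rhom_emT] mult.assoc)
 from M3_zero(4)[OF this] show ?thesis by simp
qed

end

lemma gpoly_dx_simps: "gpoly dx (vx i) = Polynomial.monom (vx i) 1" "gpoly dx (vy i) = Polynomial.monom (vy i) 0"
 "gpoly dx (mc c) = Polynomial.monom (mc c) 0" "gpoly dx (emT t) = Polynomial.monom (emT t) 0"
 and gpoly_dy_simps: "gpoly dy (vx i) = Polynomial.monom (vx i) 0" "gpoly dy (vy i) = Polynomial.monom (vy i) 1"
 "gpoly dy (mc c) = Polynomial.monom (mc c) 0"
 and gpoly_dt_simps: "gpoly dt (mpv j) = Polynomial.monom (mpv j) 1" "gpoly dt (mc c) = Polynomial.monom (mc c) 0"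
 by (simp_all add: hdeg_gpoly[OF hom_dx(1)] hdeg_gpoly[OF hom_dx(2)] hdeg_gpoly[OF hom_dx(3)]
  hdeg_gpoly[OF hom_dx_emT] hdeg_gpoly[OF hom_dy(1)] hdeg_gpoly[OF hom_dy(2)] hdeg_gpoly[OF hom_dy(3)]
  hdeg_gpoly[OF hom_dt(1)] hdeg_gpoly[OF hom_dt(2)])

lemmas hdeg_simps = hdeg_iff_gpoly gpoly_dx_simps gpoly_dy_simps gpoly_dt_simps
 rhom_simps[OF rhom_gpoly[OF graded_dx]] rhom_simps[OF rhom_gpoly[OF graded_dy]] rhom_simps[OF rhom_gpoly[OF graded_dt]]
 mult_monom add_monom diff_monom minus_monom power2_eq_square numeral_eq_Suc

lemma tors_mult: "tors (idl G) b ==> tors (idl G) (c * b)"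
proof -
 assume b: "tors (idl G) b"
 have "vx i ^ N * (c * b) \<in> idl G" if "vx i ^ N * b \<in> idl G" for i N
  using ispan_scale[OF that, of c] by (simp only: mult.left_commute)
 then show ?thesis using b unfolding tors_def by blast
qed

section \<open>The torsion in each x-degree\<close>

context diag
begin

lemma hom_FG: "hdeg dx 2 FF" "hdeg dx 2 GG" "hdeg dx 1 L1" "hdeg dx 1 L2"
 "hdeg dy 0 FF" "hdeg dy 0 GG" "hdeg dy 1 L1" "hdeg dy 1 L2"
 unfolding FF_def GG_def L1_def L2_def sum_4 by (simp_all add: hdeg_simps)

lemma hom_Del: "hdeg dx 2 Del" "hdeg dy 2 Del"
 unfolding Del_def by (simp_all add: hdeg_simps)

lemma hom_mm:
 assumes "\<And>j. hdeg dx 0 (v j)" "\<And>j. hdeg dy e (v j)"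
 shows "hdeg dx 1 (mm v)" "hdeg dy (2 + e) (mm v)"
 using assms unfolding mm_def by (simp_all add: hdeg_simps)

lemma hom_rr:
 assumes "\<And>i j. hdeg dx 0 (W i j)" "\<And>i j. hdeg dy e (W i j)"
 shows "hdeg dx 0 (rr W)" "hdeg dy (2 + e) (rr W)"
 using assms unfolding rr_def by (simp_all add: hdeg_simps)

lemma hom_PP: "hdeg dt 2 (PP i j)"
 unfolding PP_def Let_def by (simp add: hdeg_simps)

lemma hom_WW: "hdeg dt 6 (WW i j)"
 unfolding WW_def by (rule hdeg_sum, rule hdeg_sum) (use hom_PP in \<open>simp add: hdeg_simps\<close>)

lemma hcomp_II: "b \<in> idl II ==> hcomp dx n b \<in> idl II"
 by (rule hcomp_idl[OF graded_dx]) (use hom_FG in auto)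

text \<open>Modulo \<open>Gf 4\<close> and \<open>Gf 3\<close> the squares of x_3 and x_4 are
  combinations of x_1^2 and x_2^2, so powers of x_1 and x_2 suffice.\<close>

lemma tors_12:
 assumes "vx 1 ^ N * b \<in> idl II" "vx 2 ^ M * b \<in> idl II"
 shows "tors (idl II) b"
proof -
 have r: "vx 1 \<in> rad II b" "vx 2 \<in> rad II b" using assms by (auto simp: rad_def)
 have "vx k \<in> rad II b" if "k \<noteq> l" "distinct [1, 2, k, l]" for k l
 proof -
  let ?c = "mc (inverse (d l k)) :: 'a poly44"
  have c1: "?c * mc (d l k) = 1" using that by (simp add: mpoly_const_mult[symmetric])
  have "vx k ^ Suc 1 = (?c * mc (d l k)) * vx k ^ 2" unfolding c1 by (simp add: power2_eq_square)
  also have "\<dots> = ?c * Gf l + (- (?c * KD l 1 * vx 1)) * vx 1 + (- (?c * KD l 2 * vx 2)) * vx 2"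
   unfolding Gf_def sum_distinct4[OF that(2)] by (simp add: power2_eq_square algebra_simps)
  also have "\<dots> \<in> rad II b"
   by (intro rad_closed(1) rad_closed(2) rad_closed(5) Gf_II r)
  finally show ?thesis by (rule rad_closed(4))
 qed
 from this[of 3 4] this[of 4 3] r have "vx i \<in> rad II b" for i
  using exhaust_4[of i] by auto
 then show ?thesis by (auto simp: tors_def rad_def)
qed

text \<open>Multiples of \<open>Del\<close> by T live in x-degree 2 only.\<close>

lemma socle_hom:
 assumes "vx 1 * b \<in> idl II" "vx 2 * b \<in> idl II" "hdeg dx n b" "n \<noteq> 2"
 shows "b \<in> idl II"
proof -
 obtain t where t: "b - emT t * Del \<in> idl II" using socle[OF assms(1,2)] by blast
 have "hdeg dx (0 + 2) (emT t * Del)" by (intro hdeg_mult graded_dx hom_Del) simp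
 then have "hcomp dx n (b - emT t * Del) = b"
  using assms(3,4) by (simp add: hcomp_diff[OF graded_dx] hcomp_hom)
 then show ?thesis using hcomp_II[OF t, of n] by simp
qed

text \<open>By induction on N + M: x_1 b and x_2 b have a smaller exponent sum and larger x-degree,
  so they lie in the ideal, and then b does by \<open>socle_hom\<close>.\<close>

lemma high_row_aux:
 "vx 1 ^ N * b \<in> idl II ==> vx 2 ^ M * b \<in> idl II ==> hdeg dx n b ==> n \<ge> 3 ==> b \<in> idl II"
proof (induction "N + M" arbitrary: N M b n rule: less_induct)
 case less
 show ?case
 proof (cases "N = 0 \<or> M = 0")
  case True
  then show ?thesis using less.prems by auto
 next
  case False
  then obtain N' M' where N: "N = Suc N'" "M = Suc M'" by (metis not0_implies_Suc)
  have h: "hdeg dx (1 + n) (vx i * b)" for i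
   by (intro hdeg_mult graded_dx less.prems hom_dx)
  have "vx 1 * b \<in> idl II"
  proof (rule less.hyps[where n = "1 + n"])
   show "N' + M < N + M" using N by simp
   show "vx 1 ^ N' * (vx 1 * b) \<in> idl II" using less.prems(1) unfolding N by (simp add: mult_ac)
   show "vx 2 ^ M * (vx 1 * b) \<in> idl II"
    using ispan_scale[OF less.prems(2), of "vx 1"] by (simp add: mult_ac)
  qed (use h[of 1] less.prems in auto)
  moreover have "vx 2 * b \<in> idl II"
  proof (rule less.hyps[where n = "1 + n"])
   show "N + M' < N + M" using N by simp
   show "vx 2 ^ M' * (vx 2 * b) \<in> idl II" using less.prems(2) unfolding N by (simp add: mult_ac)
   show "vx 1 ^ N * (vx 2 * b) \<in> idl II"
    using ispan_scale[OF less.prems(1), of "vx 2"] by (simp add: mult_ac)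
  qed (use h[of 2] less.prems in auto)
  ultimately show ?thesis using less.prems by (intro socle_hom[of b n]) auto
 qed
qed

lemma high_row: "tors (idl II) b ==> hdeg dx n b ==> n \<ge> 3 ==> b \<in> idl II"
 unfolding tors_def using high_row_aux by metis

lemma X_Del: "vx 1 * Del \<in> idl II" "vx 2 * Del \<in> idl II"
proof -
 have c: "mc (inverse (d 1 2)) * KD 1 2 = 1" by (simp add: mpoly_const_mult[symmetric])
 have "(KD 1 2 * vx 1 * Del - (A1 * Lf 1 + A2 * Lf 2)) + (A1 * Lf 1 + A2 * Lf 2) \<in> idl II"
  "(KD 1 2 * vx 2 * Del - (C1 * Lf 1 + C2 * Lf 2)) + (C1 * Lf 1 + C2 * Lf 2) \<in> idl II"
  by (intro ispan_add idl_J_II Del_koszul ispan_scale Lf_in_II)+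
 then have "mc (inverse (d 1 2)) * (KD 1 2 * vx 1 * Del) \<in> idl II"
  "mc (inverse (d 1 2)) * (KD 1 2 * vx 2 * Del) \<in> idl II"
  by (simp_all add: ispan_scale)
 then show "vx 1 * Del \<in> idl II" "vx 2 * Del \<in> idl II"
  using c by (simp_all add: mult.assoc[symmetric])
qed

lemma row2_ex:
 assumes "tors (idl II) b" "hdeg dx 2 b" shows "\<exists>t. b - emT t * Del \<in> idl II"
proof -
 have "hdeg dx (1 + 2) (vx i * b)" for i by (intro hdeg_mult graded_dx assms hom_dx)
 then have "vx i * b \<in> idl II" for i by (intro high_row[of _ "1 + 2"] tors_mult assms) auto
 then show ?thesis by (intro socle)
qed

lemma row2: "row_gens (idl II) 2 2 (\<lambda>_::unit. Del)"
 unfolding row_gens_def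
proof (intro conjI allI impI)
 show "tors (idl II) Del" using tors_12[of 1 Del 1] X_Del by simp
 show "\<exists>t. b - (\<Sum>l\<in>(UNIV :: unit set). emT (t l) * Del) \<in> idl II" if "tors (idl II) b" "hdeg dx 2 b" for b
  proof -
  from row2_ex[OF that] obtain t where "b - emT t * Del \<in> idl II" by blast
  then show ?thesis by (intro exI[of _ "\<lambda>_. t"]) (simp add: UNIV_unit)
 qed
 show "c l = 0" if "(\<Sum>l\<in>(UNIV :: unit set). mc (c l) * Del) \<in> idl II" for c l
  using that Del_free[of "mc (c ())"] by (cases l) (simp add: UNIV_unit)
qed (use hom_Del in auto)

lemma Del_coeff_eq:
 assumes "b - emT s * Del \<in> idl II" "b \<in> idl II" shows "s = 0"
 using ispan_diff[OF assms(2,1)] by (intro Del_free) simp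

definition gen1 :: "4 \<Rightarrow> 'a poly44" where "gen1 l = mm (\<lambda>j. emT (PP l j))"

lemma R_emT: "R (\<lambda>j. emT (v j)) l = emT (\<Sum>m\<in>UNIV. mc (d l m) * v m * mpv m)"
 by (simp add: R_def rhom_simps[OF rhom_emT])

lemma X_gen1: "vx j * gen1 l - emT (PP l j) * Del \<in> idl II"
 unfolding gen1_def by (rule X_mm) (simp add: R_emT PP_syz rhom_0[OF rhom_emT])

lemma X_sum_gen1:
 "vx j * (\<Sum>l\<in>UNIV. emT (t l) * gen1 l) - emT (\<Sum>l\<in>UNIV. t l * PP l j) * Del \<in> idl II"
proof -
 have "(\<Sum>l\<in>UNIV. emT (t l) * (vx j * gen1 l - emT (PP l j) * Del)) \<in> idl II"
  by (intro ispan_sum ispan_scale X_gen1)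
 then show ?thesis
  by (simp add: rhom_sum[OF rhom_emT] rhom_mult[OF rhom_emT] sum_distrib_left sum_distrib_right
    right_diff_distrib sum_subtractf mult_ac)
qed

lemma hom_gen1: "hdeg dx 1 (gen1 l)" "hdeg dy 4 (gen1 l)"
 using hom_mm[of "\<lambda>j. emT (PP l j)" 2] hom_dy_emT[OF hom_PP] unfolding gen1_def by auto

text \<open>For torsion b of x-degree 1, x_j b = v_j Del by row 2. Since \<open>Lf l\<close> times b
  is in the ideal and \<open>Del\<close> is free over T, v is a syzygy. Subtracting the matching
  combination of \<open>gen1\<close> leaves an element killed by the variables, which is zero in
  x-degree 1.\<close>

lemma row1: "row_gens (idl II) 1 4 gen1"
 unfolding row_gens_def
proof (intro conjI allI impI)
 fix l
 have "vx i ^ 2 * gen1 l \<in> idl II" if "i = 1 \<or> i = 2" for i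
 proof -
  have D: "vx i * Del \<in> idl II" using X_Del that by auto
  have "vx i * (vx i * gen1 l - emT (PP l i) * Del) + emT (PP l i) * (vx i * Del) \<in> idl II"
   by (rule ispan_add[OF ispan_scale[OF X_gen1] ispan_scale[OF D]])
  then show ?thesis by (simp add: power2_eq_square algebra_simps)
 qed
 then show "tors (idl II) (gen1 l)" by (intro tors_12[of 2 _ 2]) auto
next
 fix b assume b: "tors (idl II) b" "hdeg dx 1 b"
 have "hdeg dx (1 + 1) (vx j * b)" for j by (intro hdeg_mult graded_dx b hom_dx)
 then have "\<exists>t. vx j * b - emT t * Del \<in> idl II" for j by (intro row2_ex tors_mult b) (simp add: numeral_2_eq_2)
 then obtain v where v: "vx j * b - emT (v j) * Del \<in> idl II" for j by metis
 have "(\<Sum>m\<in>UNIV. mc (d l m) * v m * mpv m) = 0" for l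
 proof (rule Del_coeff_eq)
  show "Lf l * b \<in> idl II" using ispan_scale[OF Lf_in_II, of b] by (simp add: mult.commute)
  have "(\<Sum>m\<in>UNIV. KD l m * vy m * (vx m * b - emT (v m) * Del)) \<in> idl II"
   by (intro ispan_sum ispan_scale v)
  then show "Lf l * b - emT (\<Sum>m\<in>UNIV. mc (d l m) * v m * mpv m) * Del \<in> idl II"
   by (simp add: Lf_def rhom_sum[OF rhom_emT] rhom_mult[OF rhom_emT] sum_distrib_right sum_distrib_left
     right_diff_distrib sum_subtractf mult_ac)
 qed
 from syzygy_span[OF this] obtain t where t: "\<And>j. v j = (\<Sum>l\<in>UNIV. t l * PP l j)" by blast
 let ?b = "b - (\<Sum>l\<in>UNIV. emT (t l) * gen1 l)"
 have x: "vx j * ?b \<in> idl II" for j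
  using ispan_diff[OF v[of j, unfolded t] X_sum_gen1[of j t]] by (simp add: algebra_simps)
 have "hdeg dx (0 + 1) (emT (t l) * gen1 l)" for l by (intro hdeg_mult graded_dx hom_gen1) simp
 then have "hdeg dx 1 ?b" using b by (intro hdeg_diff hdeg_sum) auto
 from socle_hom[OF x x this] show "\<exists>t. b - (\<Sum>l\<in>UNIV. emT (t l) * gen1 l) \<in> idl II" by auto
next
 fix c l assume "(\<Sum>l\<in>UNIV. mc (c l) * gen1 l) \<in> idl II"
 then have c: "vx j * (\<Sum>l\<in>UNIV. emT (mc (c l)) * gen1 l) \<in> idl II" for j
  by (simp add: ispan_scale)
 have z: "(\<Sum>l\<in>UNIV. mc (c l) * PP l j) = 0" for j
  by (rule Del_coeff_eq[OF X_sum_gen1 c])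
 have cc: "cf z 0 (\<Sum>l\<in>UNIV. mc (c l) * PP l j) = 0" for z j
  unfolding z by (simp add: rhom_0[OF rhom_cf0])
 \<comment> \<open>In a column of the combined relation, setting the variable of one row to zero
   leaves only the term of that row.\<close>
 have "c 2 = 0" using cc[of 2 1] by (simp add: sum_4 PP_def Let_def cf0_simps d_def)
   (use nondeg[of 3 4] in simp)
 moreover have "c 3 = 0" using cc[of 3 1] by (simp add: sum_4 PP_def Let_def cf0_simps)
 moreover have "c 4 = 0" using cc[of 4 1] by (simp add: sum_4 PP_def Let_def cf0_simps)
 moreover have "c 1 = 0" using cc[of 1 2] by (simp add: sum_4 PP_def Let_def cf0_simps)
 ultimately show "c l = 0" using exhaust_4[of l] by auto
qed (use hom_gen1 in auto)

definition rho :: "'a poly44" where "rho = rr (\<lambda>i j. emT (WW i j))"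

lemma hom_rho: "hdeg dx 0 rho" "hdeg dy 8 rho"
 using hom_rr[of "\<lambda>i j. emT (WW i j)" 6] hom_dy_emT[OF hom_WW] unfolding rho_def by auto

lemma X_X_rho: "vx i * (vx j * rho) - emT (WW j i) * Del \<in> idl II"
proof -
 have R: "R (\<lambda>j. emT (WW i j)) l = 0" for i l by (simp add: R_emT WW_syz rhom_0[OF rhom_emT])
 have "(\<Sum>m\<in>UNIV. KD l m * emT (WW m m)) = emT (\<Sum>m\<in>UNIV. mc (d l m) * WW m m)" for l
  by (simp add: rhom_sum[OF rhom_emT] rhom_mult[OF rhom_emT])
 then have tr: "(\<Sum>m\<in>UNIV. KD l m * emT (WW m m)) = 0" for l by (simp add: WW_trace rhom_0[OF rhom_emT])
 have "vx j * rho - mm (\<lambda>i. emT (WW j i)) \<in> idl II"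
  unfolding rho_def by (rule X_rr[where W = "\<lambda>i j. emT (WW i j)"]) (auto simp: R tr intro: arg_cong[OF WW_sym])
 from ispan_add[OF ispan_scale[OF this, of "vx i"] X_mm[of "\<lambda>i. emT (WW j i)" i, OF R]]
 show ?thesis by (simp add: algebra_simps)
qed

text \<open>At y_1 = y_2 = 0 a single term of the double sum survives. Nonvanishing makes
  \<open>rho\<close> nonzero.\<close>

lemma WW12_nz: "WW 1 2 \<noteq> 0"
proof
 assume W: "WW 1 2 = 0"
 have "cf 1 0 (cf 2 0 (WW 1 2)) = mc (d 1 2) * (mc (d 3 4) * mpv 3 * mpv 4) ^ 3"
  unfolding WW_def sum_4 by (simp add: PP_def Let_def cf0_simps d_swap[of 2 1] rhom_minus[OF rhom_const] power3_eq_cube)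
 then show False unfolding W by (simp add: rhom_0[OF rhom_cf0])
qed

lemma prT_II: "b \<in> idl II ==> prT b = 0"
 by (induction rule: ispan_induct_alt)
  (auto simp: rhom_simps[OF rhom_prT] FF_def GG_def L1_def L2_def)

text \<open>Comparing x_i x_j b = psi Del with x_i x_j rho = WW Del and cancelling the free element
  \<open>Del\<close> gives r psi = be WW in T, where r and be represent rho and b. As
  \<open>WW\<close> has no common factor, r divides be.\<close>

lemma row0: "row_gens (idl II) 0 8 (\<lambda>_::unit. rho)"
proof -
 define r where "r = prT rho"
 have rho: "rho = emT r" using emT_prT[OF hom_rho(1)] by (simp add: r_def)
 have r: "r \<noteq> 0"
 proof
  assume "r = 0"
  then have "rho = 0" using rho by (simp add: rhom_0[OF rhom_emT])
  then have "0 - emT (WW 1 2) * Del \<in> idl II" using X_X_rho[of 2 1] by simp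
  then show False using Del_coeff_eq[OF _ ispan_zero] WW12_nz by blast
 qed
 show ?thesis
  unfolding row_gens_def
 proof (intro conjI allI impI)
  have "vx i ^ 3 * rho \<in> idl II" if "i = 1 \<or> i = 2" for i
  proof -
   have D: "vx i * Del \<in> idl II" using X_Del that by auto
   have "vx i * (vx i * (vx i * rho) - emT (WW i i) * Del) + emT (WW i i) * (vx i * Del) \<in> idl II"
    by (rule ispan_add[OF ispan_scale[OF X_X_rho] ispan_scale[OF D]])
   then show ?thesis by (simp add: power3_eq_cube algebra_simps)
  qed
  then show "tors (idl II) rho" by (intro tors_12[of 3 _ 3]) auto
 next
  fix b assume b: "tors (idl II) b" "hdeg dx 0 b"
  define be where "be = prT b"
  have be: "b = emT be" using emT_prT[OF b(2)] by (simp add: be_def)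
  have "hdeg dx (1 + (1 + 0)) (vx i * (vx j * b))" for i j
   by (intro hdeg_mult graded_dx hom_dx b)
  then have "\<exists>t. vx i * (vx j * b) - emT t * Del \<in> idl II" for i j
   by (intro row2_ex tors_mult b) (simp add: numeral_2_eq_2)
  then obtain \<psi> where psi: "vx i * (vx j * b) - emT (\<psi> i j) * Del \<in> idl II" for i j by metis
  have "r * \<psi> j i = be * WW i j" for i j
  proof -
   have "emT be * (vx j * (vx i * rho) - emT (WW i j) * Del) - emT r * (vx j * (vx i * b) - emT (\<psi> j i) * Del) \<in> idl II"
    by (intro ispan_diff ispan_scale X_X_rho psi)
   then have "emT (r * \<psi> j i - be * WW i j) * Del \<in> idl II"
    unfolding rho be by (simp add: rhom_simps[OF rhom_emT] algebra_simps)
   then show ?thesis using Del_free by fastforce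
  qed
  then obtain e where "be = e * r" using WW_proportional[OF r, of "\<lambda>i j. \<psi> j i" be] by blast
  then have "b - emT e * rho = 0" unfolding rho be by (simp add: rhom_mult[OF rhom_emT])
  then show "\<exists>t. b - (\<Sum>l\<in>(UNIV :: unit set). emT (t l) * rho) \<in> idl II"
   by (intro exI[of _ "\<lambda>_. e"]) (simp add: ispan_zero UNIV_unit)
 next
  fix c and l :: unit assume "(\<Sum>l\<in>(UNIV :: unit set). mc (c l) * rho) \<in> idl II"
  then have "prT (mc (c ()) * rho) = 0" using prT_II by (simp add: UNIV_unit)
  then show "c l = 0" using r by (cases l) (simp add: rhom_mult[OF rhom_prT] r_def)
 qed (use hom_rho in auto)
qed

theorem good_diag: "good (idl II)"
 unfolding good_def using high_row row2 row1 row0 by blast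

end

section \<open>Differentials, and the ideal that defines the symmetric algebra in B\<close>

section \<open>The ideal of the symmetric algebra\<close>

text \<open>The substitution x_i -> x_i + y_i t with t a univariate variable. Its linear coefficient
  \<open>DD\<close> is the total differential with dx_i = y_i, obtained without partial
  derivatives.\<close>

definition EE :: "'a::comm_ring_1 poly4 \<Rightarrow> 'a poly44 poly" where
 "EE = ev (\<lambda>c. [:mc c:]) (\<lambda>i. [:vx i, vy i:])"
definition emS :: "'a::comm_ring_1 poly4 \<Rightarrow> 'a poly44" where "emS = ev mc (\<lambda>i. vx i)"
definition DD :: "'a::comm_ring_1 poly4 \<Rightarrow> 'a poly44" where "DD p = pco (EE p) 1"

abbreviation IB :: "'a::comm_ring_1 poly4 \<Rightarrow> 'a poly4 \<Rightarrow> 'a poly44 set" where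
 "IB f g \<equiv> {emS f, emS g, DD f, DD g}"

lemma rhom_EE: "rhom EE" unfolding EE_def by (rule rhom_ev[OF rhom_zconst])
lemma EE_const: "EE (mc c) = [:mc c:]" and EE_var: "EE (mpv i) = [:vx i, vy i:]"
 unfolding EE_def by (simp_all add: ev_const[OF rhom_zconst] ev_var[OF rhom_zconst])
lemma rhom_emS: "rhom emS" unfolding emS_def by (rule rhom_ev[OF rhom_const])
lemma emS_const [simp]: "emS (mc c) = mc c"
 and emS_var [simp]: "emS (mpv i) = vx i"
 unfolding emS_def by (simp_all add: ev_const[OF rhom_const] ev_var[OF rhom_const])

lemma rhom_coeff0: "rhom (\<lambda>p. pco p 0)"
 by (rule rhomI) (simp_all add: coeff_mult_0)

lemma coeff0_EE: "pco (EE p) 0 = emS p"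
 by (rule mpoly_hom_unique[OF rhom_comp[OF rhom_EE rhom_coeff0] rhom_emS]) (simp_all add: EE_const EE_var)

lemma DD_const [simp]: "DD (mc c) = 0" and DD_var [simp]: "DD (mpv i) = vy i"
 by (simp_all add: DD_def EE_const EE_var)

lemma DD_add: "DD (p + q) = DD p + DD q" and DD_diff: "DD (p - q) = DD p - DD q"
 and DD_minus: "DD (- p) = - DD p" and DD_0: "DD 0 = 0" and DD_sum: "DD (sum h A) = (\<Sum>a\<in>A. DD (h a))"
 by (simp_all add: DD_def rhom_simps[OF rhom_EE] coeff_sum)

lemma DD_mult: "DD (p * q) = emS p * DD q + emS q * DD p"
 by (simp add: DD_def rhom_mult[OF rhom_EE] coeff_mult atMost_Suc coeff0_EE mult.commute add.commute)

lemma zfree_emS [simp]: "zfree (Inr z) (emS p)"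
 by (induction p rule: mpoly_induct) (simp_all add: rhom_simps[OF rhom_emS])

lemma hom_emS_DD:
 assumes "hdeg dt n p"
 shows "hdeg dx n (emS p)" "hdeg dy 0 (emS p)" "hdeg dy 1 (DD p)"
proof -
 have y0: "hdeg dy 0 (emS p)" for p :: "'a poly4"
 proof (induction p rule: mpoly_induct)
  case (add p q) then show ?case by (simp add: rhom_add[OF rhom_emS] hdeg_add)
 next
  case (mult p q) then show ?case using hdeg_mult[OF graded_dy, of 0 "emS p" 0 "emS q"] by (simp add: rhom_mult[OF rhom_emS])
 qed simp_all
 show "hdeg dy 0 (emS p)" by (rule y0)
 show "hdeg dy 1 (DD p)"
 proof (induction p rule: mpoly_induct)
  case (add p q) then show ?case by (simp add: DD_add hdeg_add)
 next
  case (mult p q)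
  show ?case unfolding DD_mult
   using hdeg_mult[OF graded_dy y0[of p] mult(2)] hdeg_mult[OF graded_dy y0[of q] mult(1)] by (auto intro: hdeg_add)
 qed (simp_all add: hom_dy(2)[simplified])
 have "hdeg dx n (emS (pms m (pml p m)))" if "m \<in> pmk p" for m
 proof -
  have "hdeg dx (0 + 1 * (\<Sum>i\<in>UNIV. pml m i))
    (mc (pml p m) * (\<Prod>i\<in>UNIV. vx i ^ pml m i))"
   by (intro hdeg_mult graded_dx hdeg_prod_power hom_dx finite)
  then show ?thesis using assms that
   unfolding single_eq_prod by (simp add: rhom_simps[OF rhom_emS] hdeg_def dt_def)
 qed
 then have "hdeg dx n (emS (\<Sum>m\<in>pmk p. pms m (pml p m)))"
  unfolding rhom_sum[OF rhom_emS] by (rule hdeg_sum)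
 then show "hdeg dx n (emS p)" by (simp add: poly_mapping_eq_sum)
qed

lemma idl_unit_insert:
 fixes a :: "('i, 'a::field) mpoly"
 assumes "c \<noteq> 0" shows "idl (insert (mc c * a) G) = idl (insert a G)"
proof (rule idl_eqI)
 show "insert (mc c * a) G \<subseteq> idl (insert a G)" by (auto intro: ispan_base ispan_scale)
 have "mc (inverse c) * (mc c * a) \<in> idl (insert (mc c * a) G)"
  by (intro ispan_scale ispan_base) simp
 moreover have "mc (inverse c) * (mc c * a) = a"
  using assms by (simp add: mult.assoc[symmetric] mpoly_const_mult[symmetric])
 ultimately show "insert a G \<subseteq> idl (insert (mc c * a) G)" by (auto intro: ispan_base)
qed

context diag
begin

abbreviation "fd \<equiv> (\<Sum>i\<in>UNIV. mc (p i) * mpv i ^ 2) :: 'a poly4"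
abbreviation "gd \<equiv> (\<Sum>i\<in>UNIV. mc (q i) * mpv i ^ 2) :: 'a poly4"

lemma emS_fd: "emS fd = FF" "emS gd = GG"
 by (simp_all add: FF_def GG_def rhom_simps[OF rhom_emS])

text \<open>Differentiating the squares gives 2 L1 and 2 L2, and 2 is a unit.\<close>

lemma idl_IB_diag: "idl (IB fd gd) = idl II"
proof -
 have c2: "mc 2 = (2 :: 'a poly44)" by (rule rhom_numeral[OF rhom_const])
 have "DD (mc (r i) * mpv i ^ 2) = mc 2 * (mc (r i) * vx i * vy i :: 'a poly44)" for r :: "4 \<Rightarrow> 'a" and i
  unfolding c2 by (simp add: power2_eq_square DD_mult rhom_mult[OF rhom_emS] algebra_simps)
 then have D: "DD fd = mc 2 * L1" "DD gd = mc 2 * L2"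
  unfolding DD_sum L1_def L2_def by (simp_all add: sum_distrib_left)
 have "idl {FF, GG, mc 2 * L1, mc 2 * L2} = idl (insert (mc 2 * L1) (insert (mc 2 * L2) J))"
  by (simp add: insert_commute)
 also have "\<dots> = idl (insert L1 (insert (mc 2 * L2) J))" by (rule idl_unit_insert) simp
 also have "\<dots> = idl (insert (mc 2 * L2) (insert L1 J))" by (simp add: insert_commute)
 also have "\<dots> = idl (insert L2 (insert L1 J))" by (rule idl_unit_insert) simp
 finally show ?thesis unfolding emS_fd D by (simp add: insert_commute)
qed

end

section \<open>Invariance under linear substitutions acting alike on the x and the y\<close>

section \<open>Linear changes of coordinates\<close>

definition lin :: "(4 \<Rightarrow> 4 \<Rightarrow> 'a::comm_ring_1) \<Rightarrow> 'a poly4 \<Rightarrow> 'a poly4" where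
 "lin V = ev mc (\<lambda>i. \<Sum>j\<in>UNIV. mc (V i j) * mpv j)"
definition linB :: "(4 \<Rightarrow> 4 \<Rightarrow> 'a::comm_ring_1) \<Rightarrow> 'a poly44 \<Rightarrow> 'a poly44" where
 "linB V = ev mc (case_sum (\<lambda>i. \<Sum>j\<in>UNIV. mc (V i j) * vx j) (\<lambda>i. \<Sum>j\<in>UNIV. mc (V i j) * vy j))"

definition inverses :: "(4 \<Rightarrow> 4 \<Rightarrow> 'a::comm_ring_1) \<Rightarrow> (4 \<Rightarrow> 4 \<Rightarrow> 'a) \<Rightarrow> bool" where
 "inverses V W \<longleftrightarrow> (\<forall>i k. (\<Sum>j\<in>UNIV. V i j * W j k) = (if i = k then 1 else 0)) \<and>
  (\<forall>i k. (\<Sum>j\<in>UNIV. W i j * V j k) = (if i = k then 1 else 0))"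

lemma inverses_sym: "inverses V W \<longleftrightarrow> inverses W V"
 by (auto simp: inverses_def)

lemma rhom_lin: "rhom (lin V)" unfolding lin_def by (rule rhom_ev[OF rhom_const])
lemma rhom_linB: "rhom (linB V)" unfolding linB_def by (rule rhom_ev[OF rhom_const])
lemma lin_simps [simp]: "lin V (mc c) = mc c"
  "lin V (mpv i) = (\<Sum>j\<in>UNIV. mc (V i j) * mpv j)"
 and linB_simps [simp]: "linB V (mc c) = mc c"
  "linB V (vx i) = (\<Sum>j\<in>UNIV. mc (V i j) * vx j)"
  "linB V (vy i) = (\<Sum>j\<in>UNIV. mc (V i j) * vy j)"
 unfolding lin_def linB_def by (simp_all add: ev_const[OF rhom_const] ev_var[OF rhom_const])

lemma inverse_sum:
 assumes "inverses V W"
 shows "(\<Sum>j\<in>UNIV. mc (W i j) * (\<Sum>k\<in>UNIV. mc (V j k) * x k)) = x i"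
proof -
 have "(\<Sum>j\<in>UNIV. mc (W i j) * (\<Sum>k\<in>UNIV. mc (V j k) * x k)) =
   (\<Sum>k\<in>UNIV. \<Sum>j\<in>UNIV. mc (W i j) * mc (V j k) * x k)"
  by (subst sum.swap) (simp add: sum_distrib_left mult.assoc)
 also have "\<dots> = (\<Sum>k\<in>UNIV. mc (\<Sum>j\<in>UNIV. W i j * V j k) * x k)"
  by (simp add: rhom_sum[OF rhom_const] sum_distrib_right mpoly_const_mult)
 also have "\<dots> = (\<Sum>k\<in>UNIV. if k = i then x i else 0)"
  using assms by (intro sum.cong) (auto simp: inverses_def)
 finally show ?thesis by simp
qed

lemma lin_lin: "inverses V W ==> lin V (lin W p) = p"
 by (rule mpoly_hom_unique[OF rhom_comp[OF rhom_lin rhom_lin] rhom_id])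
  (simp_all add: rhom_simps[OF rhom_lin] inverse_sum)

lemma linB_linB: "inverses V W ==> linB V (linB W p) = p"
proof (rule mpoly_hom_unique[OF rhom_comp[OF rhom_linB rhom_linB] rhom_id])
 fix i assume VW: "inverses V W"
 show "linB V (linB W (mpv i)) = mpv i"
  by (cases i) (simp_all add: rhom_sum[OF rhom_linB] rhom_mult[OF rhom_linB] inverse_sum[OF VW, where x = vx]
   inverse_sum[OF VW, where x = vy])
qed simp

lemma linB_emS: "linB V (emS p) = emS (lin V p)"
 by (rule mpoly_hom_unique[OF rhom_comp[OF rhom_emS rhom_linB] rhom_comp[OF rhom_lin rhom_emS]])
  (simp_all add: rhom_simps[OF rhom_emS])

lemma linB_emT: "linB V (emT p) = emT (lin V p)"
 by (rule mpoly_hom_unique[OF rhom_comp[OF rhom_emT rhom_linB] rhom_comp[OF rhom_lin rhom_emT]])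
  (simp_all add: rhom_simps[OF rhom_emT])

lemma rhom_map_poly: assumes "rhom h" shows "rhom (map_poly h)"
proof (rule rhomI)
 have h0: "h 0 = 0" by (rule rhom_0[OF assms])
 show "map_poly h 1 = 1" by (simp add: map_poly_1' rhom_1[OF assms])
 show "map_poly h (p + q) = map_poly h p + map_poly h q" for p q
  by (rule poly_eqI) (simp add: coeff_map_poly h0 rhom_add[OF assms])
 show "map_poly h (p * q) = map_poly h p * map_poly h q" for p q
  by (rule poly_eqI) (simp add: coeff_map_poly h0 coeff_mult rhom_sum[OF assms] rhom_mult[OF assms])
qed

text \<open>The chain rule, read off from the fact that the substitution commutes with
  \<open>EE\<close>.\<close>

lemma linB_DD: "linB V (DD p) = DD (lin V p)"
proof -
 have "map_poly (linB V) (EE p) = EE (lin V p)"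
 proof (rule mpoly_hom_unique[OF rhom_comp[OF rhom_EE rhom_map_poly[OF rhom_linB]] rhom_comp[OF rhom_lin rhom_EE]])
  show "map_poly (linB V) (EE (mc c)) = EE (lin V (mc c))" for c
   by (simp add: EE_const map_poly_pCons rhom_0[OF rhom_linB])
  show "map_poly (linB V) (EE (mpv i)) = EE (lin V (mpv i))" for i
   by (rule poly_eqI) (simp add: EE_const EE_var map_poly_pCons rhom_0[OF rhom_linB] rhom_simps[OF rhom_EE]
     coeff_sum coeff_pCons mult.commute split: nat.splits)
 qed
 from arg_cong[OF this, of "\<lambda>p. pco p 1"] show ?thesis
  by (simp add: DD_def coeff_map_poly rhom_0[OF rhom_linB])
qed

lemma linB_IB: "b \<in> idl (IB f g) ==> linB V b \<in> idl (IB (lin V f) (lin V g))"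
 by (erule idl_image[OF rhom_linB, rotated]) (auto simp: linB_emS linB_DD intro: ispan_base)

lemma hom_linB_x: "hdeg dx n b ==> hdeg dx n (linB V b)"
  and hom_linB_y: "hdeg dy n b ==> hdeg dy n (linB V b)"
proof -
 have m: "map_poly (linB V) (Polynomial.monom a k) = Polynomial.monom (linB V a) k" for a k
  by (simp add: map_poly_monom rhom_0[OF rhom_linB])
 have ms: "(\<Sum>j\<in>A. Polynomial.monom (a j) k) = Polynomial.monom (\<Sum>j\<in>A. a j) k" for a k and A :: "4 set"
  by (rule poly_eqI) (simp add: coeff_sum)
 have "gpoly dx (linB V b) = map_poly (linB V) (gpoly dx b)"
 proof (rule mpoly_hom_unique[OF rhom_comp[OF rhom_linB rhom_gpoly[OF graded_dx]]
    rhom_comp[OF rhom_gpoly[OF graded_dx] rhom_map_poly[OF rhom_linB]]])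
  fix i show "gpoly dx (linB V (mpv i)) = map_poly (linB V) (gpoly dx (mpv i))"
   by (cases i) (simp_all add: m ms hdeg_simps)
 qed (simp add: m hdeg_simps)
 then show "hdeg dx n b ==> hdeg dx n (linB V b)"
  unfolding hdeg_iff_gpoly by (simp add: m)
 have "gpoly dy (linB V b) = map_poly (linB V) (gpoly dy b)"
 proof (rule mpoly_hom_unique[OF rhom_comp[OF rhom_linB rhom_gpoly[OF graded_dy]]
    rhom_comp[OF rhom_gpoly[OF graded_dy] rhom_map_poly[OF rhom_linB]]])
  fix i show "gpoly dy (linB V (mpv i)) = map_poly (linB V) (gpoly dy (mpv i))"
   by (cases i) (simp_all add: m ms hdeg_simps)
 qed (simp add: m hdeg_simps)
 then show "hdeg dy n b ==> hdeg dy n (linB V b)"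
  unfolding hdeg_iff_gpoly by (simp add: m)
qed

text \<open>Each x_i is a linear combination of the substituted variables, and radicals of
  annihilators are closed under linear combinations.\<close>

lemma tors_linB:
 assumes VW: "inverses V W" and b: "tors (idl (IB f g)) b"
 shows "tors (idl (IB (lin V f) (lin V g))) (linB V b)"
proof -
 let ?G = "IB (lin V f) (lin V g)"
 have x: "linB V (vx i) \<in> rad ?G (linB V b)" for i
 proof -
  obtain N where "vx i ^ N * b \<in> idl (IB f g)" using b by (auto simp: tors_def)
  from linB_IB[OF this, of V] show ?thesis
   unfolding rad_def by (auto simp: rhom_mult[OF rhom_linB] rhom_power[OF rhom_linB])
 qed
 have "vx i \<in> rad ?G (linB V b)" for i
 proof -
  have "(\<Sum>j\<in>UNIV. mc (W i j) * linB V (vx j)) \<in> rad ?G (linB V b)"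
   by (intro rad_sum rad_closed(2) x)
  moreover have "(\<Sum>j\<in>UNIV. mc (W i j) * linB V (vx j)) = vx i"
   using inverse_sum[OF VW, of i vx] by simp
  ultimately show ?thesis by (simp only:)
 qed
 then show ?thesis by (auto simp: tors_def rad_def)
qed

lemma row_gens_linB:
 assumes VW: "inverses V W" and a: "row_gens (idl (IB (lin V f) (lin V g))) i j a"
 shows "row_gens (idl (IB f g)) i j (\<lambda>l. linB W (a l))"
proof -
 have WV: "inverses W V" using VW by (simp add: inverses_sym)
 have fg: "lin W (lin V f) = f" "lin W (lin V g) = g" by (simp_all add: lin_lin[OF WV])
 show ?thesis
  unfolding row_gens_def
 proof (intro conjI allI impI)
  fix l
  show "hdeg dx i (linB W (a l))" "hdeg dy j (linB W (a l))"
   using a by (auto simp: row_gens_def intro: hom_linB_x hom_linB_y)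
  show "tors (idl (IB f g)) (linB W (a l))"
   using tors_linB[OF WV, of "lin V f" "lin V g" "a l"] a fg by (simp add: row_gens_def)
 next
  fix b assume b: "tors (idl (IB f g)) b" "hdeg dx i b"
  obtain t where "linB V b - (\<Sum>l\<in>UNIV. emT (t l) * a l) \<in> idl (IB (lin V f) (lin V g))"
   using a tors_linB[OF VW b(1)] hom_linB_x[OF b(2)] unfolding row_gens_def by blast
  from linB_IB[OF this, of W]
  have "b - (\<Sum>l\<in>UNIV. emT (lin W (t l)) * linB W (a l)) \<in> idl (IB f g)"
   by (simp add: rhom_diff[OF rhom_linB] rhom_sum[OF rhom_linB] rhom_mult[OF rhom_linB] linB_linB[OF WV] linB_emT fg)
  then show "\<exists>t. b - (\<Sum>l\<in>UNIV. emT (t l) * linB W (a l)) \<in> idl (IB f g)"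
   by (rule exI[of _ "\<lambda>l. lin W (t l)"])
 next
  fix c l assume "(\<Sum>l\<in>UNIV. mc (c l) * linB W (a l)) \<in> idl (IB f g)"
  from linB_IB[OF this, of V] have "(\<Sum>l\<in>UNIV. mc (c l) * a l) \<in> idl (IB (lin V f) (lin V g))"
   by (simp add: rhom_sum[OF rhom_linB] rhom_mult[OF rhom_linB] linB_linB[OF VW])
  then show "c l = 0" using a by (simp add: row_gens_def)
 qed
qed

lemma good_linB:
 assumes VW: "inverses V W" and g: "good (idl (IB (lin V f) (lin V g)))"
 shows "good (idl (IB f g))"
proof -
 have WV: "inverses W V" using VW by (simp add: inverses_sym)
 have fg: "lin W (lin V f) = f" "lin W (lin V g) = g" by (simp_all add: lin_lin[OF WV])
 have "b \<in> idl (IB f g)" if b: "tors (idl (IB f g)) b" "hdeg dx n b" "n \<ge> 3" for b n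
 proof -
  have "linB V b \<in> idl (IB (lin V f) (lin V g))"
   using g tors_linB[OF VW b(1)] hom_linB_x[OF b(2)] b(3) unfolding good_def by blast
  from linB_IB[OF this, of W] show ?thesis by (simp add: linB_linB[OF WV] fg)
 qed
 moreover have "\<exists>a :: 'n::finite \<Rightarrow> _. row_gens (idl (IB f g)) i j a"
  if "\<exists>a :: 'n \<Rightarrow> _. row_gens (idl (IB (lin V f) (lin V g))) i j a" for i j
  using that row_gens_linB[OF VW] by blast
 ultimately show ?thesis using g row_gens_linB[OF VW] unfolding good_def by meson
qed

section \<open>Descent from the algebraic closure to k\<close>

section \<open>Extension of the base field\<close>

lemma vector_space_alg_closure:
 "vector_space (\<lambda>(c::'k::field) (x::'k alg_closure). to_ac c * x)"
 by unfold_locales (simp_all add: algebra_simps)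

text \<open>Coordinates with respect to a k-basis of the closure that contains 1; the last condition
  makes the coordinate at 1 a retraction onto k.\<close>

lemma ex_coordinates:
 "\<exists>C :: 'k::field alg_closure \<Rightarrow> 'k alg_closure \<Rightarrow> 'k.
  (\<forall>e x y. C e (x + y) = C e x + C e y) \<and> (\<forall>e c x. C e (to_ac c * x) = c * C e x) \<and>
  (\<forall>x. finite {e. C e x \<noteq> 0}) \<and> (\<forall>x. (\<Sum>e | C e x \<noteq> 0. to_ac (C e x) * e) = x) \<and> C 1 1 = 1"
proof -
 interpret V: vector_space "\<lambda>(c::'k) (x::'k alg_closure). to_ac c * x" by (rule vector_space_alg_closure)
 have ind: "V.independent {1}" by simp
 define B where "B = V.extend_basis {1}"
 have B: "V.independent B" "V.span B = UNIV" "1 \<in> B"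
  using V.independent_extend_basis[OF ind] V.span_extend_basis[OF ind] V.extend_basis_superset[OF ind]
  by (auto simp: B_def)
 define C where "C e x = V.representation B x e" for e x
 show ?thesis
 proof (intro exI[of _ C] conjI allI)
  show "C e (x + y) = C e x + C e y" for e x y
   unfolding C_def using V.representation_add[OF B(1), of y x] B(2) by simp
  show "C e (to_ac c * x) = c * C e x" for e c x
   unfolding C_def using V.representation_scale[OF B(1), of x c] B(2) by simp
  show "finite {e. C e x \<noteq> 0}" for x
   unfolding C_def by (rule V.finite_representation)
  show "(\<Sum>e | C e x \<noteq> 0. to_ac (C e x) * e) = x" for x
   unfolding C_def using V.sum_nonzero_representation_eq[OF B(1), of x] B(2) by simp
  show "C 1 1 = 1"
   unfolding C_def using V.representation_basis[OF B(1,3)] by simp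
 qed
qed

definition coord :: "'k::field alg_closure \<Rightarrow> 'k alg_closure \<Rightarrow> 'k" where
 "coord = (SOME C. (\<forall>e x y. C e (x + y) = C e x + C e y) \<and> (\<forall>e c x. C e (to_ac c * x) = c * C e x) \<and>
  (\<forall>x. finite {e. C e x \<noteq> 0}) \<and> (\<forall>x. (\<Sum>e | C e x \<noteq> 0. to_ac (C e x) * e) = x) \<and> C 1 1 = 1)"

lemma coord_add: "coord e (x + y) = coord e x + coord e y"
 and coord_scale: "coord e (to_ac c * x) = c * coord e x"
 and finite_coord: "finite {e. coord e x \<noteq> 0}"
 and sum_coord: "(\<Sum>e | coord e x \<noteq> 0. to_ac (coord e x) * e) = x"
 and coord_1_1: "coord 1 1 = 1"
 using someI_ex[OF ex_coordinates] unfolding coord_def[symmetric] by blast+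

lemma coord_0 [simp]: "coord e 0 = 0"
 using coord_scale[of e 0 0] by simp

text \<open>\<open>embL\<close> extends scalars, and \<open>cpart e\<close> takes the e-th
  coordinate of every coefficient. The latter is linear over polynomials with coefficients in k
  (\<open>cpart_mult\<close>), so ideals, torsion and nonzerodivisors pass in both
  directions.\<close>

definition embL :: "('m \<Rightarrow>\<^sub>0 'k::field) \<Rightarrow> ('m \<Rightarrow>\<^sub>0 'k alg_closure)" where
 "embL = Poly_Mapping.map to_ac"
definition cpart :: "'k::field alg_closure \<Rightarrow> ('m \<Rightarrow>\<^sub>0 'k alg_closure) \<Rightarrow> ('m \<Rightarrow>\<^sub>0 'k)" where
 "cpart e = Poly_Mapping.map (coord e)"

lemma lookup_embL: "pml (embL p) m = to_ac (pml p m)"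
 and lookup_cpart: "pml (cpart e q) m = coord e (pml q m)"
 unfolding embL_def cpart_def by (simp_all add: map.rep_eq when_def)

lemma embL_add: "embL (p + q) = embL p + embL q" and embL_0 [simp]: "embL 0 = 0"
 and cpart_add: "cpart e (r + s) = cpart e r + cpart e s" and cpart_0 [simp]: "cpart e 0 = 0"
 and embL_single: "embL (pms m c) = pms m (to_ac c)"
 and cpart_single: "cpart e (pms m x) = pms m (coord e x)"
 by (rule poly_mapping_eqI; simp add: lookup_embL lookup_cpart lookup_add coord_add lookup_single when_def)+

lemma cpart_diff: "cpart e (r - s) = cpart e r - cpart e s" for r :: "'m \<Rightarrow>\<^sub>0 'k::field alg_closure"
 using cpart_add[of e "r - s" s] by simp

lemma embL_sum: "embL (sum f A) = (\<Sum>a\<in>A. embL (f a))"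
 by (induction A rule: infinite_finite_induct) (simp_all add: embL_add)

lemma cpart_sum: "cpart e (sum f A) = (\<Sum>a\<in>A. cpart e (f a))"
 by (induction A rule: infinite_finite_induct) (simp_all add: cpart_add)

lemma cpart_mult: "cpart e (embL p * q) = p * cpart e q"
 for p :: "'m::comm_monoid_add \<Rightarrow>\<^sub>0 'k::field"
proof -
 have "cpart e (embL (\<Sum>a\<in>pmk p. pms a (pml p a)) *
   (\<Sum>b\<in>pmk q. pms b (pml q b))) =
  (\<Sum>a\<in>pmk p. pms a (pml p a)) *
   cpart e (\<Sum>b\<in>pmk q. pms b (pml q b))"
  by (simp only: sum_product embL_sum cpart_sum embL_single cpart_single mult_single coord_scale)
 then show ?thesis by (simp only: poly_mapping_eq_sum)
qed

lemma rhom_embL: "rhom (embL :: ('m::comm_monoid_add \<Rightarrow>\<^sub>0 'k::field) \<Rightarrow> _)"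
proof (rule rhomI)
 show "embL (1 :: 'm \<Rightarrow>\<^sub>0 'k) = 1" using embL_single[of "0 :: 'm" "1 :: 'k"] by simp
 show "embL (p * q) = embL p * embL q" for p q :: "'m \<Rightarrow>\<^sub>0 'k"
 proof -
  have "embL ((\<Sum>a\<in>pmk p. pms a (pml p a)) *
    (\<Sum>b\<in>pmk q. pms b (pml q b))) =
   embL (\<Sum>a\<in>pmk p. pms a (pml p a)) *
    embL (\<Sum>b\<in>pmk q. pms b (pml q b))"
   by (simp only: sum_product embL_sum embL_single mult_single to_ac_mult)
  then show ?thesis by (simp only: poly_mapping_eq_sum)
 qed
qed (rule embL_add)

lemma embL_const [simp]: "embL (mc c) = mc (to_ac c)"
 and embL_var [simp]: "embL (mpv i) = mpv i"
 by (simp_all add: mpoly_const_def mpoly_var_def embL_single)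

lemma cpart_embL: "cpart 1 (embL p) = p" for p :: "'m::comm_monoid_add \<Rightarrow>\<^sub>0 'k::field"
proof -
 have "cpart 1 (1 :: 'm \<Rightarrow>\<^sub>0 'k alg_closure) = 1"
  using cpart_single[of 1 "0 :: 'm" "1 :: 'k alg_closure"] unfolding coord_1_1 single_one .
 then show ?thesis using cpart_mult[of 1 p 1] by simp
qed

lemma cpart_expand:
 fixes q :: "('i \<Rightarrow>\<^sub>0 nat) \<Rightarrow>\<^sub>0 'k::field alg_closure"
 shows "\<exists>E. finite E \<and> q = (\<Sum>e\<in>E. mc e * embL (cpart e q))"
proof -
 define E where "E = (\<Union>m\<in>pmk q. {e. coord e (pml q m) \<noteq> 0})"
 have fin: "finite E" unfolding E_def by (intro finite_UN_I finite_coord) simp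
 have "pml q m = pml (\<Sum>e\<in>E. mc e * embL (cpart e q)) m" for m
 proof -
  have l: "pml (mc e * embL (cpart e q)) m = to_ac (coord e (pml q m)) * e" for e
   unfolding mpoly_const_def by (simp add: lookup_embL lookup_cpart flip: mult_map_scale_conv_mult)
    (simp add: lookup_embL lookup_cpart map.rep_eq when_def mult.commute)
  have sub: "{e. coord e (pml q m) \<noteq> 0} \<subseteq> E"
   unfolding E_def by (cases "m \<in> pmk q") (auto simp: in_keys_iff)
  have "(\<Sum>e\<in>E. to_ac (coord e (pml q m)) * e) = pml q m"
   using sum.mono_neutral_right[OF fin sub, of "\<lambda>e. to_ac (coord e (pml q m)) * e"] sum_coord
   by auto
  then show ?thesis by (simp add: lookup_sum l)
 qed
 then have "q = (\<Sum>e\<in>E. mc e * embL (cpart e q))" by (rule poly_mapping_eqI)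
 then show ?thesis using fin by blast
qed

lemma keys_embL: "pmk (embL p) = pmk p"
 and keys_cpart: "pmk (cpart e q) \<subseteq> pmk q"
 by (auto simp: in_keys_iff lookup_embL lookup_cpart)

lemma hdeg_embL [simp]: "hdeg \<delta> n (embL p) \<longleftrightarrow> hdeg \<delta> n p"
 and hdeg_cpart: "hdeg \<delta> n q ==> hdeg \<delta> n (cpart e q)"
 using keys_cpart[of e q] by (auto simp: hdeg_def keys_embL)

lemma cpart_idl:
 fixes G :: "('m::comm_monoid_add \<Rightarrow>\<^sub>0 'k::field) set"
 assumes "q \<in> idl (embL ` G)" shows "cpart e q \<in> idl G"
 using assms
proof (induction rule: ispan_induct_alt)
 case base
 then show ?case by (simp add: ispan_zero)
next
 case (step c x y)
 then obtain g where g: "g \<in> G" "x = embL g" by blast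
 have "cpart e (c * x) = cpart e c * g" using cpart_mult[of e g c] by (simp add: g mult.commute)
 then show ?case using step g by (simp add: cpart_add ispan_add ispan_scale ispan_base)
qed

lemma embL_idl: "embL b \<in> idl (embL ` G) \<longleftrightarrow> b \<in> idl G" for b :: "'m::comm_monoid_add \<Rightarrow>\<^sub>0 'k::field"
 using cpart_idl[of "embL b" G 1] idl_image[OF rhom_embL, of G "embL ` G" b]
 by (auto simp: cpart_embL intro: ispan_base)

lemma idl_embLI:
 fixes q :: "('i \<Rightarrow>\<^sub>0 nat) \<Rightarrow>\<^sub>0 'k::field alg_closure"
 assumes "\<And>e. cpart e q \<in> idl G" shows "q \<in> idl (embL ` G)"
proof -
 obtain E where "q = (\<Sum>e\<in>E. mc e * embL (cpart e q))" using cpart_expand by blast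
 moreover have "(\<Sum>e\<in>E. mc e * embL (cpart e q)) \<in> idl (embL ` G)"
  by (intro ispan_sum ispan_scale) (simp add: embL_idl assms)
 ultimately show ?thesis by simp
qed

lemma nzd_embL:
 fixes r :: "('i \<Rightarrow>\<^sub>0 nat) \<Rightarrow>\<^sub>0 'k::field"
 shows "nzd (embL r) (idl (embL ` G)) \<longleftrightarrow> nzd r (idl G)"
proof
 assume n: "nzd (embL r) (idl (embL ` G))"
 show "nzd r (idl G)" unfolding nzd_def
 proof (intro allI impI)
  fix b assume "r * b \<in> idl G"
  then have "embL r * embL b \<in> idl (embL ` G)" using embL_idl[of "r * b" G] by (simp add: rhom_mult[OF rhom_embL])
  then show "b \<in> idl G" using n embL_idl by (auto simp: nzd_def)
 qed
next
 assume n: "nzd r (idl G)"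
 show "nzd (embL r) (idl (embL ` G))" unfolding nzd_def
 proof (intro allI impI)
  fix b assume "embL r * b \<in> idl (embL ` G)"
  then have "r * cpart e b \<in> idl G" for e using cpart_idl[of "embL r * b" G e] by (simp add: cpart_mult)
  then show "b \<in> idl (embL ` G)" using n by (intro idl_embLI) (auto simp: nzd_def)
 qed
qed

lemma embL_emT: "embL (emT t) = emT (embL t)"
 by (rule mpoly_hom_unique[OF rhom_comp[OF rhom_emT rhom_embL] rhom_comp[OF rhom_embL rhom_emT]]) simp_all

lemma embL_emS: "embL (emS t) = emS (embL t)"
 by (rule mpoly_hom_unique[OF rhom_comp[OF rhom_emS rhom_embL] rhom_comp[OF rhom_embL rhom_emS]]) simp_all

lemma embL_DD: "embL (DD t) = DD (embL t)"
proof (induction t rule: mpoly_induct)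
 case (mult p q)
 then show ?case by (simp add: DD_mult rhom_simps[OF rhom_embL] embL_emS)
qed (simp_all add: DD_add embL_add)

lemma embL_IB: "embL ` IB f g = IB (embL f) (embL g)"
 by (simp add: embL_emS embL_DD)

lemma cpart_emT: "cpart e (emT t) = emT (cpart e t)"
proof -
 obtain E where E: "finite E" "t = (\<Sum>e\<in>E. mc e * embL (cpart e t))" using cpart_expand by blast
 have c: "cpart e (mc x) = mc (coord e x)" for x
  unfolding mpoly_const_def by (rule cpart_single)
 have "cpart e (emT (mc x * embL s)) = emT (cpart e (mc x * embL s))" for x s
  unfolding rhom_mult[OF rhom_emT] embL_emT[symmetric] emT_const mult.commute[of "mc x"] cpart_mult c by simp
 then have "cpart e (emT (\<Sum>e\<in>E. mc e * embL (cpart e t))) = emT (cpart e (\<Sum>e\<in>E. mc e * embL (cpart e t)))"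
  by (simp add: rhom_sum[OF rhom_emT] cpart_sum)
 then show ?thesis using E(2) by simp
qed

lemma cpart_emT_mult: "cpart e (emT t * embL b) = emT (cpart e t) * b"
 unfolding mult.commute[of "emT t"] cpart_mult cpart_emT by (rule mult.commute)

lemma tors_embL: "tors (idl (embL ` G)) (embL b) \<longleftrightarrow> tors (idl G) b"
proof -
 have "embL (vx i ^ N * b) = vx i ^ N * embL b" for i N
  by (simp add: rhom_mult[OF rhom_embL] rhom_power[OF rhom_embL])
 then show ?thesis unfolding tors_def by (metis embL_idl)
qed

lemma tors_cpart: "tors (idl (embL ` G)) q ==> tors (idl G) (cpart e q)"
proof -
 assume q: "tors (idl (embL ` G)) q"
 have "vx i ^ N * cpart e q = cpart e (vx i ^ N * q)" for i N
  using cpart_mult[of e "vx i ^ N" q] by (simp add: rhom_power[OF rhom_embL])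
 then show ?thesis using q cpart_idl unfolding tors_def by metis
qed

lemma bidegree0_const: assumes "hdeg dx 0 b" "hdeg dy 0 b" shows "\<exists>c. b = mc c"
proof -
 have "m = 0" if "m \<in> pmk b" for m
 proof (rule poly_mapping_eqI)
  fix k show "pml m k = pml 0 k"
   using assms that by (cases k) (auto simp: hdeg_def dx_def dy_def)
 qed
 then have "b = pms 0 (pml b 0)"
  by (intro poly_mapping_eqI) (auto simp: lookup_single when_def in_keys_iff)
 then show ?thesis unfolding mpoly_const_def by blast
qed

text \<open>Modulo the ideal, torsion of bidegree (i, j) is a vector space over the closure with
  basis a. Coordinate parts of torsion elements are torsion elements over k, so those defined over k
  span it and a basis can be selected among them.\<close>

lemma row_gens_descent:
 fixes G :: "'k::field poly44 set" and a :: "'n::finite \<Rightarrow> 'k alg_closure poly44"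
 assumes a: "row_gens (idl (embL ` G)) i j a" and G: "\<And>g. g \<in> G ==> \<exists>d. hdeg dy d g"
 shows "\<exists>a' :: 'n \<Rightarrow> 'k poly44. row_gens (idl G) i j a'"
proof -
 let ?I = "idl (embL ` G)"
 let ?K = "mc :: 'k alg_closure \<Rightarrow> 'k alg_closure poly44"
 have ha: "hdeg dx i (a l)" "hdeg dy j (a l)" "tors ?I (a l)" for l using a by (auto simp: row_gens_def)
 have span: "\<exists>t. q - (\<Sum>l\<in>UNIV. emT (t l) * a l) \<in> ?I" if "tors ?I q" "hdeg dx i q" for q
  using a that unfolding row_gens_def by blast
 have ind: "m = m'" if "(\<Sum>l\<in>UNIV. ?K (m $ l) * a l) - (\<Sum>l\<in>UNIV. ?K (m' $ l) * a l) \<in> ?I" for m m' :: "'k alg_closure ^ 'n"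
 proof -
  have "(\<Sum>l\<in>UNIV. ?K ((m - m') $ l) * a l) \<in> ?I"
   using that by (simp add: rhom_diff[OF rhom_const] algebra_simps sum_subtractf)
  then have "\<forall>l. (m - m') $ l = 0" using a unfolding row_gens_def by blast
  then show ?thesis by (simp add: vec_eq_iff)
 qed
 \<comment> \<open>Taking the part of y-degree j replaces the coefficients in T by
   constants.\<close>
 have co: "\<exists>m. embL b - (\<Sum>l\<in>UNIV. ?K (m $ l) * a l) \<in> ?I"
  if b: "tors (idl G) b" "hdeg dx i b" "hdeg dy j b" for b
 proof -
  obtain t where t: "embL b - (\<Sum>l\<in>UNIV. emT (t l) * a l) \<in> ?I"
   using span[of "embL b"] b by (auto simp: tors_embL)
  have "hcomp dy j (embL b - (\<Sum>l\<in>UNIV. emT (t l) * a l)) \<in> ?I"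
   by (rule hcomp_idl[OF graded_dy _ t]) (use G in auto)
  moreover have "hcomp dy j (emT (t l) * a l) = hcomp dy 0 (emT (t l)) * a l" for l
   using hcomp_mult[OF graded_dy ha(2), where n = j and p = "emT (t l)"] by (simp add: mult.commute)
  moreover have "\<exists>c. hcomp dy 0 (emT (t l)) = ?K c" for l
   by (intro bidegree0_const hdeg_keep hom_dx_emT hdeg_hcomp)
  then have "\<exists>c. \<forall>l. hcomp dy 0 (emT (t l)) = ?K (c l)" by (intro choice) blast
  then obtain c where "hcomp dy 0 (emT (t l)) = ?K (c l)" for l by blast
  ultimately have "embL b - (\<Sum>l\<in>UNIV. ?K (c l) * a l) \<in> ?I"
   using b by (simp add: hcomp_diff[OF graded_dy] hcomp_sum[OF graded_dy] hcomp_hom)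
  then show ?thesis by (intro exI[of _ "\<chi> l. c l"]) simp
 qed
 \<comment> \<open>Coordinate vectors, relative to a, of the torsion elements defined over
   k.\<close>
 define W where "W = {m. \<exists>b. tors (idl G) b \<and> hdeg dx i b \<and> hdeg dy j b \<and> embL b - (\<Sum>l\<in>UNIV. ?K (m $ l) * a l) \<in> ?I}"
 have ax: "axis l 1 \<in> vec.span W" for l
 proof -
  obtain E where E: "finite E" "a l = (\<Sum>e\<in>E. mc e * embL (cpart e (a l)))" using cpart_expand by blast
  have "\<exists>m. m \<in> W \<and> embL (cpart e (a l)) - (\<Sum>l\<in>UNIV. ?K (m $ l) * a l) \<in> ?I" for e
  proof -
   have c: "tors (idl G) (cpart e (a l))" "hdeg dx i (cpart e (a l))" "hdeg dy j (cpart e (a l))"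
    using tors_cpart[OF ha(3)] hdeg_cpart[OF ha(1)] hdeg_cpart[OF ha(2)] by auto
   obtain m where m: "embL (cpart e (a l)) - (\<Sum>l\<in>UNIV. ?K (m $ l) * a l) \<in> ?I" using co[OF c] by blast
   have "m \<in> W" unfolding W_def using c m by (intro CollectI exI[of _ "cpart e (a l)"] conjI)
   then show ?thesis using m by blast
  qed
  then have "\<exists>m. \<forall>e. m e \<in> W \<and> embL (cpart e (a l)) - (\<Sum>l\<in>UNIV. ?K (m e $ l) * a l) \<in> ?I"
   by (intro choice) blast
  then obtain m where m: "m e \<in> W" "embL (cpart e (a l)) - (\<Sum>l\<in>UNIV. ?K (m e $ l) * a l) \<in> ?I" for e by blast
  have "(\<Sum>e\<in>E. ?K e * (embL (cpart e (a l)) - (\<Sum>l\<in>UNIV. ?K (m e $ l) * a l))) \<in> ?I"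
   by (intro ispan_sum ispan_scale m)
  moreover have "(\<Sum>e\<in>E. ?K e * (embL (cpart e (a l)) - (\<Sum>l\<in>UNIV. ?K (m e $ l) * a l))) =
    a l - (\<Sum>k\<in>UNIV. ?K ((\<Sum>e\<in>E. e *s m e) $ k) * a k)"
  proof -
   have "(\<Sum>e\<in>E. ?K e * (\<Sum>l\<in>UNIV. ?K (m e $ l) * a l)) = (\<Sum>k\<in>UNIV. \<Sum>e\<in>E. ?K e * (?K (m e $ k) * a k))"
    unfolding sum_distrib_left by (rule sum.swap)
   also have "\<dots> = (\<Sum>k\<in>UNIV. ?K ((\<Sum>e\<in>E. e *s m e) $ k) * a k)"
    by (simp add: rhom_sum[OF rhom_const] rhom_mult[OF rhom_const] sum_distrib_right mult.assoc)
   finally show ?thesis using E(2) by (simp add: right_diff_distrib sum_subtractf)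
  qed
  moreover have "a l = (\<Sum>k\<in>UNIV. ?K (axis l 1 $ k) * a k)"
  proof -
   have "(\<Sum>k\<in>UNIV. ?K (axis l 1 $ k) * a k) = (\<Sum>k\<in>UNIV. if k = l then a l else 0)"
    by (rule sum.cong) (auto simp: axis_def)
   then show ?thesis by simp
  qed
  ultimately have "axis l 1 = (\<Sum>e\<in>E. e *s m e)" by (intro ind) simp
  then show ?thesis using m by (auto intro: vec.span_sum vec.span_scale vec.span_base)
 qed
 have "vec.span W = UNIV"
 proof -
  have "x \<in> vec.span W" for x :: "'k alg_closure ^ 'n"
  proof -
   have "(\<Sum>l\<in>UNIV. x $ l *s axis l 1) \<in> vec.span W"
    by (intro vec.span_sum vec.span_scale ax)
   then show ?thesis by (simp only: basis_expansion)
  qed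
  then show ?thesis by blast
 qed
 obtain B where B: "B \<subseteq> W" "vec.independent B" "W \<subseteq> vec.span B"
  using vec.maximal_independent_subset by blast
 have sB: "vec.span B = UNIV" using vec.span_mono[OF B(3)] \<open>vec.span W = UNIV\<close> by (auto simp: vec.span_span)
 have fB: "finite B" by (rule vec.finiteI_independent[OF B(2)])
 have "card B = CARD('n)"
  using vec.dim_eq_card[of B UNIV] sB B(2) by (simp add: vec.span_UNIV vec_dim_card card_cart_basis)
 then obtain \<beta> where \<beta>: "bij_betw \<beta> (UNIV :: 'n set) B"
  using fB by (metis finite_same_card_bij finite)
 have "\<beta> l \<in> W" for l using \<beta> B(1) by (auto simp: bij_betw_def)
 then have "\<exists>b. tors (idl G) b \<and> hdeg dx i b \<and> hdeg dy j b \<and> embL b - (\<Sum>k\<in>UNIV. ?K (\<beta> l $ k) * a k) \<in> ?I" for l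
  unfolding W_def by blast
 then have "\<exists>b. \<forall>l. tors (idl G) (b l) \<and> hdeg dx i (b l) \<and> hdeg dy j (b l) \<and>
  embL (b l) - (\<Sum>k\<in>UNIV. ?K (\<beta> l $ k) * a k) \<in> ?I" by (intro choice) blast
 then obtain b where b: "tors (idl G) (b l)" "hdeg dx i (b l)" "hdeg dy j (b l)"
  "embL (b l) - (\<Sum>k\<in>UNIV. ?K (\<beta> l $ k) * a k) \<in> ?I" for l by blast
 have comb: "(\<Sum>l\<in>UNIV. c l * embL (b l)) - (\<Sum>k\<in>UNIV. (\<Sum>l\<in>UNIV. c l * ?K (\<beta> l $ k)) * a k) \<in> ?I" for c
 proof -
  have "(\<Sum>l\<in>UNIV. c l * (embL (b l) - (\<Sum>k\<in>UNIV. ?K (\<beta> l $ k) * a k))) \<in> ?I"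
   by (intro ispan_sum ispan_scale b)
  moreover have "(\<Sum>l\<in>UNIV. c l * (\<Sum>k\<in>UNIV. ?K (\<beta> l $ k) * a k)) = (\<Sum>k\<in>UNIV. (\<Sum>l\<in>UNIV. c l * ?K (\<beta> l $ k)) * a k)"
   unfolding sum_distrib_left sum_distrib_right by (subst sum.swap) (simp add: mult.assoc)
  ultimately show ?thesis by (simp add: right_diff_distrib sum_subtractf)
 qed
 have "\<exists>n. axis k 1 = (\<Sum>l\<in>UNIV. n l *s \<beta> l)" for k
 proof -
  have "axis k 1 \<in> vec.span B" unfolding sB by simp
  then obtain u where "axis k 1 = (\<Sum>v\<in>B. u v *s v)" unfolding vec.span_finite[OF fB] by blast
  also have "\<dots> = (\<Sum>l\<in>UNIV. u (\<beta> l) *s \<beta> l)" by (rule sum.reindex_bij_betw[OF \<beta>, symmetric])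
  finally show ?thesis by (rule exI[of _ "\<lambda>l. u (\<beta> l)"])
 qed
 then have "\<exists>n. \<forall>k. axis k 1 = (\<Sum>l\<in>UNIV. n k l *s \<beta> l)" by (intro choice) blast
 then obtain n where n: "axis k 1 = (\<Sum>l\<in>UNIV. n k l *s \<beta> l)" for k by blast
 \<comment> \<open>The inverse change of basis: each a k in terms of the new generators b.\<close>
 have al: "(\<Sum>l\<in>UNIV. ?K (n k l) * embL (b l)) - a k \<in> ?I" for k
 proof -
  have h: "(\<Sum>l\<in>UNIV. ?K (n k l) * ?K (\<beta> l $ k')) = (if k' = k then 1 else 0)" for k'
   using arg_cong[OF n[of k], of "\<lambda>v. ?K (v $ k')"]
   by (simp add: rhom_sum[OF rhom_const] rhom_mult[OF rhom_const] axis_def split: if_splits)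
  have "(\<Sum>k'\<in>UNIV. (\<Sum>l\<in>UNIV. ?K (n k l) * ?K (\<beta> l $ k')) * a k') = (\<Sum>k'\<in>UNIV. if k' = k then a k else 0)"
   unfolding h by (intro sum.cong) auto
  also have "\<dots> = a k" by simp
  finally show ?thesis using comb[of "\<lambda>l. ?K (n k l)"] by simp
 qed
 have "row_gens (idl G) i j b"
  unfolding row_gens_def
 proof (intro conjI allI impI)
  fix c assume c: "tors (idl G) c" "hdeg dx i c"
  obtain t where t: "embL c - (\<Sum>k\<in>UNIV. emT (t k) * a k) \<in> ?I"
   using span[of "embL c"] c by (auto simp: tors_embL)
  have "embL c - (\<Sum>k\<in>UNIV. emT (t k) * a k) - (\<Sum>k\<in>UNIV. emT (t k) * ((\<Sum>l\<in>UNIV. ?K (n k l) * embL (b l)) - a k)) \<in> ?I"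
   by (intro ispan_diff ispan_sum ispan_scale al t)
  moreover have "(\<Sum>k\<in>UNIV. emT (t k) * (\<Sum>l\<in>UNIV. ?K (n k l) * embL (b l))) =
    (\<Sum>l\<in>UNIV. emT (\<Sum>k\<in>UNIV. t k * mc (n k l)) * embL (b l))"
   by (simp add: rhom_sum[OF rhom_emT] rhom_mult[OF rhom_emT] sum_distrib_left sum_distrib_right mult.assoc)
    (rule sum.swap)
  ultimately have "embL c - (\<Sum>l\<in>UNIV. emT (\<Sum>k\<in>UNIV. t k * mc (n k l)) * embL (b l)) \<in> ?I"
   by (simp add: right_diff_distrib sum_subtractf)
  \<comment> \<open>The coordinate at 1 turns cofactors over the closure into cofactors over
    k.\<close>
  from cpart_idl[OF this, of 1]
  have "c - (\<Sum>l\<in>UNIV. emT (cpart 1 (\<Sum>k\<in>UNIV. t k * mc (n k l))) * b l) \<in> idl G"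
   unfolding cpart_diff cpart_embL cpart_sum cpart_emT_mult .
  then show "\<exists>t. c - (\<Sum>l\<in>UNIV. emT (t l) * b l) \<in> idl G" by (rule exI[of _ "\<lambda>l. cpart 1 (\<Sum>k\<in>UNIV. t k * mc (n k l))"])
 next
  fix c l assume "(\<Sum>l\<in>UNIV. mc (c l) * b l) \<in> idl G"
  then have "embL (\<Sum>l\<in>UNIV. mc (c l) * b l) \<in> ?I" by (simp add: embL_idl)
  then have "(\<Sum>l\<in>UNIV. ?K (to_ac (c l)) * embL (b l)) \<in> ?I"
   by (simp add: rhom_sum[OF rhom_embL] rhom_mult[OF rhom_embL])
  from ispan_diff[OF this comb[of "\<lambda>l. ?K (to_ac (c l))"]]
  have "(\<Sum>k\<in>UNIV. (\<Sum>l\<in>UNIV. ?K (to_ac (c l)) * ?K (\<beta> l $ k)) * a k) \<in> ?I" by simp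
  then have "(\<Sum>k\<in>UNIV. ?K ((\<Sum>l\<in>UNIV. to_ac (c l) *s \<beta> l) $ k) * a k) - (\<Sum>k\<in>UNIV. ?K ((0 :: 'k alg_closure ^ 'n) $ k) * a k) \<in> ?I"
   by (simp add: rhom_sum[OF rhom_const] rhom_mult[OF rhom_const])
  then have "(\<Sum>l\<in>UNIV. to_ac (c l) *s \<beta> l) = 0" by (rule ind)
  moreover have "(\<Sum>l\<in>UNIV. to_ac (c l) *s \<beta> l) = (\<Sum>v\<in>B. to_ac (c (inv_into UNIV \<beta> v)) *s v)"
   using \<beta> by (subst sum.reindex_bij_betw[OF \<beta>, symmetric]) (simp add: bij_betw_def)
  ultimately have "to_ac (c (inv_into UNIV \<beta> (\<beta> l))) = 0"
   using vec.independentD[OF B(2) fB order_refl, of "\<lambda>v. to_ac (c (inv_into UNIV \<beta> v))" "\<beta> l"] \<beta>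
   by (auto simp: bij_betw_def)
  then show "c l = 0" using \<beta> by (simp add: bij_betw_def)
 qed (use b in auto)
 then show ?thesis by blast
qed

lemma good_descent:
 fixes f g :: "'k::field poly4"
 assumes "good (idl (IB (embL f) (embL g)))" "hdeg dt n f" "hdeg dt n' g"
 shows "good (idl (IB f g))"
proof -
 have G: "\<exists>d. hdeg dy d h" if "h \<in> IB f g" for h
  using that hom_emS_DD[OF assms(2)] hom_emS_DD[OF assms(3)] by auto
 let ?I = "idl (embL ` IB f g)"
 have gd: "good ?I" using assms(1) unfolding embL_IB .
 have "b \<in> idl (IB f g)" if b: "tors (idl (IB f g)) b" "hdeg dx n b" "n \<ge> 3" for b n
 proof -
  have "embL b \<in> ?I" if "tors ?I (embL b)" "hdeg dx n (embL b)"
   using gd that b(3) unfolding good_def by blast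
  then show ?thesis using b unfolding tors_embL hdeg_embL embL_idl by blast
 qed
 moreover have "\<exists>a. row_gens ?I 2 2 (a :: unit \<Rightarrow> _)" "\<exists>a. row_gens ?I 1 4 (a :: 4 \<Rightarrow> _)"
  "\<exists>a. row_gens ?I 0 8 (a :: unit \<Rightarrow> _)" using gd unfolding good_def by blast+
 then have "\<exists>a. row_gens (idl (IB f g)) 2 2 (a :: unit \<Rightarrow> _)" "\<exists>a. row_gens (idl (IB f g)) 1 4 (a :: 4 \<Rightarrow> _)"
  "\<exists>a. row_gens (idl (IB f g)) 0 8 (a :: unit \<Rightarrow> _)"
  using row_gens_descent[of "IB f g", OF _ G] by blast+
 ultimately show ?thesis unfolding good_def by blast
qed

section \<open>Normality expressed in S\<close>

section \<open>Normal complete intersections of two quadrics\<close>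

text \<open>The hypotheses pulled back to S: only Koszul relations between f and g, the ideal (f, g)
  is radical, and a fraction a/b that is integral over the quotient already lies in it.\<close>

definition nrm :: "'a::field_char_0 poly4 \<Rightarrow> 'a poly4 \<Rightarrow> bool" where
 "nrm f g \<longleftrightarrow> hdeg dt 2 f \<and> hdeg dt 2 g \<and>
  (\<forall>u v. u * f + v * g = 0 \<longrightarrow> (\<exists>w. u = w * g \<and> v = - (w * f))) \<and>
  (\<forall>a n. a ^ n \<in> idl {f, g} \<longrightarrow> a \<in> idl {f, g}) \<and>
  (\<forall>a b n c. nzd b (idl {f, g}) \<longrightarrow> n > 0 \<longrightarrow> a ^ n + (\<Sum>i<n. c i * (a ^ i * b ^ (n - i))) \<in> idl {f, g} \<longrightarrow>
    (\<exists>r. a - b * r \<in> idl {f, g}))"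

definition pt :: "(4 \<Rightarrow> 'a::comm_ring_1) \<Rightarrow> 'a poly4 \<Rightarrow> 'a" where "pt v = ev (\<lambda>c. c) v"

lemma rhom_pt: "rhom (pt v)" unfolding pt_def by (rule rhom_ev[OF rhom_id])
lemma pt_const: "pt v (mc c) = c" and pt_var: "pt v (mpv i) = v i"
 unfolding pt_def by (simp_all add: ev_const[OF rhom_id] ev_var[OF rhom_id])
lemmas pt_simps = pt_const pt_var rhom_simps[OF rhom_pt]

lemma dt0_const: assumes "hdeg dt 0 b" shows "\<exists>c. b = mc c"
proof -
 have "m = 0" if "m \<in> pmk b" for m
  using assms that by (intro poly_mapping_eqI) (auto simp: hdeg_def dt_def)
 then have "b = pms 0 (pml b 0)"
  by (intro poly_mapping_eqI) (auto simp: lookup_single when_def in_keys_iff)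
 then show ?thesis unfolding mpoly_const_def by blast
qed

lemma idl_empty: "b \<in> idl {} \<longleftrightarrow> b = 0" for b :: "'a::comm_ring_1"
 by (simp add: ispan_empty)

lemma idl_one: "b \<in> idl {f} \<longleftrightarrow> (\<exists>u. b = u * f)" for b :: "'a::comm_ring_1"
 by (simp add: idl_insert idl_empty)

lemma idl_two: "b \<in> idl {f, g} \<longleftrightarrow> (\<exists>u v. b = u * f + v * g)" for b :: "'a::comm_ring_1"
 by (auto simp: idl_insert idl_empty algebra_simps)

lemma pt_hom0: fixes f :: "'a::comm_ring_1 poly4" assumes "hdeg dt n f" "n > 0" shows "pt (\<lambda>_. 0) f = 0"
proof -
 have e: "pml f m = 0 \<or> (\<Prod>i\<in>UNIV. (0::'a) ^ pml m i) = 0" if "m \<in> pmk f" for m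
 proof -
  have "dt m = n" using assms that by (auto simp: hdeg_def)
  then have "\<exists>i. pml m i \<noteq> 0" using assms(2) unfolding dt_def by (metis not_gr_zero sum.neutral)
  then have "(\<Prod>i\<in>UNIV. (0::'a) ^ pml m i) = 0" by (intro prod_zero) (auto simp: power_0_left)
  then show ?thesis ..
 qed
 show ?thesis unfolding pt_def ev_def evm_def
 proof (intro sum.neutral ballI)
  fix m assume "m \<in> pmk f"
  from e[OF this] show "pml f m * (\<Prod>i\<in>UNIV. 0 ^ pml m i) = 0" by auto
 qed
qed

lemma nrm_reg: "nrm f g ==> u * f + v * g = 0 ==> \<exists>w. u = w * g \<and> v = - (w * f)"
 and nrm_red: "nrm f g ==> a ^ n \<in> idl {f, g} ==> a \<in> idl {f, g}"
 and nrm_hom: "nrm f g ==> hdeg dt 2 f" "nrm f g ==> hdeg dt 2 g"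
 unfolding nrm_def by blast+

lemma nrm_neq_0: assumes "nrm f g" shows "f \<noteq> 0" "g \<noteq> 0"
proof -
 have z: "pt (\<lambda>_. 0) f = 0" "pt (\<lambda>_. 0) g = 0" using nrm_hom[OF assms] by (auto intro: pt_hom0)
 show "f \<noteq> 0"
 proof
  assume "f = 0"
  then obtain w where "1 = w * g" using nrm_reg[OF assms, of 1 0] by auto
  then have "pt (\<lambda>_. 0) 1 = pt (\<lambda>_. 0) (w * g)" by simp
  then show False using z by (simp add: pt_simps)
 qed
 show "g \<noteq> 0"
 proof
  assume "g = 0"
  then obtain w where "1 = - (w * f)" using nrm_reg[OF assms, of 0 1] by auto
  then have "pt (\<lambda>_. 0) 1 = pt (\<lambda>_. 0) (- (w * f))" by simp
  then show False using z by (simp add: pt_simps)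
 qed
qed

lemma nzd_idom: "b \<noteq> 0 ==> nzd b (idl {})" for b :: "'a::idom"
 by (simp add: nzd_def idl_empty)

lemma nrm_nzd_g: assumes "nrm f g" shows "nzd g (idl {f})"
 unfolding nzd_def idl_one
proof (intro allI impI)
 fix b assume "\<exists>u. g * b = u * f"
 then obtain u where "(- u) * f + b * g = 0" by (auto simp: mult.commute)
 then obtain w where "b = - (w * f)" using nrm_reg[OF assms] by blast
 then show "\<exists>u. b = u * f" by (intro exI[of _ "- w"]) simp
qed

text \<open>The denominators below must be regular modulo (f, g). By two exchanges it is enough that
  f is regular modulo b and g modulo (f, b).\<close>

lemma nrm_nzd:
 assumes n: "nrm f g" and b: "b \<noteq> 0" and f: "nzd f (idl {b})" and g: "nzd g (idl {f, b})"
 shows "nzd b (idl {f, g})"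
proof -
 have "nzd b (idl {f})"
  by (rule nzd_exchange[OF nzd_idom[OF b] f nzd_idom[OF nrm_neq_0(1)[OF n]]])
 then have "nzd b (idl {g, f})"
  by (rule nzd_exchange[OF _ _ nrm_nzd_g[OF n]]) (use g in \<open>simp add: insert_commute\<close>)
 then show ?thesis by (simp add: insert_commute)
qed

lemma nrm_int:
 assumes "nrm f g" "nzd b (idl {f, g})" "n > 0" "a ^ n + (\<Sum>i<n. c i * (a ^ i * b ^ (n - i))) \<in> idl {f, g}"
 shows "\<exists>r. a - b * r \<in> idl {f, g}"
 using assms unfolding nrm_def by blast

lemma nrm_int2:
 assumes "nrm f g" "nzd b (idl {f, g})" and q: "a\<^sup>2 + s * a * b + t * b\<^sup>2 \<in> idl {f, g}"
 shows "\<exists>r. a - b * r \<in> idl {f, g}"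
proof (rule nrm_int[OF assms(1,2), where n = 2 and c = "\<lambda>i. if i = 0 then t else s"])
 show "a\<^sup>2 + (\<Sum>i<2. (if i = 0 then t else s) * (a ^ i * b ^ (2 - i))) \<in> idl {f, g}"
  using q by (simp add: numeral_2_eq_2 lessThan_Suc algebra_simps)
qed simp

lemma idl_degree:
 assumes h: "hdeg dt 2 f" "hdeg dt 2 g" and z: "z \<in> idl {f, g}"
 shows "hcomp dt 1 z = 0" "\<exists>k l. hcomp dt 2 z = mc k * f + mc l * g"
proof -
 obtain u v where z: "z = f * u + g * v" using z by (auto simp: idl_two mult.commute)
 show "hcomp dt 1 z = 0"
  unfolding z by (simp add: hcomp_add[OF graded_dt] hcomp_mult[OF graded_dt h(1)] hcomp_mult[OF graded_dt h(2)])
 obtain k l where "hcomp dt 0 u = mc k" "hcomp dt 0 v = mc l"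
  using dt0_const[OF hdeg_hcomp] by metis
 then have "hcomp dt 2 z = mc k * f + mc l * g"
  unfolding z by (simp add: hcomp_add[OF graded_dt] hcomp_mult[OF graded_dt h(1)] hcomp_mult[OF graded_dt h(2)] mult.commute)
 then show "\<exists>k l. hcomp dt 2 z = mc k * f + mc l * g" by blast
qed

lemma degree1_multiple:
 assumes "nrm f g" "a - b * r \<in> idl {f, g}" "hdeg dt 1 a" "hdeg dt 1 b"
 shows "\<exists>c. a = mc c * b"
proof -
 have "hcomp dt 1 (a - b * r) = 0" by (rule idl_degree(1)[OF nrm_hom[OF assms(1)] assms(2)])
 then have "a = b * hcomp dt 0 r"
  by (simp add: hcomp_diff[OF graded_dt] hcomp_mult[OF graded_dt assms(4)] hcomp_hom[OF assms(3)])
 moreover obtain c where "hcomp dt 0 r = mc c" using dt0_const[OF hdeg_hcomp] by metis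
 ultimately show ?thesis by (intro exI[of _ c]) (simp add: mult.commute)
qed

lemma degree2_multiple:
 assumes "nrm f g" "a - b * r \<in> idl {f, g}" "hdeg dt 2 a" "hdeg dt k b" "k \<le> 2"
 shows "\<exists>s x y. a = b * s + mc x * f + mc y * g \<and> hdeg dt (2 - k) s"
proof -
 obtain x y where "hcomp dt 2 (a - b * r) = mc x * f + mc y * g"
  using idl_degree(2)[OF nrm_hom[OF assms(1)] assms(2)] by blast
 then have "a - b * hcomp dt (2 - k) r = mc x * f + mc y * g"
  using assms(5) by (simp add: hcomp_diff[OF graded_dt] hcomp_mult[OF graded_dt assms(4)] hcomp_hom[OF assms(3)])
 then show ?thesis using hdeg_hcomp[of dt "2 - k" r]
  by (intro exI[of _ "hcomp dt (2 - k) r"] exI[of _ x] exI[of _ y]) (simp add: algebra_simps)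
qed

section \<open>Normal forms of degenerate pencils that contradict normality\<close>

abbreviation kk :: "'a::comm_ring_1 \<Rightarrow> 'a poly4" where "kk \<equiv> mc"
abbreviation z1 :: "'a::comm_ring_1 poly4" where "z1 \<equiv> mpv 1"
abbreviation z2 :: "'a::comm_ring_1 poly4" where "z2 \<equiv> mpv 2"
abbreviation z3 :: "'a::comm_ring_1 poly4" where "z3 \<equiv> mpv 3"
abbreviation z4 :: "'a::comm_ring_1 poly4" where "z4 \<equiv> mpv 4"

lemma nzd_quadratic:
 fixes c :: "'a::field_char_0"
 assumes G: "\<And>g. g \<in> G ==> zfree z g" and c: "c \<noteq> 0" and l: "zfree z l" and m: "zfree z m"
 shows "nzd (mc c * mpv z ^ 2 + mpv z * l + m) (idl G)"
proof (rule nzd_lead[OF G, where m = 2])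
 have e: "zpoly z (mc c * mpv z ^ 2 + mpv z * l + m) = [:m, l, mc c:]"
  by (simp add: zpoly_simps zfree_zpoly[OF l] zfree_zpoly[OF m] power2_eq_square)
 show "cf z n (mc c * mpv z ^ 2 + mpv z * l + m) = 0" if "n > 2" for n
  unfolding e using that by (simp add: coeff_pCons split: nat.splits)
 show "nzd (cf z 2 (mc c * mpv z ^ 2 + mpv z * l + m)) (idl G)"
  unfolding e using nzd_const[OF c] by (simp add: numeral_2_eq_2)
qed

text \<open>The tested expression is the resultant in z_1 of f and z_1 P + Q. Modulo f it is a
  multiple of g, so its regularity passes to g.\<close>

lemma nzd_resultant:
 fixes f g :: "'a::field_char_0 poly4"
 assumes f: "f = kk a * z1 ^ 2 + z1 * l + m" and a: "a \<noteq> 0" and g: "g = z1 * P + Q + w * f"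
  and zf: "zfree 1 l" "zfree 1 m" "zfree 1 P" "zfree 1 Q" "zfree 1 b"
  and n: "nzd (kk a * Q\<^sup>2 - l * P * Q + m * P\<^sup>2) (idl {b})"
 shows "nzd g (idl {f, b})"
proof -
 let ?n = "kk a * Q\<^sup>2 - l * P * Q + m * P\<^sup>2"
 have "nzd ?n (idl {f, b})"
  by (rule nzd_exchange[OF n]; unfold f; rule nzd_quadratic) (use a zf in auto)
 moreover have "?n - (- (kk a * z1 * P - kk a * Q + l * P)) * g = (P\<^sup>2 + w * (kk a * z1 * P - kk a * Q + l * P)) * f"
  unfolding g unfolding f by (simp add: power2_eq_square algebra_simps)
 then have "?n - (- (kk a * z1 * P - kk a * Q + l * P)) * g \<in> idl {f, b}"
  by (simp add: ispan_scale ispan_base)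
 ultimately have "nzd ((- (kk a * z1 * P - kk a * Q + l * P)) * g) (idl {f, b})" by (rule nzd_cong[rotated])
 then show ?thesis by (rule nzd_left)
qed

lemma var_not_multiple: "i \<noteq> j ==> mpv i \<noteq> kk c * mpv j" for c :: "'a::field"
proof
 assume "i \<noteq> j" and e: "mpv i = kk c * mpv j"
 have "pt (\<lambda>k. if k = i then 1 else 0) (mpv i) = pt (\<lambda>k. if k = i then 1 else 0) (kk c * mpv j)"
  by (subst e) simp
 then show False using \<open>i \<noteq> j\<close> by (simp add: pt_simps)
qed

text \<open>The first form has rank at most two, so z_1/z_2 has a scalar square and is integral, but
  z_1 is not a scalar multiple of z_2.\<close>

lemma not_nrm_rank2:
 assumes n: "nrm (kk a * z1 ^ 2 + kk c * z2 ^ 2) (kk s * z3 ^ 2 + z3 * l + r)"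
  and nz: "a \<noteq> 0" "s \<noteq> 0" and zf: "zfree 3 l" "zfree 3 r"
 shows False
proof -
 let ?f = "kk a * z1 ^ 2 + kk c * z2 ^ 2" and ?g = "kk s * z3 ^ 2 + z3 * l + r"
 have f: "?f = kk a * z1 ^ 2 + z1 * 0 + kk c * z2 ^ 2" by simp
 have "nzd z2 (idl {?f, ?g})"
 proof (rule nrm_nzd[OF n])
  show "nzd ?f (idl {z2})" unfolding f by (rule nzd_quadratic) (use nz in auto)
  show "nzd ?g (idl {?f, z2})" by (rule nzd_quadratic) (use nz zf in auto)
 qed simp
 moreover have "z1\<^sup>2 + 0 * z1 * z2 + kk (c / a) * z2\<^sup>2 = kk (inverse a) * ?f"
  using nz by (simp add: distrib_left mult.assoc[symmetric] mpoly_const_mult[symmetric] divide_inverse mult.commute)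
 then have "z1\<^sup>2 + 0 * z1 * z2 + kk (c / a) * z2\<^sup>2 \<in> idl {?f, ?g}" by (simp only:) (intro ispan_scale ispan_base, simp)
 ultimately obtain t where "z1 - z2 * t \<in> idl {?f, ?g}" using nrm_int2[OF n] by blast
 from degree1_multiple[OF n this hom_dt(1) hom_dt(1)] show False using var_not_multiple[of 1 2] by auto
qed

text \<open>The line z_1 = z_2 = 0 lies on the second quadric and is contained in the vertex of the
  first, so the curve is not reduced along it; w is nilpotent modulo (f, g) but nonzero.\<close>

lemma not_nrm_double_line:
 assumes n: "nrm (kk a * z1 ^ 2 + kk c * z2 ^ 2) (z1 * (2 * z3 + kk p * z1 + kk q * z2) + z2 * (2 * z4 + kk q * z1 + kk r * z2))"
  and nz: "a \<noteq> 0"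
 shows False
proof -
 define u3 where "u3 = 2 * z3 + kk p * z1 + kk q * z2"
 define u4 where "u4 = 2 * z4 + kk q * z1 + kk r * z2"
 let ?f = "kk a * z1 ^ 2 + kk c * z2 ^ 2"
 define g where "g = z1 * u3 + z2 * u4"
 note n = n[folded u3_def u4_def, folded g_def]
 define w where "w = kk a * z1 * u4 - kk c * z2 * u3"
 have fg: "?f \<in> idl {?f, g}" "g \<in> idl {?f, g}" by (auto intro: ispan_base)
 have "w ^ 2 = kk a * u4 * (z1 * w) - kk c * u3 * (z2 * w)"
  unfolding w_def by (simp add: power2_eq_square algebra_simps)
 also have "z1 * w = u4 * ?f - kk c * z2 * g" unfolding w_def g_def by (simp add: power2_eq_square algebra_simps)
 also have "z2 * w = kk a * z1 * g - u3 * ?f" unfolding w_def g_def by (simp add: power2_eq_square algebra_simps)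
 also have "kk a * u4 * (u4 * ?f - kk c * z2 * g) - kk c * u3 * (kk a * z1 * g - u3 * ?f) \<in> idl {?f, g}"
  by (intro ispan_diff ispan_scale fg)
 finally have "w - 0 * 0 \<in> idl {?f, g}" using nrm_red[OF n] by simp
 moreover have "hdeg dt 2 w" unfolding w_def u3_def u4_def by (simp add: hdeg_simps rhom_numeral[OF rhom_gpoly[OF graded_dt]] numeral_monom)
 ultimately obtain x y where w: "w = kk x * ?f + kk y * g"
  using degree2_multiple[OF n, of w 0 0 2] by (auto simp: hdeg_def)
 have A: "pt v w = x * pt v ?f + y * pt v g" for v unfolding w by (simp add: pt_simps)
 show False
  using A[of "\<lambda>i. if i = 1 \<or> i = 4 then 1 else 0"] A[of "\<lambda>i. if i = 1 then 1 else 0"] A[of "\<lambda>i. if i = 4 then 1 else 0"] nz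
  unfolding w_def g_def u3_def u4_def by (simp add: pt_simps algebra_simps)
qed

text \<open>The first quadric is a cone with e_4 in its vertex and the second passes through e_4, so
  the curve is singular there. The fraction z_1 z_4 / z_2 satisfies a monic quadratic
  equation.\<close>

lemma not_nrm_node:
 assumes n: "nrm (kk a * z1 ^ 2 + z1 * (kk b * z2 + kk c * z3) + (kk d * z2 ^ 2 + kk e * z2 * z3 + kk h * z3 ^ 2))
   (2 * z3 * z4 + z2 * (kk p * z1 + kk q * z2))" and nz: "a \<noteq> 0"
 shows False
proof -
 define l where "l = kk b * z2 + kk c * z3"
 define m where "m = kk d * z2 ^ 2 + kk e * z2 * z3 + kk h * z3 ^ 2"
 define M where "M = kk p * z1 + kk q * z2"
 define f where "f = kk a * z1 ^ 2 + z1 * l + m"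
 define g where "g = 2 * z3 * z4 + z2 * M"
 note n = n[folded l_def m_def M_def, folded f_def g_def]
 have zf: "zfree 1 l" "zfree 1 m" "zfree 4 l" "zfree 4 m" by (simp_all add: l_def m_def)
 have fz: "nzd f (idl G)" if "\<And>k. k \<in> G ==> zfree 1 k" for G
  unfolding f_def by (rule nzd_quadratic) (use that nz zf in auto)
 have two: "(2 :: 'a poly4) = kk 2" by (simp add: rhom_numeral[OF rhom_const])
 have "nzd z2 (idl {f, g})"
 proof (rule nrm_nzd[OF n])
  show "nzd f (idl {z2})" by (rule fz) auto
  have "nzd z3 (idl {f, z2})"
   by (rule nzd_exchange; (rule fz)?) (auto intro: nzd_var)
  moreover have "nzd z4 (idl {f, z2})" by (rule nzd_var) (use zf in \<open>auto simp: f_def\<close>)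
  ultimately have "nzd (2 * z3 * z4) (idl {f, z2})" unfolding two by (intro nzd_mult nzd_const) auto
  moreover have "2 * z3 * z4 - g = (- M) * z2" by (simp add: g_def algebra_simps)
  then have "2 * z3 * z4 - g \<in> idl {f, z2}" by (simp only:) (intro ispan_scale ispan_base, simp)
  ultimately show "nzd g (idl {f, z2})" by (rule nzd_cong[rotated])
 qed simp
 moreover have "\<exists>s t. (z1 * z4)\<^sup>2 + s * (z1 * z4) * z2 + t * z2\<^sup>2 \<in> idl {f, g}"
 proof -
  let ?h = "inverse a / 4"
  let ?s = "4 * kk b * z4 - 2 * kk c * M" and ?t = "4 * kk d * z4 ^ 2 - 2 * kk e * z4 * M + kk h * M ^ 2"
  have "4 * kk a * (z1 * z4)\<^sup>2 + ?s * (z1 * z4) * z2 + ?t * z2\<^sup>2 =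
   4 * z4 ^ 2 * f - (2 * z1 * z4 * kk c + 2 * kk e * z2 * z4 + kk h * (2 * z3 * z4 - z2 * M)) * g"
   unfolding f_def g_def l_def m_def by (simp add: power2_eq_square algebra_simps)
  also have "\<dots> \<in> idl {f, g}" by (intro ispan_diff ispan_scale ispan_base) simp_all
  finally have "kk ?h * (4 * kk a * (z1 * z4)\<^sup>2 + ?s * (z1 * z4) * z2 + ?t * z2\<^sup>2) \<in> idl {f, g}" by (rule ispan_scale)
  moreover have "kk ?h * (4 * kk a) = 1"
   using nz rhom_numeral[OF rhom_const, of "num.Bit0 (num.Bit0 num.One)"]
   by (metis (no_types, lifting) mpoly_const_1 mpoly_const_mult divide_inverse mult.commute mult.left_commute nonzero_divide_mult_cancel_left times_divide_eq_left right_inverse zero_neq_numeral mult_1_right)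
  ultimately have "(z1 * z4)\<^sup>2 + (kk ?h * ?s) * (z1 * z4) * z2 + (kk ?h * ?t) * z2\<^sup>2 \<in> idl {f, g}"
   unfolding distrib_left mult.assoc[symmetric] by simp
  then show ?thesis by blast
 qed
 ultimately obtain r where "z1 * z4 - z2 * r \<in> idl {f, g}" using nrm_int2[OF n] by blast
 moreover have "hdeg dt 2 (z1 * z4)" by (simp add: hdeg_simps)
 ultimately obtain s x y where w: "z1 * z4 = z2 * s + kk x * f + kk y * g"
  using degree2_multiple[OF n _ _ hom_dt(1)[of 2], of "z1 * z4" r] by auto
 have A: "pt v (z1 * z4) = pt v z2 * pt v s + x * pt v f + y * pt v g" for v unfolding w by (simp add: pt_simps)
 show False
  using A[of "\<lambda>i. if i = 1 \<or> i = 4 then 1 else 0"] A[of "\<lambda>i. if i = 1 then 1 else 0"] A[of "\<lambda>i. if i = 4 then 1 else 0"]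
  unfolding f_def g_def l_def m_def M_def by (simp add: pt_simps algebra_simps)
qed

text \<open>Neither form involves z_4. Eliminating z_1 gives a binary quartic H in the ideal whose
  z_2^4-coefficient is nonzero by hypothesis, so z_2/z_3 is integral.\<close>

lemma not_nrm_cone:
 assumes n: "nrm (kk a * z1 ^ 2 + (kk b * z2 ^ 2 + kk c * z2 * z3 + kk d * z3 ^ 2))
   (z1 * (kk p * z2 + kk q * z3) + (kk r * z2 ^ 2 + kk s * z2 * z3 + kk t * z3 ^ 2))"
  and nz: "a \<noteq> 0" "a * r\<^sup>2 + b * p\<^sup>2 \<noteq> 0"
 shows False
proof -
 define m where "m = kk b * z2 ^ 2 + kk c * z2 * z3 + kk d * z3 ^ 2"
 define P where "P = kk p * z2 + kk q * z3"
 define Q where "Q = kk r * z2 ^ 2 + kk s * z2 * z3 + kk t * z3 ^ 2"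
 define f where "f = kk a * z1 ^ 2 + m"
 define g where "g = z1 * P + Q"
 note n = n[folded m_def P_def Q_def, folded f_def g_def]
 define H where "H = kk a * Q\<^sup>2 + m * P\<^sup>2"
 define h where "h i = (if i = 4 then a * r\<^sup>2 + b * p\<^sup>2 else if i = 3 then 2 * a * r * s + 2 * b * p * q + c * p\<^sup>2
  else if i = 2 then a * (s\<^sup>2 + 2 * r * t) + b * q\<^sup>2 + 2 * c * p * q + d * p\<^sup>2
  else if i = 1 then 2 * a * s * t + c * q\<^sup>2 + 2 * d * p * q else a * t\<^sup>2 + d * q\<^sup>2)" for i :: nat
 have H: "H = kk (h 4) * z2 ^ 4 + (\<Sum>i<4. kk (h i) * (z2 ^ i * z3 ^ (4 - i)))"
  unfolding H_def h_def m_def P_def Q_def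
  by (simp add: numeral_eq_Suc lessThan_Suc rhom_simps[OF rhom_const] algebra_simps)
 have zf: "zfree 1 m" "zfree 1 P" "zfree 1 Q" by (simp_all add: m_def P_def Q_def)
 have f: "f = kk a * z1 ^ 2 + z1 * 0 + m" by (simp add: f_def)
 have HI: "H \<in> idl {f, g}"
 proof -
  have "H = P\<^sup>2 * f - (kk a * (z1 * P - Q)) * g" unfolding H_def f_def g_def by (simp add: power2_eq_square algebra_simps)
  also have "\<dots> \<in> idl {f, g}" by (intro ispan_diff ispan_scale ispan_base) simp_all
  finally show ?thesis .
 qed
 have "nzd z3 (idl {f, g})"
 proof (rule nrm_nzd[OF n])
  show "nzd f (idl {z3})" unfolding f by (rule nzd_quadratic) (use nz zf in auto)
  show "nzd g (idl {f, z3})"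
  proof (rule nzd_resultant[OF f nz(1), where w = 0 and P = P and Q = Q])
   have "nzd (kk (h 4) * z2 ^ 4 + 0) (idl {z3})" by (rule nzd_monic) (use nz in \<open>auto simp: h_def intro: nzd_const\<close>)
   moreover have "(kk (h 4) * z2 ^ 4 + 0) - (kk a * Q\<^sup>2 - 0 * P * Q + m * P\<^sup>2) =
     (- (\<Sum>i<4. kk (h i) * (z2 ^ i * z3 ^ (3 - i)))) * z3"
    using H unfolding H_def by (simp add: numeral_eq_Suc lessThan_Suc algebra_simps)
   then have "(kk (h 4) * z2 ^ 4 + 0) - (kk a * Q\<^sup>2 - 0 * P * Q + m * P\<^sup>2) \<in> idl {z3}"
    by (simp only:) (intro ispan_scale ispan_base, simp)
   ultimately show "nzd (kk a * Q\<^sup>2 - 0 * P * Q + m * P\<^sup>2) (idl {z3})" by (rule nzd_cong[rotated])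
  qed (use zf in \<open>auto simp: g_def\<close>)
 qed simp
 moreover have "z2 ^ 4 + (\<Sum>i<4. kk (inverse (h 4) * h i) * (z2 ^ i * z3 ^ (4 - i))) = kk (inverse (h 4)) * H"
 proof -
  have "kk (inverse (h 4)) * kk (h 4) = 1" using nz by (simp add: h_def mpoly_const_mult[symmetric])
  then show ?thesis unfolding H by (simp add: distrib_left sum_distrib_left mpoly_const_mult mult.assoc[symmetric])
 qed
 then have "z2 ^ 4 + (\<Sum>i<4. kk (inverse (h 4) * h i) * (z2 ^ i * z3 ^ (4 - i))) \<in> idl {f, g}"
  using ispan_scale[OF HI] by simp
 ultimately obtain w where "z2 - z3 * w \<in> idl {f, g}" using nrm_int[OF n, of z3 4 z2 "\<lambda>i. kk (inverse (h 4) * h i)"] by auto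
 from degree1_multiple[OF n this hom_dt(1) hom_dt(1)] show False using var_not_multiple[of 2 3] by auto
qed

text \<open>A vanishing resultant is a relation between f and g that is linear in z_1 at the place
  of g. As a multiple of the Koszul relation it would have z_1-degree at least two there, unless it
  is zero, and then g = 0.\<close>

lemma not_nrm_cone_degenerate:
 assumes n: "nrm (kk a * z1 ^ 2 + m) (z1 * P + Q)" and zf: "zfree 1 m" "zfree 1 P" "zfree 1 Q"
  and nz: "a \<noteq> 0" and h: "kk a * Q\<^sup>2 + m * P\<^sup>2 = 0"
 shows False
proof -
 let ?f = "kk a * z1 ^ 2 + m" and ?g = "z1 * P + Q"
 have "P\<^sup>2 * ?f + (- (kk a * (z1 * P - Q))) * ?g = kk a * Q\<^sup>2 + m * P\<^sup>2" by (simp add: power2_eq_square algebra_simps)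
 then obtain w where w: "P\<^sup>2 = w * ?g" "- (kk a * (z1 * P - Q)) = - (w * ?f)" using nrm_reg[OF n] h by metis
 have g0: "?g \<noteq> 0" by (rule nrm_neq_0(2)[OF n])
 have zw: "zpoly 1 (w * ?f) = zpoly 1 w * [:m, 0, kk a:]"
  by (simp add: zpoly_simps zfree_zpoly zf power2_eq_square)
 have "zpoly 1 (w * ?f) = zpoly 1 (kk a * (z1 * P - Q))" using w(2) by simp
 also have "\<dots> = [:- (kk a * Q), kk a * P:]" by (simp add: zpoly_simps zfree_zpoly zf)
 finally have e: "zpoly 1 w * [:m, 0, kk a:] = [:- (kk a * Q), kk a * P:]" using zw by simp
 have "zpoly 1 w = 0"
 proof (rule ccontr)
  assume "zpoly 1 w \<noteq> 0"
  then have "pdeg (zpoly 1 w * [:m, 0, kk a:]) = pdeg (zpoly 1 w) + 2"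
   using nz by (subst degree_mult_eq) auto
  moreover have "pdeg [:- (kk a * Q), kk a * P:] \<le> 1" by (simp add: degree_pCons_le)
  ultimately show False using e by simp
 qed
 then have "w = 0" using poly_zpoly[of 1 w] by simp
 then have "P = 0" "kk a * Q = 0" using w by auto
 then show False using g0 nz by simp
qed

text \<open>With \<theta> a square root of d, f + \<theta> g = (a + b \<theta>)(z_1 + \<theta>
  z_2)^2 + (q1 + \<theta> q2), and the norm of q1 + \<theta> q2 is B^2 up to the constant e. Taking
  norms shows that u/B has a scalar square modulo (f, g), where u is the norm of z_1 + \<theta> z_2.
  At e_1 and e_2, u takes values incompatible with u being a multiple of B.\<close>

lemma not_nrm_split:
 assumes n: "nrm (kk a * (z1 ^ 2 + kk d * z2 ^ 2) + kk (2 * d * b) * z1 * z2 + q1)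
   (kk b * (z1 ^ 2 + kk d * z2 ^ 2) + kk (2 * a) * z1 * z2 + q2)"
  and nz: "a \<noteq> 0" "d \<noteq> 0" "a\<^sup>2 - d * b\<^sup>2 \<noteq> 0" "e \<noteq> 0"
  and q: "kk e * (q1\<^sup>2 - kk d * q2\<^sup>2) = B\<^sup>2" and B: "B \<noteq> 0"
  and zf: "zfree 1 q1" "zfree 1 q2" "zfree 1 B" "zfree 2 q1" "zfree 2 q2" "zfree 2 B"
  and hB: "hdeg dt 2 B"
  and av: "\<And>v. v 3 = 0 ==> v 4 = 0 ==> pt v B = 0 \<and> pt v q1 = 0 \<and> pt v q2 = 0"
 shows False
proof -
 define S1 where "S1 = kk a * (z1 ^ 2 + kk d * z2 ^ 2) + kk (2 * d * b) * z1 * z2"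
 define S2 where "S2 = kk b * (z1 ^ 2 + kk d * z2 ^ 2) + kk (2 * a) * z1 * z2"
 define f where "f = S1 + q1"
 define g where "g = S2 + q2"
 note n = n[folded S1_def S2_def, folded f_def g_def]
 define u where "u = z1 ^ 2 - kk d * z2 ^ 2"
 let ?N = "a\<^sup>2 - d * b\<^sup>2"
 define l where "l = kk (2 * d * b) * z2"
 define m where "m = kk (a * d) * z2 ^ 2 + q1"
 define c where "c = 2 * ?N / a"
 define P where "P = kk c * z2"
 define Q where "Q = q2 - kk (b / a) * q1"
 have zz: "zfree 1 l" "zfree 1 m" "zfree 1 P" "zfree 1 Q" using zf by (simp_all add: l_def m_def P_def Q_def)
 have f: "f = kk a * z1 ^ 2 + z1 * l + m"
  unfolding f_def S1_def l_def m_def by (simp add: mpoly_const_mult algebra_simps)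
 have g: "g = z1 * P + Q + kk (b / a) * f"
 proof -
  have 1: "kk (b / a) * kk a = kk b" using nz by (simp add: mpoly_const_mult[symmetric])
  have 2: "kk (2 * ?N / a) + kk (b / a) * kk (2 * d * b) = kk (2 * a)"
   using nz unfolding mpoly_const_mult[symmetric] mpoly_const_add[symmetric]
   by (simp add: field_simps power2_eq_square)
  have "z1 * P + Q + kk (b / a) * f = (kk (b / a) * kk a) * (z1 ^ 2 + kk d * z2 ^ 2) + (kk (2 * ?N / a) + kk (b / a) * kk (2 * d * b)) * z1 * z2 + q2"
   unfolding P_def Q_def f_def S1_def c_def by (simp add: algebra_simps)
  then show ?thesis unfolding 1 2 g_def S2_def by simp
 qed
 have "nzd B (idl {f, g})"
 proof (rule nrm_nzd[OF n B])
  show "nzd f (idl {B})" unfolding f by (rule nzd_quadratic) (use nz zf zz in auto)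
  show "nzd g (idl {f, B})"
  proof (rule nzd_resultant[OF f nz(1) g zz zf(3)])
   let ?c = "a * d * c\<^sup>2"
   have z: "zpoly 2 (kk a * Q\<^sup>2 - l * P * Q + m * P\<^sup>2) =
    [:kk a * Q\<^sup>2, 0, q1 * kk (c\<^sup>2) - kk (2 * d * b) * kk c * Q, 0, kk ?c:]"
   proof -
    have Q: "zfree 2 Q" using zf by (simp add: Q_def)
    have k: "zpoly 2 (kk y) = [:kk y:]" for y :: 'a by (rule zpoly_const)
    show ?thesis
     unfolding l_def P_def m_def
     by (simp add: zpoly_simps zfree_zpoly zf Q power2_eq_square mpoly_const_mult algebra_simps)
   qed
   have nc: "?c \<noteq> 0" using nz by (simp add: c_def)
   show "nzd (kk a * Q\<^sup>2 - l * P * Q + m * P\<^sup>2) (idl {B})"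
   proof (rule nzd_lead[where z = 2 and m = 4])
    show "cf 2 k (kk a * Q\<^sup>2 - l * P * Q + m * P\<^sup>2) = 0" if "k > 4" for k
     unfolding z using that by (simp add: coeff_pCons split: nat.splits)
    show "nzd (cf 2 4 (kk a * Q\<^sup>2 - l * P * Q + m * P\<^sup>2)) (idl {B})"
     unfolding z using nzd_const[OF nc] by (simp add: numeral_eq_Suc)
   qed (use zf in auto)
  qed
 qed
 moreover have "u\<^sup>2 + 0 * u * B + kk (- inverse (e * ?N)) * B\<^sup>2 \<in> idl {f, g}"
 proof -
  have S: "S1\<^sup>2 - kk d * S2\<^sup>2 = kk ?N * u\<^sup>2"
   unfolding S1_def S2_def u_def by (simp add: rhom_simps[OF rhom_const] power2_eq_square algebra_simps)
  have "kk (inverse (e * ?N)) * (kk e * ((S1 - q1) * f - (kk d * (S2 - q2)) * g)) \<in> idl {f, g}"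
   by (intro ispan_scale ispan_diff ispan_base) simp_all
  also have "kk e * ((S1 - q1) * f - (kk d * (S2 - q2)) * g) = kk e * (S1\<^sup>2 - kk d * S2\<^sup>2) - kk e * (q1\<^sup>2 - kk d * q2\<^sup>2)"
   unfolding f_def g_def by (simp add: power2_eq_square algebra_simps)
  also have "kk (inverse (e * ?N)) * (kk e * (S1\<^sup>2 - kk d * S2\<^sup>2) - kk e * (q1\<^sup>2 - kk d * q2\<^sup>2)) =
    (kk (inverse (e * ?N)) * kk e * kk ?N) * u\<^sup>2 - kk (inverse (e * ?N)) * B\<^sup>2"
   unfolding S q by (simp add: algebra_simps)
  also have "kk (inverse (e * ?N)) * kk e * kk ?N = 1"
  proof -
   have "inverse (e * ?N) * e * ?N = 1" using nz left_inverse[of "e * ?N"] by (metis mult.assoc mult_eq_0_iff)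
   then show ?thesis by (simp only: mpoly_const_mult[symmetric] rhom_1[OF rhom_const])
  qed
  finally show ?thesis by (simp add: rhom_minus[OF rhom_const])
 qed
 ultimately obtain r where "u - B * r \<in> idl {f, g}" using nrm_int2[OF n] by blast
 moreover have "hdeg dt 2 u" by (simp add: u_def hdeg_simps)
 ultimately obtain s x y where w: "u = B * s + kk x * f + kk y * g"
  using degree2_multiple[OF n _ _ hB, of u r] by auto
 have A: "pt v u = pt v B * pt v s + x * pt v f + y * pt v g" for v by (subst w) (simp add: pt_simps)
 have h: "x * a + y * b = 1" "- d = x * (a * d) + y * (b * d)"
  using A[of "\<lambda>i. if i = 1 then 1 else 0"] A[of "\<lambda>i. if i = 2 then 1 else 0"]
   av[of "\<lambda>i. if i = 1 then 1 else 0"] av[of "\<lambda>i. if i = 2 then 1 else 0"]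
  unfolding u_def f_def g_def S1_def S2_def by (simp_all add: pt_simps)
 have "- d = d * (x * a + y * b)" by (subst h(2)) (simp add: algebra_simps)
 then show False using h(1) nz(2) by simp
qed

text \<open>With \<theta> a square root of d, f + \<theta> g = (z_1 - \<theta> z_2)^2 + (a + b
  \<theta>)(z_1 + \<theta> z_2)(z_3 + \<theta> z_4). Multiplying by the conjugate relation gives u^2
  = (a^2 - d b^2) u w modulo (f, g) for the norms u and w of the last two linear forms, so u/w is
  integral.\<close>

lemma not_nrm_cubic:
 fixes a b d :: "'a::field_char_0"
 assumes n: "nrm (z1 ^ 2 + kk d * z2 ^ 2 + kk a * (z1 * z3 + kk d * z2 * z4) + kk (d * b) * (z1 * z4 + z2 * z3))
   (kk b * (z1 * z3 + kk d * z2 * z4) + kk a * (z1 * z4 + z2 * z3) - 2 * z1 * z2)"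
  and nz: "d \<noteq> 0"
 shows False
proof -
 define s where "s = z1 * z3 + kk d * z2 * z4"
 define t :: "'a poly4" where "t = z1 * z4 + z2 * z3"
 define m1 where "m1 = kk a * s + kk (d * b) * t"
 define m2 where "m2 = kk b * s + kk a * t"
 define f where "f = z1 ^ 2 + kk d * z2 ^ 2 + m1"
 define g where "g = m2 - 2 * z1 * z2"
 have fg: "nrm f g" using n unfolding f_def g_def m1_def m2_def s_def t_def by (simp add: add.assoc)
 define u where "u = z1 ^ 2 - kk d * z2 ^ 2"
 define w where "w = z3 ^ 2 - kk d * z4 ^ 2"
 define l where "l = kk a * z3 + kk (d * b) * z4"
 define m where "m = kk d * z2 ^ 2 + z2 * (kk (d * a) * z4 + kk (d * b) * z3)"
 define P where "P = kk b * z3 + kk a * z4 - 2 * z2"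
 define Q where "Q = z2 * (kk (d * b) * z4 + kk a * z3)"
 have zz: "zfree 1 l" "zfree 1 m" "zfree 1 P" "zfree 1 Q" "zfree 1 w"
  by (simp_all add: l_def m_def P_def Q_def w_def)
 have f: "f = kk 1 * z1 ^ 2 + z1 * l + m"
  unfolding f_def m1_def s_def t_def l_def m_def by (simp add: mpoly_const_mult algebra_simps)
 have g: "g = z1 * P + Q + 0 * f"
  unfolding g_def m2_def s_def t_def P_def Q_def by (simp add: mpoly_const_mult algebra_simps)
 have w0: "w \<noteq> 0"
 proof
  assume "w = 0"
  then have "pt (\<lambda>i. if i = 3 then 1 else 0) w = 0" by (simp add: pt_simps)
  then show False by (simp add: w_def pt_simps)
 qed
 have "nzd w (idl {f, g})"
 proof (rule nrm_nzd[OF fg w0])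
  show "nzd f (idl {w})" unfolding f by (rule nzd_quadratic) (use zz in auto)
  show "nzd g (idl {f, w})"
  proof (rule nzd_resultant[OF f _ g zz])
   define k where "k = kk b * z3 + kk a * z4"
   define j where "j = kk (d * b) * z4 + kk a * z3"
   define i where "i = kk (d * a) * z4 + kk (d * b) * z3"
   have zf: "zpoly 2 l = [:l:]" "zpoly 2 k = [:k:]" "zpoly 2 j = [:j:]" "zpoly 2 i = [:i:]"
    by (rule zfree_zpoly; simp add: l_def k_def j_def i_def)+
   have z: "zpoly 2 (kk 1 * Q\<^sup>2 - l * P * Q + m * P\<^sup>2) =
    [:0, i * k\<^sup>2 - l * k * j, j\<^sup>2 + 2 * l * j + kk d * k\<^sup>2 - 4 * i * k, 4 * i - 4 * kk d * k, kk (4 * d):]"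
    unfolding P_def Q_def m_def k_def[symmetric] j_def[symmetric] i_def[symmetric]
    by (simp add: zpoly_simps zf power2_eq_square mpoly_const_mult rhom_numeral[OF rhom_const] numeral_poly algebra_simps)
   have nc: "4 * d \<noteq> 0" using nz by simp
   show "nzd (kk 1 * Q\<^sup>2 - l * P * Q + m * P\<^sup>2) (idl {w})"
   proof (rule nzd_lead[where z = 2 and m = 4])
    show "cf 2 k (kk 1 * Q\<^sup>2 - l * P * Q + m * P\<^sup>2) = 0" if "k > 4" for k
     unfolding z using that by (simp add: coeff_pCons split: nat.splits)
    show "nzd (cf 2 4 (kk 1 * Q\<^sup>2 - l * P * Q + m * P\<^sup>2)) (idl {w})"
     unfolding z using nzd_const[OF nc] by (simp add: numeral_eq_Suc)
   qed (auto simp: w_def)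
  qed simp
 qed
 moreover have "u\<^sup>2 + kk (- (a\<^sup>2 - d * b\<^sup>2)) * u * w + 0 * w\<^sup>2 \<in> idl {f, g}"
 proof -
  have "u\<^sup>2 + kk (- (a\<^sup>2 - d * b\<^sup>2)) * u * w + 0 * w\<^sup>2 = (z1 ^ 2 + kk d * z2 ^ 2 - m1) * f - (kk d * (- 2 * z1 * z2 - m2)) * g"
   unfolding f_def g_def u_def w_def m1_def m2_def s_def t_def
   by (simp add: rhom_simps[OF rhom_const] power2_eq_square algebra_simps)
  also have "\<dots> \<in> idl {f, g}" by (intro ispan_diff ispan_scale ispan_base) simp_all
  finally show ?thesis .
 qed
 ultimately obtain r where "u - w * r \<in> idl {f, g}" using nrm_int2[OF fg] by blast
 moreover have "hdeg dt 2 u" "hdeg dt 2 w" by (simp_all add: u_def w_def hdeg_simps)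
 ultimately obtain c x y where ww: "u = w * c + kk x * f + kk y * g"
  using degree2_multiple[OF fg, of u w r 2] by auto
 have A: "pt v u = pt v w * pt v c + x * pt v f + y * pt v g" for v by (subst ww) (simp add: pt_simps)
 show False
  using A[of "\<lambda>i. if i = 1 then 1 else 0"] A[of "\<lambda>i. if i = 2 then 1 else 0"] nz
  unfolding u_def w_def f_def g_def m1_def m2_def s_def t_def by (simp add: pt_simps)
qed

abbreviation en :: "'a ^ 'n ^ 'm \<Rightarrow> 'm \<Rightarrow> 'n \<Rightarrow> 'a" where "en M i j \<equiv> vec_nth (vec_nth M i) j"

section \<open>Quadratic forms, frames and Gram matrices\<close>

section \<open>Quadratic forms and bases\<close>

definition dot :: "'a::comm_ring_1 ^ 4 \<Rightarrow> 'a ^ 4 \<Rightarrow> 'a" where "dot v w = (\<Sum>i\<in>UNIV. vec_nth v i * vec_nth w i)"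
definition bl :: "'a::comm_ring_1 ^ 4 ^ 4 \<Rightarrow> 'a ^ 4 \<Rightarrow> 'a ^ 4 \<Rightarrow> 'a" where "bl M v w = dot v (M *v w)"
definition pm :: "'a::comm_ring_1 \<Rightarrow> 'a ^ 4 ^ 4 \<Rightarrow> 'a \<Rightarrow> 'a ^ 4 ^ 4 \<Rightarrow> 'a ^ 4 ^ 4" where
 "pm a A b C = (\<chi> i j. a * en A i j + b * en C i j)"
definition qf :: "'a::comm_ring_1 ^ 4 ^ 4 \<Rightarrow> 'a poly4" where
 "qf M = (\<Sum>i\<in>UNIV. \<Sum>j\<in>UNIV. kk (en M i j) * (mpv i * mpv j))"
definition fr :: "'v \<Rightarrow> 'v \<Rightarrow> 'v \<Rightarrow> 'v \<Rightarrow> 4 \<Rightarrow> 'v" where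
 "fr a b c d i = (if i = 1 then a else if i = 2 then b else if i = 3 then c else d)"
definition gr :: "'a::comm_ring_1 ^ 4 ^ 4 \<Rightarrow> 'a ^ 4 \<Rightarrow> 'a ^ 4 \<Rightarrow> 'a ^ 4 \<Rightarrow> 'a ^ 4 \<Rightarrow> 'a ^ 4 ^ 4" where
 "gr M a b c d = (\<chi> i j. bl M (fr a b c d i) (fr a b c d j))"
definition indep4 :: "'a::comm_ring_1 ^ 4 \<Rightarrow> 'a ^ 4 \<Rightarrow> 'a ^ 4 \<Rightarrow> 'a ^ 4 \<Rightarrow> bool" where
 "indep4 a b c d \<longleftrightarrow> (\<forall>p q r s. p *s a + q *s b + r *s c + s *s d = 0 \<longrightarrow> p = 0 \<and> q = 0 \<and> r = 0 \<and> s = 0)"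
definition indep2 :: "'a::comm_ring_1 ^ 4 \<Rightarrow> 'a ^ 4 \<Rightarrow> bool" where
 "indep2 a b \<longleftrightarrow> (\<forall>p q. p *s a + q *s b = 0 \<longrightarrow> p = 0 \<and> q = 0)"

abbreviation symm :: "'a ^ 4 ^ 4 \<Rightarrow> bool" where "symm A \<equiv> transpose A = A"

lemma fr_simps [simp]: "fr a b c d 1 = a" "fr a b c d 2 = b" "fr a b c d 3 = c" "fr a b c d 4 = d"
 by (simp_all add: fr_def)

lemma dot_simps [simp]:
 "dot (u + v) w = dot u w + dot v w" "dot (x *s u) w = x * dot u w"
 "dot w (u + v) = dot w u + dot w v" "dot w (x *s u) = x * dot w u" "dot 0 w = 0" "dot w 0 = 0"
 "dot (u - v) w = dot u w - dot v w" "dot w (u - v) = dot w u - dot w v" "dot (- u) w = - dot u w"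
 by (simp_all add: dot_def sum_4 algebra_simps)

lemma mv_simps [simp]:
 "M *v (u + v) = M *v u + M *v v" "M *v (x *s u) = x *s (M *v u)" "M *v (u - v) = M *v u - M *v v"
 for M :: "'a::comm_ring_1 ^ 4 ^ 4"
 by (simp_all add: matrix_vector_mult_def vec_eq_iff sum_4 algebra_simps)

lemma bl_simps [simp]:
 "bl M (u + v) w = bl M u w + bl M v w" "bl M (x *s u) w = x * bl M u w"
 "bl M w (u + v) = bl M w u + bl M w v" "bl M w (x *s u) = x * bl M w u" "bl M 0 w = 0" "bl M w 0 = 0"
 "bl M (u - v) w = bl M u w - bl M v w" "bl M w (u - v) = bl M w u - bl M w v"
 by (simp_all add: bl_def)

lemma bl_sym: "symm M ==> bl M u v = bl M v u"
proof -
 assume s: "symm M"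
 have "en M i j = en M j i" for i j by (subst s[symmetric]) (simp add: transpose_def)
 then show ?thesis unfolding bl_def dot_def matrix_vector_mult_def
  by (simp add: sum_distrib_left) (subst sum.swap, simp add: mult_ac)
qed

lemma bl_pm [simp]: "bl (pm a A b C) u v = a * bl A u v + b * bl C u v"
 by (simp add: bl_def dot_def matrix_vector_mult_def pm_def sum_4 algebra_simps)

lemma symm_pm: "symm A ==> symm C ==> symm (pm a A b C)"
 by (simp add: vec_eq_iff transpose_def pm_def)

lemma dot_axis: "dot (axis i 1) v = vec_nth v i" "dot v (axis i 1) = vec_nth v i"
 unfolding dot_def axis_def by (simp_all add: if_distrib[of "\<lambda>x. x * _"] if_distrib[of "\<lambda>x. _ * x"] cong: if_cong)

lemma dot_eq_0: "(\<And>u. dot u v = 0) ==> v = 0"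
 by (simp add: vec_eq_iff) (metis dot_axis(1))

lemma bl_ker: "M *v z = 0 ==> bl M u z = 0" by (simp add: bl_def)

lemma bl_axis: "bl M (axis i 1) (axis j 1) = en M i j"
proof -
 have "M *v axis j 1 = (\<chi> i. en M i j)"
  by (simp add: matrix_vector_mult_def axis_def vec_eq_iff if_distrib[of "\<lambda>x. _ * x"] cong: if_cong)
 then show ?thesis by (simp add: bl_def dot_axis)
qed

lemma gr_simps: "en (gr M a b c d) i j = bl M (fr a b c d i) (fr a b c d j)" by (simp add: gr_def)

lemma qf_symm:
 assumes "symm M"
 shows "qf M = kk (en M 1 1) * z1 ^ 2 + kk (en M 2 2) * z2 ^ 2 + kk (en M 3 3) * z3 ^ 2 + kk (en M 4 4) * z4 ^ 2 +
  kk (2 * en M 1 2) * (z1 * z2) + kk (2 * en M 1 3) * (z1 * z3) + kk (2 * en M 1 4) * (z1 * z4) +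
  kk (2 * en M 2 3) * (z2 * z3) + kk (2 * en M 2 4) * (z2 * z4) + kk (2 * en M 3 4) * (z3 * z4)"
proof -
 have "en M i j = en M j i" for i j by (subst assms[symmetric]) (simp add: transpose_def)
 then have "en M 2 1 = en M 1 2" "en M 3 1 = en M 1 3" "en M 4 1 = en M 1 4" "en M 3 2 = en M 2 3" "en M 4 2 = en M 2 4" "en M 4 3 = en M 3 4" by auto
 then show ?thesis
  by (simp add: qf_def sum_4 rhom_mult[OF rhom_const] rhom_numeral[OF rhom_const] power2_eq_square algebra_simps)
qed

lemma symm_gr: "symm M ==> symm (gr M a b c d)"
 using bl_sym[of M] by (simp add: vec_eq_iff transpose_def gr_simps)

lemma hom_qf: "hdeg dt 2 (qf M)"
 unfolding qf_def by (intro hdeg_sum) (simp add: hdeg_simps)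

lemma qf_pm: "qf (pm a A b C) = kk a * qf A + kk b * qf C"
 by (simp add: qf_def pm_def sum_distrib_left sum.distrib rhom_simps[OF rhom_const] algebra_simps)

lemma dt_Suc:
 assumes "dt m = Suc k" shows "\<exists>i m'. m = m' + pms i 1 \<and> dt m' = k"
proof -
 obtain i where i: "pml m i > 0" using assms unfolding dt_def by (metis gr0I sum.neutral nat.distinct(1))
 have i1: "m = (m - pms i 1) + pms i 1"
  using i by (intro poly_mapping_eqI) (auto simp: lookup_add lookup_minus lookup_single when_def)
 have "dt m = dt (m - pms i 1) + dt (pms i 1)"
  by (subst i1) (simp add: dt_def lookup_add sum.distrib)
 also have "dt (pms i 1) = 1" by (simp add: dt_def lookup_single when_def)
 finally show ?thesis using i1 assms by auto
qed

lemma quadratic_form: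
 fixes f :: "'a::field_char_0 poly4"
 assumes "hdeg dt 2 f" shows "\<exists>M. symm M \<and> f = qf M"
proof -
 have single: "\<exists>M. symm M \<and> pms m c = qf M" if m: "dt m = 2" for m :: "4 \<Rightarrow>\<^sub>0 nat" and c :: 'a
 proof -
  obtain i m' where i1: "m = m' + pms i 1" and "dt m' = Suc 0"
   using dt_Suc[of m "Suc 0"] m by (auto simp: numeral_2_eq_2)
  then obtain j m'' where m': "m' = m'' + pms j 1" and m'': "dt m'' = 0" using dt_Suc by blast
  have "m'' = 0" using m'' by (intro poly_mapping_eqI) (simp add: dt_def)
  then have j: "m' = pms j 1" using m' by simp
  define M :: "'a ^ 4 ^ 4" where "M = (\<chi> p q. (if p = i \<and> q = j then c / 2 else 0) + (if p = j \<and> q = i then c / 2 else 0))"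
  have t: "(\<Sum>p\<in>UNIV. \<Sum>q\<in>UNIV. kk (if p = i \<and> q = j then c / 2 else 0) * (mpv p * mpv q)) =
    kk (c / 2) * (mpv i * mpv j :: 'a poly4)" for i j
  proof -
   have "(\<Sum>q\<in>UNIV. kk (if p = i \<and> q = j then c / 2 else 0) * (mpv p * mpv q)) =
    (if p = i then kk (c / 2) * (mpv i * mpv j) else (0 :: 'a poly4))" for p
    by (auto simp: if_distrib[of kk] if_distrib[of "\<lambda>x. x * _"] rhom_0[OF rhom_const] cong: if_cong)
   then show ?thesis by simp
  qed
  have "qf M = kk (c / 2) * (mpv i * mpv j) + kk (c / 2) * (mpv j * mpv i)"
   unfolding qf_def M_def by (simp add: rhom_add[OF rhom_const] distrib_right sum.distrib t)
  also have "\<dots> = (kk (c / 2) + kk (c / 2)) * (mpv j * mpv i)" by (simp add: algebra_simps)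
  also have "kk (c / 2) + kk (c / 2) = kk c" by (simp add: mpoly_const_add[symmetric])
  also have "kk c * (mpv j * mpv i) = pms m c"
   by (subst i1) (simp add: j mpoly_const_def mpoly_var_def mult_single)
  finally have "pms m c = qf M" ..
  moreover have "symm M" unfolding M_def transpose_def by (simp add: vec_eq_iff add.commute conj_commute)
  ultimately show ?thesis by blast
 qed
 have "\<exists>M. symm M \<and> (\<Sum>m\<in>A. pms m (pml f m)) = qf M"
  if "finite A" "A \<subseteq> pmk f" for A
  using that
 proof (induction A)
  case empty
  have "qf (0 :: 'a ^ 4 ^ 4) = 0" by (simp add: qf_def rhom_0[OF rhom_const])
  then show ?case by (intro exI[of _ 0]) (simp add: vec_eq_iff transpose_def)
 next
  case (insert m A)
  then obtain M where M: "symm M" "(\<Sum>m\<in>A. pms m (pml f m)) = qf M" by auto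
  have "dt m = 2" using insert assms by (auto simp: hdeg_def)
  then obtain N where N: "symm N" "pms m (pml f m) = qf N" using single by blast
  show ?case
   using insert.hyps M N by (intro exI[of _ "pm 1 N 1 M"]) (simp add: symm_pm qf_pm rhom_1[OF rhom_const])
 qed
 from this[OF finite_keys order_refl] show ?thesis using poly_mapping_eq_sum[of f] by metis
qed

lemma sum_swap3: "(\<Sum>i\<in>A. \<Sum>j\<in>B. \<Sum>p\<in>C. h i j p) = (\<Sum>p\<in>C. \<Sum>i\<in>A. \<Sum>j\<in>B. h i j p)"
proof -
 have "(\<Sum>i\<in>A. \<Sum>j\<in>B. \<Sum>p\<in>C. h i j p) = (\<Sum>i\<in>A. \<Sum>p\<in>C. \<Sum>j\<in>B. h i j p)" by (intro sum.cong refl sum.swap)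
 also have "\<dots> = (\<Sum>p\<in>C. \<Sum>i\<in>A. \<Sum>j\<in>B. h i j p)" by (rule sum.swap)
 finally show ?thesis .
qed

text \<open>Coordinates relative to a frame turn a form into that of its Gram matrix, so normal
  forms of a pencil become statements about \<open>bl\<close> on well chosen vectors.\<close>

lemma lin_qf: "lin (\<lambda>i j. vec_nth (fr a b c d j) i) (qf M) = qf (gr M a b c d)"
proof -
 let ?e = "fr a b c d"
 have e: "lin (\<lambda>i j. vec_nth (?e j) i) (mpv i * mpv j) =
  (\<Sum>p\<in>UNIV. \<Sum>q\<in>UNIV. kk (vec_nth (?e p) i * vec_nth (?e q) j) * (mpv p * mpv q))" for i j
  unfolding rhom_mult[OF rhom_lin] lin_simps sum_product
  by (intro sum.cong refl) (simp add: rhom_mult[OF rhom_const] mult_ac)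
 have "lin (\<lambda>i j. vec_nth (?e j) i) (qf M) =
  (\<Sum>i\<in>UNIV. \<Sum>j\<in>UNIV. \<Sum>p\<in>UNIV. \<Sum>q\<in>UNIV. kk (en M i j * vec_nth (?e p) i * vec_nth (?e q) j) * (mpv p * mpv q))"
  unfolding qf_def rhom_sum[OF rhom_lin] rhom_mult[OF rhom_lin, where a = "kk c" for c] lin_simps(1) e sum_distrib_left
  by (intro sum.cong refl) (simp add: rhom_mult[OF rhom_const] mult_ac)
 also have "\<dots> = (\<Sum>p\<in>UNIV. \<Sum>q\<in>UNIV. \<Sum>i\<in>UNIV. \<Sum>j\<in>UNIV. kk (en M i j * vec_nth (?e p) i * vec_nth (?e q) j) * (mpv p * mpv q))"
  by (subst sum_swap3, rule sum.cong[OF refl], rule sum_swap3)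
 also have "\<dots> = qf (gr M a b c d)"
  unfolding qf_def gr_simps bl_def dot_def matrix_vector_mult_def
  by (simp add: sum_distrib_left sum_distrib_right rhom_sum[OF rhom_const] mult_ac)
 finally show ?thesis .
qed

lemma indep4_inverses:
 fixes a b c d :: "'a::field ^ 4"
 assumes "indep4 a b c d" shows "\<exists>W. inverses (\<lambda>i j. vec_nth (fr a b c d j) i) W"
proof -
 define V :: "'a ^ 4 ^ 4" where "V = (\<chi> i j. vec_nth (fr a b c d j) i)"
 have "x = 0" if "V *v x = 0" for x
 proof -
  have "V *v x = vec_nth x 1 *s a + vec_nth x 2 *s b + vec_nth x 3 *s c + vec_nth x 4 *s d"
   by (simp add: V_def matrix_vector_mult_def vec_eq_iff sum_4 mult.commute)
  then have "vec_nth x 1 *s a + vec_nth x 2 *s b + vec_nth x 3 *s c + vec_nth x 4 *s d = 0" using that by simp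
  from assms[unfolded indep4_def, rule_format, OF this] show ?thesis unfolding vec_eq_iff forall_4 by simp
 qed
 then obtain W where W: "W ** V = mat 1" using matrix_left_invertible_ker by blast
 then have "V ** W = mat 1" by (simp add: matrix_left_right_inverse)
 then have "inverses (\<lambda>i j. en V i j) (\<lambda>i j. en W i j)"
  using W by (simp add: inverses_def matrix_matrix_mult_def mat_def vec_eq_iff)
 then show ?thesis unfolding V_def by auto
qed

lemma nrm_lin:
 assumes VW: "inverses V W" and n: "nrm f g" and h: "hdeg dt 2 (lin V f)" "hdeg dt 2 (lin V g)"
 shows "nrm (lin V f) (lin V g)"
proof -
 let ?J = "idl {f, g}" and ?J' = "idl {lin V f, lin V g}"
 have WV: "inverses W V" using VW by (simp add: inverses_sym)
 note VW = lin_lin[OF VW] and WV = lin_lin[OF WV] and hV = rhom_simps[OF rhom_lin[of V]] and hW = rhom_simps[OF rhom_lin[of W]]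
 have i: "lin W b \<in> ?J" if "b \<in> ?J'" for b
  by (rule idl_image[OF rhom_lin _ that]) (auto simp: WV intro: ispan_base)
 have i': "lin V b \<in> ?J'" if "b \<in> ?J" for b
  by (rule idl_image[OF rhom_lin _ that]) (auto intro: ispan_base)
 have inj: "lin W a = lin W b ==> a = b" for a b using VW by metis
 show ?thesis
  unfolding nrm_def
 proof (intro conjI allI impI h)
  fix u v assume "u * lin V f + v * lin V g = 0"
  then have "lin W (u * lin V f + v * lin V g) = 0" by (simp add: hW)
  then have "lin W u * f + lin W v * g = 0" by (simp add: hW WV)
  then obtain w where "lin W u = w * g" "lin W v = - (w * f)" using nrm_reg[OF n] by blast
  then have "lin V (lin W u) = lin V w * lin V g" "lin V (lin W v) = - (lin V w * lin V f)" by (simp_all add: hV)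
  then show "\<exists>w. u = w * lin V g \<and> v = - (w * lin V f)" unfolding VW by blast
 next
  fix a and k :: nat assume "a ^ k \<in> ?J'"
  then have "lin W a ^ k \<in> ?J" using i by (metis rhom_power[OF rhom_lin])
  then have "lin W a \<in> ?J" by (rule nrm_red[OF n])
  from i'[OF this] show "a \<in> ?J'" by (simp add: VW)
 next
  fix a b k c assume b: "nzd b ?J'" and "k > 0" and "a ^ k + (\<Sum>i<k. c i * (a ^ i * b ^ (k - i))) \<in> ?J'"
  then have "lin W a ^ k + (\<Sum>i<k. lin W (c i) * (lin W a ^ i * lin W b ^ (k - i))) \<in> ?J" using i[of "a ^ k + (\<Sum>i<k. c i * (a ^ i * b ^ (k - i)))"] by (simp add: hW)
  moreover have "nzd (lin W b) ?J" unfolding nzd_def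
  proof (intro allI impI)
   fix u assume "lin W b * u \<in> ?J"
   from i'[OF this] have "b * lin V u \<in> ?J'" by (simp add: hV VW)
   then have "lin V u \<in> ?J'" using b by (simp add: nzd_def)
   from i[OF this] show "u \<in> ?J" by (simp add: WV)
  qed
  ultimately obtain r where "lin W a - lin W b * r \<in> ?J" using nrm_int[OF n _ \<open>k > 0\<close>, of "lin W b" "lin W a" "\<lambda>i. lin W (c i)"] by blast
  from i'[OF this] have "a - b * lin V r \<in> ?J'" by (simp add: hV VW)
  then show "\<exists>r. a - b * r \<in> ?J'" by blast
 qed
qed

lemma nrm_gr:
 assumes "nrm (qf A) (qf C)" "indep4 a b c d" shows "nrm (qf (gr A a b c d)) (qf (gr C a b c d))"
proof -
 obtain W where "inverses (\<lambda>i j. vec_nth (fr a b c d j) i) W" using indep4_inverses[OF assms(2)] by blast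
 from nrm_lin[OF this assms(1)] show ?thesis by (simp add: lin_qf hom_qf)
qed

lemma nrm_pencil:
 fixes s t u v :: "'a::field_char_0"
 assumes n: "nrm f g" and d: "s * v - t * u \<noteq> 0"
 shows "nrm (kk s * f + kk t * g) (kk u * f + kk v * g)" (is "nrm ?f ?g")
proof -
 have J: "idl {?f, ?g} = idl {f, g}" by (rule idl_pencil[OF d])
 have "hdeg dt 2 (kk c * h)" if "hdeg dt 2 h" for c :: 'a and h
  using hdeg_mult[OF graded_dt hom_dt(2) that, of c] by (simp only: add_0)
 then have "hdeg dt 2 ?f" "hdeg dt 2 ?g" using nrm_hom[OF n] by (simp_all add: hdeg_add)
 moreover have "\<exists>w. x = w * ?g \<and> y = - (w * ?f)" if xy: "x * ?f + y * ?g = 0" for x y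
 proof -
  have "(kk s * x + kk u * y) * f + (kk t * x + kk v * y) * g = 0" using xy by (simp add: algebra_simps)
  then obtain w where w: "kk s * x + kk u * y = w * g" "kk t * x + kk v * y = - (w * f)" using nrm_reg[OF n] by blast
  define e where "e = inverse (s * v - t * u)"
  have e: "kk e * (kk s * kk v - kk t * kk u) = 1"
   using d by (simp add: e_def rhom_mult[OF rhom_const, symmetric] rhom_diff[OF rhom_const, symmetric] rhom_1[OF rhom_const])
  have "x = kk e * (kk s * kk v - kk t * kk u) * x" "y = kk e * (kk s * kk v - kk t * kk u) * y" using e by simp_all
  moreover have "kk e * (kk s * kk v - kk t * kk u) * x = kk e * (kk v * (kk s * x + kk u * y) - kk u * (kk t * x + kk v * y))"
   "kk e * (kk s * kk v - kk t * kk u) * y = kk e * (kk s * (kk t * x + kk v * y) - kk t * (kk s * x + kk u * y))"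
   by (simp_all add: algebra_simps)
  ultimately have "x = kk e * (kk v * (w * g) - kk u * (- (w * f)))" "y = kk e * (kk s * (- (w * f)) - kk t * (w * g))"
   unfolding w by simp_all
  then have "x = kk e * w * ?g" "y = - (kk e * w * ?f)" by (simp_all only:) (simp_all add: algebra_simps)
  then show ?thesis by blast
 qed
 ultimately show ?thesis using n unfolding nrm_def J by blast
qed

lemma nrm_pm:
 "nrm (qf A) (qf C) ==> s * v - t * u \<noteq> 0 ==> nrm (qf (pm s A t C)) (qf (pm u A v C))"
 for s :: "'a::field_char_0"
 unfolding qf_pm by (rule nrm_pencil)

text \<open>n is a kernel vector of the matrix with rows a, b, c, c, which is singular because of
  the repeated row. The vector d, where n takes the value 1, then serves to extend independent
  systems.\<close>

lemma dot_step: "\<exists>n d. dot n a = 0 \<and> dot n b = 0 \<and> dot n c = 0 \<and> dot n d = 1" for a b c :: "'a::field_char_0 ^ 4"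
proof -
 define M :: "'a ^ 4 ^ 4" where "M = (\<chi> i. fr a b c c i)"
 have "row 3 M = row 4 M" by (simp add: row_def M_def)
 then have "det M = 0" by (rule det_identical_rows[rotated]) simp
 then obtain n where n: "n \<noteq> 0" "M *v n = 0"
  using matrix_left_invertible_ker[of M] invertible_left_inverse[of M] invertible_det_nz[of M] by auto
 then obtain i where i: "vec_nth n i \<noteq> 0" by (auto simp: vec_eq_iff)
 have "dot n (fr a b c c j) = vec_nth (M *v n) j" for j
  by (simp add: M_def dot_def matrix_vector_mult_def mult.commute)
 from this[of 1] this[of 2] this[of 3] have "dot n a = 0" "dot n b = 0" "dot n c = 0" using n by simp_all
 moreover have "dot n (inverse (vec_nth n i) *s axis i 1) = 1" using i by (simp add: dot_axis)
 ultimately show ?thesis by blast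
qed

lemma indep4_extend: 
 fixes a b c :: "'a::field_char_0 ^ 4"
 assumes "\<And>p q r. p *s a + q *s b + r *s c = 0 ==> p = 0 \<and> q = 0 \<and> r = 0" shows "\<exists>d. indep4 a b c d"
proof -
 obtain n d where n: "dot n a = 0" "dot n b = 0" "dot n c = 0" "dot n d = 1" using dot_step by blast
 have "indep4 a b c d" unfolding indep4_def
 proof (intro allI impI)
  fix p q r s assume e: "p *s a + q *s b + r *s c + s *s d = 0"
  have "dot n (p *s a + q *s b + r *s c + s *s d) = s" by (simp add: n)
  then have "s = 0" using e by simp
  then show "p = 0 \<and> q = 0 \<and> r = 0 \<and> s = 0" using assms[of p q r] e by simp
 qed
 then show ?thesis by blast
qed

lemma indep2_extend: 
 fixes a b :: "'a::field_char_0 ^ 4"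
 assumes "indep2 a b" shows "\<exists>c d. indep4 a b c d"
proof -
 obtain n c where n: "dot n a = 0" "dot n b = 0" "dot n c = 1" using dot_step[of a b b] by blast
 have "\<exists>d. indep4 a b c d"
 proof (rule indep4_extend)
  fix p q r assume e: "p *s a + q *s b + r *s c = 0"
  have "dot n (p *s a + q *s b + r *s c) = r" by (simp add: n)
  then have "r = 0" using e by simp
  then show "p = 0 \<and> q = 0 \<and> r = 0" using assms e by (simp add: indep2_def)
 qed
 then show ?thesis by blast
qed

lemma indep1_extend: 
 fixes a :: "'a::field_char_0 ^ 4"
 assumes "a \<noteq> 0" shows "\<exists>b c d. indep4 a b c d"
proof -
 obtain n b where n: "dot n a = 0" "dot n b = 1" using dot_step[of a a a] by blast
 have "indep2 a b" unfolding indep2_def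
 proof (intro allI impI)
  fix p q assume e: "p *s a + q *s b = 0"
  have "dot n (p *s a + q *s b) = q" by (simp add: n)
  then have "q = 0" using e by simp
  then show "p = 0 \<and> q = 0" using assms e by (auto simp: vec_eq_iff)
 qed
 then show ?thesis using indep2_extend by blast
qed

lemma indep4_rot: "indep4 a b c d ==> indep4 b c d a"
 unfolding indep4_def
proof (intro allI impI, goal_cases)
 case (1 p q r s)
 have "s *s a + p *s b + q *s c + r *s d = 0" using 1(2) by (simp add: add_ac)
 then show ?case using 1(1) by blast
qed

lemma indep4_rot2: "indep4 a b c d ==> indep4 c d a b"
 and indep4_rot3: "indep4 a b c d ==> indep4 d a b c"
 by (rule indep4_rot[OF indep4_rot], assumption) (rule indep4_rot[OF indep4_rot[OF indep4_rot]], assumption)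

lemma indep4_swap: "indep4 a b c d ==> indep4 b a c d"
 unfolding indep4_def
proof (intro allI impI, goal_cases)
 case (1 p q r s)
 have "q *s a + p *s b + r *s c + s *s d = 0" using 1(2) by (simp add: add_ac)
 then show ?case using 1(1) by blast
qed

lemma indep4_op: "indep4 a b c d ==> indep4 a (b - x *s a) (c - y *s a) (d - z *s a)"
 unfolding indep4_def
proof (intro allI impI, goal_cases)
 case (1 p q r s)
 have "(p - q * x - r * y - s * z) *s a + q *s b + r *s c + s *s d = 0" using 1(2) by (simp add: vec_eq_iff algebra_simps)
 then have "p - q * x - r * y - s * z = 0 \<and> q = 0 \<and> r = 0 \<and> s = 0" using 1(1) by blast
 then show ?case by auto
qed

lemma indep4_indep2: "indep4 a b c d ==> indep2 a b"
 unfolding indep4_def indep2_def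
proof (intro allI impI, goal_cases)
 case (1 p q)
 have "p *s a + q *s b + 0 *s c + 0 *s d = 0" using 1(2) by (simp add: vec_eq_iff)
 then show ?case using 1(1) by blast
qed

lemma indep4_span:
 fixes a b c d :: "'a::field ^ 4"
 assumes "indep4 a b c d" shows "\<exists>p q r s. v = p *s a + q *s b + r *s c + s *s d"
proof -
 obtain W where W: "inverses (\<lambda>i j. vec_nth (fr a b c d j) i) W" using indep4_inverses[OF assms] by blast
 define x where "x j = (\<Sum>k\<in>UNIV. W j k * vec_nth v k)" for j
 have "(\<Sum>j\<in>UNIV. vec_nth (fr a b c d j) i * x j) = vec_nth v i" for i
 proof -
  have "(\<Sum>j\<in>UNIV. vec_nth (fr a b c d j) i * x j) = (\<Sum>k\<in>UNIV. (\<Sum>j\<in>UNIV. vec_nth (fr a b c d j) i * W j k) * vec_nth v k)"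
   unfolding x_def sum_distrib_left sum_distrib_right by (subst sum.swap) (simp add: mult.assoc)
  also have "\<dots> = vec_nth v i" using W by (simp add: inverses_def if_distrib[of "\<lambda>x. x * _"] cong: if_cong)
  finally show ?thesis .
 qed
 then have "v = x 1 *s a + x 2 *s b + x 3 *s c + x 4 *s d" by (simp add: vec_eq_iff sum_4 mult.commute)
 then show ?thesis by blast
qed

lemma bl_indep_0:
 fixes a b c d :: "'a::field ^ 4"
 assumes "indep4 a b c d" "bl M a v = 0" "bl M b v = 0" "bl M c v = 0" "bl M d v = 0"
 shows "M *v v = 0"
proof (rule dot_eq_0)
 fix u
 obtain p q r s where u: "u = p *s a + q *s b + r *s c + s *s d" using indep4_span[OF assms(1)] by blast
 have "bl M u v = 0" unfolding u by (simp add: assms)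
 then show "dot u (M *v v) = 0" by (simp add: bl_def)
qed

lemma bl_eq_0:
 fixes M :: "'a::field_char_0 ^ 4 ^ 4"
 assumes "symm M" "\<And>v. bl M v v = 0" shows "M = 0"
proof -
 have "bl M u v = 0" for u v using assms(2)[of "u + v"] assms(2)[of u] assms(2)[of v] bl_sym[OF assms(1), of u v] by simp
 then show ?thesis using bl_axis[of M] by (simp add: vec_eq_iff)
qed

lemma det_4:
 "det (A :: 'a::comm_ring_1 ^ 4 ^ 4) =
  en A 1 1 * (en A 2 2 * (en A 3 3 * en A 4 4 - en A 3 4 * en A 4 3) - en A 2 3 * (en A 3 2 * en A 4 4 - en A 3 4 * en A 4 2) + en A 2 4 * (en A 3 2 * en A 4 3 - en A 3 3 * en A 4 2))
  - en A 1 2 * (en A 2 1 * (en A 3 3 * en A 4 4 - en A 3 4 * en A 4 3) - en A 2 3 * (en A 3 1 * en A 4 4 - en A 3 4 * en A 4 1) + en A 2 4 * (en A 3 1 * en A 4 3 - en A 3 3 * en A 4 1))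
  + en A 1 3 * (en A 2 1 * (en A 3 2 * en A 4 4 - en A 3 4 * en A 4 2) - en A 2 2 * (en A 3 1 * en A 4 4 - en A 3 4 * en A 4 1) + en A 2 4 * (en A 3 1 * en A 4 2 - en A 3 2 * en A 4 1))
  - en A 1 4 * (en A 2 1 * (en A 3 2 * en A 4 3 - en A 3 3 * en A 4 2) - en A 2 2 * (en A 3 1 * en A 4 3 - en A 3 3 * en A 4 1) + en A 2 3 * (en A 3 1 * en A 4 2 - en A 3 2 * en A 4 1))"
proof -
 have f1: "finite {2::4, 3, 4}" "1 \<notin> {2::4, 3, 4}" and f2: "finite {3::4, 4}" "2 \<notin> {3::4, 4}" and f3: "finite {4::4}" "3 \<notin> {4::4}" by auto
 show ?thesis
  unfolding det_def UNIV_4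
  unfolding sum_over_permutations_insert[OF f1]
  unfolding sum_over_permutations_insert[OF f2]
  unfolding sum_over_permutations_insert[OF f3]
  unfolding permutes_sing
  by (simp add: sign_swap_id permutation_swap_id sign_compose sign_id permutation_compose swap_id_eq algebra_simps)
qed

lemma singular_kernel: "det M = 0 ==> \<exists>z. z \<noteq> 0 \<and> M *v z = 0" for M :: "'a::field ^ 4 ^ 4"
 using matrix_left_invertible_ker[of M] invertible_left_inverse[of M] invertible_det_nz[of M] by auto

lemma kernel_singular: "M *v z = 0 ==> z \<noteq> 0 ==> det M = 0" for M :: "'a::field ^ 4 ^ 4"
 using matrix_left_invertible_ker[of M] invertible_left_inverse[of M] invertible_det_nz[of M] by auto

text \<open>The scalar is the squared determinant of the frame. It is the same for all M, so it
  factors out of the determinant of a whole pencil (\<open>Pd_gr\<close>).\<close>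

lemma det_gr: "\<exists>t. \<forall>M. det (gr M a b c d) = t\<^sup>2 * det M"
proof -
 define E where "E = (\<chi> i. fr a b c d i)"
 have "gr M a b c d = E ** (M ** transpose E)" for M
  by (simp add: vec_eq_iff gr_simps E_def bl_def dot_def matrix_matrix_mult_def matrix_vector_mult_def transpose_def)
 then have "det (gr M a b c d) = (det E)\<^sup>2 * det M" for M by (simp add: det_mul power2_eq_square)
 then show ?thesis by blast
qed

section \<open>Singular members over k: no common vertex, and only simple rational roots\<close>

section \<open>Singular members of the pencil\<close>

lemma qf_gr:
 assumes "symm M"
 shows "qf (gr M a b c d) = kk (bl M a a) * z1 ^ 2 + kk (bl M b b) * z2 ^ 2 + kk (bl M c c) * z3 ^ 2 + kk (bl M d d) * z4 ^ 2 +
  kk (2 * bl M a b) * (z1 * z2) + kk (2 * bl M a c) * (z1 * z3) + kk (2 * bl M a d) * (z1 * z4) +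
  kk (2 * bl M b c) * (z2 * z3) + kk (2 * bl M b d) * (z2 * z4) + kk (2 * bl M c d) * (z3 * z4)"
 unfolding qf_symm[OF symm_gr[OF assms]] gr_simps fr_simps by (rule refl)

lemma indep4_comb:
 fixes a b c d :: "'a::field ^ 4"
 assumes i: "indep4 a b c d" and n: "s * v - t * u \<noteq> 0"
 shows "indep4 a b (s *s c + t *s d) (u *s c + v *s d)"
 unfolding indep4_def
proof (intro allI impI)
 fix p q x y assume "p *s a + q *s b + x *s (s *s c + t *s d) + y *s (u *s c + v *s d) = 0"
 then have "p *s a + q *s b + (x * s + y * u) *s c + (x * t + y * v) *s d = 0" by (simp add: vec_eq_iff algebra_simps)
 then have e: "p = 0" "q = 0" "x * s + y * u = 0" "x * t + y * v = 0" using i unfolding indep4_def by blast+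
 have "(s * v - t * u) * x = v * (x * s + y * u) - u * (x * t + y * v)"
  "(s * v - t * u) * y = s * (x * t + y * v) - t * (x * s + y * u)" by (simp_all add: algebra_simps)
 then show "p = 0 \<and> q = 0 \<and> x = 0 \<and> y = 0" using e n by simp
qed

lemma qf_0: "qf 0 = 0" by (simp add: qf_def rhom_0[OF rhom_const])

lemma nonzero_value:
 assumes "nrm (qf A) (qf C)" "symm A" shows "\<exists>v. bl A v v \<noteq> 0"
 using bl_eq_0[OF assms(2)] nrm_neq_0(1)[OF assms(1)] qf_0 by metis

lemma kernel_complement:
 fixes A :: "'a::field_char_0 ^ 4 ^ 4"
 assumes n: "nrm (qf A) (qf C)" and sA: "symm A" and yz: "indep2 y z" and ker: "A *v y = 0" "A *v z = 0"
 shows "\<exists>a b. indep4 a b y z \<and> bl A a a \<noteq> 0 \<and> bl A a b = 0"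
proof -
 obtain a where a: "bl A a a \<noteq> 0" using nonzero_value[OF n sA] by blast
 have "\<exists>d. indep4 y z a d"
 proof (rule indep4_extend)
  fix p q r assume e: "p *s y + q *s z + r *s a = 0"
  have "bl A a (p *s y + q *s z + r *s a) = r * bl A a a" by (simp add: bl_ker[OF ker(1)] bl_ker[OF ker(2)])
  then have "r = 0" using e a by simp
  then show "p = 0 \<and> q = 0 \<and> r = 0" using yz e by (simp add: indep2_def)
 qed
 then obtain d where "indep4 y z a d" ..
 then have "indep4 a d y z" by (rule indep4_rot2)
 from indep4_op[OF this, of "bl A a d / bl A a a" 0 0] have "indep4 a (d - (bl A a d / bl A a a) *s a) y z" by simp
 then show ?thesis using a by (intro exI conjI) (assumption | simp)+
qed

text \<open>In the frame of \<open>kernel_complement\<close>, A is diagonal in two variables, and C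
  y y being nonzero puts the pencil in the form of \<open>not_nrm_rank2\<close>.\<close>

lemma no_kernel_plane_anisotropic:
 fixes A C :: "'a::field_char_0 ^ 4 ^ 4"
 assumes n: "nrm (qf A) (qf C)" and s: "symm A" "symm C" and yz: "indep2 y z" and ker: "A *v y = 0" "A *v z = 0"
 shows "bl C y y = 0"
proof (rule ccontr)
 assume nz: "bl C y y \<noteq> 0"
 obtain a b where ab: "indep4 a b y z" "bl A a a \<noteq> 0" "bl A a b = 0" using kernel_complement[OF n s(1) yz ker] by blast
 have k: "bl A u y = 0" "bl A u z = 0" for u using ker by (simp_all add: bl_ker)
 have "qf (gr A a b y z) = kk (bl A a a) * z1 ^ 2 + kk (bl A b b) * z2 ^ 2"
  unfolding qf_gr[OF s(1)] by (simp add: k ab rhom_0[OF rhom_const])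
 moreover have "qf (gr C a b y z) = kk (bl C y y) * z3 ^ 2 +
   z3 * (kk (2 * bl C a y) * z1 + kk (2 * bl C b y) * z2 + kk (2 * bl C y z) * z4) +
   (kk (bl C a a) * z1 ^ 2 + kk (bl C b b) * z2 ^ 2 + kk (bl C z z) * z4 ^ 2 +
  kk (2 * bl C a b) * (z1 * z2) + kk (2 * bl C a z) * (z1 * z4) + kk (2 * bl C b z) * (z2 * z4))"
  unfolding qf_gr[OF s(2)] by (simp add: algebra_simps)
 ultimately have "nrm (kk (bl A a a) * z1 ^ 2 + kk (bl A b b) * z2 ^ 2) (kk (bl C y y) * z3 ^ 2 +
   z3 * (kk (2 * bl C a y) * z1 + kk (2 * bl C b y) * z2 + kk (2 * bl C y z) * z4) +
   (kk (bl C a a) * z1 ^ 2 + kk (bl C b b) * z2 ^ 2 + kk (bl C z z) * z4 ^ 2 +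
  kk (2 * bl C a b) * (z1 * z2) + kk (2 * bl C a z) * (z1 * z4) + kk (2 * bl C b z) * (z2 * z4)))"
  using nrm_gr[OF n ab(1)] by (simp only:)
 then show False by (rule not_nrm_rank2) (use nz ab(2) in simp_all)
qed

lemma indep2_sym: "indep2 y z ==> indep2 z y"
 unfolding indep2_def
proof (intro allI impI, goal_cases)
 case (1 p q)
 have "q *s y + p *s z = 0" using 1(2) by (simp add: add.commute)
 then show ?case using 1(1) by blast
qed

lemma indep2_add: "indep2 y z ==> indep2 (y + z) z"
 unfolding indep2_def
proof (intro allI impI, goal_cases)
 case (1 p q)
 have "p *s y + (p + q) *s z = 0" using 1(2) by (simp add: vec_eq_iff algebra_simps)
 then have "p = 0 \<and> p + q = 0" using 1(1) by blast
 then show ?case by auto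
qed

text \<open>By the preceding lemma for y, z and y + z, C vanishes on the kernel plane. Without a
  common kernel it must pair this plane perfectly with a complement, and dual bases give the form of
  \<open>not_nrm_double_line\<close>.\<close>

lemma no_kernel_plane:
 fixes A C :: "'a::field_char_0 ^ 4 ^ 4"
 assumes n: "nrm (qf A) (qf C)" and s: "symm A" "symm C" and yz: "indep2 y z" and ker: "A *v y = 0" "A *v z = 0"
  and nk: "\<And>v. A *v v = 0 ==> C *v v = 0 ==> v = 0"
 shows False
proof -
 have "A *v (y + z) = 0" using ker by simp
 note C0 = no_kernel_plane_anisotropic[OF n s yz ker] no_kernel_plane_anisotropic[OF n s indep2_sym[OF yz] ker(2,1)]
  no_kernel_plane_anisotropic[OF n s indep2_add[OF yz] this ker(2)]
 have sC: "bl C z y = bl C y z" by (rule bl_sym[OF s(2)])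
 have C0': "bl C y z = 0" using C0 sC by simp
 obtain a b where ab: "indep4 a b y z" "bl A a a \<noteq> 0" "bl A a b = 0" using kernel_complement[OF n s(1) yz ker] by blast
 define D where "D = bl C a y * bl C b z - bl C a z * bl C b y"
 have D: "D \<noteq> 0"
 proof
  assume D0: "D = 0"
  have "p = 0 \<and> q = 0" if e: "bl C a (p *s y + q *s z) = 0" "bl C b (p *s y + q *s z) = 0" for p q
  proof -
   have "C *v (p *s y + q *s z) = 0" by (rule bl_indep_0[OF ab(1) e]) (simp_all add: C0 C0' sC)
   moreover have "A *v (p *s y + q *s z) = 0" using ker by simp
   ultimately have "p *s y + q *s z = 0" using nk by blast
   then show ?thesis using yz unfolding indep2_def by blast
  qed
  from this[of "bl C a z" "- bl C a y"] this[of "bl C b z" "- bl C b y"] this[of 1 0] show False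
   using D0 unfolding D_def by (simp add: algebra_simps)
 qed
 \<comment> \<open>The basis of the kernel plane dual to a, b with respect to C.\<close>
 let ?y = "(bl C b z / D) *s y + (- bl C b y / D) *s z" and ?z = "(- bl C a z / D) *s y + (bl C a y / D) *s z"
 have "(bl C b z / D) * (bl C a y / D) - (- bl C b y / D) * (- bl C a z / D) = D / (D * D)"
  unfolding D_def by (simp add: diff_divide_distrib mult_ac)
 then have i: "indep4 a b ?y ?z" using D by (intro indep4_comb[OF ab(1)]) simp
 have k: "bl A u ?y = 0" "bl A u ?z = 0" for u using ker by (simp_all add: bl_ker)
 have "bl C a ?y = (bl C a y * bl C b z - bl C a z * bl C b y) / D" "bl C b ?z = (bl C a y * bl C b z - bl C a z * bl C b y) / D"
  by (simp_all add: diff_divide_distrib mult_ac)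
 then have d: "bl C a ?y = 1" "bl C b ?z = 1" using D unfolding D_def[symmetric] by simp_all
 have d': "bl C b ?y = 0" "bl C a ?z = 0" "bl C ?y ?y = 0" "bl C ?y ?z = 0" "bl C ?z ?z = 0"
  by (simp_all add: C0 C0' sC)
 have "qf (gr A a b ?y ?z) = kk (bl A a a) * z1 ^ 2 + kk (bl A b b) * z2 ^ 2"
  unfolding qf_gr[OF s(1)] k by (simp add: ab rhom_0[OF rhom_const])
 moreover have "qf (gr C a b ?y ?z) = z1 * (2 * z3 + kk (bl C a a) * z1 + kk (bl C a b) * z2) + z2 * (2 * z4 + kk (bl C a b) * z1 + kk (bl C b b) * z2)"
  unfolding qf_gr[OF s(2)] d d' by (simp add: rhom_simps[OF rhom_const] power2_eq_square algebra_simps)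
 ultimately have "nrm (kk (bl A a a) * z1 ^ 2 + kk (bl A b b) * z2 ^ 2)
   (z1 * (2 * z3 + kk (bl C a a) * z1 + kk (bl C a b) * z2) + z2 * (2 * z4 + kk (bl C a b) * z1 + kk (bl C b b) * z2))"
  using nrm_gr[OF n i] by (simp only:)
 then show False using ab(2) by (rule not_nrm_double_line)
qed

text \<open>A pencil member E with E a a = 0 replaces C. Shifting a, b, c by multiples of the vertex
  z changes E but not A, and clears the pairings of E with c, which gives the form of
  \<open>not_nrm_node\<close>.\<close>

lemma no_node_basis:
 fixes A C :: "'a::field_char_0 ^ 4 ^ 4"
 assumes n: "nrm (qf A) (qf C)" and s: "symm A" "symm C" and i: "indep4 a b c z" and ker: "A *v z = 0"
  and C: "bl C z z = 0" "bl C a z = 0" "bl C b z = 0" "bl C c z = 1" and a: "bl A a a \<noteq> 0"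
 shows False
proof -
 define E where "E = pm (- (bl C a a / bl A a a)) A 1 C"
 have nE: "nrm (qf A) (qf E)" using nrm_pm[OF n, of 1 1 0 "- (bl C a a / bl A a a)"]
  by (simp add: E_def pm_def)
 have sE: "symm E" using s by (simp add: E_def symm_pm)
 have k: "bl A u z = 0" "bl A z u = 0" for u using ker bl_sym[OF s(1), of z u] by (simp_all add: bl_ker)
 have Ez: "bl E u z = bl C u z" "bl E z u = bl C u z" for u
  using bl_sym[OF s(2), of z u] by (simp_all add: E_def k)
 have Ea: "bl E a a = 0" using a by (simp add: E_def)
 let ?a = "a - bl E a c *s z" and ?b = "b - bl E b c *s z" and ?c = "c - (bl E c c / 2) *s z"
 have "indep4 z a b c" using i by (rule indep4_rot3)
 from indep4_rot[OF indep4_op[OF this]] have i: "indep4 ?a ?b ?c z" .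
 have vE: "bl E ?a ?a = 0" "bl E ?a ?c = 0" "bl E ?b ?c = 0" "bl E ?c ?c = 0" "bl E ?a z = 0" "bl E ?b z = 0" "bl E ?c z = 1" "bl E z z = 0"
  using Ea by (simp_all add: Ez C)
 have vA: "bl A ?a ?a = bl A a a" "bl A u z = 0" for u by (simp_all add: k)
 have "qf (gr A ?a ?b ?c z) = kk (bl A a a) * z1 ^ 2 + z1 * (kk (2 * bl A ?a ?b) * z2 + kk (2 * bl A ?a ?c) * z3) +
   (kk (bl A ?b ?b) * z2 ^ 2 + kk (2 * bl A ?b ?c) * z2 * z3 + kk (bl A ?c ?c) * z3 ^ 2)"
  unfolding qf_gr[OF s(1)] vA by (simp add: rhom_0[OF rhom_const] algebra_simps del: bl_simps)
 moreover have "qf (gr E ?a ?b ?c z) = 2 * z3 * z4 + z2 * (kk (2 * bl E ?a ?b) * z1 + kk (bl E ?b ?b) * z2)"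
  unfolding qf_gr[OF sE] vE by (simp add: rhom_simps[OF rhom_const] power2_eq_square algebra_simps del: bl_simps)
 ultimately have "nrm (kk (bl A a a) * z1 ^ 2 + z1 * (kk (2 * bl A ?a ?b) * z2 + kk (2 * bl A ?a ?c) * z3) +
   (kk (bl A ?b ?b) * z2 ^ 2 + kk (2 * bl A ?b ?c) * z2 * z3 + kk (bl A ?c ?c) * z3 ^ 2))
  (2 * z3 * z4 + z2 * (kk (2 * bl E ?a ?b) * z1 + kk (bl E ?b ?b) * z2))" using nrm_gr[OF nE i] by (simp only:)
 then show False using a by (rule not_nrm_node)
qed

text \<open>\<open>no_node_basis\<close> forces A to vanish on the plane of c and d, chosen
  C-orthogonal to the vertex z. Then A kills a second vector y in that plane, against
  \<open>no_kernel_plane\<close>.\<close>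

lemma no_node:
 fixes A C :: "'a::field_char_0 ^ 4 ^ 4"
 assumes n: "nrm (qf A) (qf C)" and s: "symm A" "symm C" and z: "z \<noteq> 0" "A *v z = 0" "bl C z z = 0"
  and nk: "\<And>v. A *v v = 0 ==> C *v v = 0 ==> v = 0"
 shows False
proof -
 have k: "bl A u z = 0" "bl A z u = 0" for u using z(2) bl_sym[OF s(1), of z u] by (simp_all add: bl_ker)
 have "C *v z \<noteq> 0" using nk z by blast
 then obtain e' where e': "bl C e' z \<noteq> 0" using dot_eq_0 unfolding bl_def by metis
 define e where "e = inverse (bl C e' z) *s e'"
 have e: "bl C e z = 1" using e' by (simp add: e_def)
 have "indep2 e z" unfolding indep2_def
 proof (intro allI impI)
  fix p q assume h: "p *s e + q *s z = 0"
  have "bl C (p *s e + q *s z) z = p" using z e by simp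
  then have "p = 0" using h by simp
  then show "p = 0 \<and> q = 0" using h z(1) by (auto simp: vec_eq_iff)
 qed
 then obtain c' d' where cd': "indep4 e z c' d'" using indep2_extend by blast
 define c where "c = c' - bl C c' z *s e"
 define d where "d = d' - bl C d' z *s e"
 have i: "indep4 e z c d" using indep4_op[OF cd', of 0 "bl C c' z" "bl C d' z"] by (simp add: c_def d_def)
 have cz: "bl C c z = 0" "bl C d z = 0" using e by (simp_all add: c_def d_def)
 have i1: "indep4 c d e z" using i by (rule indep4_rot2)
 have i2: "indep4 d c e z" using indep4_swap[OF i1] .
 have i3: "indep4 (c + d) d e z"
 proof -
  from indep4_comb[OF i, of 1 1 1 0] have "indep4 e z (c + d) d" by simp
  then show ?thesis by (rule indep4_rot2)
 qed
 have A0: "bl A c c = 0" using no_node_basis[OF n s i1 z(2,3) cz e] by blast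
 have A1: "bl A d d = 0" using no_node_basis[OF n s i2 z(2,3) cz(2,1) e] by blast
 have "bl A (c + d) (c + d) = 0" using no_node_basis[OF n s i3 z(2,3) _ cz(2) e] cz by auto
 then have A2: "bl A c d = 0" "bl A d c = 0" using A0 A1 bl_sym[OF s(1), of d c] by simp_all
 have "\<exists>p q. (p \<noteq> 0 \<or> q \<noteq> 0) \<and> p * bl A e c + q * bl A e d = 0"
 proof (cases "bl A e c = 0")
  case True
  then show ?thesis by (intro exI[of _ 1] exI[of _ 0]) simp
 next
  case False
  then show ?thesis by (intro exI[of _ "bl A e d"] exI[of _ "- bl A e c"]) simp
 qed
 then obtain p q where pq: "p \<noteq> 0 \<or> q \<noteq> 0" "p * bl A e c + q * bl A e d = 0" by blast
 define y where "y = p *s c + q *s d"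
 have "A *v y = 0" by (rule bl_indep_0[OF i1]) (use pq in \<open>simp_all add: y_def A0 A1 A2 k\<close>)
 moreover have "indep2 y z" unfolding indep2_def
 proof (intro allI impI)
  fix x t assume "x *s y + t *s z = 0"
  then have "(x * p) *s c + (x * q) *s d + 0 *s e + t *s z = 0" by (simp add: y_def vec_eq_iff algebra_simps)
  then have "x * p = 0 \<and> x * q = 0 \<and> t = 0" using i1 unfolding indep4_def by blast
  then show "x = 0 \<and> t = 0" using pq(1) by auto
 qed
 ultimately show False using no_kernel_plane[OF n s _ _ z(2) nk] by blast
qed

text \<open>Replacing b by b + t c turns the leading coefficient of the binary quartic in
  \<open>not_nrm_cone\<close> into the value of that quartic at t. So it is zero for every t, the
  quartic vanishes identically, and \<open>not_nrm_cone_degenerate\<close> applies.\<close>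

lemma no_common_kernel_basis:
 fixes A C :: "'a::field_char_0 ^ 4 ^ 4"
 assumes n: "nrm (qf A) (qf C)" and s: "symm A" "symm C" and i: "indep4 a b c z"
  and z: "\<And>u. bl A u z = 0" "\<And>u. bl C u z = 0"
  and A: "bl A a a \<noteq> 0" "bl A a b = 0" "bl A a c = 0" and C: "bl C a a = 0"
 shows False
proof -
 define h where "h i = (if i = 4 then bl A a a * (bl C b b)\<^sup>2 + bl A b b * (2 * bl C a b)\<^sup>2
  else if i = 3 then 2 * bl A a a * bl C b b * (2 * bl C b c) + 2 * bl A b b * (2 * bl C a b) * (2 * bl C a c) + (2 * bl A b c) * (2 * bl C a b)\<^sup>2
  else if i = 2 then bl A a a * ((2 * bl C b c)\<^sup>2 + 2 * bl C b b * bl C c c) + bl A b b * (2 * bl C a c)\<^sup>2 + 2 * (2 * bl A b c) * (2 * bl C a b) * (2 * bl C a c) + bl A c c * (2 * bl C a b)\<^sup>2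
  else if i = 1 then 2 * bl A a a * (2 * bl C b c) * bl C c c + (2 * bl A b c) * (2 * bl C a c)\<^sup>2 + 2 * bl A c c * (2 * bl C a b) * (2 * bl C a c)
  else bl A a a * (bl C c c)\<^sup>2 + bl A c c * (2 * bl C a c)\<^sup>2)" for i :: nat
 have form: "nrm (kk (bl A a a) * z1 ^ 2 + (kk (bl A u u) * z2 ^ 2 + kk (2 * bl A u c) * z2 * z3 + kk (bl A c c) * z3 ^ 2))
  (z1 * (kk (2 * bl C a u) * z2 + kk (2 * bl C a c) * z3) + (kk (bl C u u) * z2 ^ 2 + kk (2 * bl C u c) * z2 * z3 + kk (bl C c c) * z3 ^ 2))"
  if u: "indep4 a u c z" "bl A a u = 0" for u
  using nrm_gr[OF n u(1)] unfolding qf_gr[OF s(1)] qf_gr[OF s(2)]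
  by (simp add: z A C u(2) rhom_0[OF rhom_const] distrib_left mult_ac add_ac)
 have "poly [:h 4, h 3, h 2, h 1, h 0:] t = 0" for t
 proof -
  let ?u = "b + t *s c"
  have "indep4 c z a b" using i by (rule indep4_rot2)
  from indep4_op[OF this, of 0 0 "- t"] have "indep4 c z a ?u" by simp
  then have "indep4 a ?u c z" by (rule indep4_rot2)
  moreover have "bl A a ?u = 0" using A by simp
  ultimately have "bl A a a * (bl C ?u ?u)\<^sup>2 + bl A ?u ?u * (2 * bl C a ?u)\<^sup>2 = 0"
   using not_nrm_cone[OF form A(1)] by blast
  then show ?thesis using bl_sym[OF s(1), of c b] bl_sym[OF s(2), of c b]
   by (simp add: h_def power2_eq_square algebra_simps)
 qed
 then have "[:h 4, h 3, h 2, h 1, h 0:] = 0" by (simp only: poly_all_0_iff_0[symmetric]) blast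
 then have h0: "h 4 = 0" "h 3 = 0" "h 2 = 0" "h 1 = 0" "h 0 = 0" by simp_all
 let ?m = "kk (bl A b b) * z2 ^ 2 + kk (2 * bl A b c) * z2 * z3 + kk (bl A c c) * z3 ^ 2"
 let ?P = "kk (2 * bl C a b) * z2 + kk (2 * bl C a c) * z3"
 let ?Q = "kk (bl C b b) * z2 ^ 2 + kk (2 * bl C b c) * z2 * z3 + kk (bl C c c) * z3 ^ 2"
 have "kk (bl A a a) * ?Q\<^sup>2 + ?m * ?P\<^sup>2 =
  kk (h 4) * z2 ^ 4 + kk (h 3) * (z2 ^ 3 * z3) + kk (h 2) * (z2 ^ 2 * z3 ^ 2) + kk (h 1) * (z2 * z3 ^ 3) + kk (h 0) * z3 ^ 4"
  unfolding h_def by (simp add: rhom_simps[OF rhom_const] numeral_eq_Suc algebra_simps)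
 also have "\<dots> = 0" unfolding h0 by (simp add: rhom_0[OF rhom_const])
 finally have e: "kk (bl A a a) * ?Q\<^sup>2 + ?m * ?P\<^sup>2 = 0" .
 show False by (rule not_nrm_cone_degenerate[OF form[OF i A(2)] _ _ _ A(1) e]) simp_all
qed

lemma no_common_kernel:
 fixes A C :: "'a::field_char_0 ^ 4 ^ 4"
 assumes n: "nrm (qf A) (qf C)" and s: "symm A" "symm C" and z: "A *v z = 0" "C *v z = 0"
 shows "z = 0"
proof (rule ccontr)
 assume z0: "z \<noteq> 0"
 obtain a where a: "bl A a a \<noteq> 0" using nonzero_value[OF n s(1)] by blast
 have "indep2 a z" unfolding indep2_def
 proof (intro allI impI)
  fix p q assume h: "p *s a + q *s z = 0"
  have "bl A a (p *s a + q *s z) = p * bl A a a" using z by (simp add: bl_ker)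
  then have "p = 0" using h a by simp
  then show "p = 0 \<and> q = 0" using h z0 by (auto simp: vec_eq_iff)
 qed
 then obtain b c where "indep4 a z b c" using indep2_extend by blast
 from indep4_op[OF this, of 0 "bl A a b / bl A a a" "bl A a c / bl A a a"]
 have "indep4 a z (b - (bl A a b / bl A a a) *s a) (c - (bl A a c / bl A a a) *s a)" by simp
 then have "indep4 z a (b - (bl A a b / bl A a a) *s a) (c - (bl A a c / bl A a a) *s a)" by (rule indep4_swap)
 then have i: "indep4 a (b - (bl A a b / bl A a a) *s a) (c - (bl A a c / bl A a a) *s a) z" by (rule indep4_rot)
 define E where "E = pm (- (bl C a a / bl A a a)) A 1 C"
 have nE: "nrm (qf A) (qf E)" using nrm_pm[OF n, of 1 1 0 "- (bl C a a / bl A a a)"] by (simp add: E_def pm_def)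
 show False
  by (rule no_common_kernel_basis[OF nE s(1) _ i])
   (use s z a in \<open>simp_all add: E_def symm_pm bl_ker\<close>)
qed

definition Pd :: "'a::comm_ring_1 ^ 4 ^ 4 \<Rightarrow> 'a ^ 4 ^ 4 \<Rightarrow> 'a poly" where
 "Pd A C = det (\<chi> i j. [:en A i j, en C i j:])"

lemma rhom_det: "rhom h ==> h (det M) = det (\<chi> i j. h (en M i j))" for M :: "'a::comm_ring_1 ^ 4 ^ 4"
 by (simp only: det_4 rhom_add rhom_mult rhom_diff vec_lambda_beta)

lemma poly_Pd: "poly (Pd A C) x = det (pm 1 A x C)"
 unfolding Pd_def rhom_det[OF rhom_poly_eval] by (rule arg_cong[of _ _ det]) (simp add: vec_eq_iff pm_def)

lemma Pd_gr: 
 fixes A C :: "'a::field_char_0 ^ 4 ^ 4"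
 shows "\<exists>t. Pd (gr A a b c d) (gr C a b c d) = [:t:] * Pd A C \<and> det (gr N a b c d) = t * det N"
proof -
 obtain t where t: "\<And>M. det (gr M a b c d) = t\<^sup>2 * det M" using det_gr[of a b c d] by blast
 have "pm 1 (gr A a b c d) x (gr C a b c d) = gr (pm 1 A x C) a b c d" for x
  by (simp add: vec_eq_iff pm_def[of _ "gr A a b c d"] gr_simps)
 then have "poly (Pd (gr A a b c d) (gr C a b c d)) x = poly ([:t\<^sup>2:] * Pd A C) x" for x
  by (simp add: poly_Pd t)
 then have "Pd (gr A a b c d) (gr C a b c d) = [:t\<^sup>2:] * Pd A C" by (simp only: poly_eq_poly_eq_iff[symmetric] fun_eq_iff) blast
 then show ?thesis using t by blast
qed

definition minor4 :: "'a::comm_ring_1 ^ 4 ^ 4 \<Rightarrow> 'a" where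
 "minor4 A = en A 1 1 * (en A 2 2 * en A 3 3 - en A 2 3 * en A 3 2) - en A 1 2 * (en A 2 1 * en A 3 3 - en A 2 3 * en A 3 1)
  + en A 1 3 * (en A 2 1 * en A 3 2 - en A 2 2 * en A 3 1)"

lemma det_block:
 assumes "\<And>i. i \<noteq> 4 ==> en A i 4 = 0" "\<And>i. i \<noteq> 4 ==> en A 4 i = 0"
 shows "det A = en A 4 4 * minor4 A"
proof -
 have "en A 1 4 = 0" "en A 2 4 = 0" "en A 3 4 = 0" "en A 4 1 = 0" "en A 4 2 = 0" "en A 4 3 = 0" using assms by simp_all
 then show ?thesis unfolding det_4 minor4_def by (simp add: algebra_simps)
qed

lemma coeff_Pd_block:
 assumes "\<And>i. en A i 4 = 0" "\<And>i. en A 4 i = 0" "\<And>i. i \<noteq> 4 ==> en C i 4 = 0" "\<And>i. i \<noteq> 4 ==> en C 4 i = 0"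
 shows "pco (Pd A C) 1 = en C 4 4 * minor4 A"
proof -
 let ?P = "\<chi> i j. [:en A i j, en C i j:]"
 have "Pd A C = [:0, en C 4 4:] * minor4 ?P"
  unfolding Pd_def by (subst det_block) (simp_all add: assms)
 then have "pco (Pd A C) 1 = en C 4 4 * poly (minor4 ?P) 0" by (simp add: poly_0_coeff_0)
 also have "poly (minor4 ?P) 0 = minor4 A" by (simp add: minor4_def mult_ac)
 finally show ?thesis .
qed

text \<open>With z in the kernel of A, the linear coefficient of det (A + tC) is, up to the scale of
  the frame, C z z times the determinant of A on the C-orthogonal complement of z. The first factor
  is nonzero by \<open>no_node\<close>; a zero of the second would produce a kernel plane of
  A.\<close>

lemma pencil_simple_root:
 fixes A C :: "'a::field_char_0 ^ 4 ^ 4"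
 assumes n: "nrm (qf A) (qf C)" and s: "symm A" "symm C" and d: "det A = 0"
 shows "pco (Pd A C) 1 \<noteq> 0"
proof
 assume c1: "pco (Pd A C) 1 = 0"
 have nk: "v = 0" if "A *v v = 0" "C *v v = 0" for v by (rule no_common_kernel[OF n s that])
 obtain z where z: "z \<noteq> 0" "A *v z = 0" using singular_kernel[OF d] by blast
 have k: "bl A u z = 0" "bl A z u = 0" for u using z(2) bl_sym[OF s(1), of z u] by (simp_all add: bl_ker)
 have Cz: "bl C z z \<noteq> 0" using no_node[OF n s z _ nk] by blast
 have sC: "bl C z u = bl C u z" for u by (rule bl_sym[OF s(2)])
 obtain a' b' c' where "indep4 z a' b' c'" using indep1_extend[OF z(1)] by blast
 note i = indep4_rot[OF indep4_op[OF this, of "bl C a' z / bl C z z" "bl C b' z / bl C z z" "bl C c' z / bl C z z"]]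
 define a where "a = a' - (bl C a' z / bl C z z) *s z"
 define b where "b = b' - (bl C b' z / bl C z z) *s z"
 define c where "c = c' - (bl C c' z / bl C z z) *s z"
 note i = i[folded a_def b_def c_def]
 have o: "bl C a z = 0" "bl C b z = 0" "bl C c z = 0" using Cz by (simp_all add: a_def b_def c_def)
 \<comment> \<open>A rank-one correction of A that agrees with A on the C-orthogonal complement of z
   and is nonzero at z, so singularity on the complement becomes singularity of N.\<close>
 define N where "N = (\<chi> i j. en A i j + vec_nth (C *v z) i * vec_nth (C *v z) j)"
 have N: "bl N u v = bl A u v + bl C u z * bl C v z" for u v
  unfolding bl_def N_def by (simp add: dot_def matrix_vector_mult_def[of "\<chi> i j. _ i j"] matrix_vector_mult_def[of A] sum_4 algebra_simps)
 obtain t where t: "Pd (gr A a b c z) (gr C a b c z) = [:t:] * Pd A C" "det (gr N a b c z) = t * det N"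
  using Pd_gr by blast
 have o4: "bl C (fr a b c z i) z = 0" if "i \<noteq> 4" for i using that exhaust_4[of i] o by auto
 have o4': "bl C z (fr a b c z i) = 0" if "i \<noteq> 4" for i using o4[OF that] by (simp add: sC)
 have "pco (Pd (gr A a b c z) (gr C a b c z)) 1 = bl C z z * minor4 (gr A a b c z)"
  by (subst coeff_Pd_block) (simp_all add: gr_simps k o4 o4')
 moreover have "det (gr N a b c z) = (bl C z z)\<^sup>2 * minor4 (gr A a b c z)"
 proof -
  have "minor4 (gr N a b c z) = minor4 (gr A a b c z)" unfolding minor4_def gr_simps by (simp add: N o)
  then show ?thesis by (subst det_block) (simp_all add: gr_simps N k o4 o4' power2_eq_square)
 qed
 moreover have "pco (Pd (gr A a b c z) (gr C a b c z)) 1 = 0" unfolding t using c1 by simp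
 ultimately have "det (gr N a b c z) = 0" using Cz by simp
 moreover have "det (gr N a b c z) \<noteq> 0 \<or> det N = 0"
 proof (cases "det N = 0")
  case False
  have "w = 0" if w: "gr N a b c z *v w = 0" for w
  proof -
   define v where "v = vec_nth w 1 *s a + vec_nth w 2 *s b + vec_nth w 3 *s c + vec_nth w 4 *s z"
   have e: "bl N (fr a b c z i) v = vec_nth (gr N a b c z *v w) i" for i
    unfolding v_def by (simp add: matrix_vector_mult_def[of "gr N a b c z"] sum_4 gr_simps mult.commute)
   have "N *v v = 0"
    by (rule bl_indep_0[OF i]) (use e[of 1] e[of 2] e[of 3] e[of 4] w in simp_all)
   then have "v = 0" using kernel_singular False by blast
   then have "vec_nth w 1 = 0 \<and> vec_nth w 2 = 0 \<and> vec_nth w 3 = 0 \<and> vec_nth w 4 = 0" using i unfolding v_def indep4_def by blast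
   then show ?thesis by (simp add: vec_eq_iff forall_4)
  qed
  then have "det (gr N a b c z) \<noteq> 0" using singular_kernel by metis
  then show ?thesis ..
 qed simp
 ultimately have "det N = 0" by blast
 then obtain y where y: "y \<noteq> 0" "N *v y = 0" using singular_kernel by blast
 have Ny: "bl A u y + bl C u z * bl C y z = 0" for u using bl_ker[OF y(2), of u] by (simp add: N)
 from this[of z] have yz: "bl C y z = 0" using Cz by (simp add: k)
 have Ay: "A *v y = 0" using Ny yz by (intro dot_eq_0) (simp add: bl_def)
 have "indep2 y z" unfolding indep2_def
 proof (intro allI impI)
  fix p q assume h: "p *s y + q *s z = 0"
  have "bl C (p *s y + q *s z) z = q * bl C z z" using yz by simp
  then have "q = 0" using h Cz by simp
  then show "p = 0 \<and> q = 0" using h y(1) by (auto simp: vec_eq_iff)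
 qed
 then show False using no_kernel_plane[OF n s _ Ay z(2) nk] by blast
qed

section \<open>Two conjugate double roots\<close>

section \<open>Conjugate double points\<close>

lemma solve2: "a * d - b * c \<noteq> 0 ==> \<exists>x y. a * x + b * y = m \<and> c * x + d * y = n" for a b c d m n :: "'a::field"
proof -
 assume D: "a * d - b * c \<noteq> 0"
 define e where "e = inverse (a * d - b * c)"
 have e: "(a * d - b * c) * e = 1" using D by (simp add: e_def)
 have "a * ((d * m - b * n) * e) + b * ((a * n - c * m) * e) = ((a * d - b * c) * e) * m"
  "c * ((d * m - b * n) * e) + d * ((a * n - c * m) * e) = ((a * d - b * c) * e) * n" by (simp_all add: algebra_simps)
 then show ?thesis unfolding e by (metis mult_1)
qed

lemma singular2:
 fixes a b c d :: "'a::field"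
 assumes "a * d = b * c" shows "\<exists>p q. (p \<noteq> 0 \<or> q \<noteq> 0) \<and> p * a + q * b = 0 \<and> p * c + q * d = 0"
proof (cases "a = 0 \<and> b = 0")
 case True
 show ?thesis
 proof (cases "c = 0 \<and> d = 0")
  case False
  then show ?thesis using True by (intro exI[of _ d] exI[of _ "- c"]) auto
 qed (use True in \<open>auto intro: exI[of _ 1]\<close>)
next
 case False
 then show ?thesis using assms by (intro exI[of _ b] exI[of _ "- a"]) (auto simp: mult_ac)
qed

lemma norm_form_neq_0:
 fixes a b d :: "'a::field"
 assumes d: "\<And>x. x\<^sup>2 \<noteq> d" and ab: "a \<noteq> 0 \<or> b \<noteq> 0" shows "a\<^sup>2 - d * b\<^sup>2 \<noteq> 0"
proof
 assume e: "a\<^sup>2 - d * b\<^sup>2 = 0"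
 then have b: "b \<noteq> 0" using ab by auto
 have "(a / b)\<^sup>2 = d" using e b by (simp add: power_divide)
 then show False using d by blast
qed

lemma norm_form_mult:
 fixes a b c e d :: "'a::comm_ring_1"
 shows "(a\<^sup>2 - d * b\<^sup>2) * (c\<^sup>2 - d * e\<^sup>2) = (a * c + d * b * e)\<^sup>2 - d * (a * e + b * c)\<^sup>2"
 by (simp add: power2_eq_square algebra_simps)

lemma det_blocks:
 fixes M :: "'a::comm_ring_1 ^ 4 ^ 4"
 assumes "en M 1 3 = 0" "en M 1 4 = 0" "en M 2 3 = 0" "en M 2 4 = 0" "en M 3 1 = 0" "en M 4 1 = 0" "en M 3 2 = 0" "en M 4 2 = 0"
 shows "det M = (en M 1 1 * en M 2 2 - en M 1 2 * en M 2 1) * (en M 3 3 * en M 4 4 - en M 3 4 * en M 4 3)"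
 unfolding det_4 by (simp add: assms algebra_simps)

text \<open>
 A pair \<open>v\<close>, \<open>w\<close> with \<open>A v = C w\<close> and \<open>A w = d C v\<close> is an eigenvector of \<open>C\<^sup>-\<^sup>1 A\<close> for the
 eigenvalue \<open>\<surd>d\<close>, written over the ground field.
\<close>

context
 fixes A C :: "'a::field_char_0 ^ 4 ^ 4" and d :: 'a and v w :: "'a ^ 4"
 assumes n: "nrm (qf A) (qf C)" and s: "symm A" "symm C" and C: "det C \<noteq> 0" and d: "\<And>x. x\<^sup>2 \<noteq> d"
  and v: "v \<noteq> 0" and Av: "A *v v = C *v w" and Aw: "A *v w = d *s (C *v v)"
begin

lemma C_inj: "C *v u = 0 ==> u = 0" using kernel_singular C by blast

lemma A_right: "bl A u v = bl C u w" "bl A u w = d * bl C u v"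
 by (simp_all add: bl_def Av Aw)

lemma A_left: "bl A v u = bl C u w" "bl A w u = d * bl C u v"
 using A_right bl_sym[OF s(1), of v u] bl_sym[OF s(1), of w u] by simp_all

lemma C_w: "bl C w v = bl C v w" "bl C w w = d * bl C v v"
 using A_right(2)[of v] A_left(1)[of w] bl_sym[OF s(2), of w v] by simp_all

lemma d_neq_0: "d \<noteq> 0" using d[of 0] by auto

text \<open>A relation p v + q w = 0 together with its image under A gives (p^2 - d q^2) v = 0, and
  d is not a square.\<close>

lemma indep_vw: "indep2 v w"
 unfolding indep2_def
proof (intro allI impI)
 fix p q assume e: "p *s v + q *s w = 0"
 have "A *v (p *s v + q *s w) = C *v (p *s w + (q * d) *s v)" by (simp add: Av Aw vec_eq_iff mult_ac)
 then have "p *s w + (q * d) *s v = 0" using e C_inj by simp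
 then have "p *s (p *s v + q *s w) - q *s (p *s w + (q * d) *s v) = 0" using e by simp
 moreover have "p *s (p *s v + q *s w) - q *s (p *s w + (q * d) *s v) = (p\<^sup>2 - d * q\<^sup>2) *s v"
  by (simp add: vec_eq_iff algebra_simps power2_eq_square)
 ultimately have "p\<^sup>2 - d * q\<^sup>2 = 0" using v by (auto simp: vec_eq_iff)
 then show "p = 0 \<and> q = 0" using norm_form_neq_0[OF d] by blast
qed

text \<open>Otherwise C is nondegenerate on the plane of v and w, and both forms split along its
  C-orthogonal complement. The remaining binary form has a conjugate pair of double points too,
  which is the situation of \<open>not_nrm_split\<close>.\<close>

lemma no_split:
 assumes P: "Pd A C = [:k:] * [:- d, 0, 1:]\<^sup>2" shows "bl C v w = 0"
proof (rule ccontr)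
 assume nz: "bl C v w \<noteq> 0"
 define a0 where "a0 = bl C v w"
 define a1 where "a1 = bl C v v"
 have N: "a0\<^sup>2 - d * a1\<^sup>2 \<noteq> 0" using norm_form_neq_0[OF d, of "bl C v w" "bl C v v"] nz by (simp add: a0_def a1_def)
 \<comment> \<open>The C-Gram matrix of v, w has determinant d a1^2 - a0^2, nonzero since d is no
   square; xc and yc are the coefficients of the orthogonal projection.\<close>
 have "\<exists>x y. a1 * x + a0 * y = m1 \<and> a0 * x + (d * a1) * y = m2" for m1 m2
  by (rule solve2) (use N in \<open>simp add: power2_eq_square algebra_simps\<close>)
 then obtain xc yc where XY: "\<And>m1 m2. a1 * xc m1 m2 + a0 * yc m1 m2 = m1 \<and> a0 * xc m1 m2 + (d * a1) * yc m1 m2 = m2"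
  by metis
 obtain x' y' where i: "indep4 v w x' y'" using indep2_extend[OF indep_vw] by blast
 define c where "c u = u - xc (bl C v u) (bl C w u) *s v - yc (bl C v u) (bl C w u) *s w" for u
 have cC: "bl C v (c u) = 0" "bl C w (c u) = 0" for u
  using XY[of "bl C v u" "bl C w u"] by (simp_all add: c_def C_w a0_def[symmetric] a1_def[symmetric] algebra_simps)
 have cC': "bl C (c u) v = 0" "bl C (c u) w = 0" for u using cC[of u] bl_sym[OF s(2)] by simp_all
 define x where "x = c x'"
 define y where "y = c y'"
 have "indep4 v w (x' - xc (bl C v x') (bl C w x') *s v) (y' - xc (bl C v y') (bl C w y') *s v)"
  using indep4_op[OF i, of 0 "xc (bl C v x') (bl C w x')" "xc (bl C v y') (bl C w y')"] by simp
 from indep4_op[OF indep4_rot[OF this], of "yc (bl C v x') (bl C w x')" "yc (bl C v y') (bl C w y')" 0]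
 have "indep4 w x y v" by (simp add: x_def y_def c_def)
 then have i: "indep4 v w x y" by (rule indep4_rot3)
 have vals: "bl C v x = 0" "bl C w x = 0" "bl C v y = 0" "bl C w y = 0" "bl C x v = 0" "bl C x w = 0" "bl C y v = 0" "bl C y w = 0"
  using cC cC' by (simp_all add: x_def y_def)
 note Cv = vals C_w[folded a0_def a1_def] a0_def[symmetric] a1_def[symmetric]
 have Av: "bl A v x = 0" "bl A w x = 0" "bl A v y = 0" "bl A w y = 0" "bl A x v = 0" "bl A x w = 0" "bl A y v = 0" "bl A y w = 0"
  "bl A v v = a0" "bl A v w = d * a1" "bl A w v = d * a1" "bl A w w = d * a0"
  by (simp_all add: A_left A_right Cv)
 define a b c' a' b' c'' where "a = bl A x x" and "b = bl A x y" and "c' = bl A y y"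
  and "a' = bl C x x" and "b' = bl C x y" and "c'' = bl C y y"
 note abc = a_def[symmetric] b_def[symmetric] c'_def[symmetric] a'_def[symmetric] b'_def[symmetric] c''_def[symmetric]
 have yx: "bl A y x = b" "bl C y x = b'" using bl_sym[OF s(1), of y x] bl_sym[OF s(2), of y x] by (simp_all add: abc)
 obtain t where t: "Pd (gr A v w x y) (gr C v w x y) = [:t:] * Pd A C" using Pd_gr by blast
 \<comment> \<open>Both Gram matrices are block diagonal; the block of v, w accounts for one factor
   t^2 - d, so the block of x, y accounts for the other.\<close>
 have "Pd (gr A v w x y) (gr C v w x y) =
  ([:a0, a1:] * [:d * a0, d * a1:] - [:d * a1, a0:] * [:d * a1, a0:]) * ([:a, a':] * [:c', c'':] - [:b, b':] * [:b, b':])"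
  unfolding Pd_def by (subst det_blocks) (simp_all add: gr_simps Av Cv abc yx)
 also have "[:a0, a1:] * [:d * a0, d * a1:] - [:d * a1, a0:] * [:d * a1, a0:] = [:- (a0\<^sup>2 - d * a1\<^sup>2):] * [:- d, 0, 1:]"
  by (simp add: power2_eq_square algebra_simps)
 also have "[:a, a':] * [:c', c'':] - [:b, b':] * [:b, b':] = [:a * c' - b * b, a * c'' + a' * c' - 2 * b * b', a' * c'' - b' * b':]"
  by (simp add: algebra_simps)
 finally have "[:- d, 0, 1:] * ([:- (a0\<^sup>2 - d * a1\<^sup>2):] * [:a * c' - b * b, a * c'' + a' * c' - 2 * b * b', a' * c'' - b' * b':]) =
   [:- d, 0, 1:] * ([:t:] * [:k:] * [:- d, 0, 1:])"
  unfolding t P by (simp only: power2_eq_square mult_ac)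
 then have "[:- (a0\<^sup>2 - d * a1\<^sup>2):] * [:a * c' - b * b, a * c'' + a' * c' - 2 * b * b', a' * c'' - b' * b':] = [:t:] * [:k:] * [:- d, 0, 1:]"
  by (rule mult_left_cancel[THEN iffD1, rotated]) simp
 then have e: "- (a0\<^sup>2 - d * a1\<^sup>2) * (a * c' - b * b) = - (t * k * d)" "- (a0\<^sup>2 - d * a1\<^sup>2) * (a * c'' + a' * c' - 2 * b * b') = 0"
  "- (a0\<^sup>2 - d * a1\<^sup>2) * (a' * c'' - b' * b') = t * k"
  by (auto simp: mult_ac)
 have "- (a0\<^sup>2 - d * a1\<^sup>2) * (a * c' + d * (a' * c'') - b * b - d * (b' * b')) =
   - (a0\<^sup>2 - d * a1\<^sup>2) * (a * c' - b * b) + d * (- (a0\<^sup>2 - d * a1\<^sup>2) * (a' * c'' - b' * b'))"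
  by (simp add: algebra_simps)
 also have "\<dots> = 0" unfolding e by simp
 finally have "a * c' + d * (a' * c'') - b * b - d * (b' * b') = 0" using N by simp
 then have r1: "a * c' + d * (a' * c'') = b * b + d * (b' * b')" by (simp add: algebra_simps)
 have r2: "a * c'' + a' * c' = 2 * b * b'" using e(2) N by simp
 have aa: "a \<noteq> 0 \<or> a' \<noteq> 0"
 proof (rule ccontr)
  assume "\<not> (a \<noteq> 0 \<or> a' \<noteq> 0)"
  then have a: "a = 0" "a' = 0" by auto
  then have "b\<^sup>2 - (- d) * b'\<^sup>2 = 0" "b * b' = 0" using r1 r2 by (simp_all add: power2_eq_square)
  then have "b' = 0" using d_neq_0 by auto
  then have "C *v x = 0" using a by (intro bl_indep_0[OF i]) (simp_all add: Cv abc yx)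
  then have "x = 0" by (rule C_inj)
  moreover have "0 *s v + 0 *s w + 1 *s x + 0 *s y = x" by simp
  ultimately show False using i unfolding indep4_def by (metis zero_neq_one)
 qed
 let ?e = "a\<^sup>2 - d * a'\<^sup>2"
 have e0: "?e \<noteq> 0" by (rule norm_form_neq_0[OF d aa])
 let ?q1 = "kk a * z3 ^ 2 + kk (2 * b) * z3 * z4 + kk c' * z4 ^ 2"
 let ?q2 = "kk a' * z3 ^ 2 + kk (2 * b') * z3 * z4 + kk c'' * z4 ^ 2"
 \<comment> \<open>By \<open>r1\<close> and \<open>r2\<close> the binary form q1 + \<theta> q2, with
   \<theta> a square root of d, has discriminant zero. Multiplied by a + \<theta> a' it is the
   square of U + \<theta> U', which is what \<open>h1\<close> and \<open>h2\<close> say.\<close>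
 define U where "U = kk a * z3 + kk b * z4"
 define U' where "U' = kk a' * z3 + kk b' * z4"
 let ?B = "U\<^sup>2 - kk d * U'\<^sup>2"
 have h1: "kk a * ?q1 + kk (d * a') * ?q2 = U\<^sup>2 + kk d * U'\<^sup>2"
 proof -
  have "kk a * ?q1 + kk (d * a') * ?q2 - (U\<^sup>2 + kk d * U'\<^sup>2) = kk (a * c' + d * (a' * c'') - (b * b + d * (b' * b'))) * z4 ^ 2"
   unfolding U_def U'_def by (simp add: rhom_simps[OF rhom_const] power2_eq_square algebra_simps)
  also have "\<dots> = 0" unfolding r1 by (simp add: rhom_0[OF rhom_const])
  finally show ?thesis by simp
 qed
 have h2: "kk a * ?q2 + kk a' * ?q1 = 2 * U * U'"
 proof -
  have "kk a * ?q2 + kk a' * ?q1 - 2 * U * U' = kk (a * c'' + a' * c' - 2 * b * b') * z4 ^ 2"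
   unfolding U_def U'_def by (simp add: rhom_simps[OF rhom_const] power2_eq_square algebra_simps)
  also have "\<dots> = 0" unfolding r2 by (simp add: rhom_0[OF rhom_const])
  finally show ?thesis by simp
 qed
 have "kk ?e * (?q1\<^sup>2 - kk d * ?q2\<^sup>2) = (kk a * ?q1 + kk (d * a') * ?q2)\<^sup>2 - kk d * (kk a * ?q2 + kk a' * ?q1)\<^sup>2"
  unfolding rhom_diff[OF rhom_const] rhom_mult[OF rhom_const] rhom_power[OF rhom_const] by (rule norm_form_mult)
 also have "\<dots> = ?B\<^sup>2" unfolding h1 h2 by (simp add: power2_eq_square algebra_simps)
 finally have q: "kk ?e * (?q1\<^sup>2 - kk d * ?q2\<^sup>2) = ?B\<^sup>2" .
 have fA: "qf (gr A v w x y) = kk a0 * (z1 ^ 2 + kk d * z2 ^ 2) + kk (2 * d * a1) * z1 * z2 + ?q1"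
  unfolding qf_gr[OF s(1)] by (simp add: Av abc rhom_simps[OF rhom_const] algebra_simps)
 have fC: "qf (gr C v w x y) = kk a1 * (z1 ^ 2 + kk d * z2 ^ 2) + kk (2 * a0) * z1 * z2 + ?q2"
  unfolding qf_gr[OF s(2)] by (simp add: Cv abc rhom_simps[OF rhom_const] algebra_simps)
 have B0: "?B \<noteq> 0"
 proof
  assume "?B = 0"
  then have "pt (\<lambda>i. if i = 3 then 1 else 0) ?B = 0" by (simp add: pt_simps)
  then show False using e0 by (simp add: U_def U'_def pt_simps)
 qed
 note n' = nrm_gr[OF n i, unfolded fA fC]
 have zB: "zfree 1 ?B" "zfree 2 ?B" "hdeg dt 2 ?B" by (simp_all add: U_def U'_def hdeg_simps)
 have pB: "pt u ?B = 0 \<and> pt u ?q1 = 0 \<and> pt u ?q2 = 0" if "u 3 = 0" "u 4 = 0" for u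
  using that by (simp add: U_def U'_def pt_simps)
 have "a0 \<noteq> 0" using nz by (simp add: a0_def)
 then show False
  by (rule not_nrm_split[OF n' _ d_neq_0 N e0 q B0]) (use zB pB in simp_all)
qed

text \<open>Both forms vanish on the plane of v and w, that is, the base curve contains a line.
  Vectors a, b dual to w, v are corrected by v and w until two parameters c0, c1 remain; these give
  \<open>not_nrm_cubic\<close>, or \<open>not_nrm_split\<close> when both are zero.\<close>

lemma no_cubic:
 assumes vw: "bl C v w = 0" "bl C v v = 0"
 shows False
proof -
 have iso: "bl C v w = 0" "bl C v v = 0" "bl C w v = 0" "bl C w w = 0" using vw C_w by simp_all
 obtain x y where i: "indep4 v w x y" using indep2_extend[OF indep_vw] by blast
 have D: "bl C v x * bl C w y - bl C v y * bl C w x \<noteq> 0"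
 proof
  assume "bl C v x * bl C w y - bl C v y * bl C w x = 0"
  then have "bl C v x * bl C w y = bl C w x * bl C v y" by (simp add: mult_ac)
  from singular2[OF this] obtain p q where pq: "p \<noteq> 0 \<or> q \<noteq> 0" "p * bl C v x + q * bl C w x = 0" "p * bl C v y + q * bl C w y = 0" by blast
  have "C *v (p *s v + q *s w) = 0"
   by (rule bl_indep_0[OF i]) (use pq iso bl_sym[OF s(2), of x] bl_sym[OF s(2), of y] in simp_all)
  then have "p *s v + q *s w = 0" by (rule C_inj)
  then show False using indep_vw pq(1) unfolding indep2_def by blast
 qed
 have dual: "\<exists>e. bl C v e = m \<and> bl C w e = m'" for m m'
 proof -
  obtain p q where "bl C v x * p + bl C v y * q = m \<and> bl C w x * p + bl C w y * q = m'" using solve2[OF D] by blast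
  then show ?thesis by (intro exI[of _ "p *s x + q *s y"]) (simp add: mult.commute)
 qed
 obtain e1 where e1: "bl C v e1 = 0" "bl C w e1 = 1" using dual by blast
 obtain e2 where e2: "bl C v e2 = 1" "bl C w e2 = 0" using dual by blast
 have e: "bl C e1 v = 0" "bl C e1 w = 1" "bl C e2 v = 1" "bl C e2 w = 0"
  using e1 e2 bl_sym[OF s(2), of e1] bl_sym[OF s(2), of e2] by simp_all
 define A11 A12 A22 C11 C12 C22 where "A11 = bl A e1 e1" and "A12 = bl A e1 e2" and "A22 = bl A e2 e2"
  and "C11 = bl C e1 e1" and "C12 = bl C e1 e2" and "C22 = bl C e2 e2"
 define k l m where "k = A22 / d" and "l = C22 / d" and "m = A12 / d"
 have klm: "A22 = d * k" "C22 = d * l" "A12 = d * m" using d_neq_0 by (simp_all add: k_def l_def m_def)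
 \<comment> \<open>r, s', t and r' solve the linear equations that give the Gram entries of a and b
   the values in \<open>ab\<close>.\<close>
 define r where "r = (- A11 - C12 - (A11 - k) / 2) / 4"
 define s' where "s' = (A11 - k) / 2 + r"
 define h where "h = (C11 - l) / 2"
 define t where "t = (- C11 - m - h) / 4"
 define r' where "r' = d * (h + t)"
 define c0 where "c0 = A11 + 2 * r"
 define c1 where "c1 = C11 + 2 * t"
 define a where "a = e1 + r *s v + t *s w"
 define b where "b = e2 + r' *s v + s' *s w"
 have sy: "bl A e2 e1 = A12" "bl C e2 e1 = C12" using bl_sym[OF s(1), of e2 e1] bl_sym[OF s(2), of e2 e1] by (simp_all add: A12_def C12_def)
 note ent = A11_def[symmetric] A12_def[symmetric] A22_def[symmetric] C11_def[symmetric] C12_def[symmetric] C22_def[symmetric]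
 have Cab: "bl C a v = 0" "bl C a w = 1" "bl C b v = 1" "bl C b w = 0" "bl C v a = 0" "bl C w a = 1" "bl C v b = 1" "bl C w b = 0"
  by (simp_all add: a_def b_def e e1 e2 iso)
 have Aab: "bl A a v = 1" "bl A a w = 0" "bl A b v = 0" "bl A b w = d" "bl A v a = 1" "bl A w a = 0" "bl A v b = 0" "bl A w b = d"
  "bl A v v = 0" "bl A v w = 0" "bl A w w = 0" "bl A w v = 0"
  by (simp_all add: A_left A_right Cab iso)
 have vals: "bl A a a = A11 + 2 * r" "bl C a a = C11 + 2 * t" "bl A b b = d * (k + 2 * s')" "bl C b b = d * (l + 2 * (h + t))"
  "bl A a b = d * (m + (h + t) + t)" "bl C a b = C12 + s' + r"
  by (simp_all add: a_def b_def A_left A_right e e1 e2 iso ent klm r'_def algebra_simps)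
 have q1: "k + 2 * s' = c0" "l + 2 * (h + t) = c1" "C12 + s' + r = - c0"
  by (simp_all add: c0_def c1_def s'_def r_def t_def h_def field_simps)
 have q2: "m + (h + t) + t = - c1" by (simp add: c1_def t_def h_def field_simps)
 have ab: "bl A a a = c0" "bl C a a = c1" "bl A b b = d * c0" "bl C b b = d * c1" "bl A a b = - (d * c1)" "bl C a b = - c0"
  by (simp_all only: vals q1 q2 c0_def[symmetric] c1_def[symmetric] mult_minus_right)
 have ba: "bl A b a = - (d * c1)" "bl C b a = - c0" using ab bl_sym[OF s(1), of b a] bl_sym[OF s(2), of b a] by simp_all
 have i: "indep4 a b v w" unfolding indep4_def
 proof (intro allI impI)
  fix p q x y assume h: "p *s a + q *s b + x *s v + y *s w = 0"
  have pq: "q = 0" "p = 0" using arg_cong[OF h, of "bl C v"] arg_cong[OF h, of "bl C w"] by (simp_all add: Cab iso)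
  then have "x = 0 \<and> y = 0" using h indep_vw unfolding indep2_def by simp
  then show "p = 0 \<and> q = 0 \<and> x = 0 \<and> y = 0" using pq by simp
 qed
 let ?f = "kk c0 * (z1 ^ 2 + kk d * z2 ^ 2) - kk (2 * d * c1) * (z1 * z2) + 2 * (z1 * z3 + kk d * z2 * z4)"
 let ?g = "kk c1 * (z1 ^ 2 + kk d * z2 ^ 2) - kk (2 * c0) * (z1 * z2) + 2 * (z1 * z4 + z2 * z3)"
 have fA: "qf (gr A a b v w) = ?f"
  unfolding qf_gr[OF s(1)] by (simp add: Aab ab rhom_simps[OF rhom_const] algebra_simps)
 have fC: "qf (gr C a b v w) = ?g"
  unfolding qf_gr[OF s(2)] by (simp add: Cab iso ab rhom_simps[OF rhom_const] algebra_simps)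
 note n' = nrm_gr[OF n i, unfolded fA fC]
 show False
 proof (cases "c0 = 0 \<and> c1 = 0")
  case False
  then have N: "c0\<^sup>2 - d * c1\<^sup>2 \<noteq> 0" by (intro norm_form_neq_0[OF d]) auto
  \<comment> \<open>With \<theta> a square root of d, f + \<theta> g is divided by c0 + c1 \<theta>,
    using the inverse norm N.\<close>
  define N where "N = inverse (c0\<^sup>2 - d * c1\<^sup>2)"
  have N1: "N * (c0\<^sup>2 - d * c1\<^sup>2) = 1" using N by (simp add: N_def)
  then have N1': "kk N * (kk c0 * kk c0 - kk d * (kk c1 * kk c1)) = 1"
   by (simp add: rhom_mult[OF rhom_const, symmetric] rhom_diff[OF rhom_const, symmetric] rhom_1[OF rhom_const] power2_eq_square)
  have "(N * c0) * (N * c0) - (- (d * (N * c1))) * (- (N * c1)) = N * (N * (c0\<^sup>2 - d * c1\<^sup>2))"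
   by (simp add: power2_eq_square algebra_simps)
  then have "(N * c0) * (N * c0) - (- (d * (N * c1))) * (- (N * c1)) \<noteq> 0" unfolding N1 using N by (simp add: N_def)
  note n'' = nrm_pencil[OF n' this]
  let ?s = "z1 * z3 + kk d * z2 * z4" and ?t = "z1 * z4 + z2 * z3"
  have "kk (N * c0) * ?f + kk (- (d * (N * c1))) * ?g =
    kk N * (kk c0 * kk c0 - kk d * (kk c1 * kk c1)) * (z1 ^ 2 + kk d * z2 ^ 2) + kk (2 * N * c0) * ?s + kk (d * (- 2 * N * c1)) * ?t"
   by (simp add: rhom_simps[OF rhom_const] algebra_simps)
  moreover have "kk (- (N * c1)) * ?f + kk (N * c0) * ?g =
    kk (- 2 * N * c1) * ?s + kk (2 * N * c0) * ?t - kk N * (kk c0 * kk c0 - kk d * (kk c1 * kk c1)) * (2 * z1 * z2)"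
   by (simp add: rhom_simps[OF rhom_const] algebra_simps)
  ultimately have "nrm (z1 ^ 2 + kk d * z2 ^ 2 + kk (2 * N * c0) * ?s + kk (d * (- 2 * N * c1)) * ?t)
   (kk (- 2 * N * c1) * ?s + kk (2 * N * c0) * ?t - 2 * z1 * z2)" using n'' unfolding N1' by simp
  then show False using d_neq_0 by (rule not_nrm_cubic)
 next
  case True
  then have c: "c0 = 0" "c1 = 0" by auto
  \<comment> \<open>Here f + \<theta> g is twice a product of two linear forms; sums and differences
    of the basis vectors make it a difference of squares.\<close>
  let ?q1 = "- 2 * (z3 ^ 2 + kk d * z4 ^ 2)" and ?q2 = "- 4 * z3 * z4" and ?B = "2 * (z3 ^ 2 - kk d * z4 ^ 2)"
  have i': "indep4 (a + v) (b + w) (a - v) (b - w)" unfolding indep4_def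
  proof (intro allI impI)
   fix p q x y assume "p *s (a + v) + q *s (b + w) + x *s (a - v) + y *s (b - w) = 0"
   then have "(p + x) *s a + (q + y) *s b + (p - x) *s v + (q - y) *s w = 0" by (simp add: vec_eq_iff algebra_simps)
   then have "p + x = 0" "q + y = 0" "p - x = 0" "q - y = 0" using i unfolding indep4_def by blast+
   then have xy: "x = p" "y = q" and "p + x = 0" "q + y = 0" by (simp_all only: right_minus_eq)
   then have "2 * p = 0" "2 * q = 0" by (simp_all only: mult_2)
   then show "p = 0 \<and> q = 0 \<and> x = 0 \<and> y = 0" using xy by simp
  qed
  have fA: "qf (gr A (a + v) (b + w) (a - v) (b - w)) = kk 2 * (z1 ^ 2 + kk d * z2 ^ 2) + kk (2 * d * 0) * z1 * z2 + ?q1"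
   unfolding qf_gr[OF s(1)] by (simp add: Aab ab ba c rhom_simps[OF rhom_const] algebra_simps)
  have fC: "qf (gr C (a + v) (b + w) (a - v) (b - w)) = kk 0 * (z1 ^ 2 + kk d * z2 ^ 2) + kk (2 * 2) * z1 * z2 + ?q2"
   unfolding qf_gr[OF s(2)] by (simp add: Cab iso ab ba c rhom_simps[OF rhom_const] algebra_simps)
  note n'' = nrm_gr[OF n i', unfolded fA fC]
  have q: "kk 1 * (?q1\<^sup>2 - kk d * ?q2\<^sup>2) = ?B\<^sup>2"
   by (simp add: rhom_1[OF rhom_const] power2_eq_square algebra_simps)
  have B0: "?B \<noteq> 0"
  proof
   assume "?B = 0"
   then have "pt (\<lambda>i. if i = 3 then 1 else 0) ?B = 0" by (simp only: pt_simps)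
   then show False by (simp add: pt_simps)
  qed
  have zB: "zfree 1 ?B" "zfree 2 ?B" "zfree 1 ?q1" "zfree 2 ?q1" "zfree 1 ?q2" "zfree 2 ?q2" by simp_all
  have "hdeg dt 2 (kk 2 * (z3 ^ 2 - kk d * z4 ^ 2))" by (simp add: hdeg_simps)
  then have hB: "hdeg dt 2 ?B" by (simp add: rhom_numeral[OF rhom_const])
  show False
   by (rule not_nrm_split[OF n'' _ d_neq_0 _ _ q B0]) (use zB hB in \<open>simp_all add: pt_simps\<close>)
 qed
qed

end

lemma pm_mv: "pm a A b C *v u = a *s (A *v u) + b *s (C *v u)"
 by (simp add: vec_eq_iff pm_def matrix_vector_mult_def sum_4 algebra_simps)

text \<open>The values - n^2 for natural n are infinitely many.\<close>

lemma poly_eq_squares: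
 fixes p q :: "'a::field_char_0 poly"
 assumes "\<And>x. poly p (- x\<^sup>2) = poly q (- x\<^sup>2)" shows "p = q"
proof (rule ccontr)
 assume "p \<noteq> q"
 then have "finite {y. poly (p - q) y = 0}" by (intro poly_roots_finite) simp
 moreover have "range (\<lambda>n::nat. - (of_nat n :: 'a)\<^sup>2) \<subseteq> {y. poly (p - q) y = 0}" using assms by auto
 ultimately have "finite (range (\<lambda>n::nat. - (of_nat n :: 'a)\<^sup>2))" by (rule rev_finite_subset)
 moreover have "inj (\<lambda>n::nat. - (of_nat n :: 'a)\<^sup>2)"
  by (rule injI) (simp add: of_nat_power[symmetric] del: of_nat_power)
 ultimately show False using finite_imageD infinite_UNIV_nat by blast
qed

text \<open>From (A + xC) C^-1 (A - xC) = A C^-1 A - x^2 C, the form A C^-1 A - d C is singular,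
  which yields a pair v, w over k. \<open>no_split\<close> applies to it and to (v + w, w + d v),
  the same eigenvector multiplied by 1 + \<theta> with \<theta> a square root of d; together they
  give C v w = C v v = 0, against \<open>no_cubic\<close>.\<close>

lemma no_conjugate_double_roots:
 fixes A C :: "'a::field_char_0 ^ 4 ^ 4"
 assumes n: "nrm (qf A) (qf C)" and s: "symm A" "symm C" and C: "det C \<noteq> 0" and d: "\<And>x. x\<^sup>2 \<noteq> d"
  and P: "Pd A C = [:k:] * [:- d, 0, 1:]\<^sup>2"
 shows False
proof -
 obtain I where I: "C ** I = mat 1" "I ** C = mat 1"
  using C invertible_det_nz[of C] unfolding invertible_def by blast
 have CI: "C *v (I *v u) = u" "I *v (C *v u) = u" for u using I by (simp_all add: matrix_vector_mul_assoc)
 define H where "H = A ** (I ** A)"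
 have e: "pm 1 A x C ** (I ** pm 1 A (- x) C) = pm 1 H (- x\<^sup>2) C" for x
  unfolding matrix_eq H_def
  by (simp add: matrix_vector_mul_assoc[symmetric] pm_mv CI vec_eq_iff power2_eq_square algebra_simps)
 have "poly (Pd H C) (- x\<^sup>2) = poly ([:det I * k * k:] * [:- d, - 1:] ^ 4) (- x\<^sup>2)" for x
 proof -
  have "poly (Pd H C) (- x\<^sup>2) = poly (Pd A C) x * (det I * poly (Pd A C) (- x))"
   unfolding poly_Pd e[symmetric] by (simp add: det_mul)
  then show ?thesis unfolding P by (simp add: power2_eq_square numeral_eq_Suc algebra_simps)
 qed
 then have "Pd H C = [:det I * k * k:] * [:- d, - 1:] ^ 4" by (rule poly_eq_squares)
 then have "poly (Pd H C) (- d) = 0" by simp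
 then have "det (pm 1 H (- d) C) = 0" by (simp add: poly_Pd)
 then obtain v where v: "v \<noteq> 0" "pm 1 H (- d) C *v v = 0" using singular_kernel by blast
 have Hv: "A *v (I *v (A *v v)) = d *s (C *v v)"
  using v(2) by (simp add: pm_mv H_def matrix_vector_mul_assoc[symmetric] vec_eq_iff)
 define w where "w = I *v (A *v v)"
 have w: "A *v v = C *v w" "A *v w = d *s (C *v v)" using Hv by (simp_all add: w_def CI)
 note ctx = n s C d
 have vw0: "bl C v w = 0" by (rule no_split[OF n s C d v(1) w P])
 have "v + w \<noteq> 0"
 proof
  assume "v + w = 0"
  then have "1 *s v + 1 *s w = 0" by simp
  then show False using indep_vw[OF n s C d v(1) w] unfolding indep2_def by (metis zero_neq_one)
 qed
 moreover have "A *v (v + w) = C *v (w + d *s v)" "A *v (w + d *s v) = d *s (C *v (v + w))"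
  using w by (simp_all add: vec_eq_iff algebra_simps)
 ultimately have "bl C (v + w) (w + d *s v) = 0" by (intro no_split[OF n s C d _ _ _ P])
 then have "2 * (d * bl C v v) = 0"
  using vw0 C_w[OF n s C d v(1) w] by simp
 then have "bl C v v = 0" using d_neq_0[OF n s C d v(1) w] by simp
 then show False by (rule no_cubic[OF n s C d v(1) w vw0])
qed

lemma pcompose_Pd: "Pd (pm 1 A x C) C = pcompose (Pd A C) [:x, 1:]" for x :: "'a::field_char_0"
proof -
 have "pm 1 (pm 1 A x C) y C = pm 1 A (x + y) C" for y by (simp add: vec_eq_iff pm_def algebra_simps)
 then have "poly (Pd (pm 1 A x C) C) y = poly (pcompose (Pd A C) [:x, 1:]) y" for y
  by (simp add: poly_Pd poly_pcompose)
 then show ?thesis by (simp only: poly_eq_poly_eq_iff[symmetric] fun_eq_iff) blast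
qed

abbreviation upL :: "'k::field poly \<Rightarrow> 'k alg_closure poly" where "upL \<equiv> map_poly to_ac"

lemma upL_simps:
 fixes p q :: "'k::field poly"
 shows "upL (p + q) = upL p + upL q" "upL (p * q) = upL p * upL q" "upL (pderiv p) = pderiv (upL p)"
 "poly (upL p) (to_ac x) = to_ac (poly p x)"
proof -
 have r: "rhom (to_ac :: 'k \<Rightarrow> _)" by (simp add: rhom_def)
 show "upL (p + q) = upL p + upL q" by (rule poly_eqI) (simp add: coeff_map_poly)
 show "upL (p * q) = upL p * upL q" by (rule rhom_mult[OF rhom_map_poly[OF r]])
 show "upL (pderiv p) = pderiv (upL p)" by (rule poly_eqI) (simp add: coeff_map_poly coeff_pderiv)
 show "poly (upL p) (to_ac x) = to_ac (poly p x)" by (induction p) (simp_all add: map_poly_pCons)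
qed

text \<open>m has least degree over k among the polynomials vanishing at \<theta>. By minimality its
  derivative does not vanish there, so a double root of D makes m divide the cofactor as
  well.\<close>

lemma double_root_square:
 fixes D :: "'k::field_char_0 poly"
 assumes D: "D \<noteq> 0" and r: "poly (upL D) \<theta> = 0" "poly (pderiv (upL D)) \<theta> = 0"
 shows "\<exists>m u. D = m\<^sup>2 * u \<and> m \<noteq> 0 \<and> poly (upL m) \<theta> = 0 \<and>
  (\<forall>q. q \<noteq> 0 \<longrightarrow> poly (upL q) \<theta> = 0 \<longrightarrow> pdeg m \<le> pdeg q)"
proof -
 define S where "S q \<longleftrightarrow> q \<noteq> 0 \<and> poly (upL q) \<theta> = 0" for q :: "'k poly"
 obtain m where m: "S m" and min: "\<And>q. S q ==> pdeg m \<le> pdeg q"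
  using ex_has_least_nat[of S D pdeg] D r(1) unfolding S_def by blast
 have dvd: "m dvd q" if "poly (upL q) \<theta> = 0" for q
 proof (rule ccontr)
  assume nd: "\<not> m dvd q"
  have "poly (upL q) \<theta> = poly (upL (q div m * m + q mod m)) \<theta>" by simp
  also have "\<dots> = poly (upL (q mod m)) \<theta>" using m unfolding upL_simps S_def by simp
  finally have "S (q mod m)" using that nd unfolding S_def by (simp add: mod_eq_0_iff_dvd)
  moreover have "pdeg (q mod m) < pdeg m"
   using degree_mod_less'[of m q] m nd unfolding S_def by (simp add: mod_eq_0_iff_dvd)
  ultimately show False using min by fastforce
 qed
 obtain u where u: "D = m * u" using dvd[OF r(1)] by blast
 have "pdeg m \<noteq> 0"
 proof
  assume "pdeg m = 0"
  then obtain a where "m = [:a:]" by (metis degree_eq_zeroE)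
  then show False using m unfolding S_def by (simp add: map_poly_pCons)
 qed
 then have "poly (upL (pderiv m)) \<theta> \<noteq> 0" "pderiv m \<noteq> 0"
  using min[of "pderiv m"] unfolding S_def by (auto simp: degree_pderiv pderiv_eq_0_iff)
 moreover have "poly (upL (pderiv m)) \<theta> * poly (upL u) \<theta> = 0"
  using r(2) m unfolding u S_def by (auto simp: upL_simps pderiv_mult)
 ultimately have "poly (upL u) \<theta> = 0" by simp
 then obtain u' where "u = m * u'" using dvd by blast
 then have "D = m\<^sup>2 * u'" using u by (simp add: power2_eq_square mult_ac)
 then show ?thesis using m min unfolding S_def by blast
qed

lemma degree_mult_le2: "pdeg p \<le> 1 ==> pdeg q \<le> n ==> pdeg (p * q) \<le> Suc n"
 using degree_mult_le[of p q] by simp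

lemma degree_Pd: "pdeg (Pd A C) \<le> 4"
proof -
 show ?thesis
  unfolding Pd_def det_4 vec_lambda_beta numeral_eq_Suc pred_numeral_simps numeral_nat
  by (intro degree_diff_le degree_add_le degree_mult_le2; simp)
qed

text \<open>As m^2 divides a polynomial of degree at most 4, m has degree 1 or 2. In degree 1 the
  double root is moved to 0 and contradicts \<open>pencil_simple_root\<close>. In degree 2
  completing the square gives a multiple of (t^2 - d)^2, where d is no square by minimality of
  m.\<close>

lemma Pd_simple_roots:
 fixes A C :: "'k::field_char_0 ^ 4 ^ 4"
 assumes n: "nrm (qf A) (qf C)" and s: "symm A" "symm C" and C: "det C \<noteq> 0" and r: "poly (upL (Pd A C)) \<theta> = 0"
  and D: "Pd A C \<noteq> 0"
 shows "poly (pderiv (upL (Pd A C))) \<theta> \<noteq> 0"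
proof
 assume r': "poly (pderiv (upL (Pd A C))) \<theta> = 0"
 from double_root_square[OF D r r'] obtain m u where m: "Pd A C = m\<^sup>2 * u" "m \<noteq> 0" "poly (upL m) \<theta> = 0"
  and min: "\<And>q. q \<noteq> 0 ==> poly (upL q) \<theta> = 0 ==> pdeg m \<le> pdeg q" by blast
 have u: "u \<noteq> 0" using D m(1) by auto
 have "2 * pdeg m + pdeg u \<le> 4"
  using degree_Pd[of A C] unfolding m(1) by (simp add: degree_mult_eq m(2) u degree_power_eq)
 then consider "pdeg m = 0" | "pdeg m = 1" | "pdeg m = 2" "pdeg u = 0" by linarith
 then show False
 proof cases
  case 1
  then obtain a where "m = [:a:]" by (metis degree_eq_zeroE)
  then show False using m by (simp add: map_poly_pCons)
 next
  case 2
  define a b where "a = pco m 0" and "b = pco m 1"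
  have ab: "m = [:a, b:]" "b \<noteq> 0"
  proof -
   show "m = [:a, b:]"
    unfolding a_def b_def using 2 by (intro poly_eqI) (auto simp: coeff_pCons coeff_eq_0 split: nat.splits)
   show "b \<noteq> 0" using 2 m(2) unfolding b_def by (metis leading_coeff_neq_0)
  qed
  define x where "x = - a / b"
  have mx: "pcompose m [:x, 1:] = [:0, b:]" using ab(2) by (simp add: ab(1) pcompose_pCons x_def)
  have P: "Pd (pm 1 A x C) C = [:0, b:] * ([:0, b:] * pcompose u [:x, 1:])"
   unfolding pcompose_Pd m(1) by (simp only: pcompose_mult power2_eq_square mx mult.assoc)
  have n': "nrm (qf (pm 1 A x C)) (qf C)" using nrm_pm[OF n, of 1 1 x 0] by (simp add: pm_def[of 0])
  have "poly (Pd (pm 1 A x C) C) 0 = 0" unfolding P by simp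
  then have "det (pm 1 A x C) = 0" by (simp add: poly_Pd pm_def)
  from pencil_simple_root[OF n' symm_pm[OF s] s(2) this] show False unfolding P by simp
 next
  case 3
  obtain k where k: "u = [:k:]" using 3(2) by (metis degree_eq_zeroE)
  have "m = [:pco m 0, pco m 1, pco m 2:]"
   using 3(1) by (intro poly_eqI) (auto simp: coeff_pCons coeff_eq_0 numeral_2_eq_2 split: nat.splits)
  moreover define a b c where "a = pco m 2" and "b = pco m 1" and "c = pco m 0"
  ultimately have abc: "m = [:c, b, a:]" by simp
  have a: "a \<noteq> 0" using 3(1) m(2) unfolding a_def by (metis leading_coeff_neq_0)
  define x where "x = - b / (2 * a)"
  define d where "d = (b\<^sup>2 - 4 * a * c) / (4 * a\<^sup>2)"
  have mx: "pcompose m [:x, 1:] = [:a:] * [:- d, 0, 1:]"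
   using a by (simp add: abc pcompose_pCons x_def d_def field_simps power2_eq_square)
  have nosq: "y\<^sup>2 \<noteq> d" for y
  proof
   assume y: "y\<^sup>2 = d"
   have "poly m (x + y) = poly (pcompose m [:x, 1:]) y" by (simp add: poly_pcompose)
   also have "\<dots> = 0" unfolding mx using y by (simp add: power2_eq_square)
   finally obtain l where l: "m = [:- (x + y), 1:] * l" using poly_eq_0_iff_dvd by blast
   have l0: "l \<noteq> 0" using m(2) l by auto
   have dl: "pdeg l = 1" using 3(1) l0 unfolding l by (subst (asm) degree_mult_eq) auto
   have "poly (upL [:- (x + y), 1:]) \<theta> = 0 \<or> poly (upL l) \<theta> = 0" using m(3) unfolding l upL_simps by simp
   then show False using min[of "[:- (x + y), 1:]"] min[of l] l0 dl 3(1) by auto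
  qed
  have P: "Pd (pm 1 A x C) C = [:k * a * a:] * [:- d, 0, 1:]\<^sup>2"
   unfolding pcompose_Pd m(1) k pcompose_mult power2_eq_square mx by (simp add: pcompose_pCons mult_ac)
  have n': "nrm (qf (pm 1 A x C)) (qf C)" using nrm_pm[OF n, of 1 1 x 0] by (simp add: pm_def[of 0])
  show False by (rule no_conjugate_double_roots[OF n' symm_pm[OF s] s(2) C nosq P])
 qed
qed

section \<open>Diagonalization over the algebraic closure\<close>

section \<open>Simultaneous diagonalization\<close>

definition mapL :: "'k::field ^ 4 ^ 4 \<Rightarrow> 'k alg_closure ^ 4 ^ 4" where "mapL A = (\<chi> i j. to_ac (en A i j))"

lemma embL_qf: "embL (qf A) = qf (mapL A)"
 by (simp add: qf_def mapL_def rhom_sum[OF rhom_embL] rhom_mult[OF rhom_embL])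

lemma symm_mapL: "symm A ==> symm (mapL A)"
 by (simp add: vec_eq_iff transpose_def mapL_def)

lemma det_mapL: "det (mapL A) = to_ac (det A)"
 using rhom_det[of to_ac A] by (simp add: rhom_def mapL_def)

lemma Pd_mapL: "Pd (mapL A) (mapL C) = upL (Pd A C)"
proof -
 have "rhom (upL :: 'a poly \<Rightarrow> _)" by (rule rhom_map_poly) (simp add: rhom_def)
 then show ?thesis unfolding Pd_def by (subst rhom_det) (simp_all add: mapL_def map_poly_pCons)
qed

lemma poly4_expand:
 assumes "pdeg p \<le> 4"
 shows "p = [:pco p 0, pco p 1, pco p 2, pco p 3, pco p 4:]"
proof (rule poly_eqI)
 fix n show "pco p n = pco [:pco p 0, pco p 1, pco p 2, pco p 3, pco p 4:] n"
  using assms coeff_eq_0[of p n] by (auto simp: coeff_pCons numeral_eq_Suc split: nat.splits)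
qed

text \<open>\<open>Pd A C\<close> is the reversal of \<open>Pd C A\<close>, because det (A + xC) =
  x^4 det (C + A/x).\<close>

lemma coeff_Pd_4:
 fixes A C :: "'a::field_char_0 ^ 4 ^ 4"
 shows "pco (Pd A C) 4 = det C"
proof -
 define E where "E = Pd C A"
 define R where "R = [:pco E 4, pco E 3, pco E 2, pco E 1, pco E 0:]"
 have E: "E = [:pco E 0, pco E 1, pco E 2, pco E 3, pco E 4:]"
  unfolding E_def by (rule poly4_expand[OF degree_Pd])
 have "poly ([:0, 1:] * Pd A C) x = poly ([:0, 1:] * R) x" for x
 proof (cases "x = 0")
  case False
  have "det (\<chi> i j. x * en M i j) = x ^ 4 * det M" for M :: "'a ^ 4 ^ 4"
   unfolding det_4 by (simp add: numeral_eq_Suc algebra_simps)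
  moreover have "pm 1 A x C = (\<chi> i j. x * en (pm 1 C (1 / x) A) i j)" using False by (simp add: pm_def vec_eq_iff algebra_simps)
  ultimately have "poly (Pd A C) x = x ^ 4 * poly E (1 / x)" by (simp add: poly_Pd E_def)
  also have "\<dots> = poly R x" by (subst E) (use False in \<open>simp add: R_def field_simps numeral_eq_Suc\<close>)
  finally show ?thesis by simp
 qed simp
 then have "[:0, 1:] * Pd A C = [:0, 1:] * R" by (simp only: poly_eq_poly_eq_iff[symmetric] fun_eq_iff) blast
 then have "Pd A C = R" by (rule mult_left_cancel[THEN iffD1, rotated]) simp
 then have "pco (Pd A C) 4 = pco E 0" by (simp add: R_def numeral_eq_Suc)
 also have "\<dots> = det C" unfolding E_def by (simp add: poly_0_coeff_0[symmetric] poly_Pd pm_def)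
 finally show ?thesis .
qed

lemma simple_roots_card:
 fixes p :: "'b::alg_closed_field poly"
 assumes "pdeg p = n" "p \<noteq> 0" "\<And>x. poly p x = 0 ==> poly (pderiv p) x \<noteq> 0"
 shows "\<exists>S. finite S \<and> card S = n \<and> (\<forall>x\<in>S. poly p x = 0)"
 using assms
proof (induction n arbitrary: p)
 case 0
 then show ?case by (intro exI[of _ "{}"]) simp
next
 case (Suc n)
 obtain x where x: "poly p x = 0" using alg_closed_imp_poly_has_root[of p] Suc.prems by auto
 then obtain q where q: "p = [:- x, 1:] * q" using poly_eq_0_iff_dvd by blast
 have q0: "q \<noteq> 0" using Suc.prems q by auto
 have d: "poly (pderiv p) y = (y - x) * poly (pderiv q) y + poly q y" for y
  unfolding q pderiv_mult by (simp add: pderiv_pCons algebra_simps)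
 have "pdeg q = n" using Suc.prems(1) q0 unfolding q by (subst (asm) degree_mult_eq) auto
 moreover have "poly (pderiv q) y \<noteq> 0" if "poly q y = 0" for y
  using Suc.prems(3)[of y] that d[of y] by (auto simp: q)
 ultimately obtain S where S: "finite S" "card S = n" "\<forall>x\<in>S. poly q x = 0" using Suc.IH[of q] q0 by blast
 have "x \<notin> S" using S(3) Suc.prems(3)[OF x] d[of x] by auto
 then show ?case using S x by (intro exI[of _ "insert x S"]) (auto simp: q)
qed

text \<open>Eigenvectors for different eigenvalues are orthogonal for both forms by symmetry, and
  independent by the usual elimination.\<close>

lemma four_eigenvectors:
 fixes A C :: "'a::field_char_0 ^ 4 ^ 4"
 assumes s: "symm A" "symm C" and C: "det C \<noteq> 0" and \<theta>: "inj \<theta>"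
  and v: "\<And>i::4. v i \<noteq> 0" "\<And>i. A *v v i = - \<theta> i *s (C *v v i)"
 shows "indep4 (v 1) (v 2) (v 3) (v 4) \<and> diag (\<lambda>i. bl A (v i) (v i)) (\<lambda>i. bl C (v i) (v i)) \<and>
  (\<forall>i j. i \<noteq> j \<longrightarrow> bl A (v i) (v j) = 0 \<and> bl C (v i) (v j) = 0)"
proof -
 have inj: "u = 0" if "C *v u = 0" for u using that kernel_singular C by blast
 have ne: "\<theta> i \<noteq> \<theta> j" if "i \<noteq> j" for i j using \<theta> that by (auto dest: injD)
 have A: "bl A u (v j) = - \<theta> j * bl C u (v j)" for u j
  unfolding bl_def v(2) by (simp only: dot_simps(4))
 have C0: "bl C (v i) (v j) = 0" if "i \<noteq> j" for i j
 proof -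
  have "- \<theta> j * bl C (v i) (v j) = - \<theta> i * bl C (v i) (v j)"
   using A[of "v i" j] A[of "v j" i] bl_sym[OF s(1), of "v i" "v j"] bl_sym[OF s(2), of "v j" "v i"] by auto
  then show ?thesis using ne[OF that] by simp
 qed
 \<comment> \<open>Applying A and cancelling the nonsingular C multiplies the i-th coefficient of a
   relation by \<theta> i - t; three shifts leave one term.\<close>
 have shift: "(\<Sum>i\<in>UNIV. (c i * (\<theta> i - t)) *s v i) = 0" if "(\<Sum>i\<in>UNIV. c i *s v i) = 0" for c t
 proof -
  have e: "c 1 *s v 1 + c 2 *s v 2 + c 3 *s v 3 + c 4 *s v 4 = 0" using that by (simp add: sum_4)
  let ?u = "(c 1 * \<theta> 1) *s v 1 + (c 2 * \<theta> 2) *s v 2 + (c 3 * \<theta> 3) *s v 3 + (c 4 * \<theta> 4) *s v 4"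
  have "A *v (c 1 *s v 1 + c 2 *s v 2 + c 3 *s v 3 + c 4 *s v 4) + C *v ?u = 0"
   by (simp only: mv_simps v(2)) (simp add: vec_eq_iff algebra_simps)
  then have "C *v ?u = 0" unfolding e by simp
  then have "?u - t *s (c 1 *s v 1 + c 2 *s v 2 + c 3 *s v 3 + c 4 *s v 4) = 0" using inj e by simp
  then show ?thesis by (simp add: sum_4 vec_eq_iff algebra_simps)
 qed
 have coord0: "c i = 0" if h: "(\<Sum>i\<in>UNIV. c i *s v i) = 0" for c i
 proof -
  have "\<exists>j k l. distinct [i, j, k, l]"
  proof -
   obtain j :: 4 where "i \<noteq> j" by (metis one_neq_zero numeral_neq_zero zero_neq_one)
   then show ?thesis using ex_distinct4 by blast
  qed
  then obtain j k l where d: "distinct [i, j, k, l]" by blast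
  define b where "b m = c m * (\<theta> m - \<theta> j) * (\<theta> m - \<theta> k) * (\<theta> m - \<theta> l)" for m
  have "(\<Sum>m\<in>UNIV. b m *s v m) = 0" unfolding b_def by (intro shift h)
  then have "b i *s v i + b j *s v j + b k *s v k + b l *s v l = 0" by (simp only: sum_distinct4[OF d])
  then have "b i *s v i = 0" by (simp add: b_def)
  then have "b i = 0" using v(1)[of i] by (auto simp: vec_eq_iff)
  then show ?thesis using d ne by (auto simp: b_def)
 qed
 have i: "indep4 (v 1) (v 2) (v 3) (v 4)" unfolding indep4_def
 proof (intro allI impI)
  fix p q r t assume "p *s v 1 + q *s v 2 + r *s v 3 + t *s v 4 = 0"
  then have "(\<Sum>i\<in>UNIV. fr p q r t i *s v i) = 0" by (simp add: sum_4)
  from coord0[OF this] have "fr p q r t i = 0" for i .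
  from this[of 1] this[of 2] this[of 3] this[of 4] show "p = 0 \<and> q = 0 \<and> r = 0 \<and> t = 0" by simp
 qed
 have q: "bl C (v j) (v j) \<noteq> 0" for j
 proof
  assume 0: "bl C (v j) (v j) = 0"
  have "bl C (v i) (v j) = 0" for i using 0 C0 by (cases "i = j") auto
  then have "C *v v j = 0" by (intro bl_indep_0[OF i]) auto
  then show False using inj v(1) by blast
 qed
 have "diag (\<lambda>i. bl A (v i) (v i)) (\<lambda>i. bl C (v i) (v i))"
 proof
  fix i j :: 4 assume "i \<noteq> j"
  have "bl A (v i) (v i) * bl C (v j) (v j) - bl A (v j) (v j) * bl C (v i) (v i) = (\<theta> j - \<theta> i) * (bl C (v i) (v i) * bl C (v j) (v j))"
   by (simp add: A algebra_simps)
  then show "bl A (v i) (v i) * bl C (v j) (v j) - bl A (v j) (v j) * bl C (v i) (v i) \<noteq> 0" using q ne[OF \<open>i \<noteq> j\<close>] by simp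
 qed
 then show ?thesis using i C0 A by simp
qed

lemma diagonalization_nonsingular:
 fixes A C :: "'k::field_char_0 ^ 4 ^ 4"
 assumes n: "nrm (qf A) (qf C)" and s: "symm A" "symm C" and C: "det C \<noteq> 0"
 shows "\<exists>V W p q. inverses V W \<and> diag p q \<and> lin V (embL (qf A)) = (\<Sum>i\<in>UNIV. kk (p i) * mpv i ^ 2) \<and>
  lin V (embL (qf C)) = (\<Sum>i\<in>UNIV. kk (q i) * mpv i ^ 2)"
proof -
 have D4: "pdeg (Pd A C) = 4"
  using coeff_Pd_4[of A C] C degree_Pd[of A C] le_degree[of "Pd A C" 4] by simp
 then have D: "Pd A C \<noteq> 0" by auto
 have "pdeg (upL (Pd A C)) = 4" unfolding D4[symmetric] by (rule degree_map_poly) simp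
 moreover from this have "upL (Pd A C) \<noteq> 0" by auto
 ultimately obtain S where S: "finite S" "card S = 4" "\<forall>x\<in>S. poly (upL (Pd A C)) x = 0"
  using simple_roots_card[of "upL (Pd A C)" 4] Pd_simple_roots[OF n s C _ D] by blast
 have "card (UNIV :: 4 set) = card S" using S(2) by simp
 then obtain \<theta> :: "4 \<Rightarrow> 'k alg_closure" where \<theta>: "bij_betw \<theta> UNIV S" using finite_same_card_bij[OF finite S(1)] by blast
 have "\<exists>v. v \<noteq> 0 \<and> mapL A *v v = - \<theta> i *s (mapL C *v v)" for i
 proof -
  have "\<theta> i \<in> S" using \<theta> by (auto simp: bij_betw_def)
  then have "det (pm 1 (mapL A) (\<theta> i) (mapL C)) = 0" using S(3) by (simp add: Pd_mapL[symmetric] poly_Pd)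
  then obtain v where "v \<noteq> 0" "pm 1 (mapL A) (\<theta> i) (mapL C) *v v = 0" using singular_kernel by blast
  then show ?thesis by (intro exI[of _ v]) (simp add: pm_mv vec_eq_iff add_eq_0_iff2)
 qed
 then obtain v where v: "\<And>i. v i \<noteq> 0" "\<And>i. mapL A *v v i = - \<theta> i *s (mapL C *v v i)" by metis
 have sL: "symm (mapL A)" "symm (mapL C)" using s by (auto intro: symm_mapL)
 have "det (mapL C) \<noteq> 0" "inj \<theta>" using C \<theta> by (simp_all add: det_mapL bij_betw_def)
 from four_eigenvectors[of "mapL A" "mapL C" \<theta> v, OF sL this v] have i: "indep4 (v 1) (v 2) (v 3) (v 4)"
  and d: "diag (\<lambda>i. bl (mapL A) (v i) (v i)) (\<lambda>i. bl (mapL C) (v i) (v i))"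
  and o: "\<And>i j. i \<noteq> j ==> bl (mapL A) (v i) (v j) = 0 \<and> bl (mapL C) (v i) (v j) = 0"
  by blast+
 obtain W where W: "inverses (\<lambda>i j. vec_nth (fr (v 1) (v 2) (v 3) (v 4) j) i) W" using indep4_inverses[OF i] by blast
 have "qf (gr (mapL A) (v 1) (v 2) (v 3) (v 4)) = (\<Sum>i\<in>UNIV. kk (bl (mapL A) (v i) (v i)) * mpv i ^ 2)"
  "qf (gr (mapL C) (v 1) (v 2) (v 3) (v 4)) = (\<Sum>i\<in>UNIV. kk (bl (mapL C) (v i) (v i)) * mpv i ^ 2)"
  unfolding qf_gr[OF sL(1)] qf_gr[OF sL(2)] by (simp_all add: o sum_4 rhom_0[OF rhom_const])
 then show ?thesis using W d by (intro exI conjI) (assumption | simp add: embL_qf lin_qf)+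
qed

text \<open>\<open>pencil_simple_root\<close> excludes a pencil with identically zero determinant,
  so some A + tC is nonsingular. The pair (C, A + tC) is diagonalized, and t times the second form
  is subtracted again.\<close>

theorem diagonalization:
 fixes f g :: "'k::field_char_0 poly4"
 assumes n: "nrm f g"
 shows "\<exists>V W p q. inverses V W \<and> diag p q \<and> lin V (embL f) = (\<Sum>i\<in>UNIV. kk (p i) * mpv i ^ 2) \<and>
  lin V (embL g) = (\<Sum>i\<in>UNIV. kk (q i) * mpv i ^ 2)"
proof -
 obtain A C where A: "symm A" "f = qf A" and C: "symm C" "g = qf C" using quadratic_form nrm_hom[OF n] by metis
 note n = n[unfolded A(2) C(2)]
 have "Pd A C \<noteq> 0"
 proof
  assume 0: "Pd A C = 0"
  then have "poly (Pd A C) 0 = 0" by simp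
  then have "det A = 0" by (simp add: poly_Pd pm_def)
  from pencil_simple_root[OF n A(1) C(1) this] show False using 0 by simp
 qed
 then obtain t where "poly (Pd A C) t \<noteq> 0" using poly_all_0_iff_0 by blast
 then have t: "det (pm 1 A t C) \<noteq> 0" by (simp add: poly_Pd)
 have "nrm (qf C) (qf (pm 1 A t C))" using nrm_pm[OF n, of 0 t 1 1] by (simp add: pm_def[of 0])
 from diagonalization_nonsingular[OF this C(1) symm_pm[OF A(1) C(1)] t]
 obtain V W p q where V: "inverses V W" "diag p q" "lin V (embL (qf C)) = (\<Sum>i\<in>UNIV. kk (p i) * mpv i ^ 2)"
  "lin V (embL (qf (pm 1 A t C))) = (\<Sum>i\<in>UNIV. kk (q i) * mpv i ^ 2)" by blast
 let ?t = "to_ac t"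
 have "lin V (embL (qf (pm 1 A t C))) = lin V (embL f) + kk ?t * lin V (embL g)"
  unfolding qf_pm A C by (simp add: rhom_1[OF rhom_const] rhom_add[OF rhom_embL] rhom_mult[OF rhom_embL] rhom_add[OF rhom_lin] rhom_mult[OF rhom_lin])
 then have "lin V (embL f) = (\<Sum>i\<in>UNIV. kk (q i) * mpv i ^ 2) - kk ?t * (\<Sum>i\<in>UNIV. kk (p i) * mpv i ^ 2)"
  using V(3,4) C(2) by (simp add: algebra_simps)
 also have "\<dots> = (\<Sum>i\<in>UNIV. kk (q i - ?t * p i) * mpv i ^ 2)"
  by (simp add: sum_distrib_left sum_subtractf[symmetric] rhom_simps[OF rhom_const] algebra_simps)
 finally have "lin V (embL f) = (\<Sum>i\<in>UNIV. kk (q i - ?t * p i) * mpv i ^ 2)" .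
 moreover have "diag (\<lambda>i. q i - ?t * p i) p"
 proof
  fix i j :: 4 assume "i \<noteq> j"
  then have "p j * q i - p i * q j \<noteq> 0" using diag.nondeg[OF V(2), of j i] by simp
  then show "(q i - ?t * p i) * p j - (q j - ?t * p j) * p i \<noteq> 0" by (simp add: algebra_simps)
 qed
 ultimately show ?thesis using V(1,3) C(2) by blast
qed

section \<open>Torsion over R equals torsion by powers of the variables\<close>

section \<open>Torsion\<close>

definition prS :: "'a::comm_ring_1 poly44 \<Rightarrow> 'a poly4" where "prS = ev mc (case_sum mpv (\<lambda>_. 0))"

lemma rhom_prS: "rhom prS" unfolding prS_def by (rule rhom_ev[OF rhom_const])

lemma prS_emS: "prS (emS s) = s"
 by (rule mpoly_hom_unique[OF rhom_comp[OF rhom_emS rhom_prS] rhom_id])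
  (simp_all add: prS_def ev_const[OF rhom_const] ev_var[OF rhom_const])

lemma emS_idl: "emS s \<in> idl (emS ` G) \<longleftrightarrow> s \<in> idl G"
proof
 assume "emS s \<in> idl (emS ` G)"
 have "prS (emS s) \<in> idl G"
  by (rule idl_image[OF rhom_prS _ \<open>emS s \<in> idl (emS ` G)\<close>]) (auto simp: prS_emS intro: ispan_base)
 then show "s \<in> idl G" by (simp add: prS_emS)
qed (rule idl_image[OF rhom_emS], auto intro: ispan_base)

text \<open>\<open>B\<close> as the polynomial ring in the \<open>y\<^sub>i\<close> over \<open>S\<close>.\<close>

definition toSY :: "'a::comm_ring_1 poly44 \<Rightarrow> (4, 'a poly4) mpoly" where
 "toSY = ev (\<lambda>c. mc (mc c)) (case_sum (\<lambda>i. mc (mpv i)) mpv)"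

lemma rhom_toSY: "rhom toSY"
 unfolding toSY_def by (rule rhom_ev[OF rhom_comp[OF rhom_const rhom_const]])

lemma toSY_simps: "toSY (mc c) = mc (mc c)" "toSY (vx i) = mc (mpv i)" "toSY (vy i) = mpv i"
 unfolding toSY_def by (simp_all add: ev_const[OF rhom_comp[OF rhom_const rhom_const]] ev_var[OF rhom_comp[OF rhom_const rhom_const]])

lemma toSY_emS: "toSY (emS s) = mc s"
 by (rule mpoly_hom_unique[OF rhom_comp[OF rhom_emS rhom_toSY] rhom_const]) (simp_all add: toSY_simps)

lemma fromSY: "ev emS vy (toSY b) = b"
proof (rule mpoly_hom_unique[OF rhom_comp[OF rhom_toSY rhom_ev[OF rhom_emS]] rhom_id])
 fix i :: "4 + 4" show "ev emS vy (toSY (mpv i)) = mpv i"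
  by (cases i) (simp_all add: toSY_simps ev_const[OF rhom_emS] ev_var[OF rhom_emS])
qed (simp add: toSY_simps ev_const[OF rhom_emS])

lemma lookup_const_mult: "pml (mc c * p) m = c * pml p m" for p :: "('i, 'a::comm_ring_1) mpoly"
proof -
 have "mc c * p = (\<Sum>a\<in>pmk p. pms a (c * pml p a))"
  by (subst (1) poly_mapping_eq_sum[symmetric]) (simp add: mpoly_const_def sum_distrib_left mult_single)
 also have "pml \<dots> m = c * pml p m"
  by (auto simp: lookup_sum lookup_single when_def in_keys_iff)
 finally show ?thesis .
qed

lemma toSY_idl: "b \<in> idl (emS ` G) ==> pml (toSY b) m \<in> idl G"
proof (induction rule: ispan_induct_alt)
 case base
 then show ?case by (simp add: rhom_0[OF rhom_toSY] ispan_zero)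
next
 case (step c x y)
 then obtain g where g: "x = emS g" "g \<in> G" by blast
 have "toSY (c * x) = mc g * toSY c" by (simp add: g rhom_mult[OF rhom_toSY] toSY_emS mult.commute)
 then have "pml (toSY (c * x + y)) m = pml (toSY c) m * g + pml (toSY y) m"
  by (simp add: rhom_add[OF rhom_toSY] lookup_add lookup_const_mult mult.commute)
 then show ?case using step g(2) by (simp add: ispan_add ispan_scale ispan_base)
qed

text \<open>B is free over S on the y-monomials, so regularity and membership are checked
  coefficient by coefficient.\<close>

lemma nzd_emS:
 assumes "nzd r (idl G)" shows "nzd (emS r) (idl (emS ` G))"
 unfolding nzd_def
proof (intro allI impI)
 fix b assume b: "emS r * b \<in> idl (emS ` G)"
 have "pml (toSY b) m \<in> idl G" for m
 proof -
  have "r * pml (toSY b) m \<in> idl G"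
   using toSY_idl[OF b, of m] by (simp add: rhom_mult[OF rhom_toSY] toSY_emS lookup_const_mult)
  then show ?thesis using assms by (simp add: nzd_def)
 qed
 then have "emS (pml (toSY b) m) \<in> idl (emS ` G)" for m by (simp add: emS_idl)
 then have "ev emS vy (toSY b) \<in> idl (emS ` G)"
  unfolding ev_def evm_def by (intro ispan_sum) (simp add: mult.commute[of "emS _"] ispan_scale)
 then show "b \<in> idl (emS ` G)" by (simp add: fromSY)
qed

lemma nzd_lin:
 assumes VW: "inverses V W" and r: "nzd r (idl {f, g})" shows "nzd (lin V r) (idl {lin V f, lin V g})"
 unfolding nzd_def
proof (intro allI impI)
 fix b assume b: "lin V r * b \<in> idl {lin V f, lin V g}"
 have WV: "inverses W V" using VW by (simp add: inverses_sym)
 have "lin W (lin V r * b) \<in> idl {f, g}"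
  by (rule idl_image[OF rhom_lin _ b]) (auto simp: lin_lin[OF WV] intro: ispan_base)
 then have "lin W b \<in> idl {f, g}" using r by (simp add: rhom_mult[OF rhom_lin] lin_lin[OF WV] nzd_def)
 then have "lin V (lin W b) \<in> idl {lin V f, lin V g}" by (rule idl_image[OF rhom_lin, rotated]) (auto intro: ispan_base)
 then show "b \<in> idl {lin V f, lin V g}" by (simp add: lin_lin[OF VW])
qed

theorem good_nrm:
 assumes n: "nrm f g" shows "good (idl (IB f g))"
proof -
 obtain V W p q where V: "inverses V W" "diag p q" "lin V (embL f) = (\<Sum>i\<in>UNIV. kk (p i) * mpv i ^ 2)"
  "lin V (embL g) = (\<Sum>i\<in>UNIV. kk (q i) * mpv i ^ 2)" using diagonalization[OF n] by blast
 have "good (idl (IB (lin V (embL f)) (lin V (embL g))))"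
  unfolding V diag.idl_IB_diag[OF V(2)] by (rule diag.good_diag[OF V(2)])
 then show ?thesis using good_linB[OF V(1)] good_descent nrm_hom[OF n] by blast
qed

text \<open>After extending scalars and diagonalizing, \<open>torsion_X\<close> turns annihilation
  by a regular element of R into power torsion. Conversely a power of z_1 kills b, and z_1 is
  regular on R because its transform is a nonzero linear form
  (\<open>nzd_linear_form\<close>).\<close>

theorem torsion_iff:
 assumes n: "nrm f g"
 shows "(\<exists>r. nzd r (idl {f, g}) \<and> emS r * b \<in> idl (IB f g)) \<longleftrightarrow> tors (idl (IB f g)) b"
proof -
 obtain V W p q where V: "inverses V W" "diag p q" and f: "lin V (embL f) = (\<Sum>i\<in>UNIV. kk (p i) * mpv i ^ 2)"
  and g: "lin V (embL g) = (\<Sum>i\<in>UNIV. kk (q i) * mpv i ^ 2)" using diagonalization[OF n] by blast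
 have WV: "inverses W V" using V(1) by (simp add: inverses_sym)
 have J: "idl (diag.J p q) = idl (emS ` {lin V (embL f), lin V (embL g)})"
  using diag.emS_fd[OF V(2)] by (simp add: f g)
 have im: "embL ` {f, g} = {embL f, embL g}" by simp
 show ?thesis
 proof
  assume "\<exists>r. nzd r (idl {f, g}) \<and> emS r * b \<in> idl (IB f g)"
  then obtain r where r: "nzd r (idl {f, g})" "emS r * b \<in> idl (IB f g)" by blast
  let ?r = "emS (lin V (embL r))" and ?b = "linB V (embL b)"
  have "nzd (embL r) (idl {embL f, embL g})" using r(1) nzd_embL[of r "{f, g}"] unfolding im by blast
  then have "nzd ?r (idl (diag.J p q))" unfolding J by (intro nzd_emS nzd_lin[OF V(1)])
  moreover have "embL (emS r * b) \<in> idl (IB (embL f) (embL g))"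
   unfolding embL_IB[symmetric] embL_idl by (rule r(2))
  from linB_IB[OF this, of V] have "?r * ?b \<in> idl (diag.II p q)"
   unfolding f g diag.idl_IB_diag[OF V(2)]
   by (simp add: rhom_mult[OF rhom_embL] rhom_mult[OF rhom_linB] embL_emS linB_emS)
  ultimately have "vx i \<in> rad (diag.II p q) ?b" for i
   by (intro diag.torsion_X[OF V(2), where r = ?r]) simp_all
  then have "tors (idl (diag.II p q)) ?b" unfolding tors_def rad_def by blast
  then have "tors (idl (IB (lin V (embL f)) (lin V (embL g)))) ?b" unfolding f g diag.idl_IB_diag[OF V(2)] .
  from tors_linB[OF WV this] have "tors (idl (IB (embL f) (embL g))) (embL b)"
   by (simp add: lin_lin[OF WV] linB_linB[OF WV])
  then show "tors (idl (IB f g)) b" unfolding embL_IB[symmetric] tors_embL .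
 next
  assume "tors (idl (IB f g)) b"
  then obtain N where N: "vx 1 ^ N * b \<in> idl (IB f g)" unfolding tors_def by blast
  have "\<exists>j. V 1 j \<noteq> 0"
  proof (rule ccontr)
   assume "\<not> (\<exists>j. V 1 j \<noteq> 0)"
   then have "(\<Sum>j\<in>UNIV. V 1 j * W j 1) = 0" by simp
   then show False using V(1) unfolding inverses_def by (metis zero_neq_one)
  qed
  then obtain k where k: "V 1 k \<noteq> 0" by blast
  have "nzd (emS (lin V z1)) (idl (emS ` {lin V (embL f), lin V (embL g)}))"
   using diag.nzd_linear_form[OF V(2), where c = "V 1" and ?k0.0 = k, OF k] unfolding J
   by (simp add: rhom_sum[OF rhom_emS] rhom_mult[OF rhom_emS])
  then have "nzd (lin V z1) (idl {lin V (embL f), lin V (embL g)})"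
   unfolding nzd_def by (metis emS_idl rhom_mult[OF rhom_emS])
  from nzd_lin[OF WV this] have "nzd (embL z1) (idl (embL ` {f, g}))" unfolding im by (simp only: lin_lin[OF WV] embL_var)
  then have "nzd z1 (idl {f, g})" unfolding nzd_embL .
  then have "nzd (z1 ^ N) (idl {f, g})" by (rule nzd_power)
  moreover have "emS (z1 ^ N) = vx 1 ^ N" by (simp add: rhom_power[OF rhom_emS])
  ultimately show "\<exists>r. nzd r (idl {f, g}) \<and> emS r * b \<in> idl (IB f g)" using N by metis
 qed
qed

section \<open>Computing in carrier-based rings through type-class rings\<close>

section \<open>Rings presented by type-class rings\<close>

text \<open>R is the image of a subring U of a type-class ring under h. Calculations in R are lifted
  to U, where ordinary algebra is available.\<close>

definition pres :: "'x::comm_ring_1 set \<Rightarrow> ('x \<Rightarrow> 'a) \<Rightarrow> ('a, 'm) ring_scheme \<Rightarrow> bool" where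
 "pres U h R \<longleftrightarrow> (0 \<in> U \<and> 1 \<in> U \<and> (\<forall>x\<in>U. \<forall>y\<in>U. x + y \<in> U \<and> x * y \<in> U) \<and> (\<forall>x\<in>U. - x \<in> U)) \<and>
  carrier R = h ` U \<and> \<one>\<^bsub>R\<^esub> = h 1 \<and> \<zero>\<^bsub>R\<^esub> = h 0 \<and>
  (\<forall>x\<in>U. \<forall>y\<in>U. h x \<oplus>\<^bsub>R\<^esub> h y = h (x + y) \<and> h x \<otimes>\<^bsub>R\<^esub> h y = h (x * y))"

lemma presD:
 assumes "pres U h R"
 shows "0 \<in> U" "1 \<in> U" "x \<in> U ==> y \<in> U ==> x + y \<in> U" "x \<in> U ==> y \<in> U ==> x * y \<in> U" "x \<in> U ==> - x \<in> U"
  "carrier R = h ` U" "\<one>\<^bsub>R\<^esub> = h 1" "\<zero>\<^bsub>R\<^esub> = h 0" "x \<in> U ==> y \<in> U ==> h x \<oplus>\<^bsub>R\<^esub> h y = h (x + y)"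
  "x \<in> U ==> y \<in> U ==> h x \<otimes>\<^bsub>R\<^esub> h y = h (x * y)" "x \<in> U ==> h x \<in> carrier R"
 using assms unfolding pres_def by blast+

lemma pres_diff: "pres U h R ==> x \<in> U ==> y \<in> U ==> x - y \<in> U"
 using presD(3)[of U h R x "- y"] presD(5)[of U h R y] by simp

lemma pres_cring: assumes p: "pres U h R" shows "cring R"
proof (rule cringI)
 note [simp] = presD(3-5,9,10)[OF p] presD(1,2,6,7,8)[OF p]
 show "abelian_group R"
 proof (rule abelian_groupI)
  fix x assume "x \<in> carrier R"
  then obtain a where a: "a \<in> U" "x = h a" by auto
  then show "\<exists>y\<in>carrier R. y \<oplus>\<^bsub>R\<^esub> x = \<zero>\<^bsub>R\<^esub>" by (intro bexI[of _ "h (- a)"]) auto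
 qed (auto simp: add_ac)
 show "comm_monoid R" by (rule comm_monoidI) (auto simp: mult_ac)
qed (auto simp: presD[OF p] distrib_right)

lemma pres_uminus: assumes p: "pres U h R" and x: "x \<in> U" shows "\<ominus>\<^bsub>R\<^esub> h x = h (- x)"
proof -
 interpret cring R by (rule pres_cring[OF p])
 have "h x \<oplus>\<^bsub>R\<^esub> h (- x) = \<zero>\<^bsub>R\<^esub>" using x by (simp add: presD[OF p])
 then show ?thesis using x presD(5,11)[OF p] by (metis minus_equality a_comm)
qed

lemma pres_minus: assumes p: "pres U h R" and "x \<in> U" "y \<in> U" shows "h x \<ominus>\<^bsub>R\<^esub> h y = h (x - y)"
 using presD(9)[OF p, of x "- y"] presD(5)[OF p] assms(2,3) by (simp add: a_minus_def pres_uminus[OF p])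

lemma pres_eq_iff: assumes p: "pres U h R" and "x \<in> U" "y \<in> U" shows "h x = h y \<longleftrightarrow> h (x - y) = \<zero>\<^bsub>R\<^esub>"
proof -
 interpret cring R by (rule pres_cring[OF p])
 show ?thesis using pres_minus[OF p assms(2,3)] presD(11)[OF p] assms(2,3) by (metis r_right_minus_eq)
qed

lemma pres_pow: assumes p: "pres U h R" and x: "x \<in> U" shows "x ^ n \<in> U \<and> h x [^]\<^bsub>R\<^esub> n = h (x ^ n)"
proof (induction n)
 case (Suc n)
 interpret cring R by (rule pres_cring[OF p])
 show ?case using Suc x by (simp add: presD[OF p] mult.commute)
qed (simp add: presD[OF p])

lemma pres_finsum:
 assumes p: "pres U h R" and a: "\<And>i. i \<in> A ==> a i \<in> U"
 shows "sum a A \<in> U \<and> (finite A \<longrightarrow> (\<Oplus>\<^bsub>R\<^esub>i\<in>A. h (a i)) = h (sum a A))"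
 using a
proof (induction A rule: infinite_finite_induct)
 case (insert i A)
 interpret cring R by (rule pres_cring[OF p])
 have "(\<Oplus>\<^bsub>R\<^esub>j\<in>insert i A. h (a j)) = h (a i) \<oplus>\<^bsub>R\<^esub> (\<Oplus>\<^bsub>R\<^esub>j\<in>A. h (a j))"
  using insert presD(11)[OF p] by (intro finsum_insert) auto
 then show ?case using insert by (simp add: presD[OF p])
qed (use pres_cring[OF p] in \<open>simp_all add: presD[OF p] cring_def ring_def abelian_group_def abelian_monoid.finsum_empty\<close>)

lemma pres_finprod:
 assumes p: "pres U h R" and a: "\<And>i. i \<in> A ==> a i \<in> U"
 shows "prod a A \<in> U \<and> (finite A \<longrightarrow> (\<Otimes>\<^bsub>R\<^esub>i\<in>A. h (a i)) = h (prod a A))"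
 using a
proof (induction A rule: infinite_finite_induct)
 case (insert i A)
 interpret cring R by (rule pres_cring[OF p])
 have "(\<Otimes>\<^bsub>R\<^esub>j\<in>insert i A. h (a j)) = h (a i) \<otimes>\<^bsub>R\<^esub> (\<Otimes>\<^bsub>R\<^esub>j\<in>A. h (a j))"
  using insert presD(11)[OF p] by (intro finprod_insert) auto
 then show ?case using insert by (simp add: presD[OF p])
qed (use pres_cring[OF p] in \<open>simp_all add: presD[OF p] cring_def comm_monoid.finprod_empty\<close>)

text \<open>If Q is closed under sums and multiples and contains the kernel of h, its image is an
  ideal, and membership of h x in that image reflects back to x in Q.\<close>

lemma pres_genideal:
 assumes p: "pres U h R" and Q: "Q \<subseteq> U" "\<And>x y. x \<in> Q ==> y \<in> Q ==> x + y \<in> Q" "\<And>c x. c \<in> U ==> x \<in> Q ==> c * x \<in> Q"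
  and k: "\<And>x. x \<in> U ==> h x = \<zero>\<^bsub>R\<^esub> ==> x \<in> Q" and G: "G \<subseteq> h ` Q" and x: "x \<in> U" "h x \<in> genideal R G"
 shows "x \<in> Q"
proof -
 interpret cring R by (rule pres_cring[OF p])
 have m: "- x \<in> Q" if "x \<in> Q" for x using Q(3)[of "- 1" x] that presD(2,5)[OF p] by simp
 have z: "0 \<in> Q" by (rule k) (simp_all add: presD[OF p])
 have "ideal (h ` Q) R"
 proof (rule idealI)
  show "subgroup (h ` Q) (add_monoid R)"
  proof
   show "h ` Q \<subseteq> carrier (add_monoid R)" using Q(1) by (auto simp: presD[OF p])
   show "x \<otimes>\<^bsub>add_monoid R\<^esub> y \<in> h ` Q" if "x \<in> h ` Q" "y \<in> h ` Q" for x y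
   proof -
    from that obtain a b where "x = h a" "y = h b" "a \<in> Q" "b \<in> Q" by blast
    then show ?thesis using Q by (auto simp: presD(9)[OF p] subset_iff)
   qed
   show "\<one>\<^bsub>add_monoid R\<^esub> \<in> h ` Q" using z by (simp add: presD[OF p])
   show "inv\<^bsub>add_monoid R\<^esub> x \<in> h ` Q" if "x \<in> h ` Q" for x
   proof -
    from that obtain a where a: "x = h a" "a \<in> Q" by blast
    then have "\<ominus>\<^bsub>R\<^esub> x = h (- a)" using Q(1) by (auto simp: pres_uminus[OF p])
    then show ?thesis using m a(2) by (simp add: a_inv_def)
   qed
  qed
  show "x \<otimes>\<^bsub>R\<^esub> a \<in> h ` Q" "a \<otimes>\<^bsub>R\<^esub> x \<in> h ` Q" if "a \<in> h ` Q" "x \<in> carrier R" for a x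
  proof -
   from that obtain b where b: "a = h b" "b \<in> Q" by blast
   from that presD(6)[OF p] obtain c where c: "x = h c" "c \<in> U" by auto
   have "x \<otimes>\<^bsub>R\<^esub> a = h (c * b)" using b c Q(1) by (auto simp: presD(10)[OF p])
   then show "x \<otimes>\<^bsub>R\<^esub> a \<in> h ` Q" using Q(3)[OF c(2) b(2)] by blast
   moreover have "a \<in> carrier R" using b Q(1) presD(11)[OF p] by blast
   ultimately show "a \<otimes>\<^bsub>R\<^esub> x \<in> h ` Q" using that(2) by (simp add: m_comm)
  qed
 qed (rule ring_axioms)
 from genideal_minimal[OF this G] x(2) obtain q where q: "q \<in> Q" "h x = h q" by blast
 then have "x - q \<in> Q" using Q(1) x(1) pres_diff[OF p] pres_eq_iff[OF p, of x q] by (intro k) auto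
 from Q(2)[OF this q(1)] show ?thesis by simp
qed

lemma pres_quotient:
 assumes p: "pres U h R" and I: "ideal I R"
 shows "pres U (\<lambda>x. I +>\<^bsub>R\<^esub> h x) (R Quot I)"
  and "x \<in> U ==> I +>\<^bsub>R\<^esub> h x = \<zero>\<^bsub>R Quot I\<^esub> \<longleftrightarrow> h x \<in> I"
  and "x \<in> U ==> y \<in> U ==> I +>\<^bsub>R\<^esub> h x = I +>\<^bsub>R\<^esub> h y \<longleftrightarrow> h (x - y) \<in> I"
proof -
 interpret ideal I R by fact
 interpret as: abelian_subgroup I R by (rule abelian_subgroupI3) unfold_locales
 have z: "I +>\<^bsub>R\<^esub> h 0 = I"
  using presD(8)[OF p] a_rcos_const zero_closed by (metis additive_subgroup.zero_closed is_additive_subgroup)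
 show 1: "pres U (\<lambda>x. I +>\<^bsub>R\<^esub> h x) (R Quot I)"
  unfolding pres_def
 proof (intro conjI ballI presD(1-5)[OF p])
  show "carrier (R Quot I) = (\<lambda>x. I +>\<^bsub>R\<^esub> h x) ` U"
   by (auto simp: FactRing_def A_RCOSETS_def' presD(6)[OF p])
  show "\<one>\<^bsub>R Quot I\<^esub> = I +>\<^bsub>R\<^esub> h 1" by (simp add: FactRing_def presD(7)[OF p])
  show "\<zero>\<^bsub>R Quot I\<^esub> = I +>\<^bsub>R\<^esub> h 0" by (simp add: FactRing_def z)
  fix x y assume xy: "x \<in> U" "y \<in> U"
  show "(I +>\<^bsub>R\<^esub> h x) \<oplus>\<^bsub>R Quot I\<^esub> (I +>\<^bsub>R\<^esub> h y) = I +>\<^bsub>R\<^esub> h (x + y)"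
   using a_rcos_sum[of "h x" "h y"] xy presD(9,11)[OF p] by (simp add: FactRing_def)
  show "(I +>\<^bsub>R\<^esub> h x) \<otimes>\<^bsub>R Quot I\<^esub> (I +>\<^bsub>R\<^esub> h y) = I +>\<^bsub>R\<^esub> h (x * y)"
   using rcoset_mult_add[of "h x" "h y"] xy presD(10,11)[OF p] by (simp add: FactRing_def)
 qed
 show 2: "I +>\<^bsub>R\<^esub> h x = \<zero>\<^bsub>R Quot I\<^esub> \<longleftrightarrow> h x \<in> I" if "x \<in> U" for x
  using a_rcos_const[of "h x"] a_rcos_self[of "h x"] presD(11)[OF p that] by (auto simp: FactRing_def)
 show "I +>\<^bsub>R\<^esub> h x = I +>\<^bsub>R\<^esub> h y \<longleftrightarrow> h (x - y) \<in> I" if "x \<in> U" "y \<in> U"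
  using pres_eq_iff[OF 1 that] 2[OF pres_diff[OF p that]] by simp
qed

section \<open>The ring R = S/(f,g), and its normality translated to S\<close>

section \<open>The ring \<open>R\<close>\<close>

lemma pres_type: "pres UNIV (\<lambda>x. x) (ring_of_type_algebra :: 'a::comm_ring_1 ring)"
 by (simp add: pres_def ring_of_type_algebra_def)

lemma genideal_type: "genideal (ring_of_type_algebra :: 'a::comm_ring_1 ring) G = idl G"
proof -
 let ?A = "ring_of_type_algebra :: 'a ring"
 interpret cring ?A by (rule pres_cring[OF pres_type])
 have sub: "G \<subseteq> carrier ?A" by (simp add: ring_of_type_algebra_def)
 interpret I: ideal "genideal ?A G" ?A by (rule genideal_ideal[OF sub])
 show ?thesis
 proof
  show "genideal ?A G \<subseteq> idl G"
  proof
   fix x assume "x \<in> genideal ?A G"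
   then show "x \<in> idl G"
    by (intro pres_genideal[OF pres_type, of "idl G" G x])
     (auto intro: ispan_add ispan_scale ispan_base ispan_zero simp: ring_of_type_algebra_def)
  qed
  show "idl G \<subseteq> genideal ?A G"
  proof
   fix x assume "x \<in> idl G"
   then show "x \<in> genideal ?A G"
   proof (induction rule: ispan_induct_alt)
    case base
    show ?case using I.zero_closed by (simp add: ring_of_type_algebra_def)
   next
    case (step c x y)
    have "x \<in> genideal ?A G" using genideal_self[OF sub] step by blast
    then have "c \<otimes>\<^bsub>?A\<^esub> x \<oplus>\<^bsub>?A\<^esub> y \<in> genideal ?A G"
     using step by (intro I.a_closed I.I_l_closed) (simp_all add: ring_of_type_algebra_def)
    then show ?case by (simp add: ring_of_type_algebra_def)
   qed
  qed
 qed
qed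

lemma fg_ideal: "ideal (idl {f, g}) (poly4_ring :: 'k::field poly4 ring)"
proof -
 interpret cring "poly4_ring :: 'k poly4 ring" by (rule pres_cring[OF pres_type])
 have "{f, g} \<subseteq> carrier (poly4_ring :: 'k poly4 ring)" by (simp add: ring_of_type_algebra_def)
 from genideal_ideal[OF this] show ?thesis unfolding genideal_type .
qed

lemma fg_class_alt: "fg_class f g p = idl {f, g} +>\<^bsub>poly4_ring\<^esub> p"
 and fg_ring_alt: "fg_ring f g = poly4_ring Quot idl {f, g}"
 by (simp_all add: fg_class_def fg_ring_def genideal_type)

lemma pres_R: "pres UNIV (fg_class f g) (fg_ring f g)"
 using pres_quotient(1)[OF pres_type fg_ideal, of f g] by (simp add: fg_class_alt[abs_def] fg_ring_alt)

lemma fg_class_eq: "fg_class f g p = fg_class f g q \<longleftrightarrow> p - q \<in> idl {f, g}"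
 using pres_quotient(3)[OF pres_type fg_ideal, of p q f g] by (simp add: fg_class_alt)

lemma fg_class_eq_0: "fg_class f g p = \<zero>\<^bsub>fg_ring f g\<^esub> \<longleftrightarrow> p \<in> idl {f, g}"
 using pres_quotient(2)[OF pres_type fg_ideal, of p f g] by (simp add: fg_class_alt fg_ring_alt)

lemma nonzerodivisors_R: "nonzerodivisors (fg_ring f g) = fg_class f g ` {b. nzd b (idl {f, g})}"
 unfolding nonzerodivisors_def nzd_def
 by (auto simp: presD(6)[OF pres_R] presD(10)[OF pres_R] fg_class_eq_0 image_iff)

lemma homogeneous_hdeg: "homogeneous n p \<longleftrightarrow> hdeg dt n p"
 by (simp add: homogeneous_def hdeg_def dt_def)

lemma nrm_of_normal:
 fixes f g :: "'k::field_char_0 poly4"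
 assumes h: "homogeneous 2 f" "homogeneous 2 g" and r: "regular_sequence poly4_ring [f, g]" and n: "normal_ring (fg_ring f g)"
 shows "nrm f g"
proof -
 note T = presD[OF pres_type]
 have rr: "[f, g] ! i * a \<in> idl (set (take i [f, g])) ==> a \<in> idl (set (take i [f, g]))" if "i < 2" for i a
  using r that unfolding regular_sequence_def genideal_type by (simp add: ring_of_type_algebra_def)
 have r0: "f * a = 0 ==> a = 0" for a using rr[of 0 a] by (simp add: idl_empty)
 have r1: "g * a \<in> idl {f} ==> a \<in> idl {f}" for a using rr[of 1 a] by simp
 have reg: "\<exists>w. u = w * g \<and> v = - (w * f)" if e: "u * f + v * g = 0" for u v
 proof -
  have "g * v = (- u) * f" using e by (simp add: algebra_simps eq_neg_iff_add_eq_0)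
  then have "g * v \<in> idl {f}" by (simp only:) (intro ispan_scale ispan_base, simp)
  then obtain w where w: "v = w * f" using r1 idl_one by blast
  then have "f * (u + w * g) = 0" using e by (simp add: algebra_simps)
  then have "u + w * g = 0" by (rule r0)
  then show ?thesis using w by (intro exI[of _ "- w"]) (simp add: eq_neg_iff_add_eq_0)
 qed
 let ?c = "fg_class f g" and ?R = "fg_ring f g"
 note R = presD[OF pres_R[of f g]] and pw = pres_pow[OF pres_R[of f g]]
 have red: "a \<in> idl {f, g}" if "a ^ m \<in> idl {f, g}" for a m
 proof -
  have "?c a [^]\<^bsub>?R\<^esub> m = \<zero>\<^bsub>?R\<^esub>" using that by (simp add: pw fg_class_eq_0)
  moreover have "?c a \<in> carrier ?R" using R(11) by simp
  ultimately have "?c a = \<zero>\<^bsub>?R\<^esub>" using n unfolding normal_ring_def by blast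
  then show ?thesis unfolding fg_class_eq_0 .
 qed
 have ic: "\<exists>r. a - b * r \<in> idl {f, g}"
  if b: "nzd b (idl {f, g})" and "m > 0" and e: "a ^ m + (\<Sum>i<m. c i * (a ^ i * b ^ (m - i))) \<in> idl {f, g}" for a b m c
 proof -
  have t: "?c (c i) \<otimes>\<^bsub>?R\<^esub> (?c a [^]\<^bsub>?R\<^esub> i \<otimes>\<^bsub>?R\<^esub> ?c b [^]\<^bsub>?R\<^esub> (m - i)) = ?c (c i * (a ^ i * b ^ (m - i)))" for i
   by (simp add: pw R(10))
  have A: "?c a [^]\<^bsub>?R\<^esub> m \<oplus>\<^bsub>?R\<^esub> (\<Oplus>\<^bsub>?R\<^esub>i\<in>{..<m}. ?c (c i) \<otimes>\<^bsub>?R\<^esub> (?c a [^]\<^bsub>?R\<^esub> i \<otimes>\<^bsub>?R\<^esub> ?c b [^]\<^bsub>?R\<^esub> (m - i))) = \<zero>\<^bsub>?R\<^esub>"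
   unfolding t using e pres_finsum[OF pres_R[of f g], of "{..<m}" "\<lambda>i. c i * (a ^ i * b ^ (m - i))"]
   by (simp add: pw R(9) fg_class_eq_0)
  have B: "(\<lambda>i. ?c (c i)) \<in> {..<m} \<rightarrow> carrier ?R" using R(11) by simp
  have ex: "\<exists>n>0. \<exists>c\<in>{..<n} \<rightarrow> carrier ?R. ?c a [^]\<^bsub>?R\<^esub> (n::nat) \<oplus>\<^bsub>?R\<^esub>
    (\<Oplus>\<^bsub>?R\<^esub>i\<in>{..<n}. c i \<otimes>\<^bsub>?R\<^esub> (?c a [^]\<^bsub>?R\<^esub> i \<otimes>\<^bsub>?R\<^esub> ?c b [^]\<^bsub>?R\<^esub> (n - i))) = \<zero>\<^bsub>?R\<^esub>"
   by (intro exI[of _ m] conjI bexI[of _ "\<lambda>i. ?c (c i)"] A B \<open>m > 0\<close>)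
  have "?c b \<in> nonzerodivisors ?R" using b by (simp add: nonzerodivisors_R)
  from n[unfolded normal_ring_def, THEN conjunct2, THEN conjunct2, rule_format, OF R(11)[OF UNIV_I] this ex]
  obtain r where "r \<in> carrier ?R" "?c a = ?c b \<otimes>\<^bsub>?R\<^esub> r" by blast
  then obtain r where "?c a = ?c (b * r)" using R(6,10) by auto
  then show ?thesis unfolding fg_class_eq by blast
 qed
 show ?thesis unfolding nrm_def using h reg red ic by (simp add: homogeneous_hdeg)
qed

section \<open>Polynomial rings over R as images of polynomial rings over S\<close>

section \<open>Polynomial rings over \<open>R\<close>\<close>

lemma finite_submultisets: "finite {u. u \<subseteq># m}"
proof (induction m)
 case (add x m)
 have "{u. u \<subseteq># add_mset x m} \<subseteq> {u. u \<subseteq># m} \<union> add_mset x ` {u. u \<subseteq># m}"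
 proof
  fix u assume u: "u \<in> {u. u \<subseteq># add_mset x m}"
  show "u \<in> {u. u \<subseteq># m} \<union> add_mset x ` {u. u \<subseteq># m}"
  proof (cases "x \<in># u")
   case True
   then obtain u' where "u = add_mset x u'" by (metis insert_DiffM)
   then show ?thesis using u by auto
  next
   case False
   have "count u a \<le> count m a" for a
    using u False mset_subset_eq_count[of u "add_mset x m" a] by (cases "a = x") (auto simp: not_in_iff)
   then have "u \<subseteq># m" by (rule mset_subset_eqI)
   then show ?thesis by simp
  qed
 qed
 then show ?case using add by (meson finite_UnI finite_imageI finite_subset)
qed simp

lemma pm_induct:
 fixes p :: "'m \<Rightarrow>\<^sub>0 'a::comm_monoid_add"
 assumes "\<And>m c. P (pms m c)" "\<And>p q. P p ==> P q ==> P (p + q)" shows "P p"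
proof -
 have "P (\<Sum>a\<in>A. pms a (pml p a))" for A
  using assms(1)[of undefined 0] assms by (induction A rule: infinite_finite_induct) auto
 then show ?thesis using poly_mapping_eq_sum[of p] by metis
qed

lemma lookup_times:
 fixes p q :: "'u multiset \<Rightarrow>\<^sub>0 'a::comm_ring_1"
 shows "pml (p * q) m = (\<Sum>u\<in>{u. u \<subseteq># m}. pml p u * pml q (m - u))"
proof (induction p rule: pm_induct)
 case (1 a c)
 show ?case
 proof (induction q rule: pm_induct)
  case (1 b d)
  have "(\<Sum>u\<in>{u. u \<subseteq># m}. pml (pms a c) u * pml (pms b d) (m - u)) =
    (\<Sum>u\<in>{u. u \<subseteq># m}. if a = u then c * pml (pms b d) (m - u) else 0)"
   by (intro sum.cong) (auto simp: lookup_single when_def)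
  also have "\<dots> = (if a \<subseteq># m then c * pml (pms b d) (m - a) else 0)"
   by (subst sum.delta'[OF finite_submultisets]) simp
  also have "\<dots> = pml (pms a c * pms b d) m"
  proof -
   have "a + b = m \<longleftrightarrow> a \<subseteq># m \<and> b = m - a"
    by (metis add_diff_cancel_left' mset_subset_eq_add_left subset_mset.add_diff_inverse)
   then show ?thesis by (auto simp: mult_single lookup_single when_def)
  qed
  finally show ?case ..
 qed (simp add: distrib_left lookup_add sum.distrib)
qed (simp add: distrib_right lookup_add sum.distrib)

text \<open>Takes coefficients modulo (f, g). Polynomials over R in indeterminates V are presented
  by the finitely supported families over S in \<open>MV V\<close>, on which type-class arithmetic
  applies (\<open>pres_P\<close>).\<close>

definition PhiM :: "'k::field poly4 \<Rightarrow> 'k poly4 \<Rightarrow> ('u multiset \<Rightarrow>\<^sub>0 'k poly4) \<Rightarrow> 'u multiset \<Rightarrow> 'k poly4 set" where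
 "PhiM f g p = (\<lambda>m. fg_class f g (pml p m))"
definition MV :: "'u set \<Rightarrow> ('u multiset \<Rightarrow>\<^sub>0 'a::comm_ring_1) set" where
 "MV V = {p. \<forall>m\<in>pmk p. set_mset m \<subseteq> V}"

lemma MV_single: "set_mset m \<subseteq> V ==> pms m c \<in> MV V"
 by (simp add: MV_def)

lemma MV_add: "p \<in> MV V ==> q \<in> MV V ==> p + q \<in> MV V"
 unfolding MV_def using Poly_Mapping.keys_add[of p q] by blast

lemma MV_mult: "p \<in> MV V ==> q \<in> MV V ==> p * q \<in> MV V"
 unfolding MV_def using keys_mult[of p q] by fastforce

lemma MV_induct [consumes 1, case_names single add]:
 assumes p: "p \<in> MV V" and s: "\<And>m c. set_mset m \<subseteq> V ==> P (pms m c)" and a: "\<And>p q. P p ==> P q ==> P (p + q)"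
 shows "P p"
proof -
 have "P (\<Sum>a\<in>A. pms a (pml p a))" if "A \<subseteq> pmk p" for A
  using that p
 proof (induction A rule: infinite_finite_induct)
  case (insert a A)
  then show ?case using s a by (auto simp: MV_def)
 qed (use s[of "{#}" 0] in simp_all)
 from this[OF order_refl] show ?thesis by (simp only: poly_mapping_eq_sum)
qed

context
 fixes f g :: "'k::field poly4" and V :: "'u set"
begin

abbreviation (input) "cl \<equiv> fg_class f g"
abbreviation (input) "R \<equiv> fg_ring f g"
abbreviation (input) "P \<equiv> poly_ring_over R V"

lemma ring_R: "ring R" by (rule cring.axioms(1)[OF pres_cring[OF pres_R]])

lemma R_simps: "carrier R = range cl" "\<one>\<^bsub>R\<^esub> = cl 1" "\<zero>\<^bsub>R\<^esub> = cl 0" "cl x \<oplus>\<^bsub>R\<^esub> cl y = cl (x + y)" "cl x \<otimes>\<^bsub>R\<^esub> cl y = cl (x * y)"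
 using presD(6-10)[OF pres_R[of f g]] by simp_all

lemma PhiM_single: "PhiM f g (pms m c) = (\<lambda>n. if n = m then cl c else \<zero>\<^bsub>R\<^esub>)"
 by (rule ext) (simp add: PhiM_def lookup_single when_def R_simps)

lemma PhiM_const: "PhiM f g (pms {#} c) = ring.indexed_const R (cl c)"
 by (simp add: PhiM_single ring.indexed_const_def[OF ring_R] fun_eq_iff)

lemma PhiM_padd: "ring.indexed_padd R (PhiM f g p) (PhiM f g q) = PhiM f g (p + q)"
 by (simp add: PhiM_def ring.indexed_padd_def[OF ring_R] R_simps lookup_add)

lemma lookup_single_mult:
 "pml (pms {#i#} 1 * p) m = (if i \<in># m then pml p (m - {#i#}) else 0)"
 for p :: "'v multiset \<Rightarrow>\<^sub>0 'a::comm_ring_1"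
proof -
 have "pml (pms {#i#} 1 * p) m =
   (\<Sum>u\<in>{u. u \<subseteq># m}. if {#i#} = u then pml p (m - u) else 0)"
  unfolding lookup_times by (intro sum.cong) (auto simp: lookup_single when_def)
 also have "\<dots> = (if i \<in># m then pml p (m - {#i#}) else 0)"
  by (subst sum.delta'[OF finite_submultisets]) simp
 finally show ?thesis .
qed

lemma PhiM_pmult: "ring.indexed_pmult R (PhiM f g p) i = PhiM f g (pms {#i#} 1 * p)"
 by (rule ext) (simp add: PhiM_def ring.indexed_pmult_def[OF ring_R] lookup_single_mult R_simps)

lemma PhiM_var: "PhiM f g (pms {#u#} 1) = ring.indexed_var R u"
proof -
 have "ring.indexed_var R u = ring.indexed_pmult R (PhiM f g (pms {#} 1)) u"
  unfolding ring.indexed_var_def[OF ring_R] PhiM_const by (simp add: R_simps)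
 then show ?thesis unfolding PhiM_pmult by (simp add: mult_single)
qed

lemma carrier_P: "carrier P = PhiM f g ` MV V"
proof
 show "carrier P \<subseteq> PhiM f g ` MV V"
 proof
  fix q assume "q \<in> carrier P"
  then have "q \<in> ring.indexed_pset R V (carrier R)" by (simp add: poly_ring_over_def)
  then show "q \<in> PhiM f g ` MV V"
  proof (induction rule: ring.indexed_pset.induct[OF ring_R, consumes 1])
   case (1 k)
   then obtain c where "k = cl c" by (auto simp: R_simps)
   then show ?case by (simp only: PhiM_const[symmetric]) (intro imageI MV_single, simp)
  next
   case (2 p q)
   then show ?case by (auto simp: PhiM_padd intro: imageI MV_add)
  next
   case (3 p i)
   then show ?case by (auto simp: PhiM_pmult intro!: imageI MV_mult MV_single)
  qed
 qed
 show "PhiM f g ` MV V \<subseteq> carrier P"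
 proof
  fix q assume "q \<in> PhiM f g ` MV V"
  then obtain p where p: "p \<in> MV V" "q = PhiM f g p" by blast
  from p(1) have "PhiM f g p \<in> ring.indexed_pset R V (carrier R)"
  proof (induction p rule: MV_induct)
   case (single m c)
   then show ?case
   proof (induction m)
    case empty
    have "cl c \<in> carrier R" by (simp add: R_simps)
    then show ?case unfolding PhiM_const by (rule ring.indexed_pset.indexed_const[OF ring_R])
   next
    case (add i m)
    have "pms (add_mset i m) c = pms {#i#} 1 * pms m c" by (simp add: mult_single)
    then show ?case using add by (simp only:) (simp add: PhiM_pmult[symmetric] ring.indexed_pset.indexed_pmult[OF ring_R])
   qed
  next
   case (add p q)
   then show ?case unfolding PhiM_padd[symmetric] by (rule ring.indexed_pset.indexed_padd[OF ring_R])
  qed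
  then show "q \<in> carrier P" using p by (simp add: poly_ring_over_def)
 qed
qed

lemma pres_P: "pres (MV V) (PhiM f g) P"
 unfolding pres_def
proof (intro conjI ballI)
 show "(1 :: 'u multiset \<Rightarrow>\<^sub>0 'k poly4) \<in> MV V" by (simp add: MV_def single_one[symmetric] del: single_one)
 show "\<one>\<^bsub>P\<^esub> = PhiM f g 1" by (simp add: poly_ring_over_def R_simps PhiM_const[symmetric] single_one[symmetric] del: single_one)
 show "\<zero>\<^bsub>P\<^esub> = PhiM f g 0" using PhiM_const[of 0, symmetric] by (simp add: poly_ring_over_def R_simps)
 fix p q :: "'u multiset \<Rightarrow>\<^sub>0 'k poly4"
 show "PhiM f g p \<oplus>\<^bsub>P\<^esub> PhiM f g q = PhiM f g (p + q)" by (simp add: poly_ring_over_def PhiM_padd)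
 show "PhiM f g p \<otimes>\<^bsub>P\<^esub> PhiM f g q = PhiM f g (p * q)"
 proof
  fix m
  have "(PhiM f g p \<otimes>\<^bsub>P\<^esub> PhiM f g q) m =
   (\<Oplus>\<^bsub>R\<^esub>u\<in>{u. u \<subseteq># m}. cl (pml p u * pml q (m - u)))"
   by (simp add: poly_ring_over_def PhiM_def R_simps)
  also have "\<dots> = PhiM f g (p * q) m"
   using pres_finsum[OF pres_R[of f g], of "{u. u \<subseteq># m}" "\<lambda>u. pml p u * pml q (m - u)"]
   by (simp add: finite_submultisets PhiM_def lookup_times)
  finally show "(PhiM f g p \<otimes>\<^bsub>P\<^esub> PhiM f g q) m = PhiM f g (p * q) m" .
 qed
qed (simp_all add: MV_add MV_mult carrier_P, simp_all add: MV_def)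

end

section \<open>Generated submodules, free modules and quotient modules\<close>

section \<open>Kaehler differentials\<close>

lemma submodule_gen_submodule:
 assumes M: "module A M" and G: "G \<subseteq> carrier M" shows "submodule (submodule_gen A M G) A M"
proof -
 interpret module A M by fact
 have car: "submodule (carrier M) A M" by (rule carrier_is_submodule)
 note E = submoduleE
 show ?thesis
  unfolding submodule_gen_def
 proof (rule submoduleI)
  show "\<Inter>{N. submodule N A M \<and> G \<subseteq> N} \<subseteq> carrier M" using car G by blast
  show "\<zero>\<^bsub>M\<^esub> \<in> \<Inter>{N. submodule N A M \<and> G \<subseteq> N}"
   using subgroup.one_closed submodule.axioms(1) by fastforce
  show "\<ominus>\<^bsub>M\<^esub> a \<in> \<Inter>{N. submodule N A M \<and> G \<subseteq> N}" if "a \<in> \<Inter>{N. submodule N A M \<and> G \<subseteq> N}" for a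
   using that E(3) by blast
  show "a \<oplus>\<^bsub>M\<^esub> b \<in> \<Inter>{N. submodule N A M \<and> G \<subseteq> N}"
   if "a \<in> \<Inter>{N. submodule N A M \<and> G \<subseteq> N}" "b \<in> \<Inter>{N. submodule N A M \<and> G \<subseteq> N}" for a b
   using that E(5) by blast
  show "a \<odot>\<^bsub>M\<^esub> x \<in> \<Inter>{N. submodule N A M \<and> G \<subseteq> N}"
   if "a \<in> carrier A" "x \<in> \<Inter>{N. submodule N A M \<and> G \<subseteq> N}" for a x
   using that E(4) by blast
 qed
qed

lemma free_module_module:
 assumes "cring A" shows "module A (free_module A V)"
proof -
 interpret cring A by fact
 let ?F = "free_module A V"
 have sub: "finite {x. v x \<oplus>\<^bsub>A\<^esub> w x \<noteq> \<zero>\<^bsub>A\<^esub>}" if "finite {x. v x \<noteq> \<zero>\<^bsub>A\<^esub>}" "finite {x. w x \<noteq> \<zero>\<^bsub>A\<^esub>}" for v w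
  by (rule finite_subset[of _ "{x. v x \<noteq> \<zero>\<^bsub>A\<^esub>} \<union> {x. w x \<noteq> \<zero>\<^bsub>A\<^esub>}"]) (use that in auto)
 have sub2: "finite {x. r \<otimes>\<^bsub>A\<^esub> v x \<noteq> \<zero>\<^bsub>A\<^esub>}" if "finite {x. v x \<noteq> \<zero>\<^bsub>A\<^esub>}" "r \<in> carrier A" for v r
  by (rule finite_subset[OF _ that(1)]) (use that(2) in auto)
 show ?thesis
 proof (rule moduleI)
  show "abelian_group ?F"
  proof (rule abelian_groupI)
   fix v assume v: "v \<in> carrier ?F"
   then show "\<exists>w\<in>carrier ?F. w \<oplus>\<^bsub>?F\<^esub> v = \<zero>\<^bsub>?F\<^esub>"
    by (intro bexI[of _ "\<lambda>x. \<ominus>\<^bsub>A\<^esub> v x"]) (auto simp: free_module_def l_neg elim: finite_subset[rotated])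
  qed (auto simp: free_module_def sub a_ac)
 qed (auto simp: free_module_def sub2 l_distr r_distr m_assoc is_cring)
qed

text \<open>\<open>D N v\<close> is the class of \<open>v\<close>; addition and scalars of a quotient module act on representatives.\<close>

lemma quotient_module_ops:
 assumes M: "module A M" and N: "submodule N A M"
 shows "carrier (quotient_module A M N) = (\<lambda>v. N +>\<^bsub>M\<^esub> v) ` carrier M"
  and "v \<in> carrier M ==> w \<in> carrier M ==> (N +>\<^bsub>M\<^esub> v) \<oplus>\<^bsub>quotient_module A M N\<^esub> (N +>\<^bsub>M\<^esub> w) = N +>\<^bsub>M\<^esub> (v \<oplus>\<^bsub>M\<^esub> w)"
  and "r \<in> carrier A ==> v \<in> carrier M ==> r \<odot>\<^bsub>quotient_module A M N\<^esub> (N +>\<^bsub>M\<^esub> v) = N +>\<^bsub>M\<^esub> (r \<odot>\<^bsub>M\<^esub> v)"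
  and "v \<in> carrier M ==> w \<in> carrier M ==> (N +>\<^bsub>M\<^esub> v = N +>\<^bsub>M\<^esub> w) \<longleftrightarrow> v \<ominus>\<^bsub>M\<^esub> w \<in> N"
proof -
 interpret module A M by fact
 interpret N: submodule N A M by fact
 have "additive_subgroup N M" by (intro additive_subgroup.intro N.subgroup_axioms)
 then interpret abelian_subgroup N M by (rule abelian_subgroupI3) (rule abelian_group_axioms)
 show "carrier (quotient_module A M N) = (\<lambda>v. N +>\<^bsub>M\<^esub> v) ` carrier M"
  by (auto simp: quotient_module_def A_RCOSETS_def')
 show "(N +>\<^bsub>M\<^esub> v) \<oplus>\<^bsub>quotient_module A M N\<^esub> (N +>\<^bsub>M\<^esub> w) = N +>\<^bsub>M\<^esub> (v \<oplus>\<^bsub>M\<^esub> w)" if "v \<in> carrier M" "w \<in> carrier M"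
  using a_rcos_sum[OF that] by (simp add: quotient_module_def)
 have mem: "v \<in> N +>\<^bsub>M\<^esub> w \<longleftrightarrow> v \<ominus>\<^bsub>M\<^esub> w \<in> N" if "v \<in> carrier M" "w \<in> carrier M" for v w
  using a_rcos_module[OF that(2,1)] by (simp add: a_minus_def)
 show eq: "(N +>\<^bsub>M\<^esub> v = N +>\<^bsub>M\<^esub> w) \<longleftrightarrow> v \<ominus>\<^bsub>M\<^esub> w \<in> N" if "v \<in> carrier M" "w \<in> carrier M" for v w
  using mem[OF that] a_repr_independence'[of v w] a_repr_independenceD[of v w] that by metis
 show "r \<odot>\<^bsub>quotient_module A M N\<^esub> (N +>\<^bsub>M\<^esub> v) = N +>\<^bsub>M\<^esub> (r \<odot>\<^bsub>M\<^esub> v)" if r: "r \<in> carrier A" and v: "v \<in> carrier M"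
 proof -
  have all: "N +>\<^bsub>M\<^esub> (r \<odot>\<^bsub>M\<^esub> c) = N +>\<^bsub>M\<^esub> (r \<odot>\<^bsub>M\<^esub> v)" if c: "c \<in> N +>\<^bsub>M\<^esub> v" for c
  proof -
   have cM: "c \<in> carrier M" using c a_elemrcos_carrier[OF v] by blast
   have "r \<odot>\<^bsub>M\<^esub> (c \<ominus>\<^bsub>M\<^esub> v) \<in> N" using mem[OF cM v] c r by blast
   moreover have "r \<odot>\<^bsub>M\<^esub> (c \<ominus>\<^bsub>M\<^esub> v) = r \<odot>\<^bsub>M\<^esub> c \<ominus>\<^bsub>M\<^esub> r \<odot>\<^bsub>M\<^esub> v"
    using r v cM by (simp add: a_minus_def smult_r_distr smult_r_minus)
   ultimately show ?thesis using eq r v cM by simp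
  qed
  have "(\<Union>c\<in>N +>\<^bsub>M\<^esub> v. N +>\<^bsub>M\<^esub> (r \<odot>\<^bsub>M\<^esub> c)) = N +>\<^bsub>M\<^esub> (r \<odot>\<^bsub>M\<^esub> v)"
   by (rule UN_constant_eq[OF a_rcos_self[OF v]]) (use all in blast)
  then show ?thesis by (simp add: quotient_module_def)
 qed
qed

section \<open>From the symmetric algebra of the differentials back to B\<close>

section \<open>The symmetric algebra of \<open>\<Omega>\<close>\<close>

definition cg :: "'a::comm_ring_1 set \<Rightarrow> 'a \<Rightarrow> 'a \<Rightarrow> bool" where "cg G x y \<longleftrightarrow> x - y \<in> idl G"

lemma cg_refl: "cg G x x" by (simp add: cg_def ispan_zero)
lemma cg_sym: "cg G x y ==> cg G y x"
 unfolding cg_def using ispan_neg[of "x - y" G] by simp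
lemma cg_trans: "cg G x y ==> cg G y z ==> cg G x z"
 unfolding cg_def using ispan_add[of "x - y" G "y - z"] by simp
lemma cg_add: "cg G x y ==> cg G x' y' ==> cg G (x + x') (y + y')"
 unfolding cg_def using ispan_add[of "x - y" G "x' - y'"] by (simp add: algebra_simps)
lemma cg_diff: "cg G x y ==> cg G x' y' ==> cg G (x - x') (y - y')"
 unfolding cg_def using ispan_diff[of "x - y" G "x' - y'"] by (simp add: algebra_simps)
lemma cg_scale: "cg G x y ==> cg G (c * x) (c * y)"
 unfolding cg_def using ispan_scale[of "x - y" G c] by (simp add: algebra_simps)
lemma cg_mult: assumes "cg G x y" "cg G x' y'" shows "cg G (x * x') (y * y')"
 using cg_trans[OF cg_scale[OF assms(2), of x]] cg_scale[OF assms(1), of y'] by (simp add: mult.commute)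
lemma cg_sum: "(\<And>a. a \<in> A ==> cg G (h a) (h' a)) ==> cg G (sum h A) (sum h' A)"
 unfolding cg_def sum_subtractf[symmetric] by (rule ispan_sum)
lemma cg_0: "cg G x 0 \<longleftrightarrow> x \<in> idl G" by (simp add: cg_def)
lemma cg_mem: "cg G x y ==> x \<in> idl G \<longleftrightarrow> y \<in> idl G"
 using cg_trans[of G x y 0] cg_trans[of G y x 0] cg_sym[of G x y] by (auto simp: cg_0)

text \<open>Representatives are chosen arbitrarily, so the maps built from them are well behaved
  only modulo \<open>IB f g\<close>; this is why the following lemmas are congruences
  \<open>cg\<close>.\<close>

definition rp :: "'k::field poly4 \<Rightarrow> 'k poly4 \<Rightarrow> 'k poly4 set \<Rightarrow> 'k poly4" where
 "rp f g c = (SOME p. fg_class f g p = c)"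
definition phi' :: "'k::field poly4 \<Rightarrow> 'k poly4 \<Rightarrow> ('k poly4 set \<Rightarrow> 'k poly4 set) \<Rightarrow> 'k poly44" where
 "phi' f g v = (\<Sum>r\<in>{r. v r \<noteq> \<zero>\<^bsub>fg_ring f g\<^esub>}. emS (rp f g (v r)) * DD (rp f g r))"
abbreviation Fm :: "'k::field poly4 \<Rightarrow> 'k poly4 \<Rightarrow> ('k poly4 set, 'k poly4 set \<Rightarrow> 'k poly4 set) module" where
 "Fm f g \<equiv> free_module (fg_ring f g) (carrier (fg_ring f g))"
abbreviation Nm :: "'k::field poly4 \<Rightarrow> 'k poly4 \<Rightarrow> ('k poly4 set \<Rightarrow> 'k poly4 set) set" where
 "Nm f g \<equiv> kaehler_submodule (fg_ring f g) (fg_scalars f g)"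
definition cs :: "'k::field poly4 \<Rightarrow> 'k poly4 \<Rightarrow> ('k poly4 set \<Rightarrow> 'k poly4 set) \<Rightarrow> 'k omega_elem" where
 "cs f g v = Nm f g +>\<^bsub>Fm f g\<^esub> v"
definition phi :: "'k::field poly4 \<Rightarrow> 'k poly4 \<Rightarrow> 'k omega_elem \<Rightarrow> 'k poly44" where
 "phi f g u = phi' f g (SOME v. v \<in> carrier (Fm f g) \<and> cs f g v = u)"
definition Psi :: "'k::field poly4 \<Rightarrow> 'k poly4 \<Rightarrow> ('k omega_elem multiset \<Rightarrow>\<^sub>0 'k poly4) \<Rightarrow> 'k poly44" where
 "Psi f g = evm emS (\<lambda>m. prod_mset (image_mset (phi f g) m))"
definition chi :: "'k::field poly4 \<Rightarrow> 'k poly4 \<Rightarrow> ('k omega_elem multiset \<Rightarrow>\<^sub>0 'k poly4) \<Rightarrow> 'k sym_elem" where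
 "chi f g p = sym_ideal (fg_ring f g) (Omega f g) +>\<^bsub>poly_ring_over (fg_ring f g) (carrier (Omega f g))\<^esub> PhiM f g p"
abbreviation sg :: "'u \<Rightarrow> 'u multiset \<Rightarrow>\<^sub>0 'a::comm_ring_1" where "sg u \<equiv> pms {#u#} 1"
abbreviation cc :: "'a::comm_ring_1 \<Rightarrow> 'u multiset \<Rightarrow>\<^sub>0 'a" where "cc s \<equiv> pms {#} s"

lemma rhom_cc: "rhom (cc :: 'a::comm_ring_1 \<Rightarrow> 'u multiset \<Rightarrow>\<^sub>0 'a)"
 by (rule rhomI) (simp_all add: single_add mult_single)

context
 fixes f g :: "'k::field poly4"
begin

abbreviation (input) "clS \<equiv> fg_class f g"
abbreviation (input) "RR \<equiv> fg_ring f g"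
abbreviation (input) "F \<equiv> Fm f g"
abbreviation (input) "e \<equiv> free_basis (fg_ring f g)"
abbreviation (input) "cgI \<equiv> cg (IB f g)"
abbreviation (input) "dx' i \<equiv> cs f g (free_basis (fg_ring f g) (fg_class f g (mpv i)))"

lemmas Rs = R_simps[of f g]

lemma cring_R: "cring RR" by (rule pres_cring[OF pres_R])

lemma module_F: "module RR F" by (rule free_module_module[OF cring_R])

lemma e_carrier: "e (clS a) \<in> carrier F"
proof -
 interpret cring RR by (rule cring_R)
 have "finite {x. (if x = clS a then \<one>\<^bsub>RR\<^esub> else \<zero>\<^bsub>RR\<^esub>) \<noteq> \<zero>\<^bsub>RR\<^esub>}" by (rule finite_subset[of _ "{clS a}"]) auto
 moreover have "clS a \<in> carrier RR" by (simp add: Rs(1))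
 ultimately show ?thesis by (auto simp: free_module_def free_basis_def)
qed

lemma IB_emS: assumes "p \<in> idl {f, g}" shows "emS p \<in> idl (IB f g)"
 by (rule idl_image[OF rhom_emS _ assms]) (auto intro: ispan_base)

lemma IB_DD: assumes "p \<in> idl {f, g}" shows "DD p \<in> idl (IB f g)"
proof -
 obtain u v where p: "p = u * f + v * g" using assms idl_two by blast
 have "emS f \<in> idl (IB f g)" "emS g \<in> idl (IB f g)" "DD f \<in> idl (IB f g)" "DD g \<in> idl (IB f g)" by (auto intro: ispan_base)
 then show ?thesis unfolding p DD_add DD_mult
  using ispan_scale[of "DD f" "IB f g" "emS u"] ispan_scale[of "DD g" "IB f g" "emS v"]
   ispan_scale[of "emS f" "IB f g" "DD u"] ispan_scale[of "emS g" "IB f g" "DD v"]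
  by (intro ispan_add) (simp_all add: mult.commute)
qed

lemma cl_rp: "c \<in> carrier RR ==> clS (rp f g c) = c"
 unfolding rp_def by (rule someI_ex) (auto simp: Rs(1))

lemma cg_emS: "clS p = clS q ==> cgI (emS p) (emS q)"
 unfolding cg_def using IB_emS[of "p - q"] by (simp add: fg_class_eq rhom_diff[OF rhom_emS])

lemma cg_DD: "clS p = clS q ==> cgI (DD p) (DD q)"
 unfolding cg_def using IB_DD[of "p - q"] by (simp add: fg_class_eq DD_diff)

lemma cl_rp_cl: "clS (rp f g (clS p)) = clS p" by (rule cl_rp) (simp add: Rs(1))

text \<open>Outside the support the chosen representative of the zero class need not be 0, but it
  lies in (f, g), so the extra terms vanish modulo the ideal.\<close>

lemma phi'_superset:
 assumes "finite A" "{r. v r \<noteq> \<zero>\<^bsub>RR\<^esub>} \<subseteq> A"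
 shows "cgI (phi' f g v) (\<Sum>r\<in>A. emS (rp f g (v r)) * DD (rp f g r))"
proof -
 have s: "cgI (\<Sum>r\<in>A - {r. v r \<noteq> \<zero>\<^bsub>RR\<^esub>}. emS (rp f g (v r)) * DD (rp f g r)) (\<Sum>r\<in>A - {r. v r \<noteq> \<zero>\<^bsub>RR\<^esub>}. emS 0 * DD (rp f g r))"
  by (intro cg_sum cg_mult cg_refl cg_emS) (auto simp: Rs(3) cl_rp_cl)
 have "(\<Sum>r\<in>A. emS (rp f g (v r)) * DD (rp f g r)) = (\<Sum>r\<in>A - {r. v r \<noteq> \<zero>\<^bsub>RR\<^esub>}. emS (rp f g (v r)) * DD (rp f g r)) + phi' f g v"
  unfolding phi'_def by (rule sum.subset_diff[OF assms(2,1)])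
 then show ?thesis using cg_add[OF s cg_refl, of "phi' f g v"] by (simp add: rhom_0[OF rhom_emS] cg_sym)
qed

lemma F_add: "(v \<oplus>\<^bsub>F\<^esub> w) r = v r \<oplus>\<^bsub>RR\<^esub> w r" and F_smult: "(s \<odot>\<^bsub>F\<^esub> v) r = s \<otimes>\<^bsub>RR\<^esub> v r" and F_zero: "\<zero>\<^bsub>F\<^esub> = (\<lambda>_. \<zero>\<^bsub>RR\<^esub>)"
 by (simp_all add: free_module_def)

lemma F_carrierD: "v \<in> carrier F ==> v r \<in> carrier RR" "v \<in> carrier F ==> finite {r. v r \<noteq> \<zero>\<^bsub>RR\<^esub>}"
 "v \<in> carrier F ==> r \<notin> carrier RR ==> v r = \<zero>\<^bsub>RR\<^esub>"
 by (auto simp: free_module_def)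

lemma phi'_add: assumes v: "v \<in> carrier F" and w: "w \<in> carrier F" shows "cgI (phi' f g (v \<oplus>\<^bsub>F\<^esub> w)) (phi' f g v + phi' f g w)"
proof -
 interpret cring RR by (rule cring_R)
 let ?A = "{r. v r \<noteq> \<zero>\<^bsub>RR\<^esub>} \<union> {r. w r \<noteq> \<zero>\<^bsub>RR\<^esub>}"
 have A: "finite ?A" using F_carrierD(2) v w by blast
 have "cgI (phi' f g (v \<oplus>\<^bsub>F\<^esub> w)) (\<Sum>r\<in>?A. emS (rp f g ((v \<oplus>\<^bsub>F\<^esub> w) r)) * DD (rp f g r))"
  by (rule phi'_superset[OF A]) (auto simp: F_add)
 moreover have "cgI (\<Sum>r\<in>?A. emS (rp f g ((v \<oplus>\<^bsub>F\<^esub> w) r)) * DD (rp f g r)) (\<Sum>r\<in>?A. emS (rp f g (v r) + rp f g (w r)) * DD (rp f g r))"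
 proof (intro cg_sum cg_mult cg_refl cg_emS)
  fix r
  have "v r \<oplus>\<^bsub>RR\<^esub> w r \<in> carrier RR" using F_carrierD(1) v w by simp
  then show "clS (rp f g ((v \<oplus>\<^bsub>F\<^esub> w) r)) = clS (rp f g (v r) + rp f g (w r))"
   using F_carrierD(1)[OF v, of r] F_carrierD(1)[OF w, of r] by (simp add: F_add cl_rp Rs(4)[symmetric])
 qed
 moreover have "cgI (\<Sum>r\<in>?A. emS (rp f g (v r) + rp f g (w r)) * DD (rp f g r)) (phi' f g v + phi' f g w)"
  unfolding rhom_add[OF rhom_emS] distrib_right sum.distrib
  by (intro cg_add cg_sym[OF phi'_superset[OF A]]) auto
 ultimately show ?thesis by (meson cg_trans)
qed

lemma phi'_smult: assumes v: "v \<in> carrier F" and s: "s \<in> carrier RR" shows "cgI (phi' f g (s \<odot>\<^bsub>F\<^esub> v)) (emS (rp f g s) * phi' f g v)"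
proof -
 interpret cring RR by (rule cring_R)
 let ?A = "{r. v r \<noteq> \<zero>\<^bsub>RR\<^esub>}"
 have A: "finite ?A" using F_carrierD(2) v by blast
 have s1: "cgI (phi' f g (s \<odot>\<^bsub>F\<^esub> v)) (\<Sum>r\<in>?A. emS (rp f g ((s \<odot>\<^bsub>F\<^esub> v) r)) * DD (rp f g r))"
 proof (rule phi'_superset[OF A])
  show "{r. (s \<odot>\<^bsub>F\<^esub> v) r \<noteq> \<zero>\<^bsub>RR\<^esub>} \<subseteq> ?A"
  proof (intro subsetI CollectI notI)
   fix r assume a: "r \<in> {r. (s \<odot>\<^bsub>F\<^esub> v) r \<noteq> \<zero>\<^bsub>RR\<^esub>}" and b: "v r = \<zero>\<^bsub>RR\<^esub>"
   have "(s \<odot>\<^bsub>F\<^esub> v) r = s \<otimes>\<^bsub>RR\<^esub> v r" by (rule F_smult)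
   also have "\<dots> = \<zero>\<^bsub>RR\<^esub>" unfolding b by (rule r_null[OF s])
   finally show False using CollectD[OF a] by (rule notE[rotated])
  qed
 qed
 have s2: "cgI (\<Sum>r\<in>?A. emS (rp f g ((s \<odot>\<^bsub>F\<^esub> v) r)) * DD (rp f g r)) (\<Sum>r\<in>?A. emS (rp f g s * rp f g (v r)) * DD (rp f g r))"
 proof (intro cg_sum cg_mult cg_refl cg_emS)
  fix r
  have "s \<otimes>\<^bsub>RR\<^esub> v r \<in> carrier RR" using F_carrierD(1) v s by simp
  then show "clS (rp f g ((s \<odot>\<^bsub>F\<^esub> v) r)) = clS (rp f g s * rp f g (v r))"
   using F_carrierD(1)[OF v, of r] s by (simp add: F_smult cl_rp Rs(5)[symmetric])
 qed
 have s3: "(\<Sum>r\<in>?A. emS (rp f g s * rp f g (v r)) * DD (rp f g r)) = emS (rp f g s) * phi' f g v"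
  by (simp add: phi'_def sum_distrib_left rhom_mult[OF rhom_emS] mult.assoc)
 show ?thesis using cg_trans[OF s1 s2] unfolding s3 .
qed

lemma phi'_e: "cgI (phi' f g (e (clS a))) (DD a)"
proof -
 have s1: "cgI (phi' f g (e (clS a))) (\<Sum>r\<in>{clS a}. emS (rp f g (e (clS a) r)) * DD (rp f g r))"
  by (rule phi'_superset) (auto simp: free_basis_def split: if_splits)
 have s2: "cgI (emS (rp f g (e (clS a) (clS a))) * DD (rp f g (clS a))) (emS 1 * DD a)"
  by (intro cg_mult cg_emS cg_DD) (simp_all add: free_basis_def Rs(2) cl_rp_cl)
 have "cgI (phi' f g (e (clS a))) (emS (rp f g (e (clS a) (clS a))) * DD (rp f g (clS a)))" using s1 by simp
 from cg_trans[OF this s2] show ?thesis by (simp add: rhom_1[OF rhom_emS])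
qed

lemma phi'_0: "phi' f g \<zero>\<^bsub>F\<^esub> = 0" by (simp add: phi'_def F_zero)

lemma phi'_diff: assumes v: "v \<in> carrier F" and w: "w \<in> carrier F" shows "cgI (phi' f g (v \<ominus>\<^bsub>F\<^esub> w)) (phi' f g v - phi' f g w)"
proof -
 interpret module RR F by (rule module_F)
 have "(v \<ominus>\<^bsub>F\<^esub> w) \<oplus>\<^bsub>F\<^esub> w = v" using v w by (simp add: a_minus_def M.a_assoc M.l_neg)
 then have "cgI (phi' f g v) (phi' f g (v \<ominus>\<^bsub>F\<^esub> w) + phi' f g w)" using phi'_add[of "v \<ominus>\<^bsub>F\<^esub> w" w] v w by simp
 from cg_diff[OF cg_sym[OF this] cg_refl, of "phi' f g w"] show ?thesis by simp
qed

lemma relation_cases: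
 assumes "v \<in> kaehler_relations RR (fg_scalars f g)"
 obtains (add) a b where "v = e (clS (a + b)) \<ominus>\<^bsub>F\<^esub> (e (clS a) \<oplus>\<^bsub>F\<^esub> e (clS b))"
  | (mult) a b where "v = e (clS (a * b)) \<ominus>\<^bsub>F\<^esub> (clS a \<odot>\<^bsub>F\<^esub> e (clS b) \<oplus>\<^bsub>F\<^esub> clS b \<odot>\<^bsub>F\<^esub> e (clS a))"
  | (const) c where "v = e (clS (mc c))"
 using assms unfolding kaehler_relations_def Let_def fg_scalars_def Rs(1)
 by (elim UnE CollectE exE conjE imageE rangeE; simp only: Rs(4,5))

lemma e_ops: "e (clS a) \<oplus>\<^bsub>F\<^esub> e (clS b) \<in> carrier F" "clS a \<odot>\<^bsub>F\<^esub> e (clS b) \<in> carrier F"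
 "clS a \<odot>\<^bsub>F\<^esub> e (clS b) \<oplus>\<^bsub>F\<^esub> clS b' \<odot>\<^bsub>F\<^esub> e (clS a') \<in> carrier F"
proof -
 interpret module RR F by (rule module_F)
 have c: "clS a \<in> carrier RR" for a by (simp add: Rs(1))
 show "e (clS a) \<oplus>\<^bsub>F\<^esub> e (clS b) \<in> carrier F" by (intro M.add.m_closed e_carrier)
 show "clS a \<odot>\<^bsub>F\<^esub> e (clS b) \<in> carrier F" for a b by (intro smult_closed e_carrier c)
 then show "clS a \<odot>\<^bsub>F\<^esub> e (clS b) \<oplus>\<^bsub>F\<^esub> clS b' \<odot>\<^bsub>F\<^esub> e (clS a') \<in> carrier F" by (intro M.add.m_closed)
qed

lemma relations_carrier: "kaehler_relations RR (fg_scalars f g) \<subseteq> carrier F"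
proof
 interpret module RR F by (rule module_F)
 fix v assume "v \<in> kaehler_relations RR (fg_scalars f g)"
 then show "v \<in> carrier F" by (cases rule: relation_cases) (simp_all only: M.minus_closed e_carrier e_ops)
qed

lemma submodule_N: "submodule (Nm f g) RR F"
 unfolding kaehler_submodule_def by (rule submodule_gen_submodule[OF module_F relations_carrier])

lemma relations_N: "r \<in> kaehler_relations RR (fg_scalars f g) ==> r \<in> Nm f g"
 unfolding kaehler_submodule_def submodule_gen_def by blast

text \<open>The elements sent into the ideal form a submodule, and \<open>DD\<close> satisfies the
  relations that define the differentials.\<close>

lemma phi'_N: assumes "v \<in> Nm f g" shows "phi' f g v \<in> idl (IB f g)"
proof -
 interpret module RR F by (rule module_F)
 let ?K = "{v \<in> carrier F. phi' f g v \<in> idl (IB f g)}"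
 have "submodule ?K RR F"
 proof (rule submoduleI)
  show "\<zero>\<^bsub>F\<^esub> \<in> ?K" by (simp add: phi'_0 ispan_zero)
  show "v \<oplus>\<^bsub>F\<^esub> w \<in> ?K" if "v \<in> ?K" "w \<in> ?K" for v w
   using that cg_mem[OF phi'_add[of v w]] by (simp add: ispan_add)
  show "s \<odot>\<^bsub>F\<^esub> w \<in> ?K" if "s \<in> carrier RR" "w \<in> ?K" for s w
   using that cg_mem[OF phi'_smult[of w s]] by (simp add: ispan_scale)
  show "\<ominus>\<^bsub>F\<^esub> w \<in> ?K" if "w \<in> ?K" for w
  proof -
   have "\<ominus>\<^bsub>F\<^esub> w = \<zero>\<^bsub>F\<^esub> \<ominus>\<^bsub>F\<^esub> w" using that by (simp add: a_minus_def)
   then show ?thesis using that cg_mem[OF phi'_diff[of "\<zero>\<^bsub>F\<^esub>" w]] by (simp add: phi'_0 ispan_neg)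
  qed
 qed auto
 moreover have "kaehler_relations RR (fg_scalars f g) \<subseteq> ?K"
 proof
  fix v assume v: "v \<in> kaehler_relations RR (fg_scalars f g)"
  then have vF: "v \<in> carrier F" using relations_carrier by blast
  from v have "phi' f g v \<in> idl (IB f g)"
  proof (cases rule: relation_cases)
   case (add a b)
   have "cgI (phi' f g v) (DD (a + b) - (DD a + DD b))"
    unfolding add
    by (rule cg_trans[OF phi'_diff[OF e_carrier e_ops(1)]], rule cg_diff[OF phi'_e], rule cg_trans[OF phi'_add[OF e_carrier e_carrier]], rule cg_add[OF phi'_e phi'_e])
   then show ?thesis by (simp add: cg_mem DD_add ispan_zero)
  next
   case (mult a b)
   have sm: "cgI (phi' f g (clS a \<odot>\<^bsub>F\<^esub> e (clS b))) (emS a * DD b)" for a b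
    by (rule cg_trans[OF phi'_smult[OF e_carrier]], simp add: Rs(1)) (intro cg_mult phi'_e cg_emS cl_rp_cl)
   have "cgI (phi' f g v) (DD (a * b) - (emS a * DD b + emS b * DD a))"
    unfolding mult
    by (rule cg_trans[OF phi'_diff[OF e_carrier e_ops(3)]], rule cg_diff[OF phi'_e], rule cg_trans[OF phi'_add[OF e_ops(2) e_ops(2)]], rule cg_add[OF sm sm])
   then show ?thesis by (simp add: cg_mem DD_mult ispan_zero)
  next
   case (const c)
   then show ?thesis using cg_mem[OF phi'_e[of "mc c"]] by (simp add: ispan_zero)
  qed
  then show "v \<in> ?K" using vF by simp
 qed
 ultimately show ?thesis using assms unfolding kaehler_submodule_def submodule_gen_def by blast
qed

lemma Omega_ops:
 "carrier (Omega f g) = cs f g ` carrier F"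
 "v \<in> carrier F ==> w \<in> carrier F ==> cs f g v \<oplus>\<^bsub>Omega f g\<^esub> cs f g w = cs f g (v \<oplus>\<^bsub>F\<^esub> w)"
 "r \<in> carrier RR ==> v \<in> carrier F ==> r \<odot>\<^bsub>Omega f g\<^esub> cs f g v = cs f g (r \<odot>\<^bsub>F\<^esub> v)"
 "v \<in> carrier F ==> w \<in> carrier F ==> cs f g v = cs f g w \<longleftrightarrow> v \<ominus>\<^bsub>F\<^esub> w \<in> Nm f g"
 unfolding Omega_def kaehler_differentials_def cs_def[abs_def]
 subgoal by (rule quotient_module_ops(1)[OF module_F submodule_N])
 subgoal by (rule quotient_module_ops(2)[OF module_F submodule_N])
 subgoal by (rule quotient_module_ops(3)[OF module_F submodule_N])
 subgoal by (rule quotient_module_ops(4)[OF module_F submodule_N])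
 done

lemma phi_cs: assumes v: "v \<in> carrier F" shows "cgI (phi f g (cs f g v)) (phi' f g v)"
proof -
 define w where "w = (SOME w. w \<in> carrier F \<and> cs f g w = cs f g v)"
 have w: "w \<in> carrier F" "cs f g w = cs f g v" unfolding w_def using someI[of "\<lambda>w. w \<in> carrier F \<and> cs f g w = cs f g v" v] v by auto
 have "phi' f g (w \<ominus>\<^bsub>F\<^esub> v) \<in> idl (IB f g)" using Omega_ops(4)[OF w(1) v] w(2) phi'_N by blast
 then have "phi' f g w - phi' f g v \<in> idl (IB f g)" using cg_mem[OF phi'_diff[OF w(1) v]] by blast
 then show ?thesis by (simp add: phi_def w_def[symmetric] cg_def)
qed

lemma rhom_Psi: "rhom (Psi f g)"
 unfolding Psi_def by (rule rhom_evm[OF rhom_emS]) simp_all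

lemma Psi_single: "Psi f g (pms m c) = emS c * prod_mset (image_mset (phi f g) m)"
 unfolding Psi_def by (rule evm_single[OF rhom_emS])

abbreviation (input) "V \<equiv> carrier (Omega f g)"
abbreviation (input) "PV \<equiv> poly_ring_over (fg_ring f g) (carrier (Omega f g))"

lemmas PP = pres_P[of V f g]

lemma sg_MV: "u \<in> V ==> sg u \<in> MV V" and cc_MV: "cc s \<in> MV V"
 by (simp_all add: MV_single)

text \<open>Lifts along \<open>PhiM\<close> of the relations that define the symmetric
  algebra.\<close>

definition SG :: "('k omega_elem multiset \<Rightarrow>\<^sub>0 'k poly4) set" where
 "SG = {sg (u \<oplus>\<^bsub>Omega f g\<^esub> v) - (sg u + sg v) | u v. u \<in> V \<and> v \<in> V} \<union>
  {sg (r \<odot>\<^bsub>Omega f g\<^esub> u) - cc (rp f g r) * sg u | r u. r \<in> carrier RR \<and> u \<in> V}"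

lemma V_closed: "u \<in> V ==> v \<in> V ==> u \<oplus>\<^bsub>Omega f g\<^esub> v \<in> V" "r \<in> carrier RR ==> u \<in> V ==> r \<odot>\<^bsub>Omega f g\<^esub> u \<in> V"
proof -
 interpret module RR F by (rule module_F)
 show "u \<in> V ==> v \<in> V ==> u \<oplus>\<^bsub>Omega f g\<^esub> v \<in> V" "r \<in> carrier RR ==> u \<in> V ==> r \<odot>\<^bsub>Omega f g\<^esub> u \<in> V"
  unfolding Omega_ops(1) by (auto simp: Omega_ops)
qed

lemma SG_MV: "SG \<subseteq> MV V"
 unfolding SG_def using V_closed by (auto intro!: pres_diff[OF PP] MV_add MV_mult sg_MV cc_MV)

lemma sym_ideal_alt: "sym_ideal RR (Omega f g) = genideal PV (PhiM f g ` SG)"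
proof -
 have a: "PhiM f g (sg (u \<oplus>\<^bsub>Omega f g\<^esub> v) - (sg u + sg v)) =
   ring.indexed_var RR (u \<oplus>\<^bsub>Omega f g\<^esub> v) \<ominus>\<^bsub>PV\<^esub> (ring.indexed_var RR u \<oplus>\<^bsub>PV\<^esub> ring.indexed_var RR v)" if "u \<in> V" "v \<in> V" for u v
  using that by (simp add: PhiM_var[symmetric] presD(9)[OF PP] pres_minus[OF PP] sg_MV V_closed MV_add)
 have b: "PhiM f g (sg (r \<odot>\<^bsub>Omega f g\<^esub> u) - cc (rp f g r) * sg u) =
   ring.indexed_var RR (r \<odot>\<^bsub>Omega f g\<^esub> u) \<ominus>\<^bsub>PV\<^esub> (ring.indexed_const RR r \<otimes>\<^bsub>PV\<^esub> ring.indexed_var RR u)" if "r \<in> carrier RR" "u \<in> V" for r u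
 proof -
  have c: "ring.indexed_const RR r = PhiM f g (cc (rp f g r))" using that by (simp add: PhiM_const cl_rp)
  show ?thesis
   unfolding c PhiM_var[symmetric] presD(10)[OF PP cc_MV sg_MV[OF that(2)]]
    pres_minus[OF PP sg_MV[OF V_closed(2)[OF that]] MV_mult[OF cc_MV sg_MV[OF that(2)]]] by (rule refl)
 qed
 have "PhiM f g ` SG = {ring.indexed_var RR (u \<oplus>\<^bsub>Omega f g\<^esub> v) \<ominus>\<^bsub>PV\<^esub> (ring.indexed_var RR u \<oplus>\<^bsub>PV\<^esub> ring.indexed_var RR v) | u v. u \<in> V \<and> v \<in> V} \<union>
  {ring.indexed_var RR (r \<odot>\<^bsub>Omega f g\<^esub> u) \<ominus>\<^bsub>PV\<^esub> (ring.indexed_const RR r \<otimes>\<^bsub>PV\<^esub> ring.indexed_var RR u) | r u. r \<in> carrier RR \<and> u \<in> V}"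
  (is "_ = ?A \<union> ?B")
 proof
  show "PhiM f g ` SG \<subseteq> ?A \<union> ?B" unfolding SG_def using a b by blast
  have "?A \<subseteq> PhiM f g ` SG"
  proof
   fix x assume "x \<in> ?A"
   then obtain u v where uv: "u \<in> V" "v \<in> V" "x = PhiM f g (sg (u \<oplus>\<^bsub>Omega f g\<^esub> v) - (sg u + sg v))" using a by auto
   show "x \<in> PhiM f g ` SG" unfolding uv(3) SG_def using uv(1,2) by blast
  qed
  moreover have "?B \<subseteq> PhiM f g ` SG"
  proof
   fix x assume "x \<in> ?B"
   then obtain r u where uv: "r \<in> carrier RR" "u \<in> V" "x = PhiM f g (sg (r \<odot>\<^bsub>Omega f g\<^esub> u) - cc (rp f g r) * sg u)" using b by auto
   show "x \<in> PhiM f g ` SG" unfolding uv(3) SG_def using uv(1,2) by blast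
  qed
  ultimately show "?A \<union> ?B \<subseteq> PhiM f g ` SG" by blast
 qed
 then show ?thesis unfolding sym_ideal_def Let_def by simp
qed

lemma SG_carrier: "PhiM f g ` SG \<subseteq> carrier PV"
 using SG_MV presD(6)[OF PP] by blast

lemma ideal_sym: "ideal (sym_ideal RR (Omega f g)) PV"
proof -
 interpret cring PV by (rule pres_cring[OF PP])
 show ?thesis unfolding sym_ideal_alt by (rule genideal_ideal[OF SG_carrier])
qed

lemma pres_C: "pres (MV V) (chi f g) (SymOmega f g)"
 unfolding SymOmega_def sym_algebra_def chi_def[abs_def] by (rule pres_quotient(1)[OF PP ideal_sym])

lemma chi_eq_0: "p \<in> MV V ==> chi f g p = \<zero>\<^bsub>SymOmega f g\<^esub> \<longleftrightarrow> PhiM f g p \<in> sym_ideal RR (Omega f g)"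
 unfolding SymOmega_def sym_algebra_def chi_def by (rule pres_quotient(2)[OF PP ideal_sym])

text \<open>\<open>pres_genideal\<close> applied to the polynomials whose image under
  \<open>Psi\<close> lies in the ideal: this set contains the kernel of \<open>PhiM\<close> and the
  lifted relations \<open>SG\<close>.\<close>

lemma Psi_kernel:
 assumes p: "p \<in> MV V" "chi f g p = \<zero>\<^bsub>SymOmega f g\<^esub>" shows "Psi f g p \<in> idl (IB f g)"
proof -
 let ?Q = "{p \<in> MV V. Psi f g p \<in> idl (IB f g)}"
 have "p \<in> ?Q"
 proof (rule pres_genideal[OF PP _ _ _ _ _ p(1)])
  show "PhiM f g p \<in> genideal PV (PhiM f g ` SG)" using p by (simp add: chi_eq_0 sym_ideal_alt)
  show "x + y \<in> ?Q" if "x \<in> ?Q" "y \<in> ?Q" for x y using that by (simp add: MV_add rhom_add[OF rhom_Psi] ispan_add)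
  show "c * x \<in> ?Q" if "c \<in> MV V" "x \<in> ?Q" for c x using that by (simp add: MV_mult rhom_mult[OF rhom_Psi] ispan_scale)
  show "x \<in> ?Q" if x: "x \<in> MV V" "PhiM f g x = \<zero>\<^bsub>PV\<^esub>" for x
  proof -
   have "PhiM f g x = PhiM f g 0" using x(2) presD(8)[OF PP] by simp
   then have "clS (pml x m) = clS 0" for m unfolding PhiM_def by (metis lookup_zero)
   then have "pml x m \<in> idl {f, g}" for m by (simp add: fg_class_eq)
   then have "Psi f g x \<in> idl (IB f g)" unfolding Psi_def evm_def
    by (intro ispan_sum) (simp add: mult.commute[of "emS _"] ispan_scale IB_emS)
   then show ?thesis using x by simp
  qed
  have "SG \<subseteq> ?Q"
  proof
   fix q assume q: "q \<in> SG"
   interpret module RR F by (rule module_F)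
   from q consider (add) v w where "v \<in> carrier F" "w \<in> carrier F" "q = sg (cs f g v \<oplus>\<^bsub>Omega f g\<^esub> cs f g w) - (sg (cs f g v) + sg (cs f g w))"
    | (smult) r v where "r \<in> carrier RR" "v \<in> carrier F" "q = sg (r \<odot>\<^bsub>Omega f g\<^esub> cs f g v) - cc (rp f g r) * sg (cs f g v)"
    unfolding SG_def Omega_ops(1) by blast
   then have "Psi f g q \<in> idl (IB f g)"
   proof cases
    case add
    have "cgI (phi f g (cs f g (v \<oplus>\<^bsub>F\<^esub> w)) - (phi f g (cs f g v) + phi f g (cs f g w)))
      ((phi' f g v + phi' f g w) - (phi' f g v + phi' f g w))"
     using add by (intro cg_diff cg_add phi_cs cg_trans[OF phi_cs phi'_add]) auto
    then show ?thesis unfolding add(3) using add(1,2)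
     by (simp add: Omega_ops rhom_diff[OF rhom_Psi] rhom_add[OF rhom_Psi] Psi_single rhom_1[OF rhom_emS] cg_0)
   next
    case smult
    have "cgI (phi f g (cs f g (r \<odot>\<^bsub>F\<^esub> v)) - emS (rp f g r) * phi f g (cs f g v))
      (emS (rp f g r) * phi' f g v - emS (rp f g r) * phi' f g v)"
     using smult by (intro cg_diff cg_scale phi_cs cg_trans[OF phi_cs phi'_smult]) auto
    then show ?thesis unfolding smult(3) using smult(1,2)
     by (simp add: Omega_ops rhom_diff[OF rhom_Psi] rhom_mult[OF rhom_Psi] Psi_single rhom_1[OF rhom_emS] cg_0)
   qed
   then show "q \<in> ?Q" using q SG_MV by blast
  qed
  then show "PhiM f g ` SG \<subseteq> PhiM f g ` ?Q" by blast
 qed auto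
 then show ?thesis by simp
qed

lemma chi_SG: "q \<in> SG ==> chi f g q = \<zero>\<^bsub>SymOmega f g\<^esub>"
proof -
 interpret cring PV by (rule pres_cring[OF PP])
 assume q: "q \<in> SG"
 then have "PhiM f g q \<in> sym_ideal RR (Omega f g)" unfolding sym_ideal_alt using genideal_self[OF SG_carrier] by blast
 then show ?thesis using q SG_MV chi_eq_0 by blast
qed

end

text \<open>The map of B to the symmetric algebra before classes are taken: \<open>chi\<close> after
  \<open>lam\<close> is \<open>B_to_Sym\<close>, and \<open>Psi\<close> inverts \<open>lam\<close>
  modulo \<open>IB f g\<close>.\<close>

definition lam :: "'k::field poly4 \<Rightarrow> 'k poly4 \<Rightarrow> 'k poly44 \<Rightarrow> ('k omega_elem multiset \<Rightarrow>\<^sub>0 'k poly4)" where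
 "lam f g = ev (\<lambda>c. cc (mc c)) (case_sum (\<lambda>i. cc (mpv i)) (\<lambda>i. sg (dx' f g i)))"

section \<open>The isomorphism of B modulo the ideal with the symmetric algebra\<close>

context
 fixes f g :: "'k::field poly4"
begin

abbreviation (input) "W \<equiv> carrier (Omega f g)"
abbreviation (input) "C \<equiv> SymOmega f g"
abbreviation (input) "ch \<equiv> chi f g"
abbreviation (input) "ec a \<equiv> free_basis (fg_ring f g) (fg_class f g a)"

lemmas PC = pres_C[of f g]
lemmas RS = R_simps[of f g]

lemma cring_C: "cring C" by (rule pres_cring[OF PC])

lemma cs_W: "v \<in> carrier (Fm f g) ==> cs f g v \<in> W" by (simp add: Omega_ops(1))

lemma chi_cc_cong: "fg_class f g s = fg_class f g t ==> ch (cc s) = ch (cc t)"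
 by (simp add: chi_def PhiM_const)

lemma inc_add: assumes "u \<in> W" "v \<in> W" shows "ch (sg (u \<oplus>\<^bsub>Omega f g\<^esub> v)) = ch (sg u + sg v)"
proof -
 have "sg (u \<oplus>\<^bsub>Omega f g\<^esub> v) - (sg u + sg v) \<in> SG f g" using assms unfolding SG_def by blast
 then show ?thesis using pres_eq_iff[OF PC sg_MV[OF V_closed(1)[OF assms]] MV_add[OF sg_MV[OF assms(1)] sg_MV[OF assms(2)]]] chi_SG by blast
qed

lemma inc_smult: assumes "u \<in> W" shows "ch (sg (fg_class f g s \<odot>\<^bsub>Omega f g\<^esub> u)) = ch (cc s * sg u)"
proof -
 have r: "fg_class f g s \<in> carrier (fg_ring f g)" by (simp add: RS)
 let ?s = "rp f g (fg_class f g s)"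
 have "sg (fg_class f g s \<odot>\<^bsub>Omega f g\<^esub> u) - cc ?s * sg u \<in> SG f g" using assms r unfolding SG_def by blast
 then have "ch (sg (fg_class f g s \<odot>\<^bsub>Omega f g\<^esub> u)) = ch (cc ?s * sg u)"
  using pres_eq_iff[OF PC sg_MV[OF V_closed(2)[OF r assms]] MV_mult[OF cc_MV sg_MV[OF assms]]] chi_SG by blast
 also have "\<dots> = ch (cc ?s) \<otimes>\<^bsub>C\<^esub> ch (sg u)" using presD(10)[OF PC cc_MV sg_MV[OF assms]] by simp
 also have "ch (cc ?s) = ch (cc s)" by (rule chi_cc_cong) (rule cl_rp_cl)
 also have "ch (cc s) \<otimes>\<^bsub>C\<^esub> ch (sg u) = ch (cc s * sg u)" by (rule presD(10)[OF PC cc_MV sg_MV[OF assms]])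
 finally show ?thesis .
qed

lemma rel_add: "ec (a + b) \<ominus>\<^bsub>Fm f g\<^esub> (ec a \<oplus>\<^bsub>Fm f g\<^esub> ec b) \<in> Nm f g"
 and rel_mult: "ec (a * b) \<ominus>\<^bsub>Fm f g\<^esub> (fg_class f g a \<odot>\<^bsub>Fm f g\<^esub> ec b \<oplus>\<^bsub>Fm f g\<^esub> fg_class f g b \<odot>\<^bsub>Fm f g\<^esub> ec a) \<in> Nm f g"
 and rel_const: "ec (mc c) \<in> Nm f g"
proof -
 have r: "fg_class f g s \<in> carrier (fg_ring f g)" for s by (simp add: RS)
 show "ec (a + b) \<ominus>\<^bsub>Fm f g\<^esub> (ec a \<oplus>\<^bsub>Fm f g\<^esub> ec b) \<in> Nm f g"
  unfolding RS(4)[symmetric] by (rule relations_N) (unfold kaehler_relations_def Let_def, use r in blast)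
 show "ec (a * b) \<ominus>\<^bsub>Fm f g\<^esub> (fg_class f g a \<odot>\<^bsub>Fm f g\<^esub> ec b \<oplus>\<^bsub>Fm f g\<^esub> fg_class f g b \<odot>\<^bsub>Fm f g\<^esub> ec a) \<in> Nm f g"
  unfolding RS(5)[symmetric] by (rule relations_N) (unfold kaehler_relations_def Let_def, use r in blast)
 show "ec (mc c) \<in> Nm f g"
  by (rule relations_N) (unfold kaehler_relations_def Let_def fg_scalars_def, blast)
qed

lemma inc_0: "ch (sg (cs f g \<zero>\<^bsub>Fm f g\<^esub>)) = ch 0"
proof -
 interpret module "fg_ring f g" "Fm f g" by (rule module_F)
 let ?u = "cs f g \<zero>\<^bsub>Fm f g\<^esub>"
 have u: "?u \<in> W" by (rule cs_W) simp
 have "?u \<oplus>\<^bsub>Omega f g\<^esub> ?u = ?u" using Omega_ops(2)[of "\<zero>\<^bsub>Fm f g\<^esub>" f g "\<zero>\<^bsub>Fm f g\<^esub>"] by simp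
 then have "ch (sg ?u) = ch (sg ?u + sg ?u)" using inc_add[OF u u] by simp
 then have "ch (sg ?u - (sg ?u + sg ?u)) = \<zero>\<^bsub>C\<^esub>"
  using pres_eq_iff[OF PC sg_MV[OF u] MV_add[OF sg_MV[OF u] sg_MV[OF u]]] by blast
 then have "ch (0 - sg ?u) = \<zero>\<^bsub>C\<^esub>" by simp
 then show ?thesis using pres_eq_iff[OF PC presD(1)[OF PC] sg_MV[OF u]] by simp
qed

lemma rhom_lam: "rhom (lam f g)"
 unfolding lam_def by (rule rhom_ev[OF rhom_comp[OF rhom_const rhom_cc]])

lemma lam_simps: "lam f g (mc c) = cc (mc c)" "lam f g (vx i) = cc (mpv i)" "lam f g (vy i) = sg (dx' f g i)"
 unfolding lam_def by (simp_all add: ev_const[OF rhom_comp[OF rhom_const rhom_cc]] ev_var[OF rhom_comp[OF rhom_const rhom_cc]])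

lemma dx_W: "cs f g (ec a) \<in> W" by (rule cs_W[OF e_carrier])

lemma lam_MV: "lam f g b \<in> MV W"
proof (induction b rule: mpoly_induct)
 case (var i)
 show ?case by (cases i) (simp_all add: lam_simps MV_single dx_W)
qed (simp_all add: lam_simps MV_single rhom_add[OF rhom_lam] rhom_mult[OF rhom_lam] MV_add MV_mult)

lemma lam_emS: "lam f g (emS s) = cc s"
 by (rule mpoly_hom_unique[OF rhom_comp[OF rhom_emS rhom_lam] rhom_cc]) (simp_all add: lam_simps)

lemma mpoly_eval_chi:
 fixes w :: "'i::finite \<Rightarrow> _"
 assumes w: "\<And>i. w i \<in> MV W"
 shows "mpoly_eval C (sym_scalar f g) (\<lambda>i. ch (w i)) p = ch (ev (\<lambda>c. cc (mc c)) w p)"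
proof -
 have s: "sym_scalar f g c = ch (cc (mc c))" for c
  by (simp add: sym_scalar_def sym_const_def chi_def PhiM_const)
 have pw: "w i ^ n \<in> MV W" "ch (w i) [^]\<^bsub>C\<^esub> n = ch (w i ^ n)" for i and n :: nat
  using pres_pow[OF PC w] by blast+
 have pr: "(\<Prod>i\<in>UNIV. w i ^ pml m i) \<in> MV W"
  "(\<Otimes>\<^bsub>C\<^esub>i\<in>UNIV. ch (w i ^ pml m i)) = ch (\<Prod>i\<in>UNIV. w i ^ pml m i)" for m
  using pres_finprod[OF PC, of UNIV "\<lambda>i. w i ^ pml m i"] pw(1) by simp_all
 have t: "cc (mc (pml p m)) * (\<Prod>i\<in>UNIV. w i ^ pml m i) \<in> MV W" for m
  by (rule MV_mult[OF cc_MV pr(1)])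
 have "mpoly_eval C (sym_scalar f g) (\<lambda>i. ch (w i)) p =
  (\<Oplus>\<^bsub>C\<^esub>m\<in>pmk p. ch (cc (mc (pml p m)) * (\<Prod>i\<in>UNIV. w i ^ pml m i)))"
  unfolding mpoly_eval_def s pw(2) pr(2) presD(10)[OF PC cc_MV pr(1)] by (rule refl)
 also have "\<dots> = ch (\<Sum>m\<in>pmk p. cc (mc (pml p m)) * (\<Prod>i\<in>UNIV. w i ^ pml m i))"
  using pres_finsum[OF PC, of "pmk p" "\<lambda>m. cc (mc (pml p m)) * (\<Prod>i\<in>UNIV. w i ^ pml m i)"] t by simp
 finally show ?thesis by (simp add: ev_def evm_def)
qed

lemma sym_dx_chi: "sym_dx f g i = ch (sg (dx' f g i))" and sym_x_chi: "sym_x f g i = ch (cc (mpv i))"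
 by (simp_all add: sym_dx_def sym_x_def sym_incl_def sym_const_def chi_def PhiM_var PhiM_const cs_def kaehler_d_def Omega_def)

lemma B_to_Sym_chi: "B_to_Sym f g b = ch (lam f g b)"
proof -
 let ?w = "case_sum (\<lambda>i. cc (mpv i)) (\<lambda>i. sg (dx' f g i))"
 have A: "case_sum (sym_x f g) (sym_dx f g) = (\<lambda>i. ch (?w i))"
  by (rule ext) (simp add: sym_x_chi sym_dx_chi split: sum.split)
 have B: "?w i \<in> MV W" for i by (cases i) (simp_all add: MV_single dx_W)
 show ?thesis unfolding B_to_Sym_def lam_def A by (rule mpoly_eval_chi[OF B])
qed

lemma delta: "ch (sg (cs f g (ec s))) = ch (lam f g (DD s))"
proof (induction s rule: mpoly_induct)
 case (const c)
 interpret module "fg_ring f g" "Fm f g" by (rule module_F)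
 have z: "\<ominus>\<^bsub>Fm f g\<^esub> \<zero>\<^bsub>Fm f g\<^esub> = \<zero>\<^bsub>Fm f g\<^esub>"
  using M.r_neg[of "\<zero>\<^bsub>Fm f g\<^esub>"] M.l_zero[of "\<ominus>\<^bsub>Fm f g\<^esub> \<zero>\<^bsub>Fm f g\<^esub>"] by simp
 have "cs f g (ec (mc c)) = cs f g \<zero>\<^bsub>Fm f g\<^esub>"
  unfolding Omega_ops(4)[OF e_carrier M.zero_closed] a_minus_def z M.r_zero[OF e_carrier] by (rule rel_const)
 then show ?case by (simp add: inc_0 rhom_0[OF rhom_lam])
next
 case (var i)
 show ?case by (simp add: lam_simps)
next
 case (add p q)
 have "cs f g (ec (p + q)) = cs f g (ec p) \<oplus>\<^bsub>Omega f g\<^esub> cs f g (ec q)"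
  unfolding Omega_ops(2)[OF e_carrier e_carrier] Omega_ops(4)[OF e_carrier e_ops(1)] by (rule rel_add)
 then have "ch (sg (cs f g (ec (p + q)))) = ch (sg (cs f g (ec p))) \<oplus>\<^bsub>C\<^esub> ch (sg (cs f g (ec q)))"
  using inc_add[OF dx_W dx_W] presD(9)[OF PC sg_MV[OF dx_W] sg_MV[OF dx_W]] by simp
 then show ?case unfolding add DD_add rhom_add[OF rhom_lam] by (simp add: presD(9)[OF PC lam_MV lam_MV])
next
 case (mult p q)
 have c: "fg_class f g a \<in> carrier (fg_ring f g)" for a by (simp add: RS)
 have d: "fg_class f g a \<odot>\<^bsub>Omega f g\<^esub> cs f g (ec b) = cs f g (fg_class f g a \<odot>\<^bsub>Fm f g\<^esub> ec b)" for a b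
  by (rule Omega_ops(3)[OF c e_carrier])
 have "cs f g (ec (p * q)) = fg_class f g p \<odot>\<^bsub>Omega f g\<^esub> cs f g (ec q) \<oplus>\<^bsub>Omega f g\<^esub> fg_class f g q \<odot>\<^bsub>Omega f g\<^esub> cs f g (ec p)"
  unfolding d Omega_ops(2)[OF e_ops(2) e_ops(2)] Omega_ops(4)[OF e_carrier e_ops(3)] by (rule rel_mult)
 then have "ch (sg (cs f g (ec (p * q)))) =
   ch (sg (fg_class f g p \<odot>\<^bsub>Omega f g\<^esub> cs f g (ec q)) + sg (fg_class f g q \<odot>\<^bsub>Omega f g\<^esub> cs f g (ec p)))"
  using inc_add[OF V_closed(2)[OF c dx_W] V_closed(2)[OF c dx_W]] by simp
 also have "\<dots> = ch (sg (fg_class f g p \<odot>\<^bsub>Omega f g\<^esub> cs f g (ec q))) \<oplus>\<^bsub>C\<^esub> ch (sg (fg_class f g q \<odot>\<^bsub>Omega f g\<^esub> cs f g (ec p)))"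
  by (rule presD(9)[OF PC sg_MV[OF V_closed(2)[OF c dx_W]] sg_MV[OF V_closed(2)[OF c dx_W]], symmetric])
 also have "\<dots> = ch (cc p) \<otimes>\<^bsub>C\<^esub> ch (lam f g (DD q)) \<oplus>\<^bsub>C\<^esub> ch (cc q) \<otimes>\<^bsub>C\<^esub> ch (lam f g (DD p))"
  unfolding inc_smult[OF dx_W] presD(10)[OF PC cc_MV sg_MV[OF dx_W], symmetric] mult ..
 also have "\<dots> = ch (lam f g (DD (p * q)))"
  unfolding DD_mult rhom_add[OF rhom_lam] rhom_mult[OF rhom_lam] lam_emS
  by (simp only: presD(10)[OF PC cc_MV lam_MV] presD(9)[OF PC MV_mult[OF cc_MV lam_MV] MV_mult[OF cc_MV lam_MV]])
 finally show ?case .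
qed

lemma beta_zero_gen: assumes "x \<in> IB f g" shows "ch (lam f g x) = ch 0"
proof -
 have fg: "fg_class f g f = fg_class f g 0" "fg_class f g g = fg_class f g 0" by (simp_all add: fg_class_eq ispan_base)
 have c: "ch (cc f) = ch (cc 0)" "ch (cc g) = ch (cc 0)" by (rule chi_cc_cong[OF fg(1)], rule chi_cc_cong[OF fg(2)])
 have "ch (lam f g (DD s)) = ch 0" if "fg_class f g s = fg_class f g 0" for s
  using delta[of s] delta[of 0] by (simp add: that DD_0 rhom_0[OF rhom_lam])
 then show ?thesis using assms fg c by (auto simp: lam_emS)
qed

lemma beta_idl: "b \<in> idl (IB f g) ==> ch (lam f g b) = \<zero>\<^bsub>C\<^esub>"
proof (induction rule: ispan_induct_alt)
 case base
 then show ?case by (simp add: rhom_0[OF rhom_lam] presD(8)[OF PC])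
next
 case (step c x y)
 interpret cring C by (rule cring_C)
 have "ch (lam f g (c * x + y)) = ch (lam f g c) \<otimes>\<^bsub>C\<^esub> ch (lam f g x) \<oplus>\<^bsub>C\<^esub> ch (lam f g y)"
  unfolding rhom_add[OF rhom_lam] rhom_mult[OF rhom_lam]
  by (simp only: presD(10)[OF PC lam_MV lam_MV] presD(9)[OF PC MV_mult[OF lam_MV lam_MV] lam_MV])
 also have "ch (lam f g x) = \<zero>\<^bsub>C\<^esub>" using beta_zero_gen[of x] step(1) presD(8)[OF PC] by simp
 also have "ch (lam f g y) = \<zero>\<^bsub>C\<^esub>" by (rule step)
 also have "ch (lam f g c) \<otimes>\<^bsub>C\<^esub> \<zero>\<^bsub>C\<^esub> \<oplus>\<^bsub>C\<^esub> \<zero>\<^bsub>C\<^esub> = \<zero>\<^bsub>C\<^esub>"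
  using presD(11)[OF PC lam_MV, of c] by simp
 finally show ?case .
qed

lemma Psi_lam: "cg (IB f g) (Psi f g (lam f g b)) b"
proof (induction b rule: mpoly_induct)
 case (const c)
 show ?case by (simp add: lam_simps Psi_single rhom_simps cg_refl ev_const[OF rhom_const] emS_def)
next
 case (var i)
 show ?case
 proof (cases i)
  case (Inl j)
  then show ?thesis by (simp add: lam_simps Psi_single cg_refl ev_var[OF rhom_const] emS_def)
 next
  case (Inr j)
  have "cg (IB f g) (phi f g (dx' f g j)) (DD (mpv j))" by (rule cg_trans[OF phi_cs[OF e_carrier] phi'_e])
  then show ?thesis using Inr by (simp add: lam_simps Psi_single rhom_1[OF rhom_emS])
 qed
qed (simp_all add: rhom_add[OF rhom_lam] rhom_mult[OF rhom_lam] rhom_add[OF rhom_Psi] rhom_mult[OF rhom_Psi] cg_add cg_mult)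

text \<open>The generators of the ideal die by \<open>delta\<close>; conversely whatever dies is
  sent into the ideal by \<open>Psi\<close>, which inverts \<open>lam\<close> there.\<close>

lemma beta_eq_0: "B_to_Sym f g b = \<zero>\<^bsub>C\<^esub> \<longleftrightarrow> b \<in> idl (IB f g)"
 unfolding B_to_Sym_chi using beta_idl Psi_kernel[OF lam_MV[of b]] cg_mem[OF Psi_lam[of b]] by blast

text \<open>Induction on the support of v, splitting off one term t ds at a time and replacing ds by
  means of \<open>delta\<close>.\<close>

lemma inc_surj: assumes v: "v \<in> carrier (Fm f g)" shows "\<exists>b. ch (sg (cs f g v)) = ch (lam f g b)"
proof -
 interpret module "fg_ring f g" "Fm f g" by (rule module_F)
 interpret RC: cring "fg_ring f g" by (rule cring_R)
 have "\<exists>b. ch (sg (cs f g v)) = ch (lam f g b)"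
  if "finite A" "v \<in> carrier (Fm f g)" "{r. v r \<noteq> \<zero>\<^bsub>fg_ring f g\<^esub>} \<subseteq> A" for A v
  using that
 proof (induction A arbitrary: v rule: finite_induct)
  case empty
  then have "v = \<zero>\<^bsub>Fm f g\<^esub>" unfolding F_zero by auto
  then show ?case using inc_0 by (intro exI[of _ 0]) (simp add: rhom_0[OF rhom_lam])
 next
  case (insert a A)
  show ?case
  proof (cases "a \<in> carrier (fg_ring f g)")
   case False
   then have "v a = \<zero>\<^bsub>fg_ring f g\<^esub>" using insert.prems(1) F_carrierD(3) by blast
   then have "{r. v r \<noteq> \<zero>\<^bsub>fg_ring f g\<^esub>} \<subseteq> A" using insert.prems(2) by auto
   then show ?thesis using insert.IH[OF insert.prems(1)] by blast
  next
   case True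
   then obtain s where s: "a = fg_class f g s" by (auto simp: RS)
   have "v a \<in> carrier (fg_ring f g)" by (rule F_carrierD(1)[OF insert.prems(1)])
   then obtain t where t: "v a = fg_class f g t" by (auto simp: RS)
   define v' where "v' = v(a := \<zero>\<^bsub>fg_ring f g\<^esub>)"
   have v': "v' \<in> carrier (Fm f g)"
   proof -
    have "finite {r. v' r \<noteq> \<zero>\<^bsub>fg_ring f g\<^esub>}"
     by (rule finite_subset[OF _ F_carrierD(2)[OF insert.prems(1)]]) (auto simp: v'_def)
    then show ?thesis using insert.prems(1) by (auto simp: free_module_def v'_def)
   qed
   have tc: "fg_class f g t \<in> carrier (fg_ring f g)" by (simp add: RS(1))
   have "{r. v' r \<noteq> \<zero>\<^bsub>fg_ring f g\<^esub>} \<subseteq> A" using insert.prems(2) by (auto simp: v'_def)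
   then obtain b where b: "ch (sg (cs f g v')) = ch (lam f g b)" using insert.IH[OF v'] by blast
   have "v = v' \<oplus>\<^bsub>Fm f g\<^esub> fg_class f g t \<odot>\<^bsub>Fm f g\<^esub> ec s"
   proof
    fix r
    have vr: "v r \<in> carrier (fg_ring f g)" by (rule F_carrierD(1)[OF insert.prems(1)])
    show "v r = (v' \<oplus>\<^bsub>Fm f g\<^esub> fg_class f g t \<odot>\<^bsub>Fm f g\<^esub> ec s) r"
    proof (cases "r = a")
     case True
     then show ?thesis unfolding F_add F_smult by (simp add: v'_def free_basis_def s[symmetric] t tc)
    next
     case False
     then show ?thesis unfolding F_add F_smult using vr by (simp add: v'_def free_basis_def s[symmetric] tc)
    qed
   qed
   then have "cs f g v = cs f g v' \<oplus>\<^bsub>Omega f g\<^esub> fg_class f g t \<odot>\<^bsub>Omega f g\<^esub> cs f g (ec s)"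
    by (simp only: Omega_ops(3)[OF tc e_carrier] Omega_ops(2)[OF v' e_ops(2)])
   then have "ch (sg (cs f g v)) = ch (sg (cs f g v') + sg (fg_class f g t \<odot>\<^bsub>Omega f g\<^esub> cs f g (ec s)))"
    using inc_add[OF cs_W[OF v'] V_closed(2)[OF tc dx_W]] by simp
   also have "\<dots> = ch (sg (cs f g v')) \<oplus>\<^bsub>C\<^esub> ch (sg (fg_class f g t \<odot>\<^bsub>Omega f g\<^esub> cs f g (ec s)))"
    by (rule presD(9)[OF PC sg_MV[OF cs_W[OF v']] sg_MV[OF V_closed(2)[OF tc dx_W]], symmetric])
   also have "\<dots> = ch (lam f g b) \<oplus>\<^bsub>C\<^esub> ch (cc t) \<otimes>\<^bsub>C\<^esub> ch (lam f g (DD s))"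
    unfolding b inc_smult[OF dx_W] presD(10)[OF PC cc_MV sg_MV[OF dx_W], symmetric] delta ..
   also have "\<dots> = ch (lam f g (b + emS t * DD s))"
    unfolding rhom_add[OF rhom_lam] rhom_mult[OF rhom_lam] lam_emS
    by (simp only: presD(10)[OF PC cc_MV lam_MV] presD(9)[OF PC lam_MV MV_mult[OF cc_MV lam_MV]])
   finally show ?thesis by blast
  qed
 qed
 from this[OF F_carrierD(2)[OF v] v order_refl] show ?thesis .
qed

lemma beta_surj: assumes "p \<in> MV W" shows "\<exists>b. ch p = ch (lam f g b)"
proof -
 have "p \<in> MV W \<and> (\<exists>b. ch p = ch (lam f g b))"
  using assms
 proof (induction p rule: MV_induct)
  case (single m c)
  then show ?case
  proof (induction m)
   case empty
   show ?case using lam_emS[of c] cc_MV by metis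
  next
   case (add u m)
   then obtain b where m: "pms m c \<in> MV W" and b: "ch (pms m c) = ch (lam f g b)" by auto
   have u: "u \<in> W" using add.prems by simp
   then obtain v where "v \<in> carrier (Fm f g)" "u = cs f g v" using Omega_ops(1) by blast
   then obtain b' where b': "ch (sg u) = ch (lam f g b')" using inc_surj by blast
   have e: "pms (add_mset u m) c = sg u * pms m c" by (simp add: mult_single)
   have "ch (sg u * pms m c) = ch (lam f g b') \<otimes>\<^bsub>C\<^esub> ch (lam f g b)"
    unfolding b[symmetric] b'[symmetric] by (rule presD(10)[OF PC sg_MV[OF u] m, symmetric])
   also have "\<dots> = ch (lam f g (b' * b))" unfolding rhom_mult[OF rhom_lam] by (rule presD(10)[OF PC lam_MV lam_MV])
   finally show ?case unfolding e using MV_mult[OF sg_MV[OF u] m] by blast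
  qed
 next
  case (add p q)
  then obtain b b' where b: "p \<in> MV W" "q \<in> MV W" "ch p = ch (lam f g b)" "ch q = ch (lam f g b')" by blast
  have "ch (p + q) = ch (lam f g b) \<oplus>\<^bsub>C\<^esub> ch (lam f g b')"
   unfolding b(3,4)[symmetric] by (rule presD(9)[OF PC b(1,2), symmetric])
  also have "\<dots> = ch (lam f g (b + b'))" unfolding rhom_add[OF rhom_lam] by (rule presD(9)[OF PC lam_MV lam_MV])
  finally show ?case using MV_add[OF b(1,2)] by blast
 qed
 then show ?thesis by blast
qed

theorem pres_B: "pres UNIV (B_to_Sym f g) C"
 unfolding pres_def B_to_Sym_chi
proof (intro conjI ballI)
 show "carrier C = (\<lambda>b. ch (lam f g b)) ` UNIV"
  using beta_surj lam_MV unfolding presD(6)[OF PC] by blast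
 show "\<one>\<^bsub>C\<^esub> = ch (lam f g 1)" "\<zero>\<^bsub>C\<^esub> = ch (lam f g 0)"
  by (simp_all add: rhom_1[OF rhom_lam] rhom_0[OF rhom_lam] presD(7,8)[OF PC])
 fix x y :: "'k poly44"
 show "ch (lam f g x) \<oplus>\<^bsub>C\<^esub> ch (lam f g y) = ch (lam f g (x + y))"
  unfolding rhom_add[OF rhom_lam] by (rule presD(9)[OF PC lam_MV lam_MV])
 show "ch (lam f g x) \<otimes>\<^bsub>C\<^esub> ch (lam f g y) = ch (lam f g (x * y))"
  unfolding rhom_mult[OF rhom_lam] by (rule presD(10)[OF PC lam_MV lam_MV])
qed simp_all

lemma T_smult: "t \<odot>\<^bsub>SymOmega_T f g\<^esub> s = B_to_Sym f g (emT t) \<otimes>\<^bsub>C\<^esub> s"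
proof -
 have r: "rhom (\<lambda>c. cc (mc c) :: 'k omega_elem multiset \<Rightarrow>\<^sub>0 'k poly4)" by (rule rhom_comp[OF rhom_const rhom_cc])
 have "lam f g (emT t) = ev (\<lambda>c. cc (mc c)) (\<lambda>i. sg (dx' f g i)) t"
  by (rule mpoly_hom_unique[OF rhom_comp[OF rhom_emT rhom_lam] rhom_ev[OF r]]) (simp_all add: lam_simps ev_const[OF r] ev_var[OF r])
 moreover have "mpoly_eval C (sym_scalar f g) (sym_dx f g) t = ch (ev (\<lambda>c. cc (mc c)) (\<lambda>i. sg (dx' f g i)) t)"
  unfolding sym_dx_chi[abs_def] by (rule mpoly_eval_chi[OF sg_MV[OF dx_W]])
 ultimately show ?thesis by (simp add: SymOmega_T_def B_to_Sym_chi)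
qed

lemma torsion_const: "sym_const (fg_ring f g) (Omega f g) (fg_class f g r) = B_to_Sym f g (emS r)"
 by (simp add: B_to_Sym_chi lam_emS sym_const_def chi_def PhiM_const)

end

section \<open>The torsion ideal, its rows and their generators\<close>

section \<open>The torsion of the symmetric algebra\<close>

lemma pres_ideal_image:
 assumes p: "pres U h A" and Q: "Q \<subseteq> U" "\<And>x y. x \<in> Q ==> y \<in> Q ==> x + y \<in> Q" "\<And>c x. c \<in> U ==> x \<in> Q ==> c * x \<in> Q"
  and k: "\<And>x. x \<in> U ==> h x = \<zero>\<^bsub>A\<^esub> ==> x \<in> Q"
 shows "ideal (h ` Q) A"
proof -
 interpret cring A by (rule pres_cring[OF p])
 have sub: "h ` Q \<subseteq> carrier A" using Q(1) presD(6)[OF p] by blast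
 have "genideal A (h ` Q) \<subseteq> h ` Q"
 proof
  interpret I: ideal "genideal A (h ` Q)" A by (rule genideal_ideal[OF sub])
  fix y assume y: "y \<in> genideal A (h ` Q)"
  then have "y \<in> carrier A" by (rule I.a_Hcarr)
  then obtain x where x: "x \<in> U" "y = h x" using presD(6)[OF p] by blast
  have "x \<in> Q" by (rule pres_genideal[OF p Q k order_refl x(1)]) (use x y in auto)
  then show "y \<in> h ` Q" using x by blast
 qed
 then have "genideal A (h ` Q) = h ` Q" using genideal_self[OF sub] by blast
 then show ?thesis using genideal_ideal[OF sub] by simp
qed

lemma tors_add: "tors (idl G) a ==> tors (idl G) b ==> tors (idl G) (a + b)"
 unfolding tors_def
proof
 fix i assume "\<forall>i. \<exists>N. vx i ^ N * a \<in> idl G" "\<forall>i. \<exists>N. vx i ^ N * b \<in> idl G"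
 then obtain N M where nm: "vx i ^ N * a \<in> idl G" "vx i ^ M * b \<in> idl G" by blast
 have "vx i ^ M * (vx i ^ N * a) + vx i ^ N * (vx i ^ M * b) \<in> idl G"
  by (rule ispan_add[OF ispan_scale[OF nm(1)] ispan_scale[OF nm(2)]])
 then have "vx i ^ (N + M) * (a + b) \<in> idl G" by (simp add: power_add algebra_simps)
 then show "\<exists>N. vx i ^ N * (a + b) \<in> idl G" ..
qed

lemma tors_idl: "b \<in> idl G ==> tors (idl G) b"
 unfolding tors_def by (intro allI exI[of _ 0]) simp

lemma tors_cong: "b - b' \<in> idl G ==> tors (idl G) b' ==> tors (idl G) b"
 using tors_add[OF tors_idl, of "b - b'" G b'] by simp

lemma tors_sum: "(\<And>i. i \<in> A ==> tors (idl G) (h i)) ==> tors (idl G) (sum h A)"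
 by (induction A rule: infinite_finite_induct) (auto intro: tors_add tors_idl ispan_zero)

lemma hdeg_vx: "hdeg dx N (vx i ^ N :: 'a::comm_ring_1 poly44)" "hdeg dy 0 (vx i ^ N :: 'a poly44)"
proof -
 have 1: "mc 1 = (1 :: 'a poly44)" by (rule rhom_1[OF rhom_const])
 show "hdeg dx N (vx i ^ N :: 'a poly44)"
 proof (induction N)
  case 0
  show ?case using hom_dx(3)[of "1 :: 'a"] by (simp add: 1)
 next
  case (Suc N)
  show ?case using hdeg_mult[OF graded_dx hom_dx(1)[of i] Suc] by simp
 qed
 show "hdeg dy 0 (vx i ^ N :: 'a poly44)"
 proof (induction N)
  case 0
  show ?case using hom_dy(3)[of "1 :: 'a"] by (simp add: 1)
 next
  case (Suc N)
  show ?case using hdeg_mult[OF graded_dy hom_dy(1)[of i] Suc] by simp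
 qed
qed

lemma hom_dx_DD: fixes p :: "'a::field_char_0 poly4" assumes "hdeg dt 2 p" shows "hdeg dx 1 (DD p)"
proof -
 obtain M where p: "p = qf M" using quadratic_form[OF assms] by blast
 show ?thesis unfolding p qf_def DD_sum
  by (intro hdeg_sum) (simp add: DD_mult rhom_mult[OF rhom_emS] hdeg_simps)
qed

context
 fixes f g :: "'k::field_char_0 poly4"
 assumes n: "nrm f g"
begin

abbreviation (input) "\<beta> \<equiv> B_to_Sym f g"
abbreviation (input) "SO \<equiv> SymOmega f g"
abbreviation (input) "II' \<equiv> idl (IB f g)"

lemmas PB = pres_B[of f g]

lemma IB_bihom: assumes "h \<in> IB f g" shows "\<exists>d. hdeg dx d h" "\<exists>d. hdeg dy d h"
 using assms hom_emS_DD[OF nrm_hom(1)[OF n]] hom_emS_DD[OF nrm_hom(2)[OF n]]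
  hom_dx_DD[OF nrm_hom(1)[OF n]] hom_dx_DD[OF nrm_hom(2)[OF n]] by auto

lemma beta_eq: "\<beta> a = \<beta> b \<longleftrightarrow> a - b \<in> II'"
 using pres_eq_iff[OF PB, of a b] beta_eq_0[of f g "a - b"] by simp

lemma beta_sum: "finite A ==> (\<Oplus>\<^bsub>SO\<^esub>i\<in>A. \<beta> (h i)) = \<beta> (sum h A)"
 using pres_finsum[OF PB, of A h] by simp

lemma sym_torsion_eq: "sym_torsion (fg_ring f g) (Omega f g) = \<beta> ` {b. tors II' b}"
proof -
 have "(\<exists>r\<in>nonzerodivisors (fg_ring f g). sym_const (fg_ring f g) (Omega f g) r \<otimes>\<^bsub>SO\<^esub> \<beta> b = \<zero>\<^bsub>SO\<^esub>) \<longleftrightarrow> tors II' b" for b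
  unfolding torsion_iff[OF n, symmetric] nonzerodivisors_R
  by (simp add: torsion_const presD(10)[OF PB] beta_eq_0)
 then show ?thesis unfolding sym_torsion_def SymOmega_def[symmetric] presD(6)[OF PB] by auto
qed

lemma ideal_torsion: "ideal (\<beta> ` {b. tors II' b}) SO"
 by (rule pres_ideal_image[OF PB]) (auto intro: tors_add tors_mult tors_idl simp: beta_eq_0)

lemma torsion_iff_tors: "\<beta> b \<in> \<beta> ` {b. tors II' b} \<longleftrightarrow> tors II' b"
 using tors_cong[of b _ "IB f g"] by (auto simp: beta_eq)

lemma calA_eq: "calA f g = \<beta> ` {b. tors II' b}"
proof -
 have z: "\<beta> ` {b. tors II' b} +>\<^bsub>SO\<^esub> \<beta> b = \<zero>\<^bsub>SO Quot (\<beta> ` {b. tors II' b})\<^esub> \<longleftrightarrow> tors II' b" for b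
  using pres_quotient(2)[OF PB ideal_torsion, of b] torsion_iff_tors by simp
 have "calA f g = {s \<in> carrier SO. \<beta> ` {b. tors II' b} +>\<^bsub>SO\<^esub> s = \<zero>\<^bsub>SO Quot (\<beta> ` {b. tors II' b})\<^esub>}"
  unfolding calA_def rees_kernel_def rees_algebra_def sym_torsion_eq SymOmega_def[symmetric]
  by (simp add: a_kernel_def kernel_def)
 then show ?thesis unfolding presD(6)[OF PB] using z by auto
qed

lemma bihomogeneous_iff: "bihomogeneous i j b \<longleftrightarrow> hdeg dx i b \<and> hdeg dy j b"
 by (auto simp: bihomogeneous_def hdeg_def dx_def dy_def)

lemma calA_bideg_eq: "calA_bideg f g i j = \<beta> ` {b. tors II' b \<and> hdeg dx i b \<and> hdeg dy j b}"
 unfolding calA_bideg_def SymOmega_bideg_def calA_eq bihomogeneous_iff using torsion_iff_tors by blast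

lemma tors_hcomp_y: assumes "tors II' b" shows "tors II' (hcomp dy j b)"
 unfolding tors_def
proof
 fix i
 obtain N where "vx i ^ N * b \<in> II'" using assms unfolding tors_def by blast
 then have "hcomp dy j (vx i ^ N * b) \<in> II'" using hcomp_idl[OF graded_dy IB_bihom(2)] by blast
 then show "\<exists>N. vx i ^ N * hcomp dy j b \<in> II'" by (intro exI[of _ N]) (simp add: hcomp_mult[OF graded_dy hdeg_vx(2)])
qed

lemma tors_hcomp_x: assumes "tors II' b" shows "tors II' (hcomp dx j b)"
 unfolding tors_def
proof
 fix i
 obtain N where "vx i ^ N * b \<in> II'" using assms unfolding tors_def by blast
 then have "hcomp dx (N + j) (vx i ^ N * b) \<in> II'" using hcomp_idl[OF graded_dx IB_bihom(1)] by blast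
 then show "\<exists>N. vx i ^ N * hcomp dx j b \<in> II'" by (intro exI[of _ N]) (simp add: hcomp_mult[OF graded_dx hdeg_vx(1)])
qed

text \<open>The ideal is bihomogeneous, so the y-components of a torsion element are torsion, and a
  row consists of the classes of x-homogeneous torsion elements.\<close>

lemma calA_row_eq: "calA_row f g i = \<beta> ` {b. tors II' b \<and> hdeg dx i b}"
proof
 show "calA_row f g i \<subseteq> \<beta> ` {b. tors II' b \<and> hdeg dx i b}"
 proof
  fix s assume "s \<in> calA_row f g i"
  then obtain a m where a: "\<And>j. a j \<in> calA_bideg f g i j" and s: "s = (\<Oplus>\<^bsub>SO\<^esub>j\<in>{..m::nat}. a j)" unfolding calA_row_def by blast
  have "\<forall>j. \<exists>b. a j = \<beta> b \<and> tors II' b \<and> hdeg dx i b" using a unfolding calA_bideg_eq by blast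
  then obtain b where b: "\<And>j. a j = \<beta> (b j)" "\<And>j. tors II' (b j)" "\<And>j. hdeg dx i (b j)" by metis
  have "s = \<beta> (\<Sum>j\<le>m. b j)" unfolding s b(1) by (rule beta_sum) simp
  moreover have "tors II' (\<Sum>j\<le>m. b j)" "hdeg dx i (\<Sum>j\<le>m. b j)" using b by (auto intro: tors_sum hdeg_sum)
  ultimately show "s \<in> \<beta> ` {b. tors II' b \<and> hdeg dx i b}" by blast
 qed
 show "\<beta> ` {b. tors II' b \<and> hdeg dx i b} \<subseteq> calA_row f g i"
 proof
  fix s assume "s \<in> \<beta> ` {b. tors II' b \<and> hdeg dx i b}"
  then obtain b where b: "s = \<beta> b" "tors II' b" "hdeg dx i b" by blast
  let ?m = "pdeg (gpoly dy b)"
  have "s = (\<Oplus>\<^bsub>SO\<^esub>j\<in>{..?m}. \<beta> (hcomp dy j b))" unfolding b(1) beta_sum[OF finite_atMost] sum_hcomp ..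
  moreover have "\<beta> (hcomp dy j b) \<in> calA_bideg f g i j" for j
   unfolding calA_bideg_eq using tors_hcomp_y[OF b(2), of j] hdeg_keep[OF b(3), of dy j] hdeg_hcomp[of dy j b] by blast
  ultimately show "s \<in> calA_row f g i" unfolding calA_row_def by blast
 qed
qed

text \<open>T-submodules are handled through preimages in B; closure under negation comes from the
  scalar -1.\<close>

lemma submodule_T_iff:
 "submodule N poly4_ring (SymOmega_T f g) \<longleftrightarrow> (\<exists>Q. N = \<beta> ` Q \<and> II' \<subseteq> Q \<and> (\<forall>x\<in>Q. \<forall>y\<in>Q. x + y \<in> Q) \<and> (\<forall>t. \<forall>x\<in>Q. emT t * x \<in> Q))"
proof
 interpret cring SO by (rule pres_cring[OF PB])
 have am: "carrier (add_monoid (SymOmega_T f g)) = carrier SO" "\<one>\<^bsub>add_monoid (SymOmega_T f g)\<^esub> = \<zero>\<^bsub>SO\<^esub>"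
  "\<And>x y. x \<otimes>\<^bsub>add_monoid (SymOmega_T f g)\<^esub> y = x \<oplus>\<^bsub>SO\<^esub> y"
  "\<And>x. inv\<^bsub>add_monoid (SymOmega_T f g)\<^esub> x = inv\<^bsub>add_monoid SO\<^esub> x"
  by (simp_all add: SymOmega_T_def m_inv_def)
 {
  assume "submodule N poly4_ring (SymOmega_T f g)"
  then interpret N: submodule N poly4_ring "SymOmega_T f g" .
  have sub: "N \<subseteq> carrier SO" using N.subset by (simp add: SymOmega_T_def)
  have z: "\<zero>\<^bsub>SO\<^esub> \<in> N" using N.one_closed by (simp add: SymOmega_T_def)
  have ad: "x \<oplus>\<^bsub>SO\<^esub> y \<in> N" if "x \<in> N" "y \<in> N" for x y using N.m_closed[OF that] by (simp add: SymOmega_T_def)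
  have sm: "\<beta> (emT t) \<otimes>\<^bsub>SO\<^esub> x \<in> N" if "x \<in> N" for t x
   using N.smult_closed[of t x] that by (simp add: T_smult ring_of_type_algebra_def)
  show "\<exists>Q. N = \<beta> ` Q \<and> II' \<subseteq> Q \<and> (\<forall>x\<in>Q. \<forall>y\<in>Q. x + y \<in> Q) \<and> (\<forall>t. \<forall>x\<in>Q. emT t * x \<in> Q)"
  proof (intro exI[of _ "{b. \<beta> b \<in> N}"] conjI ballI allI)
   show "N = \<beta> ` {b. \<beta> b \<in> N}" using sub presD(6)[OF PB] by auto
   show "II' \<subseteq> {b. \<beta> b \<in> N}"
   proof
    fix b assume "b \<in> II'"
    then have "\<beta> b = \<zero>\<^bsub>SO\<^esub>" by (simp add: beta_eq_0)
    then show "b \<in> {b. \<beta> b \<in> N}" using z by simp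
   qed
   show "x + y \<in> {b. \<beta> b \<in> N}" if "x \<in> {b. \<beta> b \<in> N}" "y \<in> {b. \<beta> b \<in> N}" for x y
    using ad[of "\<beta> x" "\<beta> y"] that by (simp add: presD(9)[OF PB])
   show "emT t * x \<in> {b. \<beta> b \<in> N}" if "x \<in> {b. \<beta> b \<in> N}" for t x
    using sm[of "\<beta> x" t] that by (simp add: presD(10)[OF PB])
  qed
 }
 assume "\<exists>Q. N = \<beta> ` Q \<and> II' \<subseteq> Q \<and> (\<forall>x\<in>Q. \<forall>y\<in>Q. x + y \<in> Q) \<and> (\<forall>t. \<forall>x\<in>Q. emT t * x \<in> Q)"
 then obtain Q where Q: "N = \<beta> ` Q" "II' \<subseteq> Q" "\<And>x y. x \<in> Q ==> y \<in> Q ==> x + y \<in> Q" "\<And>t x. x \<in> Q ==> emT t * x \<in> Q" by blast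
 have neg: "- x \<in> Q" if "x \<in> Q" for x
  using Q(4)[OF that, of "- 1"] by (simp add: rhom_simps[OF rhom_emT])
 show "submodule N poly4_ring (SymOmega_T f g)"
 proof (intro submodule.intro subgroup.intro submodule_axioms.intro)
  show "N \<subseteq> carrier (add_monoid (SymOmega_T f g))" unfolding am Q(1) using presD(6)[OF PB] by auto
  show "x \<otimes>\<^bsub>add_monoid (SymOmega_T f g)\<^esub> y \<in> N" if xy: "x \<in> N" "y \<in> N" for x y
  proof -
   from xy obtain a b where "x = \<beta> a" "y = \<beta> b" "a \<in> Q" "b \<in> Q" unfolding Q(1) by blast
   then show ?thesis unfolding am Q(1) using Q(3) by (auto simp: presD(9)[OF PB])
  qed
  show "\<one>\<^bsub>add_monoid (SymOmega_T f g)\<^esub> \<in> N"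
   unfolding am Q(1) using Q(2) presD(8)[OF PB] ispan_zero[of "IB f g"] by auto
  show "inv\<^bsub>add_monoid (SymOmega_T f g)\<^esub> x \<in> N" if x: "x \<in> N" for x
  proof -
   from x obtain a where a: "x = \<beta> a" "a \<in> Q" unfolding Q(1) by blast
   have "inv\<^bsub>add_monoid SO\<^esub> x = \<beta> (- a)" using pres_uminus[OF PB, of a] by (simp add: a(1) a_inv_def)
   then show ?thesis unfolding am Q(1) using neg[OF a(2)] by blast
  qed
  show "t \<odot>\<^bsub>SymOmega_T f g\<^esub> x \<in> N" if x: "x \<in> N" for t x
  proof -
   from x obtain a where a: "x = \<beta> a" "a \<in> Q" unfolding Q(1) by blast
   then show ?thesis unfolding T_smult Q(1) using Q(4)[OF a(2), of t] by (auto simp: presD(10)[OF PB])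
  qed
 qed
qed

lemma submodule_gen_T:
 fixes a :: "'n::finite \<Rightarrow> 'k poly44"
 assumes L: "L \<subseteq> UNIV"
 shows "submodule_gen poly4_ring (SymOmega_T f g) ((\<lambda>l. \<beta> (a l)) ` L) = \<beta> ` {\<Sum>l\<in>L. emT (t l) * a l | t. True}"
proof
 let ?Q = "{b. \<exists>t. b - (\<Sum>l\<in>L. emT (t l) * a l) \<in> II'}"
 have img: "\<beta> ` ?Q = \<beta> ` {\<Sum>l\<in>L. emT (t l) * a l | t. True}" (is "_ = ?N")
 proof
  show "\<beta> ` ?Q \<subseteq> ?N" using beta_eq by blast
  show "?N \<subseteq> \<beta> ` ?Q"
  proof
   fix s assume "s \<in> ?N"
   then obtain t where t: "s = \<beta> (\<Sum>l\<in>L. emT (t l) * a l)" by blast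
   have "(\<Sum>l\<in>L. emT (t l) * a l) \<in> ?Q" by (intro CollectI exI[of _ t]) (simp add: ispan_zero)
   then show "s \<in> \<beta> ` ?Q" unfolding t by (rule imageI)
  qed
 qed
 have "submodule ?N poly4_ring (SymOmega_T f g)"
  unfolding img[symmetric] submodule_T_iff
 proof (intro exI[of _ ?Q] conjI ballI allI refl)
  show "II' \<subseteq> ?Q"
  proof
   fix b assume "b \<in> II'"
   then show "b \<in> ?Q" by (intro CollectI exI[of _ "\<lambda>_. 0"]) (simp add: rhom_0[OF rhom_emT])
  qed
  show "x + y \<in> ?Q" if xy: "x \<in> ?Q" "y \<in> ?Q" for x y
  proof -
   from xy obtain t u where "x - (\<Sum>l\<in>L. emT (t l) * a l) \<in> II'" "y - (\<Sum>l\<in>L. emT (u l) * a l) \<in> II'" by blast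
   from ispan_add[OF this] show ?thesis
    by (intro CollectI exI[of _ "\<lambda>l. t l + u l"]) (simp add: rhom_add[OF rhom_emT] distrib_right sum.distrib algebra_simps)
  qed
  show "emT c * x \<in> ?Q" if x: "x \<in> ?Q" for c x
  proof -
   from x obtain t where "x - (\<Sum>l\<in>L. emT (t l) * a l) \<in> II'" by blast
   from ispan_scale[OF this, of "emT c"] show ?thesis
    by (intro CollectI exI[of _ "\<lambda>l. c * t l"]) (simp add: rhom_mult[OF rhom_emT] right_diff_distrib sum_distrib_left mult.assoc)
  qed
 qed
 moreover have "(\<lambda>l. \<beta> (a l)) ` L \<subseteq> ?N"
 proof
  fix s assume "s \<in> (\<lambda>l. \<beta> (a l)) ` L"
  then obtain l where l: "l \<in> L" "s = \<beta> (a l)" by blast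
  have "(\<Sum>k\<in>L. emT (if k = l then 1 else 0) * a k) = (\<Sum>k\<in>L. if k = l then a k else 0)"
   by (intro sum.cong) (auto simp: rhom_0[OF rhom_emT] rhom_1[OF rhom_emT])
  also have "\<dots> = a l" using l(1) by (simp add: sum.delta)
  finally have "a l = (\<Sum>k\<in>L. emT (if k = l then 1 else 0) * a k) \<and> True" by simp
  then have "a l \<in> {\<Sum>l\<in>L. emT (t l) * a l | t. True}"
   by (intro CollectI exI[of _ "\<lambda>k. if k = l then 1 else 0"])
  then show "s \<in> ?N" unfolding l(2) by (rule imageI)
 qed
 ultimately show "submodule_gen poly4_ring (SymOmega_T f g) ((\<lambda>l. \<beta> (a l)) ` L) \<subseteq> ?N"
  unfolding submodule_gen_def by blast
 show "?N \<subseteq> submodule_gen poly4_ring (SymOmega_T f g) ((\<lambda>l. \<beta> (a l)) ` L)"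
  unfolding submodule_gen_def
 proof (intro Inter_greatest, elim CollectE conjE)
  fix N assume N: "submodule N poly4_ring (SymOmega_T f g)" "(\<lambda>l. \<beta> (a l)) ` L \<subseteq> N"
  obtain Q where Q: "N = \<beta> ` Q" "II' \<subseteq> Q" "\<And>x y. x \<in> Q ==> y \<in> Q ==> x + y \<in> Q" "\<And>t x. x \<in> Q ==> emT t * x \<in> Q"
   using N(1) unfolding submodule_T_iff by blast
  have aQ: "a l \<in> Q" if l: "l \<in> L" for l
  proof -
   obtain q where q: "\<beta> (a l) = \<beta> q" "q \<in> Q" using N(2) l unfolding Q(1) by blast
   then have "a l - q \<in> Q" using Q(2) beta_eq by blast
   from Q(3)[OF this q(2)] show ?thesis by simp
  qed
  have "(\<Sum>l\<in>L'. emT (t l) * a l) \<in> Q" if "L' \<subseteq> L" for t L'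
   using that
  proof (induction L' rule: infinite_finite_induct)
   case (insert l L')
   then show ?case using Q(3)[OF Q(4)[OF aQ]] by simp
  qed (use Q(2) ispan_zero[of "IB f g"] in auto)
  then show "?N \<subseteq> N" unfolding Q(1) by blast
 qed
qed

text \<open>A proper subset of the generators omits some a l0. If it still generated the row, a l0
  would be a T-combination of the others, and its part of y-degree j a linear relation over k, which
  \<open>row_gens\<close> excludes.\<close>

lemma row_generated:
 fixes a :: "'n::finite \<Rightarrow> 'k poly44"
 assumes a: "row_gens II' i j a"
 shows "range (\<lambda>l. \<beta> (a l)) \<subseteq> calA_bideg f g i j" "card (range (\<lambda>l. \<beta> (a l))) = CARD('n)"
  "T_minimally_generates f g (range (\<lambda>l. \<beta> (a l))) (calA_row f g i)"
proof -
 have ha: "\<And>l. hdeg dx i (a l)" "\<And>l. hdeg dy j (a l)" "\<And>l. tors II' (a l)"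
  and span: "\<And>b. tors II' b ==> hdeg dx i b ==> \<exists>t. b - (\<Sum>l\<in>UNIV. emT (t l) * a l) \<in> II'"
  and ind: "\<And>c. (\<Sum>l\<in>UNIV. mc (c l) * a l) \<in> II' ==> (\<forall>l. c l = 0)"
  using a unfolding row_gens_def by blast+
 show "range (\<lambda>l. \<beta> (a l)) \<subseteq> calA_bideg f g i j" unfolding calA_bideg_eq using ha by blast
 have indep: "\<beta> (a l0) \<noteq> \<beta> (\<Sum>l\<in>L. emT (t l) * a l)" if l0: "l0 \<notin> L" for l0 L t
 proof
  assume "\<beta> (a l0) = \<beta> (\<Sum>l\<in>L. emT (t l) * a l)"
  then have "a l0 - (\<Sum>l\<in>L. emT (t l) * a l) \<in> II'" by (simp add: beta_eq)
  then have "hcomp dy j (a l0 - (\<Sum>l\<in>L. emT (t l) * a l)) \<in> II'" using hcomp_idl[OF graded_dy IB_bihom(2)] by blast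
  moreover have "hcomp dy j (emT (t l) * a l) = hcomp dy 0 (emT (t l)) * a l" for l
   using hcomp_mult[OF graded_dy ha(2), where n = j and p = "emT (t l)"] by (simp add: mult.commute)
  moreover have "\<exists>c. hcomp dy 0 (emT (t l)) = mc c" for l
   by (intro bidegree0_const hdeg_keep hom_dx_emT hdeg_hcomp)
  then have "\<exists>c. \<forall>l. hcomp dy 0 (emT (t l)) = mc (c l)" by (intro choice) blast
  then obtain c where "hcomp dy 0 (emT (t l)) = mc (c l)" for l by blast
  ultimately have e: "a l0 - (\<Sum>l\<in>L. mc (c l) * a l) \<in> II'"
   by (simp add: hcomp_diff[OF graded_dy] hcomp_sum[OF graded_dy] hcomp_hom[OF ha(2)])
  define c' where "c' l = (if l = l0 then 1 else 0) - (if l \<in> L then c l else 0)" for l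
  have "(\<Sum>l\<in>UNIV. mc (c' l) * a l) =
    (\<Sum>l\<in>UNIV. if l = l0 then a l else 0) - (\<Sum>l\<in>UNIV. if l \<in> L then mc (c l) * a l else 0)"
   unfolding sum_subtractf[symmetric] c'_def
   by (intro sum.cong) (auto simp: rhom_simps[OF rhom_const] left_diff_distrib)
  also have "\<dots> = a l0 - (\<Sum>l\<in>L. mc (c l) * a l)" by (simp add: sum.inter_restrict[symmetric])
  finally have "(\<Sum>l\<in>UNIV. mc (c' l) * a l) \<in> II'" using e by simp
  from ind[OF this] have "c' l0 = 0" by blast
  then show False using l0 by (simp add: c'_def)
 qed
 have inj: "inj (\<lambda>l. \<beta> (a l))"
 proof (rule injI)
  fix l l' assume e: "\<beta> (a l) = \<beta> (a l')"
  show "l = l'"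
  proof (rule ccontr)
   assume "l \<noteq> l'"
   then show False using indep[of l "{l'}" "\<lambda>_. 1"] e by (simp add: rhom_1[OF rhom_emT])
  qed
 qed
 then show "card (range (\<lambda>l. \<beta> (a l))) = CARD('n)" by (rule card_image)
 have gen: "submodule_gen poly4_ring (SymOmega_T f g) (range (\<lambda>l. \<beta> (a l))) = calA_row f g i"
  unfolding submodule_gen_T[OF subset_UNIV] calA_row_eq
 proof
  show "\<beta> ` {\<Sum>l\<in>UNIV. emT (t l) * a l | t. True} \<subseteq> \<beta> ` {b. tors II' b \<and> hdeg dx i b}"
  proof
   fix s assume "s \<in> \<beta> ` {\<Sum>l\<in>UNIV. emT (t l) * a l | t. True}"
   then obtain t where t: "s = \<beta> (\<Sum>l\<in>UNIV. emT (t l) * a l)" by blast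
   have "hdeg dx i (emT (t l) * a l)" for l using hdeg_mult[OF graded_dx hom_dx_emT ha(1)] by (simp only: add_0)
   then have "hdeg dx i (\<Sum>l\<in>UNIV. emT (t l) * a l)" by (intro hdeg_sum)
   moreover have "tors II' (\<Sum>l\<in>UNIV. emT (t l) * a l)" by (intro tors_sum tors_mult ha)
   ultimately show "s \<in> \<beta> ` {b. tors II' b \<and> hdeg dx i b}" unfolding t by blast
  qed
  show "\<beta> ` {b. tors II' b \<and> hdeg dx i b} \<subseteq> \<beta> ` {\<Sum>l\<in>UNIV. emT (t l) * a l | t. True}"
  proof
   fix s assume "s \<in> \<beta> ` {b. tors II' b \<and> hdeg dx i b}"
   then obtain b where b: "s = \<beta> b" "tors II' b" "hdeg dx i b" by blast
   obtain t where "b - (\<Sum>l\<in>UNIV. emT (t l) * a l) \<in> II'" using span[OF b(2,3)] by blast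
   then have e: "s = \<beta> (\<Sum>l\<in>UNIV. emT (t l) * a l)" unfolding b(1) beta_eq .
   have "(\<Sum>l\<in>UNIV. emT (t l) * a l) \<in> {\<Sum>l\<in>UNIV. emT (t l) * a l | t. True}" by (intro CollectI exI[of _ t]) simp
   then show "s \<in> \<beta> ` {\<Sum>l\<in>UNIV. emT (t l) * a l | t. True}" unfolding e by (rule imageI)
  qed
 qed
 show "T_minimally_generates f g (range (\<lambda>l. \<beta> (a l))) (calA_row f g i)"
  unfolding T_minimally_generates_def minimally_generates_def
 proof (intro conjI allI impI gen notI)
  fix H assume H: "H \<subset> range (\<lambda>l. \<beta> (a l))" and e: "submodule_gen poly4_ring (SymOmega_T f g) H = calA_row f g i"
  define L where "L = {l. \<beta> (a l) \<in> H}"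
  have HL: "H = (\<lambda>l. \<beta> (a l)) ` L" using H unfolding L_def by blast
  obtain l0 where l0: "l0 \<notin> L" using H unfolding L_def by blast
  have "\<beta> (a l0) \<in> calA_row f g i" unfolding calA_row_eq using ha by blast
  then have "\<beta> (a l0) \<in> \<beta> ` {\<Sum>l\<in>L. emT (t l) * a l | t. True}"
   unfolding e[symmetric] HL submodule_gen_T[OF subset_UNIV] .
  then show False using indep[OF l0] by blast
 qed
qed

text \<open>The x-components of a torsion element are torsion, and those of x-degree at least 3 are
  zero, so rows 0, 1 and 2 suffice.\<close>

lemma genideal_rows: "genideal SO (calA_row f g 0 \<union> calA_row f g 1 \<union> calA_row f g 2) = calA f g" (is "genideal SO ?G = _")
proof -
 interpret cring SO by (rule pres_cring[OF PB])
 have rows: "calA_row f g i \<subseteq> calA f g" for i unfolding calA_row_eq calA_eq by blast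
 have idA: "ideal (calA f g) SO" unfolding calA_eq by (rule ideal_torsion)
 have sub: "?G \<subseteq> carrier SO" using rows ideal.axioms(1)[OF idA] additive_subgroup.a_subset by blast
 interpret J: ideal "genideal SO ?G" SO by (rule genideal_ideal[OF sub])
 show ?thesis
 proof
  show "genideal SO ?G \<subseteq> calA f g" by (rule genideal_minimal[OF idA]) (use rows in blast)
  show "calA f g \<subseteq> genideal SO ?G"
  proof
   fix s assume "s \<in> calA f g"
   then obtain b where b: "s = \<beta> b" "tors II' b" unfolding calA_eq by blast
   have good: "good II'" by (rule good_nrm[OF n])
   have c: "\<beta> (hcomp dx d b) \<in> genideal SO ?G" for d
   proof (cases "d \<ge> 3")
    case True
    then have "hcomp dx d b \<in> II'" using good tors_hcomp_x[OF b(2), of d] hdeg_hcomp[of dx d b] unfolding good_def by blast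
    then have z: "\<beta> (hcomp dx d b) = \<zero>\<^bsub>SO\<^esub>" by (simp add: beta_eq_0)
    show ?thesis unfolding z by (rule J.zero_closed)
   next
    case False
    have "\<beta> (hcomp dx d b) \<in> calA_row f g d" unfolding calA_row_eq using tors_hcomp_x[OF b(2), of d] hdeg_hcomp[of dx d b] by blast
    moreover have "d = 0 \<or> d = 1 \<or> d = 2" using False by linarith
    ultimately have "\<beta> (hcomp dx d b) \<in> ?G" by blast
    then show ?thesis using genideal_self[OF sub] by blast
   qed
   have "\<beta> (\<Sum>d\<in>A. hcomp dx d b) \<in> genideal SO ?G" for A
   proof (induction A rule: infinite_finite_induct)
    case (insert d A)
    have "\<beta> (\<Sum>d\<in>insert d A. hcomp dx d b) = \<beta> (hcomp dx d b) \<oplus>\<^bsub>SO\<^esub> \<beta> (\<Sum>d\<in>A. hcomp dx d b)"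
     using insert by (simp add: presD(9)[OF PB])
    then show ?case using J.a_closed[OF c insert.IH] by simp
   qed (use J.zero_closed presD(8)[OF PB] in simp_all)
   then show "s \<in> genideal SO ?G" unfolding b(1) using sum_hcomp[of dx b] by metis
  qed
 qed
qed

end

theorem theorem4:
 fixes f g :: "'k::field_char_0 poly4"
 assumes "homogeneous 2 f" and "homogeneous 2 g"
  and "regular_sequence poly4_ring [f, g]"
  and "normal_ring (fg_ring f g)"
 shows "genideal (SymOmega f g) (calA_row f g 0 \<union> calA_row f g 1 \<union> calA_row f g 2) = calA f g \<and>
  (\<exists>q \<in> calA_bideg f g 2 2. T_minimally_generates f g {q} (calA_row f g 2)) \<and>
  (\<exists>G. G \<subseteq> calA_bideg f g 1 4 \<and> card G = 4 \<and> T_minimally_generates f g G (calA_row f g 1)) \<and>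
  (\<exists>n>0. \<exists>q \<in> calA_bideg f g 0 n. T_minimally_generates f g {q} (calA_row f g 0))"
proof -
 have n: "nrm f g" by (rule nrm_of_normal[OF assms])
 obtain a :: "unit \<Rightarrow> 'k poly44" and b :: "4 \<Rightarrow> 'k poly44" and c :: "unit \<Rightarrow> 'k poly44"
  where a: "row_gens (idl (IB f g)) 2 2 a" and b: "row_gens (idl (IB f g)) 1 4 b" and c: "row_gens (idl (IB f g)) 0 8 c"
  using good_nrm[OF n] unfolding good_def by blast
 have u: "range (\<lambda>l::unit. h l) = {h ()}" for h :: "unit \<Rightarrow> 'k sym_elem" by (auto simp: UNIV_unit)
 have 2: "\<exists>q \<in> calA_bideg f g 2 2. T_minimally_generates f g {q} (calA_row f g 2)"
  using row_generated[OF n a] unfolding u by blast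
 \<comment> \<open>The positive integer is 8, the y-degree of the single generator in x-degree
   0.\<close>
 have 0: "\<exists>n>0. \<exists>q \<in> calA_bideg f g 0 n. T_minimally_generates f g {q} (calA_row f g 0)"
  using row_generated[OF n c] unfolding u by (intro exI[of _ 8]) auto
 have 1: "\<exists>G. G \<subseteq> calA_bideg f g 1 4 \<and> card G = 4 \<and> T_minimally_generates f g G (calA_row f g 1)"
  using row_generated[OF n b] by (intro exI[of _ "range (\<lambda>l. B_to_Sym f g (b l))"]) simp
 show ?thesis using genideal_rows[OF n] 2 1 0 by blast
qed

end
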